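(* Let $X_1,\dots,X_n$ be i.i.d. with density $f_0\in\mathcal{C}^s$ on $[0,1]$, $0<s\le1$, with $c_-\le f_0\le c_+$ for some $c_-,c_+>0$. Let $\hat\Psi_0=\int\hat f^2-\frac pn$ and $\sigma^2=4\int(f_0-\int f_0^2)^2f_0$, and assume $\sigma^2>0$. Assume $1\ll p\ll n/\ln n$. 1. Let $\Pi$ be the Haar series prior $\Pi(d\theta)\propto\prod_{0\le j\le J,\,1\le k\le2^j}\exp(-H(\theta^{jk}/\sigma_j))d\theta^{jk}$ with $\sigma_j>0$, $H:\mathbb{R}\to\mathbb{R}$ twice differentiable, $\|H'\|_\infty<\infty$, $\|H''\|_\infty<\infty$ and $\sigma_-=\min_{0\le j\le J}\sigma_j\gg n^{-1/2}$. Then $$d_{BL}\left(\Pi_n\circ Z_n^{-1},\mathcal{N}(0,\sigma^2)\right)=O_p\left(p^{-s}+\sqrt{\frac{p\ln n}n}+\frac1{n\sigma_-^2}\right)=o_p(1),$$ where $$Z_n:=\sqrt n\left(\left(1+\frac1n\right)\int f^2-\frac{2p}n+\frac1n\sum_{j=0}^J\sigma_j^{-1}\sum_{k=1}^{2^j}H'\left(\sigma_j^{-1}\langle\psi_{jk}|\ln f\rangle_2\right)\langle\psi_{jk}|\hat f+f\rangle_2-\hat\Psi_0\right).$$ In particular the BvM phenomenon with centring $\hat\Psi_0$ and asymptotic variance $\sigma^2$ holds for the functional $f\mapsto(1+\frac1n)\int f^2-\frac{2p}n+\frac1n\sum_{j=0}^J\sigma_j^{-1}\sum_{k=1}^{2^j}H'(\sigma_j^{-1}\langle\psi_{jk}|\ln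 f\rangle_2)\langle\psi_{jk}|\hat f+f\rangle_2$ whenever in addition $s>1/4$ and $n^{\frac1{4s}}\ll p\ll n/\ln n$. 2. Let $\Pi$ be the Dirichlet prior with parameter $m\in(0,\infty)^p$ on $\omega$, with $\|m\|_\infty=O(1)$. Then $$d_{BL}\left(\Pi_n\circ Z_n^{-1},\mathcal{N}(0,\sigma^2)\right)=O_p\left(p^{-s}+\sqrt{\frac{p\ln n}n}\right)=o_p(1),$$ where, with $\bar m:=m/\|m\|_1$, $$Z_n:=\sqrt n\left(\left(1+\frac1n\right)\int f^2-\frac{2p}n-\frac{\|m\|_1}n\int(h_{\bar m}-f)(\hat f+f)-\hat\Psi_0\right).$$ In particular the BvM phenomenon with centring $\hat\Psi_0$ and asymptotic variance $\sigma^2$ holds for the functional $f\mapsto(1+\frac1n)\int f^2-\frac{2p}n-\frac{\|m\|_1}n\int(h_{\bar m}-f)(\hat f+f)$ whenever in addition $s>1/4$ and $n^{\frac1{4s}}\ll p\ll n/\ln n$.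
   Context: Histogram model. $p=2^{J+1}$, $J\ge0$; $I_\mu=[\frac{\mu-1}p,\frac\mu p)$ for $1\le\mu\le p-1$, $I_p=[\frac{p-1}p,1]$. $\mathcal{F}_p=\mathrm{span}\{\mathbf{1}_{I_\mu}\}$, with $L^2[0,1]$-orthonormal basis $\{1\}\cup\{\psi_{jk}:0\le j\le J,1\le k\le2^j\}$, where $\psi_{jk}$ are the $L^2$-normalised Haar wavelets on $[0,1]$ ($\psi_{jk}=2^{j/2}$ on the left half and $-2^{j/2}$ on the right half of the $k$-th dyadic interval of length $2^{-j}$, and $0$ elsewhere). $\langle\cdot|\cdot\rangle_2$ is the $L^2[0,1]$ inner product. The model is the set of strictly positive histogram densities in $\mathcal{F}_p$, parametrised either by $\theta=(\theta^{jk})\in\mathbb{R}^{p-1}$, $f_\theta=\exp(\sum_{j,k}\theta^{jk}\psi_{jk}-\psi(\theta))$ with $\psi(\theta)$ the log-normaliser (so $\theta^{jk}=\langle\psi_{jk}|\ln f_\theta\rangle_2$), or by bin probabilities $\omega$, $h_\omega=p\sum_{\mu=1}^p\omega_\mu\mathbf{1}_{I_\mu}$, $\omega_\mu>0$, $\sum_\mu\omega_\mu=1$. The Dirichlet prior with parameter $m$ has density proportional to $\prod_{\mu=1}^p\omega_\mu^{m_\mu-1}$ in $(\omega_1,\dots,\omega_{p-1})$. $\mathbb{P}_n=\frac1n\sum_{i=1}^n\delta_{X_i}$, and $\hat f=1+\sum_{j=0}^J\sum_{k=1}^{2^j}\mathbb{P}_n[\psi_{jk}]\psi_{jk}$ is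 the empirical histogram. Posterior: $\Pi_n(df)\propto\prod_{i=1}^nf(X_i)\,\Pi(df)$, assumed well-defined (finite normalising constant). $f$ denotes a generic histogram distributed according to $\Pi_n$, and $\Pi_n\circ Z_n^{-1}$ is the law of $Z_n(f)$ with data fixed. Asymptotics: $n\to\infty$ with $p=p_n$, and $\sigma_j$, $m$ allowed to depend on $n$ ($f_0,H,s$ fixed); $a_n\ll b_n$ (equivalently $b_n\gg a_n$) means $a_n/b_n\to0$; $O_p,o_p$ are under $X^n\sim f_0^{\otimes n}$. $\mathcal{C}^s$ is the classical Hölder space on $[0,1]$. For probability measures $\mu,\nu$ on $\mathbb{R}$, $d_{BL}(\mu,\nu)=\sup\{|\int h\,d(\mu-\nu)|:\ h:\mathbb{R}\to[-1,1],\ |h(x)-h(y)|\le|x-y|\}$. The BvM phenomenon with centring $\hat\Psi_0$ and asymptotic variance $\sigma^2>0$ holds for functionals $\Phi_n$ if $d_{BL}(\Pi_n\circ(\sqrt n(\Phi_n-\hat\Psi_0))^{-1},\mathcal{N}(0,\sigma^2))=o_p(1)$. *)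

theory Defs
  imports "HOL-Probability.Probability"
begin

section \<open>Asymptotic notation\<close>

definition much_less :: "(nat \<Rightarrow> real) \<Rightarrow> (nat \<Rightarrow> real) \<Rightarrow> bool"  (infix "\<lless>" 50) where
  "a \<lless> b \<longleftrightarrow> (\<lambda>n. a n / b n) \<longlonglongrightarrow> 0"

text \<open>Stochastic orders for statistics \<open>Y n\<close> on probability spaces \<open>P n\<close>. They are stated with
  outer measure because \<open>measure\<close> would assign \<open>0\<close> to a non-measurable event; for measurable
  \<open>Y n\<close> these are the usual notions.\<close>

definition bigo_prob :: "(nat \<Rightarrow> 'a measure) \<Rightarrow> (nat \<Rightarrow> 'a \<Rightarrow> real) \<Rightarrow> (nat \<Rightarrow> real) \<Rightarrow> bool" where
  "bigo_prob P Y r \<longleftrightarrow>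
     (\<forall>\<epsilon>>0. \<exists>K. \<forall>\<^sub>F n in sequentially.
        outer_measure_of (P n) {x \<in> space (P n). \<bar>Y n x\<bar> > K * r n} \<le> ennreal \<epsilon>)"

definition tends_to_0_prob :: "(nat \<Rightarrow> 'a measure) \<Rightarrow> (nat \<Rightarrow> 'a \<Rightarrow> real) \<Rightarrow> bool" where
  "tends_to_0_prob P Y \<longleftrightarrow>
     (\<forall>\<delta>>0. (\<lambda>n. outer_measure_of (P n) {x \<in> space (P n). \<bar>Y n x\<bar> > \<delta>}) \<longlonglongrightarrow> 0)"


section \<open>Bounded Lipschitz distance and the Bernstein--von Mises phenomenon\<close>

definition BL1 :: "(real \<Rightarrow> real) set" where
  "BL1 = {h. (\<forall>x. h x \<in> {-1..1}) \<and> (\<forall>x y. \<bar>h x - h y\<bar> \<le> \<bar>x - y\<bar>)}"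

definition d_BL :: "real measure \<Rightarrow> real measure \<Rightarrow> real" where
  "d_BL \<mu> \<nu> = (SUP h\<in>BL1. \<bar>(\<integral>x. h x \<partial>\<mu>) - (\<integral>x. h x \<partial>\<nu>)\<bar>)"

text \<open>The second argument is the variance, whereas that of \<^const>\<open>normal_density\<close> is the
  standard deviation.\<close>

definition normal_law :: "real \<Rightarrow> real \<Rightarrow> real measure" where
  "normal_law \<mu> v = density lborel (\<lambda>x. ennreal (normal_density \<mu> (sqrt v) x))"

text \<open>\<open>P n\<close> is the law of the data, \<open>Post n X\<close> the posterior given data \<open>X\<close>; the functional
  \<open>\<Phi> n X\<close> and the centring \<open>c n X\<close> may depend on the data.\<close>

definition BvM ::
  "(nat \<Rightarrow> 'a measure) \<Rightarrow> (nat \<Rightarrow> 'a \<Rightarrow> 'b measure) \<Rightarrow> (nat \<Rightarrow> 'a \<Rightarrow> 'b \<Rightarrow> real) \<Rightarrow>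
   (nat \<Rightarrow> 'a \<Rightarrow> real) \<Rightarrow> real \<Rightarrow> bool" where
  "BvM P Post \<Phi> c v \<longleftrightarrow> v > 0 \<and>
     tends_to_0_prob P (\<lambda>n X.
       d_BL (distr (Post n X) borel (\<lambda>t. sqrt (real n) * (\<Phi> n X t - c n X))) (normal_law 0 v))"


section \<open>Sampling model\<close>

text \<open>For \<open>s = 1\<close> this is the Lipschitz condition, which includes the continuously
  differentiable functions.\<close>

definition hoelder :: "real \<Rightarrow> (real \<Rightarrow> real) \<Rightarrow> bool" where
  "hoelder s f \<longleftrightarrow> (\<exists>L. \<forall>x\<in>{0..1}. \<forall>y\<in>{0..1}. \<bar>f x - f y\<bar> \<le> L * \<bar>x - y\<bar> powr s)"

definition sampling_law :: "(real \<Rightarrow> real) \<Rightarrow> nat \<Rightarrow> (nat \<Rightarrow> real) measure" where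
  "sampling_law f n =
     Pi\<^sub>M {1..n} (\<lambda>_. density lborel (\<lambda>x. ennreal (f x * indicator {0..1} x)))"

definition inner_L2 :: "(real \<Rightarrow> real) \<Rightarrow> (real \<Rightarrow> real) \<Rightarrow> real" where
  "inner_L2 f g = (LINT x:{0..1}|lborel. f x * g x)"

definition asymp_variance :: "(real \<Rightarrow> real) \<Rightarrow> real" where
  "asymp_variance f =
     4 * (LINT x:{0..1}|lborel. (f x - (LINT y:{0..1}|lborel. (f y)\<^sup>2))\<^sup>2 * f x)"


section \<open>Histograms and Haar wavelets\<close>

definition bin :: "nat \<Rightarrow> nat \<Rightarrow> real set" where
  "bin p \<mu> = (if \<mu> = p then {(real p - 1) / real p..1}
              else {(real \<mu> - 1) / real p..<real \<mu> / real p})"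

text \<open>The \<open>k\<close>-th dyadic interval of length \<open>2\<^sup>-\<^sup>j\<close> consists of the bins \<open>2 * k - 1\<close> and \<open>2 * k\<close>
  of length \<open>2\<^sup>-\<^sup>j\<^sup>-\<^sup>1\<close>; the rightmost one is closed.\<close>

definition haar :: "nat \<Rightarrow> nat \<Rightarrow> real \<Rightarrow> real" where
  "haar j k x = 2 powr (real j / 2) *
     (indicator (bin (2 ^ (j + 1)) (2 * k - 1)) x - indicator (bin (2 ^ (j + 1)) (2 * k)) x)"

definition haar_idx :: "nat \<Rightarrow> (nat \<times> nat) set" where
  "haar_idx J = (SIGMA j:{0..J}. {1..2 ^ j})"

definition empirical_mean :: "nat \<Rightarrow> (nat \<Rightarrow> real) \<Rightarrow> (real \<Rightarrow> real) \<Rightarrow> real" where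
  "empirical_mean n X g = (\<Sum>i=1..n. g (X i)) / real n"

definition empirical_histogram :: "nat \<Rightarrow> nat \<Rightarrow> (nat \<Rightarrow> real) \<Rightarrow> real \<Rightarrow> real" where
  "empirical_histogram J n X x =
     1 + (\<Sum>j=0..J. \<Sum>k=1..2 ^ j. empirical_mean n X (haar j k) * haar j k x)"

definition centring :: "nat \<Rightarrow> nat \<Rightarrow> (nat \<Rightarrow> real) \<Rightarrow> real" where
  "centring J n X =
     (LINT x:{0..1}|lborel. (empirical_histogram J n X x)\<^sup>2) - 2 ^ (J + 1) / real n"

definition log_normaliser :: "nat \<Rightarrow> (nat \<times> nat \<Rightarrow> real) \<Rightarrow> real" where
  "log_normaliser J \<theta> =
     ln (LINT x:{0..1}|lborel. exp (\<Sum>(j, k)\<in>haar_idx J. \<theta> (j, k) * haar j k x))"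

definition series_density :: "nat \<Rightarrow> (nat \<times> nat \<Rightarrow> real) \<Rightarrow> real \<Rightarrow> real" where
  "series_density J \<theta> x =
     exp ((\<Sum>(j, k)\<in>haar_idx J. \<theta> (j, k) * haar j k x) - log_normaliser J \<theta>)"

definition histogram :: "nat \<Rightarrow> (nat \<Rightarrow> real) \<Rightarrow> real \<Rightarrow> real" where
  "histogram p \<omega> x = real p * (\<Sum>\<mu>=1..p. \<omega> \<mu> * indicator (bin p \<mu>) x)"


section \<open>Priors and posteriors\<close>

text \<open>The series prior is only specified up to a constant, and it may be improper.\<close>

definition series_prior ::
  "nat \<Rightarrow> (real \<Rightarrow> real) \<Rightarrow> (nat \<Rightarrow> real) \<Rightarrow> (nat \<times> nat \<Rightarrow> real) measure" where
  "series_prior J H \<sigma> = density (Pi\<^sub>M (haar_idx J) (\<lambda>_. lborel))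
     (\<lambda>\<theta>. ennreal (\<Prod>(j, k)\<in>haar_idx J. exp (- H (\<theta> (j, k) / \<sigma> j))))"

text \<open>The Dirichlet law lives on the free coordinates \<open>w 1, \<dots>, w (p - 1)\<close>;
  \<open>bin_probs\<close> adds the last bin probability.\<close>

definition bin_probs :: "nat \<Rightarrow> (nat \<Rightarrow> real) \<Rightarrow> nat \<Rightarrow> real" where
  "bin_probs p w \<mu> = (if \<mu> = p then 1 - (\<Sum>\<nu>\<in>{1..<p}. w \<nu>) else w \<mu>)"

definition dirichlet_weight :: "nat \<Rightarrow> (nat \<Rightarrow> real) \<Rightarrow> (nat \<Rightarrow> real) \<Rightarrow> real" where
  "dirichlet_weight p m w =
     (if \<forall>\<mu>\<in>{1..p}. bin_probs p w \<mu> > 0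
      then (\<Prod>\<mu>=1..p. bin_probs p w \<mu> powr (m \<mu> - 1)) else 0)"

definition dirichlet_prior :: "nat \<Rightarrow> (nat \<Rightarrow> real) \<Rightarrow> (nat \<Rightarrow> real) measure" where
  "dirichlet_prior p m =
     (let L = Pi\<^sub>M {1..<p} (\<lambda>_. lborel)
      in density L (\<lambda>w. ennreal (dirichlet_weight p m w) /
                        (\<integral>\<^sup>+ w'. ennreal (dirichlet_weight p m w') \<partial>L)))"

text \<open>Priors and posteriors are measures on a parameter space, \<open>F\<close> maps parameters to densities.\<close>

definition likelihood :: "('b \<Rightarrow> real \<Rightarrow> real) \<Rightarrow> nat \<Rightarrow> (nat \<Rightarrow> real) \<Rightarrow> 'b \<Rightarrow> ennreal" where
  "likelihood F n X t = ennreal (\<Prod>i=1..n. F t (X i))"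

definition evidence :: "'b measure \<Rightarrow> ('b \<Rightarrow> real \<Rightarrow> real) \<Rightarrow> nat \<Rightarrow> (nat \<Rightarrow> real) \<Rightarrow> ennreal" where
  "evidence prior F n X = (\<integral>\<^sup>+ t. likelihood F n X t \<partial>prior)"

definition posterior :: "'b measure \<Rightarrow> ('b \<Rightarrow> real \<Rightarrow> real) \<Rightarrow> nat \<Rightarrow> (nat \<Rightarrow> real) \<Rightarrow> 'b measure" where
  "posterior prior F n X = density prior (\<lambda>t. likelihood F n X t / evidence prior F n X)"


section \<open>Debiased functionals\<close>

definition series_functional ::
  "nat \<Rightarrow> (real \<Rightarrow> real) \<Rightarrow> (nat \<Rightarrow> real) \<Rightarrow> nat \<Rightarrow> (nat \<Rightarrow> real) \<Rightarrow> (real \<Rightarrow> real) \<Rightarrow> real" where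
  "series_functional J H \<sigma> n X f =
     (1 + 1 / real n) * (LINT x:{0..1}|lborel. (f x)\<^sup>2) - 2 * 2 ^ (J + 1) / real n
     + 1 / real n * (\<Sum>j=0..J. 1 / \<sigma> j * (\<Sum>k=1..2 ^ j.
         deriv H (1 / \<sigma> j * inner_L2 (haar j k) (\<lambda>x. ln (f x)))
         * inner_L2 (haar j k) (\<lambda>x. empirical_histogram J n X x + f x)))"

definition dirichlet_functional ::
  "nat \<Rightarrow> (nat \<Rightarrow> real) \<Rightarrow> nat \<Rightarrow> (nat \<Rightarrow> real) \<Rightarrow> (real \<Rightarrow> real) \<Rightarrow> real" where
  "dirichlet_functional J m n X f =
     (let p = 2 ^ (J + 1); m1 = (\<Sum>\<mu>=1..p. \<bar>m \<mu>\<bar>); mbar = (\<lambda>\<mu>. m \<mu> / m1) in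
      (1 + 1 / real n) * (LINT x:{0..1}|lborel. (f x)\<^sup>2) - 2 * real p / real n
      - m1 / real n * (LINT x:{0..1}|lborel.
          (histogram p mbar x - f x) * (empirical_histogram J n X x + f x)))"

end

theory Submission
  imports Defs "HOL-Real_Asymp.Real_Asymp"
begin

text \<open>In terms of the bin probabilities \<open>w\<close> and the bin frequencies \<open>h\<close> of the data, both posteriors
  satisfy the same exact identity. Let \<open>D\<^sub>i\<close> be the derivative along the exponential tilt of bin \<open>i\<close>
  (a translation of \<open>\<theta>\<close> for the series prior). Integration by parts gives
  \<open>E [D\<^sub>i G + G (n h\<^sub>i - n w\<^sub>i + R\<^sub>i)] = 0\<close> under the posterior, where \<open>R\<^sub>i\<close> comes from the prior. The
  statistic \<open>Z\<close> is, up to the factor \<open>1 / sqrt n\<close>, the sum over \<open>i\<close> of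
  \<open>u\<^sub>i (n w\<^sub>i - n h\<^sub>i - R\<^sub>i) - D\<^sub>i u\<^sub>i\<close> with \<open>u\<^sub>i = p (w\<^sub>i + h\<^sub>i)\<close>. Hence \<open>G = g(Z) u\<^sub>i\<close> yields
  \<open>E [Z g(Z)] = E [g'(Z) T]\<close> without remainder, where \<open>T\<close> is the sum of the \<open>u\<^sub>i D\<^sub>i Z / sqrt n\<close>, and Stein's
  method bounds the distance to \<open>N(0, v)\<close> by a multiple of \<open>E \<bar>T - v\<bar>\<close>.

  Since \<open>T\<close> is close to \<open>v\<close> when \<open>w\<close> and \<open>h\<close> are close in \<open>L\<^sup>1\<close> to the true bin probabilities, it remains
  to prove concentration. The choice \<open>G = w\<^sub>i\<^sup>k\<close> in the identity gives a recursion for the moments of \<open>w\<^sub>i\<close>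
  and with it an upper tail bound; Chernoff bounds do the same for \<open>h\<close>. One-sided bounds suffice,
  because both vectors sum to 1.\<close>

section \<open>Stein's method for the normal law\<close>

text \<open>The weights \<open>p * (w i + h i)\<close> come from a difference of squares: multiplied
  by \<open>w i - h i\<close> and summed over the bins, they give the squared L2 norm of f minus
  that of the empirical histogram. The quadratic functional is thus linear in the deviations
  \<open>w i - h i\<close> without any Taylor remainder, and its debiased version is the one for
  which the Stein identity closes exactly. This replaces a Laplace approximation, which is delicate
  when the dimension p grows. The accuracy of T decides the rest. Its leading part is a polynomial
  in w and h that is Lipschitz in l1 as long as p w and p h stay bounded. An l1 error of order
  sqrt(p ln n / n) and the binning bias of order p^(-s) in the limit variance produce the first two
  terms of the rate; the prior adds the others through the size of the score and of its derivative.
  Off the event of concentration T is only known to be of order p^2, so this event must fail with a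
  probability that is a high power of 1 / n; this fixes the constants.\<close>

lemma normal_density_has_derivative:
  assumes "v > 0"
  shows "(normal_density 0 (sqrt v) has_real_derivative - (x / v) * normal_density 0 (sqrt v) x) (at x)"
  unfolding normal_density_def using assms
  by (auto intro!: derivative_eq_intros simp: field_simps)

lemma normal_density_at_top: "(normal_density 0 \<sigma> \<longlongrightarrow> 0) at_top" if "\<sigma> > 0"
  unfolding normal_density_def using that by real_asymp

text \<open>On \<open>S\<close> the factor \<open>x\<close> may be replaced by the larger
  integration variable y, and y times the density is the exact derivative of \<open>- v\<close>
  times the density. \<open>S\<close> is left general so that open and closed half-lines are both
  covered.\<close>

lemma normal_upper_tail:
  assumes v: "v > 0" and x: "x > 0" and k: "\<And>y. \<bar>k y\<bar> \<le> c" "k \<in> borel_measurable borel"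
    and S: "S \<in> sets borel" "S \<subseteq> {x..}"
  shows "\<bar>x * (\<integral>y. k y * normal_density 0 (sqrt v) y * indicator S y \<partial>lborel)\<bar>
           \<le> c * v * normal_density 0 (sqrt v) x"
proof -
  let ?\<phi> = "normal_density 0 (sqrt v)"
  note [measurable] = k(2) S(1)
  have c0: "c \<ge> 0" using k(1)[of 0] by linarith
  have nn: "(\<integral>\<^sup>+y. ennreal (y * ?\<phi> y) * indicator {x ..} y \<partial>lborel) = ennreal (0 - (- v * ?\<phi> x))"
  proof (rule nn_integral_FTC_atLeast)
    show "((\<lambda>y. - v * ?\<phi> y) \<longlongrightarrow> 0) at_top"
      using tendsto_mult_left[OF normal_density_at_top, of "sqrt v" "-v"] v by simp
    show "((\<lambda>y. - v * ?\<phi> y) has_real_derivative y * ?\<phi> y) (at y)" for y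
      using v by (auto intro!: derivative_eq_intros normal_density_has_derivative)
  qed (use x in auto)
  have hb: "has_bochner_integral lborel (\<lambda>y. y * ?\<phi> y * indicator {x..} y) (v * ?\<phi> x)"
  proof (rule has_bochner_integral_nn_integral)
    show "(\<integral>\<^sup>+ y. ennreal (y * ?\<phi> y * indicator {x..} y) \<partial>lborel) = ennreal (v * ?\<phi> x)"
      using nn by (simp add: indicator_mult_ennreal mult.commute[of _ "indicator _ _"])
  qed (use v x in \<open>auto simp: indicator_def\<close>)
  have "\<bar>\<integral>y. x * (k y * ?\<phi> y * indicator S y) \<partial>lborel\<bar> \<le> (\<integral>y. c * (y * ?\<phi> y * indicator {x..} y) \<partial>lborel)"
  proof (rule integral_abs_bound_integral)
    show "integrable lborel (\<lambda>y. c * (y * ?\<phi> y * indicator {x..} y))"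
      using hb by (auto simp: has_bochner_integral_iff)
    have "\<bar>x * (k y * ?\<phi> y * indicator S y)\<bar> \<le> c * (y * ?\<phi> y * indicator {x..} y)" for y
    proof (cases "y \<in> S")
      case True
      then have "x \<le> y" using S by auto
      then have "x * \<bar>k y\<bar> * ?\<phi> y \<le> y * c * ?\<phi> y"
        by (intro mult_right_mono mult_mono) (use x k(1) in auto)
      then show ?thesis using True \<open>x \<le> y\<close> x by (simp add: abs_mult mult_ac)
    next
      case False
      then show ?thesis using c0 x by (auto simp: indicator_def)
    qed
    then show b: "\<bar>x * (k y * ?\<phi> y * indicator S y)\<bar> \<le> c * (y * ?\<phi> y * indicator {x..} y)" for y .
    show "integrable lborel (\<lambda>y. x * (k y * ?\<phi> y * indicator S y))"
      by (rule Bochner_Integration.integrable_bound[OF \<open>integrable lborel (\<lambda>y. c * (y * ?\<phi> y * indicator {x..} y))\<close>])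
         (auto intro!: order_trans[OF b abs_ge_self])
  qed
  also have "\<dots> = c * v * ?\<phi> x"
    using hb by (auto simp: has_bochner_integral_iff)
  finally show ?thesis by simp
qed

text \<open>With the density as integrating factor the equation becomes an antiderivative:
  \<open>v * g\<close> times the density is the integral of \<open>k\<close> times the density up to
  x. The bound on \<open>g'\<close> is read off the equation once x g(x) is bounded by
  \<open>c\<close>; that is a tail estimate, and mean zero allows the integral to be taken from the
  side of the tail.\<close>

lemma normal_stein_solution:
  assumes v: "v > 0" and k: "continuous_on UNIV k" "\<And>x. \<bar>k x\<bar> \<le> c"
    and k0: "(\<integral>x. k x * normal_density 0 (sqrt v) x \<partial>lborel) = 0"
  obtains g g' B where "\<And>x. (g has_real_derivative g' x) (at x)" "\<And>x. v * g' x - x * g x = k x"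
    "\<And>x. \<bar>g' x\<bar> \<le> 2 * c / v" "\<And>x. \<bar>g x\<bar> \<le> B" "continuous_on UNIV g'"
proof -
  let ?\<phi> = "normal_density 0 (sqrt v)"
  have \<phi>pos: "?\<phi> x > 0" for x using v by (simp add: normal_density_pos)
  have [measurable]: "k \<in> borel_measurable borel" using k(1) by (rule borel_measurable_continuous_onI)
  have c0: "c \<ge> 0" using k(2)[of 0] by linarith
  have cont\<phi>: "continuous_on UNIV ?\<phi>"
    by (rule DERIV_continuous_on, rule has_field_derivative_at_within, rule normal_density_has_derivative[OF v])
  have int: "integrable lborel (\<lambda>x. k x * ?\<phi> x)"
    by (rule Bochner_Integration.integrable_bound[where f="\<lambda>x. c * ?\<phi> x"])
       (use k(2) c0 v in \<open>auto simp: abs_mult intro!: mult_right_mono\<close>)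
  have intS: "integrable lborel (\<lambda>x. k x * ?\<phi> x * indicator S x)" if "S \<in> sets borel" for S
    using integrable_real_mult_indicator[OF _ int, of S] that by simp
  define A where "A x = (\<integral>y. k y * ?\<phi> y * indicator {..x} y \<partial>lborel)" for x
  define g where "g x = A x / (v * ?\<phi> x)" for x
  define g' where "g' x = (x * g x + k x) / v" for x
  \<comment> \<open>Near x only the mass above x - 1 varies, so the fundamental theorem on a compact
    interval is enough.\<close>
  have A: "(A has_real_derivative k x * ?\<phi> x) (at x)" for x
  proof -
    have eq: "A y = A (x - 1) + integral {x - 1..y} (\<lambda>z. k z * ?\<phi> z)" if "y > x - 1" for y
    proof -
      have "A y = (\<integral>z. k z * ?\<phi> z * indicator {..x - 1} z + k z * ?\<phi> z * indicator {x - 1<..y} z \<partial>lborel)"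
        unfolding A_def by (rule Bochner_Integration.integral_cong) (use that in \<open>auto simp: indicator_def\<close>)
      also have "\<dots> = A (x - 1) + (\<integral>z. k z * ?\<phi> z * indicator {x - 1<..y} z \<partial>lborel)"
        unfolding A_def by (subst Bochner_Integration.integral_add) (auto intro!: intS)
      also have "(\<integral>z. k z * ?\<phi> z * indicator {x - 1<..y} z \<partial>lborel) = (\<integral>z. k z * ?\<phi> z * indicator {x - 1..y} z \<partial>lborel)"
        by (rule integral_cong_AE) (auto intro!: AE_I'[where N="{x-1}"] simp: indicator_def)
      also have "\<dots> = (LINT z:{x - 1..y}|lborel. k z * ?\<phi> z)"
        by (simp add: set_lebesgue_integral_def mult.commute)
      also have "\<dots> = integral {x - 1..y} (\<lambda>z. k z * ?\<phi> z)"
        by (rule set_borel_integral_eq_integral)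
           (use intS[of "{x-1..y}"] in \<open>auto simp: set_integrable_def mult.commute\<close>)
      finally show ?thesis .
    qed
    have "((\<lambda>y. integral {x - 1..y} (\<lambda>z. k z * ?\<phi> z)) has_real_derivative k x * ?\<phi> x) (at x within {x-1..x+1})"
      by (rule integral_has_real_derivative)
         (auto intro!: continuous_intros continuous_on_subset[OF k(1)] continuous_on_subset[OF cont\<phi>])
    then have "((\<lambda>y. integral {x - 1..y} (\<lambda>z. k z * ?\<phi> z)) has_real_derivative k x * ?\<phi> x) (at x)"
      by (simp add: at_within_Icc_at)
    then have "((\<lambda>y. A (x - 1) + integral {x - 1..y} (\<lambda>z. k z * ?\<phi> z)) has_real_derivative k x * ?\<phi> x) (at x)"
      by (auto intro!: derivative_eq_intros)
    then show ?thesis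
      by (rule has_field_derivative_transform_within_open[where S="{x-1<..}"]) (auto simp: eq)
  qed
  have g: "(g has_real_derivative g' x) (at x)" for x
  proof -
    have d: "((\<lambda>x. A x / (v * ?\<phi> x)) has_real_derivative
        ((k x * ?\<phi> x) * (v * ?\<phi> x) - A x * (v * (- (x / v) * ?\<phi> x))) / ((v * ?\<phi> x) * (v * ?\<phi> x))) (at x)"
      using v \<phi>pos[of x] by (intro DERIV_divide DERIV_cmult A normal_density_has_derivative[OF v]) simp
    have "((k x * f) * (v * f) - A x * (v * (- (x / v) * f))) / ((v * f) * (v * f))
        = (x * (A x / (v * f)) + k x) / v" if "f > 0" for f
      using v that by (simp add: divide_simps) (simp add: algebra_simps)
    from DERIV_cong[OF d this[OF \<phi>pos]] show ?thesis unfolding g_def g'_def .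
  qed
  have xg: "\<bar>x * g x\<bar> \<le> c" for x
  proof -
    have *: "\<bar>x * A x\<bar> \<le> c * v * ?\<phi> x"
    proof (cases "x = 0")
      case False
      show ?thesis
      proof (cases "x > 0")
        case True
        have "(\<integral>y. k y * ?\<phi> y \<partial>lborel) = (\<integral>y. k y * ?\<phi> y * indicator {..x} y + k y * ?\<phi> y * indicator {x<..} y \<partial>lborel)"
          by (rule Bochner_Integration.integral_cong) (auto simp: indicator_def)
        also have "\<dots> = A x + (\<integral>y. k y * ?\<phi> y * indicator {x<..} y \<partial>lborel)"
          unfolding A_def by (subst Bochner_Integration.integral_add) (auto intro!: intS)
        finally have "0 = A x + (\<integral>y. k y * ?\<phi> y * indicator {x<..} y \<partial>lborel)"
          using k0 by simp
        then have "A x = - (\<integral>y. k y * ?\<phi> y * indicator {x<..} y \<partial>lborel)" by simp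
        moreover have "\<bar>x * (\<integral>y. k y * ?\<phi> y * indicator {x<..} y \<partial>lborel)\<bar> \<le> c * v * ?\<phi> x"
          using True v k by (intro normal_upper_tail) auto
        ultimately show ?thesis by simp
      next
        case neg: False
        \<comment> \<open>Reflection turns the lower tail at a negative point into an upper tail at
          a positive one.\<close>
        have "A x = (\<integral>y. k (-y) * ?\<phi> (-y) * indicator {..x} (-y) \<partial>lborel)"
          unfolding A_def by (subst lborel_integral_real_affine[where c="-1" and t=0]) auto
        also have "\<dots> = (\<integral>y. k (-y) * ?\<phi> y * indicator {-x..} y \<partial>lborel)"
          by (rule Bochner_Integration.integral_cong) (auto simp: indicator_def normal_density_def)
        finally have "\<bar>-x * A x\<bar> = \<bar>-x * (\<integral>y. k (-y) * ?\<phi> y * indicator {-x..} y \<partial>lborel)\<bar>" by simp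
        also have "\<dots> \<le> c * v * ?\<phi> (-x)"
          using neg False v k by (intro normal_upper_tail) auto
        finally show ?thesis by (simp add: normal_density_def)
      qed
    qed (use c0 v in simp)
    have "\<bar>x * g x\<bar> = \<bar>x * A x\<bar> / (v * ?\<phi> x)"
      using v \<phi>pos[of x] by (simp add: g_def abs_mult)
    also have "\<dots> \<le> c" using * v \<phi>pos[of x] by (simp add: field_simps)
    finally show ?thesis .
  qed
  have contg: "continuous_on UNIV g"
    by (rule DERIV_continuous_on, rule has_field_derivative_at_within, rule g)
  \<comment> \<open>The bound on x g(x) is void near the origin; there compactness bounds
    \<open>g\<close>.\<close>
  have "compact (g ` {-1..1})"
    by (intro compact_continuous_image continuous_on_subset[OF contg]) auto
  then have "bounded (g ` {-1..1})" by (rule compact_imp_bounded)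
  then obtain B where B: "\<And>x. x \<in> {-1..1} \<Longrightarrow> \<bar>g x\<bar> \<le> B"
    unfolding bounded_iff by (metis imageI real_norm_def)
  have gB: "\<bar>g x\<bar> \<le> max B c" for x
  proof (cases "x \<in> {-1..1}")
    case False
    then have "\<bar>x\<bar> \<ge> 1" by auto
    then have "\<bar>g x\<bar> \<le> \<bar>x\<bar> * \<bar>g x\<bar>" by (simp add: mult_le_cancel_right1)
    then show ?thesis using xg[of x] by (simp add: abs_mult)
  qed (use B in \<open>auto intro: le_max_iff_disj[THEN iffD2]\<close>)
  show thesis
  proof (rule that[of g g' "max B c"])
    show "\<bar>g' x\<bar> \<le> 2 * c / v" for x
    proof -
      have "\<bar>x * g x + k x\<bar> \<le> 2 * c" using xg[of x] k(2)[of x] by linarith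
      then show ?thesis using v by (simp add: g'_def divide_right_mono)
    qed
    show "continuous_on UNIV g'" unfolding g'_def using v by (intro continuous_intros contg k) auto
  qed (use g gB v in \<open>auto simp: g'_def field_simps\<close>)
qed

text \<open>\<open>E\<close> has to serve all solutions of Stein equations at once, because the test
  function varies inside the supremum. A centred test function is bounded by 2, which gives 4 / v
  for \<open>g'\<close>; solving the equation for x g(x) then gives 4 + 2 = 6.\<close>

lemma d_BL_normal_law_le:
  assumes "prob_space Q" and Z[measurable]: "Z \<in> borel_measurable Q" and v: "v > 0"
    and E: "\<And>g g' B. (\<And>x. (g has_real_derivative g' x) (at x)) \<Longrightarrow> continuous_on UNIV g' \<Longrightarrow>
      (\<And>x. \<bar>g x\<bar> \<le> B) \<Longrightarrow> (\<And>x. \<bar>g' x\<bar> \<le> 4 / v) \<Longrightarrow> (\<And>x. \<bar>x * g x\<bar> \<le> 6) \<Longrightarrow>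
      \<bar>\<integral>t. v * g' (Z t) - Z t * g (Z t) \<partial>Q\<bar> \<le> E"
  shows "\<bar>d_BL (distr Q borel Z) (normal_law 0 v)\<bar> \<le> E"
proof -
  interpret prob_space Q by fact
  let ?\<phi> = "normal_density 0 (sqrt v)"
  interpret N: prob_space "density lborel (\<lambda>x. ennreal (?\<phi> x))"
    using v by (intro prob_space_normal_density) auto
  have bound: "\<bar>(\<integral>x. h x \<partial>distr Q borel Z) - (\<integral>x. h x \<partial>normal_law 0 v)\<bar> \<le> E" if h: "h \<in> BL1" for h
  proof -
    have h1: "\<bar>h x\<bar> \<le> 1" for x using h unfolding BL1_def by (auto simp: abs_le_iff minus_le_iff)
    have hL: "\<bar>h x - h y\<bar> \<le> \<bar>x - y\<bar>" for x y using h unfolding BL1_def by auto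
    have contH: "continuous_on UNIV h"
      by (rule lipschitz_on_continuous_on[of 1], rule lipschitz_onI) (use hL in \<open>auto simp: dist_real_def\<close>)
    have [measurable]: "h \<in> borel_measurable borel" using contH by (rule borel_measurable_continuous_onI)
    define m where "m = (\<integral>x. h x \<partial>normal_law 0 v)"
    have m: "m = (\<integral>x. h x * ?\<phi> x \<partial>lborel)"
      unfolding m_def normal_law_def by (subst integral_density) (auto simp: mult.commute)
    have "\<bar>m\<bar> \<le> 1"
      unfolding m_def normal_law_def using h1
      by (intro order_trans[OF integral_abs_bound] N.integral_le_const)
        (auto intro!: N.integrable_const_bound[where B=1])
    define k where "k x = h x - m" for x
    have ih: "integrable lborel (\<lambda>x. h x * ?\<phi> x)"
      by (rule Bochner_Integration.integrable_bound[where f="?\<phi>"])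
        (use h1 v in \<open>auto simp: abs_mult intro!: mult_left_le_one_le\<close>)
    have "(\<integral>x. k x * ?\<phi> x \<partial>lborel) = m - m * (\<integral>x. ?\<phi> x \<partial>lborel)"
      unfolding k_def left_diff_distrib m using v ih by (subst Bochner_Integration.integral_diff) auto
    then have k0: "(\<integral>x. k x * ?\<phi> x \<partial>lborel) = 0" using v by simp
    have kb: "\<bar>k x\<bar> \<le> 2" for x using h1[of x] \<open>\<bar>m\<bar> \<le> 1\<close> unfolding k_def by linarith
    have kc: "continuous_on UNIV k" unfolding k_def by (intro continuous_intros contH)
    obtain g g' B where g: "\<And>x. (g has_real_derivative g' x) (at x)" "\<And>x. v * g' x - x * g x = k x"
      "\<And>x. \<bar>g' x\<bar> \<le> 2 * 2 / v" "\<And>x. \<bar>g x\<bar> \<le> B" "continuous_on UNIV g'"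
      using normal_stein_solution[OF v kc kb k0] by blast
    have xg: "\<bar>x * g x\<bar> \<le> 6" for x
    proof -
      have "v * \<bar>g' x\<bar> \<le> 4" using g(3)[of x] v by (simp add: field_simps)
      then have "\<bar>v * g' x\<bar> \<le> 4" using v by (simp add: abs_mult)
      then show ?thesis using g(2)[of x] kb[of x] by linarith
    qed
    have ih2: "integrable Q (\<lambda>t. h (Z t))"
      by (rule integrable_const_bound[where B=1]) (use h1 in auto)
    have "\<bar>\<integral>t. v * g' (Z t) - Z t * g (Z t) \<partial>Q\<bar> \<le> E"
      using E[of g g' B] g xg by simp
    also have "(\<integral>t. v * g' (Z t) - Z t * g (Z t) \<partial>Q) = (\<integral>t. h (Z t) - m \<partial>Q)"
      by (simp add: g(2) k_def)
    also have "\<dots> = (\<integral>t. h (Z t) \<partial>Q) - m"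
      by (subst Bochner_Integration.integral_diff) (auto simp: ih2 prob_space)
    finally show ?thesis unfolding m_def by (simp add: integral_distr)
  qed
  have zero: "(\<lambda>_. 0) \<in> BL1" by (simp add: BL1_def)
  have E0: "0 \<le> E" using bound[OF zero] by simp
  have "d_BL (distr Q borel Z) (normal_law 0 v) \<le> E"
    unfolding d_BL_def using bound zero by (intro cSUP_least) auto
  moreover have "0 \<le> d_BL (distr Q borel Z) (normal_law 0 v)"
    unfolding d_BL_def
    by (rule cSUP_upper2[OF _ zero]) (auto intro!: bdd_aboveI2[where M=E] bound)
  ultimately show ?thesis by simp
qed

section \<open>Functions on the simplex\<close>

definition open_simplex :: "nat \<Rightarrow> (nat \<Rightarrow> real) set" where
  "open_simplex p = {w. (\<forall>i\<in>{1..p}. w i > 0) \<and> (\<Sum>i=1..p. w i) = 1}"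

text \<open>Differentiability is required along curves because \<open>nat \<Rightarrow> real\<close> carries no norm.\<close>

definition has_gradient :: "nat \<Rightarrow> ((nat \<Rightarrow> real) \<Rightarrow> real) \<Rightarrow> ((nat \<Rightarrow> real) \<Rightarrow> nat \<Rightarrow> real) \<Rightarrow> bool" where
  "has_gradient p G G' \<longleftrightarrow>
     (\<forall>\<gamma> \<eta>. \<gamma> 0 \<in> open_simplex p \<longrightarrow>
        (\<forall>i\<in>{1..p}. ((\<lambda>t. \<gamma> t i) has_real_derivative \<eta> i) (at (0::real))) \<longrightarrow>
        ((\<lambda>t. G (\<gamma> t)) has_real_derivative (\<Sum>i=1..p. G' (\<gamma> 0) i * \<eta> i)) (at 0))"

text \<open>Only the product \<open>w i * G' w i\<close> has to be bounded, since a tilt sees the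
  gradient through it. This admits functions of the logarithms of the bin probabilities, such as the
  score of the series prior, whose gradient may blow up at the boundary.\<close>

definition smooth_fn :: "nat \<Rightarrow> ((nat \<Rightarrow> real) \<Rightarrow> real) \<Rightarrow> ((nat \<Rightarrow> real) \<Rightarrow> nat \<Rightarrow> real) \<Rightarrow> bool" where
  "smooth_fn p G G' \<longleftrightarrow> has_gradient p G G' \<and>
     (\<exists>B. \<forall>w\<in>open_simplex p. \<bar>G w\<bar> \<le> B \<and> (\<forall>i\<in>{1..p}. \<bar>w i * G' w i\<bar> \<le> B))"

text \<open>The derivative at \<open>t = 0\<close>, for a function with gradient \<open>d\<close> at \<open>w\<close>, along the exponential
  tilt \<open>w j \<mapsto> w j * exp (t * of_bool (j = i))\<close>, renormalised to total mass 1.\<close>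

definition tilt_deriv :: "nat \<Rightarrow> (nat \<Rightarrow> real) \<Rightarrow> (nat \<Rightarrow> real) \<Rightarrow> nat \<Rightarrow> real" where
  "tilt_deriv p w d i = w i * (d i - (\<Sum>j=1..p. w j * d j))"

lemma open_simplexD:
  assumes "w \<in> open_simplex p"
  shows "\<And>i. i \<in> {1..p} \<Longrightarrow> 0 < w i" "\<And>i. i \<in> {1..p} \<Longrightarrow> w i \<le> 1" "(\<Sum>i=1..p. w i) = 1"
proof -
  show 1: "\<And>i. i \<in> {1..p} \<Longrightarrow> 0 < w i" and 2: "(\<Sum>i=1..p. w i) = 1"
    using assms by (auto simp: open_simplex_def)
  show "w i \<le> 1" if "i \<in> {1..p}" for i
    using member_le_sum[of i "{1..p}" w] that 1 2 by (auto intro: less_imp_le)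
qed

lemma smooth_fnI:
  assumes "\<And>\<gamma> \<eta>. \<gamma> 0 \<in> open_simplex p \<Longrightarrow>
      (\<And>i. i \<in> {1..p} \<Longrightarrow> ((\<lambda>t. \<gamma> t i) has_real_derivative \<eta> i) (at (0::real))) \<Longrightarrow>
      ((\<lambda>t. G (\<gamma> t)) has_real_derivative (\<Sum>i=1..p. G' (\<gamma> 0) i * \<eta> i)) (at 0)"
    and "\<And>w. w \<in> open_simplex p \<Longrightarrow> \<bar>G w\<bar> \<le> A"
    and "\<And>w i. w \<in> open_simplex p \<Longrightarrow> i \<in> {1..p} \<Longrightarrow> \<bar>w i * G' w i\<bar> \<le> B"
  shows "smooth_fn p G G'"
  unfolding smooth_fn_def has_gradient_def
  using assms(1) by (auto intro!: exI[of _ "max A B"] simp: le_max_iff_disj assms(2,3))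

lemma has_gradientD:
  assumes "has_gradient p G G'" "\<gamma> 0 \<in> open_simplex p"
    "\<And>i. i \<in> {1..p} \<Longrightarrow> ((\<lambda>t. \<gamma> t i) has_real_derivative \<eta> i) (at (0::real))"
  shows "((\<lambda>t. G (\<gamma> t)) has_real_derivative (\<Sum>i=1..p. G' (\<gamma> 0) i * \<eta> i)) (at 0)"
  using assms unfolding has_gradient_def by blast

lemma smooth_fnE:
  assumes "smooth_fn p G G'"
  obtains B where "B \<ge> 0" "\<And>w. w \<in> open_simplex p \<Longrightarrow> \<bar>G w\<bar> \<le> B"
    "\<And>w i. w \<in> open_simplex p \<Longrightarrow> i \<in> {1..p} \<Longrightarrow> \<bar>w i * G' w i\<bar> \<le> B"
    "has_gradient p G G'"
proof -
  obtain B where B: "\<And>w. w \<in> open_simplex p \<Longrightarrow> \<bar>G w\<bar> \<le> B"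
    "\<And>w i. w \<in> open_simplex p \<Longrightarrow> i \<in> {1..p} \<Longrightarrow> \<bar>w i * G' w i\<bar> \<le> B"
    and g: "has_gradient p G G'"
    using assms unfolding smooth_fn_def by blast
  show thesis
  proof (rule that[of "max B 0"])
    show "\<bar>G w\<bar> \<le> max B 0" if "w \<in> open_simplex p" for w using B(1)[OF that] by simp
    show "\<bar>w i * G' w i\<bar> \<le> max B 0" if "w \<in> open_simplex p" "i \<in> {1..p}" for w i
      using B(2)[OF that] by simp
  qed (use g in auto)
qed

section \<open>Closure properties of smooth functions on the simplex\<close>

lemma smooth_fn_const: "smooth_fn p (\<lambda>_. c) (\<lambda>_ _. 0)"
  by (rule smooth_fnI[where A="\<bar>c\<bar>" and B=0]) auto

lemma smooth_fn_coord:
  assumes i: "i \<in> {1..p}"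
  shows "smooth_fn p (\<lambda>w. w i) (\<lambda>_ j. if j = i then 1 else 0)"
proof (rule smooth_fnI[where A=1 and B=1])
  fix \<gamma> :: "real \<Rightarrow> nat \<Rightarrow> real" and \<eta>
  assume "\<And>i. i \<in> {1..p} \<Longrightarrow> ((\<lambda>t. \<gamma> t i) has_real_derivative \<eta> i) (at 0)"
  moreover have "(\<Sum>j = 1..p. (if j = i then 1 else 0) * \<eta> j) = \<eta> i"
    using i by (subst sum.cong[OF refl, of _ _ "\<lambda>j. if i = j then \<eta> j else 0"]) auto
  ultimately show "((\<lambda>t. \<gamma> t i) has_real_derivative (\<Sum>j = 1..p. (if j = i then 1 else 0) * \<eta> j)) (at 0)"
    using i by simp
next
  fix w j assume "w \<in> open_simplex p"
  then show "\<bar>w i\<bar> \<le> 1" using open_simplexD[of w p] i by (simp add: less_imp_le)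
next
  fix w j assume "w \<in> open_simplex p" "j \<in> {1..p}"
  then show "\<bar>w j * (if j = i then 1 else 0)\<bar> \<le> 1"
    using open_simplexD[of w p] by (simp add: less_imp_le)
qed

lemma smooth_fn_mult:
  assumes "smooth_fn p G G'" "smooth_fn p H H'"
  shows "smooth_fn p (\<lambda>w. G w * H w) (\<lambda>w i. G' w i * H w + G w * H' w i)"
proof -
  obtain A where A: "A \<ge> 0" "\<And>w. w \<in> open_simplex p \<Longrightarrow> \<bar>G w\<bar> \<le> A"
    "\<And>w i. w \<in> open_simplex p \<Longrightarrow> i \<in> {1..p} \<Longrightarrow> \<bar>w i * G' w i\<bar> \<le> A"
    "has_gradient p G G'"
    using smooth_fnE[OF assms(1)] by blast
  obtain B where B: "B \<ge> 0" "\<And>w. w \<in> open_simplex p \<Longrightarrow> \<bar>H w\<bar> \<le> B"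
    "\<And>w i. w \<in> open_simplex p \<Longrightarrow> i \<in> {1..p} \<Longrightarrow> \<bar>w i * H' w i\<bar> \<le> B"
    "has_gradient p H H'"
    using smooth_fnE[OF assms(2)] by blast
  show ?thesis
  proof (rule smooth_fnI[where A="A * B" and B="A * B + A * B"])
    fix w assume w: "w \<in> open_simplex p"
    show "\<bar>G w * H w\<bar> \<le> A * B" unfolding abs_mult using A B w by (intro mult_mono) auto
    fix i assume i: "i \<in> {1..p}"
    have "\<bar>w i * (G' w i * H w + G w * H' w i)\<bar> \<le> \<bar>w i * G' w i\<bar> * \<bar>H w\<bar> + \<bar>G w\<bar> * \<bar>w i * H' w i\<bar>"
      unfolding abs_mult[symmetric] by (rule order_trans[OF _ abs_triangle_ineq]) (simp add: algebra_simps)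
    also have "\<dots> \<le> A * B + A * B"
      using A B w i by (intro add_mono mult_mono) auto
    finally show "\<bar>w i * (G' w i * H w + G w * H' w i)\<bar> \<le> A * B + A * B" .
  next
    fix \<gamma> :: "real \<Rightarrow> nat \<Rightarrow> real" and \<eta>
    assume \<gamma>: "\<gamma> 0 \<in> open_simplex p" "\<And>i. i \<in> {1..p} \<Longrightarrow> ((\<lambda>t. \<gamma> t i) has_real_derivative \<eta> i) (at 0)"
    show "((\<lambda>t. G (\<gamma> t) * H (\<gamma> t)) has_real_derivative
       (\<Sum>i = 1..p. (G' (\<gamma> 0) i * H (\<gamma> 0) + G (\<gamma> 0) * H' (\<gamma> 0) i) * \<eta> i)) (at 0)"
      by (rule DERIV_cong[OF DERIV_mult[OF has_gradientD[OF A(4)] has_gradientD[OF B(4)]]])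
         (use \<gamma> in \<open>auto simp: sum_distrib_left sum_distrib_right sum.distrib algebra_simps\<close>)
  qed
qed

lemma smooth_fn_add:
  assumes "smooth_fn p G G'" "smooth_fn p H H'"
  shows "smooth_fn p (\<lambda>w. G w + H w) (\<lambda>w i. G' w i + H' w i)"
proof -
  obtain A where A: "A \<ge> 0" "\<And>w. w \<in> open_simplex p \<Longrightarrow> \<bar>G w\<bar> \<le> A"
    "\<And>w i. w \<in> open_simplex p \<Longrightarrow> i \<in> {1..p} \<Longrightarrow> \<bar>w i * G' w i\<bar> \<le> A"
    "has_gradient p G G'"
    using smooth_fnE[OF assms(1)] by blast
  obtain B where B: "B \<ge> 0" "\<And>w. w \<in> open_simplex p \<Longrightarrow> \<bar>H w\<bar> \<le> B"
    "\<And>w i. w \<in> open_simplex p \<Longrightarrow> i \<in> {1..p} \<Longrightarrow> \<bar>w i * H' w i\<bar> \<le> B"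
    "has_gradient p H H'"
    using smooth_fnE[OF assms(2)] by blast
  show ?thesis
  proof (rule smooth_fnI[where A="A + B" and B="A + B"])
    fix w assume w: "w \<in> open_simplex p"
    show "\<bar>G w + H w\<bar> \<le> A + B" using A(2)[OF w] B(2)[OF w] by linarith
    fix i assume i: "i \<in> {1..p}"
    show "\<bar>w i * (G' w i + H' w i)\<bar> \<le> A + B"
      unfolding distrib_left using A(3)[OF w i] B(3)[OF w i] by linarith
  next
    fix \<gamma> :: "real \<Rightarrow> nat \<Rightarrow> real" and \<eta>
    assume \<gamma>: "\<gamma> 0 \<in> open_simplex p" "\<And>i. i \<in> {1..p} \<Longrightarrow> ((\<lambda>t. \<gamma> t i) has_real_derivative \<eta> i) (at 0)"
    show "((\<lambda>t. G (\<gamma> t) + H (\<gamma> t)) has_real_derivative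
       (\<Sum>i = 1..p. (G' (\<gamma> 0) i + H' (\<gamma> 0) i) * \<eta> i)) (at 0)"
      by (rule DERIV_cong[OF DERIV_add[OF has_gradientD[OF A(4)] has_gradientD[OF B(4)]]])
         (use \<gamma> in \<open>auto simp: sum.distrib algebra_simps\<close>)
  qed
qed

lemma smooth_fn_cmult:
  assumes "smooth_fn p G G'"
  shows "smooth_fn p (\<lambda>w. c * G w) (\<lambda>w i. c * G' w i)"
  using smooth_fn_mult[OF smooth_fn_const assms, of c] by simp

lemma smooth_fn_sum:
  assumes "finite A" "\<And>a. a \<in> A \<Longrightarrow> smooth_fn p (G a) (G' a)"
  shows "smooth_fn p (\<lambda>w. \<Sum>a\<in>A. G a w) (\<lambda>w i. \<Sum>a\<in>A. G' a w i)"
  using assms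
proof (induction A)
  case empty
  then show ?case using smooth_fn_const[of p 0] by simp
next
  case (insert a A)
  then show ?case using smooth_fn_add[of p "G a" "G' a"] by simp
qed

text \<open>\<open>G\<close> takes its values in a compact interval, and there the continuous
  functions \<open>g\<close> and \<open>g'\<close> are bounded even if they are unbounded on the
  line.\<close>

lemma smooth_fn_compose:
  fixes g g' :: "real \<Rightarrow> real"
  assumes "smooth_fn p G G'" and g: "\<And>x. (g has_real_derivative g' x) (at x)" and g': "continuous_on UNIV g'"
  shows "smooth_fn p (\<lambda>w. g (G w)) (\<lambda>w i. g' (G w) * G' w i)"
proof -
  obtain A where A: "A \<ge> 0" "\<And>w. w \<in> open_simplex p \<Longrightarrow> \<bar>G w\<bar> \<le> A"
    "\<And>w i. w \<in> open_simplex p \<Longrightarrow> i \<in> {1..p} \<Longrightarrow> \<bar>w i * G' w i\<bar> \<le> A"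
    "has_gradient p G G'"
    using smooth_fnE[OF assms(1)] by blast
  have contg: "continuous_on UNIV g"
    by (rule DERIV_continuous_on, rule has_field_derivative_at_within, rule g)
  have bdd: "\<exists>B. \<forall>x\<in>{-A..A}. \<bar>f x\<bar> \<le> B" if "continuous_on UNIV f" for f :: "real \<Rightarrow> real"
  proof -
    have "bounded (f ` {-A..A})"
      by (intro compact_imp_bounded compact_continuous_image continuous_on_subset[OF that]) auto
    then show ?thesis unfolding bounded_iff by auto
  qed
  obtain B1 B2 where B: "\<And>x. x \<in> {-A..A} \<Longrightarrow> \<bar>g x\<bar> \<le> B1" "\<And>x. x \<in> {-A..A} \<Longrightarrow> \<bar>g' x\<bar> \<le> B2"
    using bdd[OF contg] bdd[OF g'] by blast
  have GA: "G w \<in> {-A..A}" if "w \<in> open_simplex p" for w using A(2)[OF that] by (auto simp: abs_le_iff)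
  show ?thesis
  proof (rule smooth_fnI[where A=B1 and B="B2 * A"])
    fix w assume w: "w \<in> open_simplex p"
    show "\<bar>g (G w)\<bar> \<le> B1" using B GA[OF w] by auto
    fix i assume i: "i \<in> {1..p}"
    have "\<bar>g' (G w)\<bar> * \<bar>w i * G' w i\<bar> \<le> B2 * A"
      using B(2)[OF GA[OF w]] A(3)[OF w i] by (intro mult_mono) auto
    then show "\<bar>w i * (g' (G w) * G' w i)\<bar> \<le> B2 * A" by (simp add: abs_mult mult_ac)
  next
    fix \<gamma> :: "real \<Rightarrow> nat \<Rightarrow> real" and \<eta>
    assume \<gamma>: "\<gamma> 0 \<in> open_simplex p" "\<And>i. i \<in> {1..p} \<Longrightarrow> ((\<lambda>t. \<gamma> t i) has_real_derivative \<eta> i) (at 0)"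
    show "((\<lambda>t. g (G (\<gamma> t))) has_real_derivative
       (\<Sum>i = 1..p. g' (G (\<gamma> 0)) * G' (\<gamma> 0) i * \<eta> i)) (at 0)"
      by (rule DERIV_cong[OF DERIV_chain2[OF g has_gradientD[OF A(4)]]])
         (use \<gamma> in \<open>auto simp: sum_distrib_left mult_ac\<close>)
  qed
qed

section \<open>Algebra of tilt derivatives\<close>

lemma tilt_deriv_add: "tilt_deriv p w (\<lambda>k. d k + d' k) i = tilt_deriv p w d i + tilt_deriv p w d' i"
  by (simp add: tilt_deriv_def algebra_simps sum.distrib sum_distrib_left)

lemma tilt_deriv_cmult: "tilt_deriv p w (\<lambda>k. c * d k) i = c * tilt_deriv p w d i"
  by (simp add: tilt_deriv_def algebra_simps sum_distrib_left)

lemma tilt_deriv_diff: "tilt_deriv p w (\<lambda>k. d k - d' k) i = tilt_deriv p w d i - tilt_deriv p w d' i"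
  by (simp add: tilt_deriv_def algebra_simps sum_subtractf sum_distrib_left)

lemma tilt_deriv_sum:
  "tilt_deriv p w (\<lambda>k. \<Sum>a\<in>A. d a k) i = (\<Sum>a\<in>A. tilt_deriv p w (d a) i)"
proof -
  have "(\<Sum>j=1..p. w j * (\<Sum>a\<in>A. d a j)) = (\<Sum>a\<in>A. \<Sum>j=1..p. w j * d a j)"
    unfolding sum_distrib_left by (rule sum.swap)
  then show ?thesis by (simp add: tilt_deriv_def sum_subtractf sum_distrib_left right_diff_distrib)
qed

lemma tilt_deriv_delta:
  assumes "i \<in> {1..p}"
  shows "tilt_deriv p w (\<lambda>k. if k = i then c else 0) i = c * w i * (1 - w i)"
proof -
  have "(\<Sum>j=1..p. w j * (if j = i then c else 0)) = w i * c"
    using assms by (subst sum.cong[OF refl, of _ _ "\<lambda>j. if i = j then w j * c else 0"]) auto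
  then show ?thesis by (simp add: tilt_deriv_def algebra_simps)
qed

lemma smooth_fn_tilt_deriv_bounded:
  assumes "smooth_fn p G G'"
  obtains B where "B \<ge> 0" "\<And>w i. w \<in> open_simplex p \<Longrightarrow> i \<in> {1..p} \<Longrightarrow> \<bar>tilt_deriv p w (G' w) i\<bar> \<le> B"
proof -
  obtain A where A: "A \<ge> 0" "\<And>w. w \<in> open_simplex p \<Longrightarrow> \<bar>G w\<bar> \<le> A"
    "\<And>w i. w \<in> open_simplex p \<Longrightarrow> i \<in> {1..p} \<Longrightarrow> \<bar>w i * G' w i\<bar> \<le> A"
    "has_gradient p G G'"
    using smooth_fnE[OF assms] by blast
  show thesis
  proof (rule that[of "A + real p * A"])
    fix w i assume w: "w \<in> open_simplex p" and i: "i \<in> {1..p}"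
    have "\<bar>\<Sum>j=1..p. w j * G' w j\<bar> \<le> (\<Sum>j=1..p. A)"
      by (intro order_trans[OF sum_abs] sum_mono A(3)[OF w])
    then have "\<bar>w i\<bar> * \<bar>\<Sum>j=1..p. w j * G' w j\<bar> \<le> 1 * (real p * A)"
      using open_simplexD[OF w] i A(1) by (intro mult_mono) (auto simp: less_imp_le)
    then show "\<bar>tilt_deriv p w (G' w) i\<bar> \<le> A + real p * A"
      using A(3)[OF w i] unfolding tilt_deriv_def right_diff_distrib abs_mult[symmetric] by linarith
  qed (use A in auto)
qed

(* Keeps the lower bound of the index sets {1..p} in the form 1. *)
declare One_nat_def [simp del]

section \<open>Stability of the leading term of T in the bin probabilities\<close>

lemma sum_abs_diff_le_of_le:
  fixes x y :: "nat \<Rightarrow> real"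
  assumes "(\<Sum>i=1..p. x i) = (\<Sum>i=1..p. y i)" "\<And>i. i \<in> {1..p} \<Longrightarrow> x i \<le> y i + \<epsilon> / p" "0 \<le> \<epsilon>"
  shows "(\<Sum>i=1..p. \<bar>x i - y i\<bar>) \<le> 2 * \<epsilon>"
proof -
  \<comment> \<open>A number d that is at most a nonnegative e satisfies |d| <= 2 e - d. Summed over
    the bins, the signed part drops out because both totals agree; this is how one-sided bounds
    control the l1 distance.\<close>
  have "(\<Sum>i=1..p. \<bar>x i - y i\<bar>) \<le> (\<Sum>i=1..p. 2 * (\<epsilon> / p) - (x i - y i))"
  proof (rule sum_mono)
    fix i assume "i \<in> {1..p}"
    then show "\<bar>x i - y i\<bar> \<le> 2 * (\<epsilon> / p) - (x i - y i)"
      using assms(2)[of i] assms(3) divide_nonneg_nonneg[of \<epsilon> "real p"] by (simp add: abs_le_iff)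
  qed
  also have "\<dots> \<le> 2 * \<epsilon>"
    using assms(1,3) by (simp add: sum_subtractf)
  finally show ?thesis .
qed

text \<open>For histograms f and g with bin probabilities \<open>w\<close> and \<open>h\<close> this
  is the integral of (f + g) f (f - m), where m is the integral of f^2. For f = g it equals twice
  the integral of (f - m)^2 f, because f - m has mean zero under f; hence twice
  \<open>main_term p q q\<close> is the limit variance of the binned density.\<close>

definition main_term :: "nat \<Rightarrow> (nat \<Rightarrow> real) \<Rightarrow> (nat \<Rightarrow> real) \<Rightarrow> real" where
  "main_term p w h = (real p)\<^sup>2 * (\<Sum>i=1..p. (w i + h i) * w i * (w i - (\<Sum>j=1..p. (w j)\<^sup>2)))"

text \<open>The leading term is \<open>C w h - A w * B w h\<close> with polynomial sums
  \<open>A\<close>, \<open>B\<close>, \<open>C\<close>. Telescoping each polynomial leaves one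
  difference \<open>w i - q i\<close> or \<open>h i - q i\<close> times factors
  \<open>P * w i\<close>, \<open>P * h i\<close>, \<open>P * q i\<close> bounded by
  \<open>c\<close>. \<open>C\<close> contributes 5 d1 + d2 and the product 7 d1 + d2, each times
  c^2.\<close>

lemma main_term_lipschitz:
  fixes w h q :: "nat \<Rightarrow> real"
  assumes w: "\<And>i. i \<in> {1..p} \<Longrightarrow> 0 \<le> w i" "\<And>i. i \<in> {1..p} \<Longrightarrow> p * w i \<le> c" "(\<Sum>i=1..p. w i) = 1"
    and h: "\<And>i. i \<in> {1..p} \<Longrightarrow> 0 \<le> h i" "\<And>i. i \<in> {1..p} \<Longrightarrow> p * h i \<le> c" "(\<Sum>i=1..p. h i) = 1"
    and q: "\<And>i. i \<in> {1..p} \<Longrightarrow> 0 \<le> q i" "\<And>i. i \<in> {1..p} \<Longrightarrow> p * q i \<le> c" "(\<Sum>i=1..p. q i) = 1"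
    and d1: "(\<Sum>i=1..p. \<bar>w i - q i\<bar>) \<le> d1" and d2: "(\<Sum>i=1..p. \<bar>h i - q i\<bar>) \<le> d2"
    and p: "p \<ge> 1" and c: "c \<ge> 0"
  shows "\<bar>main_term p w h - main_term p q q\<bar> \<le> c\<^sup>2 * (12 * d1 + 2 * d2)"
proof -
  define P where "P = real p"
  have P: "P > 0" using p by (simp add: P_def)
  define A where "A w = P * (\<Sum>i=1..p. (w i)\<^sup>2)" for w :: "nat \<Rightarrow> real"
  define B where "B w h = P * (\<Sum>i=1..p. (w i + h i) * w i)" for w h :: "nat \<Rightarrow> real"
  define C where "C w h = P\<^sup>2 * (\<Sum>i=1..p. (w i + h i) * w i * w i)" for w h :: "nat \<Rightarrow> real"
  have mt: "main_term p w h = C w h - A w * B w h" for w h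
    unfolding main_term_def A_def B_def C_def P_def
    by (simp add: right_diff_distrib sum_subtractf sum_distrib_right[symmetric] power2_eq_square mult_ac)
       (simp add: sum_distrib_left sum_distrib_right mult_ac)
  have w': "P * w i \<le> c" "0 \<le> P * w i" and h': "P * h i \<le> c" "0 \<le> P * h i" and q': "P * q i \<le> c" "0 \<le> P * q i"
    if "i \<in> {1..p}" for i using w h q that P by (auto simp: P_def)
  have Clip: "\<bar>C w h - C q q\<bar> \<le> c\<^sup>2 * (5 * d1 + d2)"
  proof -
    have "C w h - C q q = (\<Sum>i=1..p. P\<^sup>2 * ((w i + h i) * w i * w i - (q i + q i) * q i * q i))"
      by (simp add: C_def sum_distrib_left[symmetric] right_diff_distrib sum_subtractf)
    also have "\<bar>\<dots>\<bar> \<le> (\<Sum>i=1..p. c\<^sup>2 * (5 * \<bar>w i - q i\<bar> + \<bar>h i - q i\<bar>))"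
    proof (rule order_trans[OF sum_abs], rule sum_mono)
      fix i assume i: "i \<in> {1..p}"
      \<comment> \<open>The cubic is telescoped so that every remaining factor carries its own P;
        the five products next to \<open>w i - q i\<close> are the origin of the constant 5.\<close>
      have "P\<^sup>2 * ((w i + h i) * w i * w i - (q i + q i) * q i * q i) =
         (w i - q i) * ((P * w i) * (P * w i) + (P * w i) * (P * q i) + (P * q i) * (P * q i)
            + (P * q i) * (P * w i) + (P * q i) * (P * q i)) + (h i - q i) * ((P * w i) * (P * w i))"
        by (simp add: algebra_simps power2_eq_square)
      also have "\<bar>\<dots>\<bar> \<le> \<bar>w i - q i\<bar> * (c * c + c * c + c * c + c * c + c * c) + \<bar>h i - q i\<bar> * (c * c)"
      proof -
        have m: "\<bar>x * y\<bar> \<le> c * c" if "0 \<le> x" "x \<le> c" "0 \<le> y" "y \<le> c" for x y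
          unfolding abs_mult using that by (intro mult_mono) auto
        note b = w'[OF i] q'[OF i]
        note m = m[OF b(2,1,2,1)] m[OF b(2,1) b(4,3)] m[OF b(4,3,4,3)] m[OF b(4,3) b(2,1)]
        show ?thesis
          by (rule order_trans[OF abs_triangle_ineq], unfold abs_mult[of "w i - q i"] abs_mult[of "h i - q i"],
              intro add_mono mult_left_mono) (use m in linarith)+
      qed
      finally show "\<bar>P\<^sup>2 * ((w i + h i) * w i * w i - (q i + q i) * q i * q i)\<bar>
          \<le> c\<^sup>2 * (5 * \<bar>w i - q i\<bar> + \<bar>h i - q i\<bar>)"
        by (simp add: algebra_simps power2_eq_square)
    qed
    also have "\<dots> = c\<^sup>2 * (5 * (\<Sum>i=1..p. \<bar>w i - q i\<bar>) + (\<Sum>i=1..p. \<bar>h i - q i\<bar>))"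
      by (simp add: sum_distrib_left[symmetric] sum.distrib)
    also have "\<dots> \<le> c\<^sup>2 * (5 * d1 + d2)"
      using d1 d2 by (intro mult_left_mono) auto
    finally show ?thesis .
  qed
  have Blip: "\<bar>B w h - B q q\<bar> \<le> c * (3 * d1 + d2)"
  proof -
    have "B w h - B q q = (\<Sum>i=1..p. P * ((w i + h i) * w i - (q i + q i) * q i))"
      by (simp add: B_def sum_distrib_left[symmetric] right_diff_distrib sum_subtractf)
    also have "\<bar>\<dots>\<bar> \<le> (\<Sum>i=1..p. c * (3 * \<bar>w i - q i\<bar> + \<bar>h i - q i\<bar>))"
    proof (rule order_trans[OF sum_abs], rule sum_mono)
      fix i assume i: "i \<in> {1..p}"
      have "P * ((w i + h i) * w i - (q i + q i) * q i) =
         (w i - q i) * (P * w i + P * q i + P * q i) + (h i - q i) * (P * w i)"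
        by (simp add: algebra_simps power2_eq_square)
      also have "\<bar>\<dots>\<bar> \<le> \<bar>w i - q i\<bar> * (c + c + c) + \<bar>h i - q i\<bar> * c"
        by (rule order_trans[OF abs_triangle_ineq], unfold abs_mult[of "w i - q i"] abs_mult[of "h i - q i"],
            intro add_mono mult_left_mono) (use w'[OF i] q'[OF i] in linarith)+
      finally show "\<bar>P * ((w i + h i) * w i - (q i + q i) * q i)\<bar>
          \<le> c * (3 * \<bar>w i - q i\<bar> + \<bar>h i - q i\<bar>)"
        by (simp add: algebra_simps power2_eq_square)
    qed
    also have "\<dots> = c * (3 * (\<Sum>i=1..p. \<bar>w i - q i\<bar>) + (\<Sum>i=1..p. \<bar>h i - q i\<bar>))"
      by (simp add: sum_distrib_left[symmetric] sum.distrib)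
    also have "\<dots> \<le> c * (3 * d1 + d2)"
      using d1 d2 c by (intro mult_left_mono) auto
    finally show ?thesis .
  qed
  have Alip: "\<bar>A w - A q\<bar> \<le> 2 * c * d1"
  proof -
    have "A w - A q = (\<Sum>i=1..p. P * ((w i)\<^sup>2 - (q i)\<^sup>2))"
      by (simp add: A_def sum_distrib_left[symmetric] right_diff_distrib sum_subtractf)
    also have "\<bar>\<dots>\<bar> \<le> (\<Sum>i=1..p. (2 * c) * \<bar>w i - q i\<bar>)"
    proof (rule order_trans[OF sum_abs], rule sum_mono)
      fix i assume i: "i \<in> {1..p}"
      have "P * ((w i)\<^sup>2 - (q i)\<^sup>2) = (w i - q i) * (P * w i + P * q i)"
        by (simp add: algebra_simps power2_eq_square)
      also have "\<bar>\<dots>\<bar> \<le> \<bar>w i - q i\<bar> * (c + c)"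
        unfolding abs_mult by (intro mult_left_mono) (use w'[OF i] q'[OF i] in auto)
      finally show "\<bar>P * ((w i)\<^sup>2 - (q i)\<^sup>2)\<bar> \<le> (2 * c) * \<bar>w i - q i\<bar>" by (simp add: mult_ac)
    qed
    also have "\<dots> \<le> 2 * c * d1"
      unfolding sum_distrib_left[symmetric] using d1 c by (intro mult_left_mono) auto
    finally show ?thesis .
  qed
  have A0: "\<bar>A w\<bar> \<le> c"
  proof -
    have "A w = (\<Sum>i=1..p. (P * w i) * w i)" by (simp add: A_def sum_distrib_left power2_eq_square mult_ac)
    also have "\<dots> \<le> (\<Sum>i=1..p. c * w i)" by (intro sum_mono mult_right_mono) (use w w' in auto)
    also have "\<dots> = c" by (simp add: sum_distrib_left[symmetric] w)
    finally show ?thesis using P by (simp add: A_def sum_nonneg)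
  qed
  have B0: "\<bar>B q q\<bar> \<le> 2 * c"
  proof -
    have "B q q = (\<Sum>i=1..p. (2 * (P * q i)) * q i)" by (simp add: B_def sum_distrib_left mult_ac)
    also have "\<bar>\<dots>\<bar> \<le> (\<Sum>i=1..p. (2 * c) * q i)"
      by (rule order_trans[OF sum_abs], rule sum_mono) (use q q' P in \<open>simp add: abs_mult mult.assoc[symmetric] mult_right_mono\<close>)
    also have "\<dots> = 2 * c" by (simp add: sum_distrib_left[symmetric] q)
    finally show ?thesis .
  qed
  have "A w * B w h - A q * B q q = A w * (B w h - B q q) + (A w - A q) * B q q"
    by (simp add: algebra_simps)
  also have "\<bar>\<dots>\<bar> \<le> c * (c * (3 * d1 + d2)) + (2 * c * d1) * (2 * c)"
    by (rule order_trans[OF abs_triangle_ineq], unfold abs_mult, intro add_mono mult_mono)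
       (use A0 B0 Alip Blip c in auto)
  finally have "\<bar>A w * B w h - A q * B q q\<bar> \<le> c\<^sup>2 * (7 * d1 + d2)"
    by (simp add: power2_eq_square algebra_simps)
  then show ?thesis using Clip unfolding mt by (simp add: algebra_simps abs_le_iff)
qed

text \<open>The leading term is an average with weights \<open>w i\<close> of products of two
  factors, bounded by 2 c and by c.\<close>

lemma main_term_bound:
  fixes w h :: "nat \<Rightarrow> real"
  assumes w: "w \<in> open_simplex p" "\<And>i. i \<in> {1..p} \<Longrightarrow> p * w i \<le> c"
    and h: "\<And>i. i \<in> {1..p} \<Longrightarrow> 0 \<le> h i" "\<And>i. i \<in> {1..p} \<Longrightarrow> p * h i \<le> c"
    and c: "c \<ge> 0"
  shows "\<bar>main_term p w h\<bar> \<le> 2 * c\<^sup>2"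
proof -
  define P where "P = real p"
  define s where "s = (\<Sum>j=1..p. (w j)\<^sup>2)"
  have w0: "0 \<le> w i" "w i \<le> 1" if "i \<in> {1..p}" for i using open_simplexD[OF w(1)] that by (auto simp: less_imp_le)
  have P0: "P \<ge> 0" by (simp add: P_def)
  have s0: "0 \<le> s" by (simp add: s_def sum_nonneg)
  have Ps: "P * s \<le> c"
  proof -
    have "P * s = (\<Sum>i=1..p. (P * w i) * w i)" by (simp add: s_def sum_distrib_left power2_eq_square mult_ac)
    also have "\<dots> \<le> (\<Sum>i=1..p. c * w i)" by (intro sum_mono mult_right_mono) (use w w0 in \<open>auto simp: P_def\<close>)
    also have "\<dots> = c" by (simp add: sum_distrib_left[symmetric] open_simplexD[OF w(1)])
    finally show ?thesis .
  qed
  have "main_term p w h = (\<Sum>i=1..p. (P * w i + P * h i) * (P * w i - P * s) * w i)"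
    unfolding main_term_def P_def[symmetric] s_def[symmetric]
    by (simp add: sum_distrib_left power2_eq_square algebra_simps)
  also have "\<bar>\<dots>\<bar> \<le> (\<Sum>i=1..p. (2 * c) * c * w i)"
  proof (rule order_trans[OF sum_abs], rule sum_mono)
    fix i assume i: "i \<in> {1..p}"
    have "0 \<le> P * w i" "P * w i \<le> c" "0 \<le> P * h i" "P * h i \<le> c" "0 \<le> P * s" "P * s \<le> c"
      using w(2)[OF i] w0[OF i] h(1,2)[OF i] P0 s0 Ps by (auto simp: P_def)
    then have "\<bar>P * w i + P * h i\<bar> \<le> 2 * c" "\<bar>P * w i - P * s\<bar> \<le> c" by linarith+
    then show "\<bar>(P * w i + P * h i) * (P * w i - P * s) * w i\<bar> \<le> (2 * c) * c * w i"
      unfolding abs_mult using w0[OF i] c by (intro mult_mono) auto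
  qed
  also have "\<dots> = 2 * c\<^sup>2" by (simp add: sum_distrib_left[symmetric] open_simplexD[OF w(1)] power2_eq_square)
  finally show ?thesis .
qed

lemma smooth_fn_cong:
  assumes "smooth_fn p G G'" "\<And>w. G w = H w" "\<And>w k. w \<in> open_simplex p \<Longrightarrow> k \<in> {1..p} \<Longrightarrow> G' w k = H' w k"
  shows "smooth_fn p H H'"
proof -
  have "G = H" using assms(2) by auto
  moreover have "has_gradient p G H'"
    unfolding has_gradient_def
  proof (intro allI impI)
    fix \<gamma> :: "real \<Rightarrow> nat \<Rightarrow> real" and \<eta>
    assume \<gamma>: "\<gamma> 0 \<in> open_simplex p" "\<forall>i\<in>{1..p}. ((\<lambda>t. \<gamma> t i) has_real_derivative \<eta> i) (at 0)"
    have "((\<lambda>t. G (\<gamma> t)) has_real_derivative (\<Sum>i=1..p. G' (\<gamma> 0) i * \<eta> i)) (at 0)"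
      using \<gamma> assms(1) unfolding smooth_fn_def has_gradient_def by blast
    also have "(\<Sum>i=1..p. G' (\<gamma> 0) i * \<eta> i) = (\<Sum>i=1..p. H' (\<gamma> 0) i * \<eta> i)"
      using assms(3)[OF \<gamma>(1)] by (intro sum.cong) auto
    finally show "((\<lambda>t. G (\<gamma> t)) has_real_derivative (\<Sum>i=1..p. H' (\<gamma> 0) i * \<eta> i)) (at 0)" .
  qed
  ultimately show ?thesis using assms(1,3) unfolding smooth_fn_def by simp
qed

section \<open>A Stein identity for random bin probabilities\<close>

text \<open>A law of random bin probabilities \<open>W\<close> that behaves like the posterior given bin frequencies \<open>h\<close>
  under a prior with score \<open>R i\<close> in the direction of the tilt of bin \<open>i\<close>; the last assumption is
  integration by parts along that tilt.\<close>

locale stein_model = prob_space Q for Q :: "'b measure" +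
  fixes p n :: nat and W :: "'b \<Rightarrow> nat \<Rightarrow> real" and h :: "nat \<Rightarrow> real"
    and R :: "nat \<Rightarrow> (nat \<Rightarrow> real) \<Rightarrow> real" and R' :: "nat \<Rightarrow> (nat \<Rightarrow> real) \<Rightarrow> nat \<Rightarrow> real"
    and a b e :: real
  assumes p: "p \<ge> 1" and n: "n \<ge> 1"
    and W_meas: "\<And>i. i \<in> {1..p} \<Longrightarrow> (\<lambda>x. W x i) \<in> borel_measurable Q"
    and W_simplex: "AE x in Q. W x \<in> open_simplex p"
    and h_nonneg: "\<And>i. i \<in> {1..p} \<Longrightarrow> 0 \<le> h i" and h_sum: "(\<Sum>i=1..p. h i) = 1"
    and abe: "0 \<le> a" "0 \<le> b" "0 \<le> e"
    and R_smooth: "\<And>i. i \<in> {1..p} \<Longrightarrow> smooth_fn p (R i) (R' i)"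
    and R_meas: "\<And>i. i \<in> {1..p} \<Longrightarrow> (\<lambda>x. R i (W x)) \<in> borel_measurable Q"
    and R_bound: "\<And>i w. i \<in> {1..p} \<Longrightarrow> w \<in> open_simplex p \<Longrightarrow> \<bar>R i w\<bar> \<le> a + b * w i"
    and R'_bound: "\<And>u c w. w \<in> open_simplex p \<Longrightarrow> (\<And>i. i \<in> {1..p} \<Longrightarrow> \<bar>u i\<bar> \<le> c) \<Longrightarrow>
      \<bar>\<Sum>i=1..p. \<Sum>j=1..p. u i * u j * tilt_deriv p w (R' j w) i\<bar> \<le> e * c\<^sup>2"
    and stein: "\<And>G G' i. smooth_fn p G G' \<Longrightarrow> (\<lambda>x. G (W x)) \<in> borel_measurable Q \<Longrightarrow> i \<in> {1..p} \<Longrightarrow>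
      \<exists>F. has_bochner_integral Q F 0 \<and> (AE x in Q. F x = tilt_deriv p (W x) (G' (W x)) i
        + G (W x) * (n * h i - n * W x i + R i (W x)))"
begin

text \<open>The tilt derivative of \<open>p * (w i + h i)\<close> in direction i is
  \<open>p * w i * (1 - w i)\<close>. Its sum is p minus p times the sum of squares, which raises
  the coefficient from n to n + 1 and adds the term \<open>- real p\<close>.\<close>

definition Zfun :: "(nat \<Rightarrow> real) \<Rightarrow> real" where
  "Zfun w = ((real n + 1) * real p * (\<Sum>i=1..p. (w i)\<^sup>2) - real p
    - (\<Sum>i=1..p. real p * (w i + h i) * R i w) - real n * real p * (\<Sum>i=1..p. (h i)\<^sup>2)) / sqrt n"

definition Zgrad :: "(nat \<Rightarrow> real) \<Rightarrow> nat \<Rightarrow> real" where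
  "Zgrad w k = (2 * (real n + 1) * real p * w k - real p * R k w
    - (\<Sum>i=1..p. real p * (w i + h i) * R' i w k)) / sqrt n"

definition Tfun :: "(nat \<Rightarrow> real) \<Rightarrow> real" where
  "Tfun w = (\<Sum>i=1..p. real p * (w i + h i) * tilt_deriv p w (Zgrad w) i) / sqrt n"

lemma Zfun_smooth: "smooth_fn p Zfun Zgrad"
proof (rule smooth_fn_cong)
  let ?G = "\<lambda>w. 1 / sqrt n * ((\<Sum>i=1..p. ((real n + 1) * real p) * (w i * w i)
       + (-1) * (real p * ((w i + h i) * R i w))) + (- real p - real n * real p * (\<Sum>i=1..p. (h i)\<^sup>2)))"
  let ?G' = "\<lambda>w k. 1 / sqrt n * ((\<Sum>i=1..p. ((real n + 1) * real p) * ((if k = i then 1 else 0) * w i + w i * (if k = i then 1 else 0))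
       + (-1) * (real p * (((if k = i then 1 else 0) + 0) * R i w + (w i + h i) * R' i w k))) + 0)"
  show "smooth_fn p ?G ?G'"
    by (intro smooth_fn_sum smooth_fn_add smooth_fn_cmult smooth_fn_mult smooth_fn_coord R_smooth smooth_fn_const) auto
  show "?G w = Zfun w" for w
    by (simp add: Zfun_def sum.distrib sum_distrib_left sum_negf sum_subtractf power2_eq_square mult_ac)
  show "?G' w k = Zgrad w k" if "w \<in> open_simplex p" "k \<in> {1..p}" for w k
  proof -
    have 1: "(\<Sum>i=1..p. (real n + 1) * real p * ((if k = i then 1 else 0) * w i + w i * (if k = i then 1 else 0)))
      = 2 * (real n + 1) * real p * w k"
      using that by (subst sum.cong[OF refl, of _ _ "\<lambda>i. if k = i then 2 * (real n + 1) * real p * w k else 0"]) auto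
    have 2: "(\<Sum>i=1..p. real p * (((if k = i then 1 else 0) + 0) * R i w))
      = real p * R k w"
      using that by (subst sum.cong[OF refl, of _ _ "\<lambda>i. if k = i then real p * R k w else 0"]) auto
    show ?thesis using 1 2 unfolding Zgrad_def
      by (simp add: sum.distrib distrib_left sum_negf mult_ac sum_subtractf add_divide_distrib diff_divide_distrib)
  qed
qed

lemma Zfun_meas: "(\<lambda>x. Zfun (W x)) \<in> borel_measurable Q"
  unfolding Zfun_def using W_meas R_meas by (auto intro!: borel_measurable_sum borel_measurable_diff borel_measurable_times borel_measurable_add borel_measurable_divide borel_measurable_power)

text \<open>By the product rule for \<open>g (Zfun w) * (p * (w i + h i))\<close> the terms with
  \<open>g'\<close> assemble to \<open>Tfun\<close>, and those with \<open>g\<close>, together with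
  the score, to minus \<open>Zfun\<close>. The integrand is given through an a.e. equal
  \<open>F\<close>, since nothing is said about measurability of gradients along
  \<open>W\<close>.\<close>

lemma stein_Zfun:
  fixes g g' :: "real \<Rightarrow> real"
  assumes g: "\<And>x. (g has_real_derivative g' x) (at x)" and g': "continuous_on UNIV g'"
  obtains F where "has_bochner_integral Q F 0"
    "AE x in Q. F x = g' (Zfun (W x)) * Tfun (W x) - Zfun (W x) * g (Zfun (W x))"
proof -
  let ?G = "\<lambda>i w. g (Zfun w) * (real p * (w i + h i))"
  let ?G' = "\<lambda>i w k. (g' (Zfun w) * Zgrad w k) * (real p * (w i + h i)) + g (Zfun w) * (real p * ((if k = i then 1 else 0) + 0))"
  have contg: "continuous_on UNIV g"
    by (rule DERIV_continuous_on, rule has_field_derivative_at_within, rule g)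
  have [measurable]: "g \<in> borel_measurable borel" using contg by (rule borel_measurable_continuous_onI)
  note [measurable] = Zfun_meas W_meas
  have "\<exists>F. has_bochner_integral Q F 0 \<and> (AE x in Q. F x = tilt_deriv p (W x) (?G' i (W x)) i
        + ?G i (W x) * (n * h i - n * W x i + R i (W x)))" if i: "i \<in> {1..p}" for i
  proof (rule stein)
    show "smooth_fn p (?G i) (?G' i)"
      by (intro smooth_fn_mult smooth_fn_compose[OF Zfun_smooth g g'] smooth_fn_add smooth_fn_cmult smooth_fn_coord smooth_fn_const i)
    show "(\<lambda>x. ?G i (W x)) \<in> borel_measurable Q" using i by measurable
  qed (use i in auto)
  note ex = someI_ex[OF this]
  define F where "F i = (SOME F. has_bochner_integral Q F 0 \<and> (AE x in Q. F x = tilt_deriv p (W x) (?G' i (W x)) i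
        + ?G i (W x) * (n * h i - n * W x i + R i (W x))))" for i
  have F: "has_bochner_integral Q (F i) 0" "AE x in Q. F i x = tilt_deriv p (W x) (?G' i (W x)) i
        + ?G i (W x) * (n * h i - n * W x i + R i (W x))" if "i \<in> {1..p}" for i
    using ex[OF that] unfolding F_def by (rule conjunct1, rule conjunct2)
  have FI: "has_bochner_integral Q (\<lambda>x. 1 / sqrt n * (\<Sum>i=1..p. F i x)) (1 / sqrt n * (\<Sum>i=1..p. 0))"
    by (intro has_bochner_integral_mult_right has_bochner_integral_sum F)
  have FA: "AE x in Q. \<forall>i\<in>{1..p}. F i x = tilt_deriv p (W x) (?G' i (W x)) i
        + ?G i (W x) * (n * h i - n * W x i + R i (W x))"
    by (rule AE_finite_allI) (use F(2) in auto)
  have eqn: "1 / sqrt n * (\<Sum>i=1..p. tilt_deriv p w (?G' i w) i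
        + ?G i w * (n * h i - n * w i + R i w)) = g' (Zfun w) * Tfun w - Zfun w * g (Zfun w)"
    if w: "w \<in> open_simplex p" for w :: "nat \<Rightarrow> real"
  proof -
    let ?u = "\<lambda>i. real p * (w i + h i)"
    have "tilt_deriv p w (?G' i w) i = g' (Zfun w) * (?u i * tilt_deriv p w (Zgrad w) i)
        + g (Zfun w) * (real p * w i * (1 - w i))" if "i \<in> {1..p}" for i
    proof -
      have eq: "?G' i w = (\<lambda>k. (g' (Zfun w) * ?u i) * Zgrad w k + (if k = i then g (Zfun w) * real p else 0))"
        by (auto simp: fun_eq_iff)
      show ?thesis unfolding eq tilt_deriv_add tilt_deriv_cmult tilt_deriv_delta[OF that] by simp
    qed
    then have "(\<Sum>i=1..p. tilt_deriv p w (?G' i w) i + ?G i w * (n * h i - n * w i + R i w))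
      = (\<Sum>i=1..p. g' (Zfun w) * (?u i * tilt_deriv p w (Zgrad w) i) + g (Zfun w) *
          (real p * w i * (1 - w i) + ?u i * (n * h i - n * w i + R i w)))"
      by (intro sum.cong refl) (simp add: algebra_simps)
    also have "\<dots> = g' (Zfun w) * (\<Sum>i=1..p. ?u i * tilt_deriv p w (Zgrad w) i)
       + g (Zfun w) * (\<Sum>i=1..p. real p * w i * (1 - w i) + ?u i * (n * h i - n * w i + R i w))"
      by (simp add: sum.distrib sum_distrib_left[symmetric])
    \<comment> \<open>The product \<open>?u i * (n * h i - n * w i)\<close> is a difference of
      squares, so no mixed term in \<open>w\<close> and \<open>h\<close> survives.\<close>
    also have "(\<Sum>i=1..p. real p * w i * (1 - w i) + ?u i * (n * h i - n * w i + R i w))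
       = (\<Sum>i=1..p. real p * w i - (real n + 1) * real p * (w i)\<^sup>2 + ?u i * R i w + n * real p * (h i)\<^sup>2)"
      by (intro sum.cong refl) (simp add: algebra_simps power2_eq_square)
    also have "\<dots> = real p * (\<Sum>i=1..p. w i) - (real n + 1) * real p * (\<Sum>i=1..p. (w i)\<^sup>2) + (\<Sum>i=1..p. ?u i * R i w)
        + n * real p * (\<Sum>i=1..p. (h i)\<^sup>2)"
      by (simp add: sum.distrib sum_subtractf sum_distrib_left)
    also have "\<dots> = - sqrt n * Zfun w"
      using n open_simplexD(3)[OF w] by (simp add: Zfun_def)
    also have "(\<Sum>i=1..p. ?u i * tilt_deriv p w (Zgrad w) i) = sqrt n * Tfun w"
      using n by (simp add: Tfun_def)
    finally have *: "(\<Sum>i=1..p. tilt_deriv p w (?G' i w) i + ?G i w * (n * h i - n * w i + R i w))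
      = g' (Zfun w) * (sqrt n * Tfun w) + g (Zfun w) * (- sqrt n * Zfun w)" .
    show ?thesis unfolding * using n by (simp add: field_simps)
  qed
  show thesis
  proof (rule that)
    show "has_bochner_integral Q (\<lambda>x. 1 / sqrt n * (\<Sum>i=1..p. F i x)) 0" using FI by simp
    show "AE x in Q. 1 / sqrt n * (\<Sum>i=1..p. F i x) = g' (Zfun (W x)) * Tfun (W x) - Zfun (W x) * g (Zfun (W x))"
      using FA W_simplex
    proof eventually_elim
      case (elim x)
      have "(\<Sum>i=1..p. F i x) = (\<Sum>i=1..p. tilt_deriv p (W x) (?G' i (W x)) i
        + ?G i (W x) * (n * h i - n * W x i + R i (W x)))"
        by (rule sum.cong[OF refl]) (rule elim(1)[rule_format])
      then show ?case using eqn[OF elim(2)] by (simp only:)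
    qed
  qed
qed

text \<open>\<open>n * Tfun w\<close> has three groups of terms. Tilting the sum of squares yields
  the leading term exactly. Tilting the factor \<open>p * (w i + h i)\<close> next to
  \<open>R i\<close> yields \<open>E\<close>, controlled by \<open>a\<close> and \<open>b\<close>.
  Tilting \<open>R i\<close> itself yields \<open>D\<close>, controlled by \<open>e\<close>. All
  weights \<open>u i\<close> are at most 2 c.\<close>

lemma Tfun_bound:
  fixes w :: "nat \<Rightarrow> real" and c :: real
  assumes w: "w \<in> open_simplex p" "\<And>i. i \<in> {1..p} \<Longrightarrow> p * w i \<le> c" "\<And>i. i \<in> {1..p} \<Longrightarrow> p * h i \<le> c"
    and c: "c \<ge> 0"
  shows "\<bar>Tfun w - 2 * (1 + 1 / n) * main_term p w h\<bar> \<le> (4 * c * (p * a + b * c) + 4 * c\<^sup>2 * e) / n"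
proof -
  define u where "u i = real p * (w i + h i)" for i
  define D where "D = (\<Sum>i=1..p. \<Sum>j=1..p. u i * u j * tilt_deriv p w (R' j w) i)"
  define r where "r = (\<Sum>j=1..p. w j * R j w)"
  have u: "\<bar>u i\<bar> \<le> 2 * c" if "i \<in> {1..p}" for i
    using w(2,3)[OF that] h_nonneg[OF that] open_simplexD(1)[OF w(1) that] unfolding u_def
    by (simp add: distrib_left)
  have D: "\<bar>D\<bar> \<le> e * (2 * c)\<^sup>2"
    unfolding D_def by (rule R'_bound[OF w(1) u])
  have pw: "\<bar>p * w i * R i w\<bar> \<le> p * w i * (a + b * w i)" if "i \<in> {1..p}" for i
    unfolding abs_mult using open_simplexD(1)[OF w(1) that] R_bound[OF that w(1)] by (auto intro!: mult_left_mono)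
  have S: "(\<Sum>i=1..p. p * w i * (a + b * w i)) \<le> p * a + b * c"
  proof -
    have "(\<Sum>i=1..p. p * w i * (a + b * w i)) \<le> (\<Sum>i=1..p. (p * a + b * c) * w i)"
    proof (rule sum_mono)
      fix i assume i: "i \<in> {1..p}"
      have "(p * w i) * (b * w i) \<le> c * (b * w i)"
        using w(2)[OF i] open_simplexD(1)[OF w(1) i] abe by (intro mult_right_mono) auto
      then show "p * w i * (a + b * w i) \<le> (p * a + b * c) * w i" by (simp add: algebra_simps)
    qed
    also have "\<dots> = p * a + b * c" by (simp add: sum_distrib_left[symmetric] open_simplexD[OF w(1)])
    finally show ?thesis .
  qed
  have r: "\<bar>p * r\<bar> \<le> p * a + b * c"
    unfolding r_def sum_distrib_left mult.assoc[symmetric]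
    by (rule order_trans[OF sum_abs], rule order_trans[OF sum_mono[OF pw] S])
  define E where "E = (\<Sum>i=1..p. u i * (p * w i * R i w - p * r * w i))"
  have E: "\<bar>E\<bar> \<le> 2 * c * (2 * (p * a + b * c))"
  proof -
    have "\<bar>E\<bar> \<le> (\<Sum>i=1..p. 2 * c * (p * w i * (a + b * w i) + (p * a + b * c) * w i))"
      unfolding E_def
    proof (rule order_trans[OF sum_abs], rule sum_mono)
      fix i assume i: "i \<in> {1..p}"
      have "\<bar>p * r * w i\<bar> \<le> (p * a + b * c) * w i"
        unfolding abs_mult[of _ "w i"] using r open_simplexD(1)[OF w(1) i] by (simp add: mult_right_mono)
      then have "\<bar>p * w i * R i w - p * r * w i\<bar> \<le> p * w i * (a + b * w i) + (p * a + b * c) * w i"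
        using pw[OF i] by linarith
      then show "\<bar>u i * (p * w i * R i w - p * r * w i)\<bar> \<le> 2 * c * (p * w i * (a + b * w i) + (p * a + b * c) * w i)"
        unfolding abs_mult[of "u i"] using u[OF i] c by (intro mult_mono) auto
    qed
    also have "\<dots> = 2 * c * ((\<Sum>i=1..p. p * w i * (a + b * w i)) + (p * a + b * c))"
      by (simp add: sum_distrib_left[symmetric] sum.distrib open_simplexD[OF w(1)])
    also have "\<dots> \<le> 2 * c * (2 * (p * a + b * c))"
      unfolding mult_2[of "p * a + b * c"] using c by (intro mult_left_mono add_right_mono S) simp
    finally show ?thesis .
  qed
  define s2 where "s2 = (\<Sum>j=1..p. (w j)\<^sup>2)"
  have "real n * Tfun w = 2 * (real n + 1) * main_term p w h - E - D"
  proof -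
    have tz: "tilt_deriv p w (Zgrad w) i = 1 / sqrt n * (2 * (real n + 1) * p * (w i * (w i - s2))
      - (p * w i * R i w - p * r * w i) - (\<Sum>j=1..p. u j * tilt_deriv p w (R' j w) i))" for i
    proof -
      have eq: "Zgrad w = (\<lambda>k. 1 / sqrt n * ((2 * (real n + 1) * p) * w k - p * R k w - (\<Sum>j=1..p. u j * R' j w k)))"
        by (auto simp: Zgrad_def u_def fun_eq_iff)
      have 1: "tilt_deriv p w w i = w i * (w i - s2)"
        by (simp add: tilt_deriv_def s2_def power2_eq_square)
      have 2: "p * tilt_deriv p w (\<lambda>k. R k w) i = p * w i * R i w - p * r * w i"
        by (simp add: tilt_deriv_def r_def algebra_simps)
      show ?thesis unfolding eq tilt_deriv_cmult tilt_deriv_diff tilt_deriv_sum 1 2 ..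
    qed
    have "real n * Tfun w = sqrt n * (\<Sum>i=1..p. u i * tilt_deriv p w (Zgrad w) i)"
      using n by (simp add: Tfun_def u_def field_simps real_sqrt_mult[symmetric])
    also have "\<dots> = (\<Sum>i=1..p. u i * (2 * (real n + 1) * p * (w i * (w i - s2))
      - (p * w i * R i w - p * r * w i) - (\<Sum>j=1..p. u j * tilt_deriv p w (R' j w) i)))"
      unfolding sum_distrib_left by (rule sum.cong[OF refl]) (use n in \<open>simp add: tz\<close>)
    also have "\<dots> = (\<Sum>i=1..p. u i * (2 * (real n + 1) * p * (w i * (w i - s2)))) - E - D"
      unfolding E_def D_def by (simp add: right_diff_distrib sum_subtractf sum_distrib_left mult_ac)
    also have "(\<Sum>i=1..p. u i * (2 * (real n + 1) * p * (w i * (w i - s2))))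
        = 2 * (real n + 1) * main_term p w h"
      unfolding main_term_def sum_distrib_left s2_def[symmetric]
      by (rule sum.cong[OF refl]) (simp add: u_def power2_eq_square)
    finally show ?thesis .
  qed
  then have "Tfun w - 2 * (1 + 1 / n) * main_term p w h = - (E + D) / n"
    using n by (simp add: field_simps)
  moreover have "\<bar>E + D\<bar> \<le> 4 * c * (p * a + b * c) + 4 * c\<^sup>2 * e"
    using E D by (simp add: power2_eq_square abs_le_iff algebra_simps)
  ultimately show ?thesis using n by (simp add: divide_right_mono)
qed

section \<open>Moments and upper tails of a single bin probability\<close>

lemma W_power_integrable:
  assumes "i \<in> {1..p}"
  shows "integrable Q (\<lambda>x. W x i ^ k)"
proof (rule integrable_const_bound[where B=1])
  show "AE x in Q. norm (W x i ^ k) \<le> 1"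
    using W_simplex
  proof eventually_elim
    case (elim x)
    then show ?case using open_simplexD(1,2)[OF elim assms] by (simp add: power_le_one)
  qed
  show "(\<lambda>x. W x i ^ k) \<in> borel_measurable Q" using W_meas[OF assms] by measurable
qed

text \<open>The tilt derivative of the k-th power is \<open>k * w ^ k * (1 - w)\<close>, hence at
  most \<open>k * w ^ k\<close>. For b < n the outcome is, as an inequality, the moment recursion of
  a gamma law with shape \<open>n * h i + a\<close> and rate \<open>n - b\<close>.\<close>

lemma moment_step:
  assumes i: "i \<in> {1..p}"
  shows "(n - b) * (\<integral>x. W x i ^ Suc k \<partial>Q) \<le> (n * h i + a + k) * (\<integral>x. W x i ^ k \<partial>Q)"
proof -
  let ?F = "\<lambda>x. tilt_deriv p (W x) (\<lambda>j. (k * W x i ^ (k - 1)) * (if j = i then 1 else 0)) i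
     + W x i ^ k * (n * h i - n * W x i + R i (W x))"
  have "\<exists>F. has_bochner_integral Q F 0 \<and> (AE x in Q. F x = ?F x)"
  proof (rule stein)
    show "smooth_fn p (\<lambda>w. w i ^ k) (\<lambda>w j. (k * w i ^ (k - 1)) * (if j = i then 1 else 0))"
      by (rule smooth_fn_compose[OF smooth_fn_coord[OF i], of "\<lambda>x. x ^ k" "\<lambda>x. k * x ^ (k - 1)"])
         (auto intro!: derivative_eq_intros continuous_intros simp: One_nat_def)
    show "(\<lambda>x. W x i ^ k) \<in> borel_measurable Q" using W_meas[OF i] by measurable
  qed (rule i)
  then obtain F where F: "has_bochner_integral Q F 0" and F_eq: "AE x in Q. F x = ?F x" by blast
  have "0 = (\<integral>x. F x \<partial>Q)" using F by (simp add: has_bochner_integral_iff)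
  also have "\<dots> \<le> (\<integral>x. (n * h i + a + k) * W x i ^ k - (n - b) * W x i ^ Suc k \<partial>Q)"
  proof (rule integral_mono_AE)
    show "integrable Q F" using F by (simp add: has_bochner_integral_iff)
    show "integrable Q (\<lambda>x. (n * h i + a + k) * W x i ^ k - (n - b) * W x i ^ Suc k)"
      by (intro Bochner_Integration.integrable_diff integrable_mult_right W_power_integrable i)
    show "AE x in Q. F x \<le> (n * h i + a + k) * W x i ^ k - (n - b) * W x i ^ Suc k"
      using W_simplex F_eq
    proof eventually_elim
      case (elim x)
      define w where "w = W x i"
      have w: "0 < w" "w \<le> 1" using open_simplexD(1,2)[OF elim(1) i] by (auto simp: w_def)
      have "tilt_deriv p (W x) (\<lambda>j. (k * W x i ^ (k - 1)) * (if j = i then 1 else 0)) i = k * w ^ k * (1 - w)"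
        unfolding tilt_deriv_cmult tilt_deriv_delta[OF i] by (cases k) (auto simp: w_def)
      also have "\<dots> \<le> k * w ^ k" using w by (intro mult_left_le) auto
      finally have 1: "tilt_deriv p (W x) (\<lambda>j. (k * W x i ^ (k - 1)) * (if j = i then 1 else 0)) i \<le> k * w ^ k" .
      have "R i (W x) \<le> a + b * w" using R_bound[OF i elim(1)] by (simp add: w_def)
      then have "w ^ k * (n * h i - n * w + R i (W x)) \<le> w ^ k * (n * h i - n * w + (a + b * w))"
        using w by (intro mult_left_mono) auto
      then show ?case using 1 elim(2) by (simp add: w_def algebra_simps)
    qed
  qed
  also have "\<dots> = (n * h i + a + k) * (\<integral>x. W x i ^ k \<partial>Q) - (n - b) * (\<integral>x. W x i ^ Suc k \<partial>Q)"
    by (subst Bochner_Integration.integral_diff)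
       (auto intro!: integrable_mult_right W_power_integrable i simp del: power_Suc)
  finally show ?thesis by simp
qed

text \<open>The recursion produces the factors \<open>n * h i + a + j\<close> for j < k; all of them
  are enlarged to \<open>n * h i + a + k\<close>.\<close>

lemma moment_bound:
  assumes i: "i \<in> {1..p}" and b: "b < n"
  shows "(\<integral>x. W x i ^ k \<partial>Q) \<le> ((n * h i + a + k) / (n - b)) ^ k"
proof (induction k)
  case 0
  then show ?case by (simp add: prob_space)
next
  case (Suc k)
  let ?A = "n * h i + a"
  have A: "?A \<ge> 0" using h_nonneg[OF i] abe by simp
  have "(\<integral>x. W x i ^ Suc k \<partial>Q) \<le> (?A + k) / (n - b) * (\<integral>x. W x i ^ k \<partial>Q)"
    using moment_step[OF i, of k] b by (simp add: field_simps)
  also have "\<dots> \<le> (?A + Suc k) / (n - b) * ((?A + Suc k) / (n - b)) ^ k"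
  proof (rule mult_mono)
    show "(\<integral>x. W x i ^ k \<partial>Q) \<le> ((?A + Suc k) / (n - b)) ^ k"
      by (rule order_trans[OF Suc.IH power_mono]) (use A b in \<open>auto intro!: divide_right_mono\<close>)
    have "AE x in Q. 0 \<le> W x i ^ k"
      using W_simplex by eventually_elim (use open_simplexD(1) i in \<open>auto simp: less_imp_le\<close>)
    then show "0 \<le> (\<integral>x. W x i ^ k \<partial>Q)" by (rule integral_nonneg_AE)
  qed (use A b in \<open>auto intro!: divide_right_mono\<close>)
  finally show ?case by simp
qed

text \<open>Markov's inequality for the moment of order k near D / 2. Each of the k factors is then
  at most (A + D/2) / (A + D), which is at most exp(- (D/2) / (A + D)). For D >= 4 rounding leaves k
  >= D / 4, whence the constant 8.\<close>

lemma upper_tail: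
  fixes D y :: real
  assumes i: "i \<in> {1..p}" and b: "b < n" and D: "D \<ge> 4" and y: "n * h i + a + D \<le> (n - b) * y"
  shows "prob {x \<in> space Q. W x i > y} \<le> exp (- (D\<^sup>2 / (8 * (n * h i + a + D))))"
proof -
  note [measurable] = W_meas[OF i]
  define A where "A = n * h i + a"
  have A: "A \<ge> 0" using h_nonneg[OF i] abe by (simp add: A_def)
  have y0: "y > 0" using y b D A unfolding A_def
    by (metis add_nonneg_pos diff_gt_0_iff_gt less_le_trans zero_less_mult_pos zero_less_numeral)
  define k where "k = nat \<lfloor>D / 2\<rfloor>"
  have k: "k \<le> D / 2" "D / 4 \<le> k" unfolding k_def using D by linarith+
  have "prob {x \<in> space Q. W x i > y} * y ^ k = (\<integral>x. y ^ k * indicator {x \<in> space Q. W x i > y} x \<partial>Q)"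
    by simp
  also have "\<dots> \<le> (\<integral>x. W x i ^ k \<partial>Q)"
  proof (rule integral_mono_AE)
    show "AE x in Q. y ^ k * indicator {x \<in> space Q. W x i > y} x \<le> W x i ^ k"
      using W_simplex
    proof eventually_elim
      case (elim x)
      then show ?case using open_simplexD(1)[OF elim i] y0 by (auto simp: indicator_def intro!: power_mono)
    qed
  qed (auto intro!: W_power_integrable i integrable_mult_right integrable_real_indicator simp: less_top[symmetric])
  also have "\<dots> \<le> ((A + k) / (real n - b)) ^ k"
    using moment_bound[OF i b, of k] by (simp add: A_def)
  finally have "prob {x \<in> space Q. W x i > y} \<le> ((A + k) / (real n - b)) ^ k / y ^ k"
    using y0 by (subst pos_le_divide_eq) simp_all
  also have "\<dots> = ((A + k) / ((real n - b) * y)) ^ k"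
    by (simp add: power_divide power_mult_distrib)
  also have "\<dots> \<le> ((A + D / 2) / (A + D)) ^ k"
    by (rule power_mono, rule frac_le) (use A D k y b y0 in \<open>auto simp: A_def\<close>)
  also have "(A + D / 2) / (A + D) = 1 - (D / 2) / (A + D)"
    using A D by (simp add: field_simps)
  also have "\<dots> ^ k \<le> exp (- ((D / 2) / (A + D))) ^ k"
    by (rule power_mono) (use A D exp_ge_add_one_self[of "- ((D / 2) / (A + D))"] in \<open>auto simp: field_simps\<close>)
  also have "\<dots> = exp (- (k * ((D / 2) / (A + D))))"
    by (simp add: exp_of_nat_mult[symmetric])
  also have "\<dots> \<le> exp (- (D / 4 * ((D / 2) / (A + D))))"
    using mult_right_mono[OF k(2), of "(D / 2) / (A + D)"] A D by simp
  also have "D / 4 * ((D / 2) / (A + D)) = D\<^sup>2 / (8 * (A + D))"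
    by (simp add: power2_eq_square)
  finally show ?thesis by (simp add: A_def)
qed

text \<open>The constant 3 in \<open>c\<close> comes from p q <= C, p h <= C + \<epsilon> <= 2 C
  and, on the good event, p w <= C + 2 \<epsilon> <= 3 C. The l1 distances from \<open>q\<close> are
  then at most 4 \<epsilon> for \<open>w\<close> and 2 \<epsilon> for \<open>h\<close>, so the
  Lipschitz bound gives 52 c^2 \<epsilon>; the factor 2 (1 + 1/n) <= 4 makes it 208. The prefactor 4
  / v is the bound on \<open>g'\<close>.\<close>

lemma d_BL_le:
  fixes q :: "nat \<Rightarrow> real" and C \<epsilon> \<delta> v :: real
  defines "c \<equiv> 3 * C"
  assumes v: "v > 0" and C: "C \<ge> 0" and q: "q \<in> open_simplex p" "\<And>i. i \<in> {1..p} \<Longrightarrow> p * q i \<le> C"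
    and \<epsilon>: "0 \<le> \<epsilon>" "\<epsilon> \<le> C" and h: "\<And>i. i \<in> {1..p} \<Longrightarrow> h i \<le> q i + \<epsilon> / p"
    and \<delta>: "\<And>i. i \<in> {1..p} \<Longrightarrow> prob {x \<in> space Q. W x i > h i + \<epsilon> / p} \<le> \<delta>"
  shows "\<bar>d_BL (distr Q borel (\<lambda>x. Zfun (W x))) (normal_law 0 v)\<bar> \<le> 4 / v *
    ((4 * c * (p * a + b * c) + 4 * c\<^sup>2 * e) / n + 208 * c\<^sup>2 * \<epsilon> + 4 * c\<^sup>2 / n + \<bar>2 * main_term p q q - v\<bar>
      + p * \<delta> * ((real p)\<^sup>2 * (8 + 4 * (a + b + e) / n) + v))" (is "_ \<le> 4 / v * (?g + p * \<delta> * ?B)")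
proof (rule d_BL_normal_law_le)
  show "prob_space Q" by unfold_locales
  have c0: "c \<ge> 0" using C by (simp add: c_def)
  have q0: "0 \<le> q i" if "i \<in> {1..p}" for i using open_simplexD(1)[OF q(1) that] by simp
  have ph: "p * h i \<le> C + \<epsilon>" if "i \<in> {1..p}" for i
  proof -
    have "p * h i \<le> p * (q i + \<epsilon> / p)" using h[OF that] by (intro mult_left_mono) auto
    also have "\<dots> = p * q i + \<epsilon>" using p by (simp add: distrib_left)
    finally show ?thesis using q(2)[OF that] by linarith
  qed
  have hc: "p * h i \<le> c" if "i \<in> {1..p}" for i using ph[OF that] \<epsilon> C by (simp add: c_def)
  have qc: "p * q i \<le> c" if "i \<in> {1..p}" for i using q(2)[OF that] C by (simp add: c_def)
  have h1: "h i \<le> 1" if "i \<in> {1..p}" for i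
    using member_le_sum[of i "{1..p}" h] that h_nonneg h_sum by auto
  have n1: "1 / real n \<le> 1" using n by simp
  have hq: "(\<Sum>i=1..p. \<bar>h i - q i\<bar>) \<le> 2 * \<epsilon>"
    using h h_sum open_simplexD(3)[OF q(1)] \<epsilon> by (intro sum_abs_diff_le_of_le) auto
  have good: "\<bar>v - Tfun w\<bar> \<le> ?g" if w: "w \<in> open_simplex p" "\<And>i. i \<in> {1..p} \<Longrightarrow> w i \<le> h i + \<epsilon> / p" for w :: "nat \<Rightarrow> real"
  proof -
    have wc: "p * w i \<le> c" if "i \<in> {1..p}" for i
    proof -
      have "p * w i \<le> p * (h i + \<epsilon> / p)" using w(2)[OF that] by (intro mult_left_mono) auto
      also have "\<dots> = p * h i + \<epsilon>" using p by (simp add: distrib_left)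
      finally show ?thesis using ph[OF that] \<epsilon> C by (simp add: c_def)
    qed
    have "(\<Sum>i=1..p. \<bar>w i - h i\<bar>) \<le> 2 * \<epsilon>"
      using w h_sum open_simplexD(3)[OF w(1)] \<epsilon> by (intro sum_abs_diff_le_of_le) auto
    moreover have "(\<Sum>i=1..p. \<bar>w i - q i\<bar>) \<le> (\<Sum>i=1..p. \<bar>w i - h i\<bar> + \<bar>h i - q i\<bar>)"
      by (intro sum_mono) linarith
    ultimately have wq: "(\<Sum>i=1..p. \<bar>w i - q i\<bar>) \<le> 4 * \<epsilon>"
      using hq by (simp add: sum.distrib)
    have 1: "\<bar>main_term p w h - main_term p q q\<bar> \<le> c\<^sup>2 * (12 * (4 * \<epsilon>) + 2 * (2 * \<epsilon>))"
      by (rule main_term_lipschitz)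
         (use w wc hc qc h_nonneg h_sum q0 open_simplexD[OF w(1)] open_simplexD[OF q(1)] wq hq p c0 in \<open>auto simp: less_imp_le\<close>)
    have 2: "\<bar>main_term p q q\<bar> \<le> 2 * c\<^sup>2"
      by (rule main_term_bound) (use q qc q0 c0 in auto)
    have 3: "\<bar>Tfun w - 2 * (1 + 1 / n) * main_term p w h\<bar> \<le> (4 * c * (p * a + b * c) + 4 * c\<^sup>2 * e) / n"
      by (rule Tfun_bound) (use w wc hc c0 in auto)
    have "\<bar>2 * (1 + 1 / n) * (main_term p w h - main_term p q q)\<bar> \<le> 4 * (c\<^sup>2 * (12 * (4 * \<epsilon>) + 2 * (2 * \<epsilon>)))"
      unfolding abs_mult[of "2 * (1 + 1 / n)"] using n1 1 by (intro mult_mono) auto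
    then have 4: "\<bar>2 * (1 + 1 / n) * (main_term p w h - main_term p q q)\<bar> \<le> 208 * c\<^sup>2 * \<epsilon>" by simp
    have "\<bar>2 / n * main_term p q q\<bar> \<le> 2 / n * (2 * c\<^sup>2)"
      unfolding abs_mult[of "2 / n"] using 2 by (intro mult_mono) auto
    then have 5: "\<bar>2 / n * main_term p q q\<bar> \<le> 4 * c\<^sup>2 / n" by simp
    have "v - Tfun w = - (Tfun w - 2 * (1 + 1 / n) * main_term p w h)
      - 2 * (1 + 1 / n) * (main_term p w h - main_term p q q) - 2 / n * main_term p q q - (2 * main_term p q q - v)"
      by (simp add: algebra_simps)
    then have "\<bar>v - Tfun w\<bar> \<le> \<bar>Tfun w - 2 * (1 + 1 / n) * main_term p w h\<bar>
      + \<bar>2 * (1 + 1 / n) * (main_term p w h - main_term p q q)\<bar> + \<bar>2 / n * main_term p q q\<bar> + \<bar>2 * main_term p q q - v\<bar>"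
      by linarith
    then show ?thesis using 3 4 5 by linarith
  qed
  \<comment> \<open>Without concentration the bin probabilities are still at most 1, so the same
    estimates hold with p in the role of \<open>c\<close>.\<close>
  have crude: "\<bar>v - Tfun w\<bar> \<le> ?B" if w: "w \<in> open_simplex p" for w :: "nat \<Rightarrow> real"
  proof -
    have w1: "p * w i \<le> p" "p * h i \<le> p" if "i \<in> {1..p}" for i
      using open_simplexD(2)[OF w that] h1[OF that] by (auto simp: mult_left_le)
    have 1: "\<bar>main_term p w h\<bar> \<le> 2 * (real p)\<^sup>2"
      by (rule main_term_bound) (use w w1 h_nonneg in auto)
    have 2: "\<bar>2 * (1 + 1 / n) * main_term p w h\<bar> \<le> 4 * (2 * (real p)\<^sup>2)"
      unfolding abs_mult[of "2 * (1 + 1 / n)"] using n1 1 by (intro mult_mono) auto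
    have 3: "\<bar>Tfun w - 2 * (1 + 1 / n) * main_term p w h\<bar> \<le> (4 * real p * (p * a + b * p) + 4 * (real p)\<^sup>2 * e) / n"
      by (rule Tfun_bound) (use w w1 in auto)
    have 4: "(4 * real p * (p * a + b * p) + 4 * (real p)\<^sup>2 * e) / n = (real p)\<^sup>2 * (4 * (a + b + e) / n)"
      by (simp add: power2_eq_square algebra_simps)
    have "\<bar>v - Tfun w\<bar> \<le> \<bar>Tfun w - 2 * (1 + 1 / n) * main_term p w h\<bar>
      + \<bar>2 * (1 + 1 / n) * main_term p w h\<bar> + v"
      using v by linarith
    moreover have "?B = 8 * (real p)\<^sup>2 + (real p)\<^sup>2 * (4 * (a + b + e) / n) + v"
      by (simp only: distrib_left mult.commute[of _ 8])
    ultimately show ?thesis using 2 3[unfolded 4] by linarith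
  qed
  fix g g' :: "real \<Rightarrow> real" and B
  assume g: "\<And>x. (g has_real_derivative g' x) (at x)" "continuous_on UNIV g'" "\<And>x. \<bar>g x\<bar> \<le> B" "\<And>x. \<bar>g' x\<bar> \<le> 4 / v"
    "\<And>x. \<bar>x * g x\<bar> \<le> 6"
  obtain F where F: "has_bochner_integral Q F 0"
    and F_eq: "AE x in Q. F x = g' (Zfun (W x)) * Tfun (W x) - Zfun (W x) * g (Zfun (W x))"
    using stein_Zfun[OF g(1,2)] .
  have contg: "continuous_on UNIV g"
    by (rule DERIV_continuous_on, rule has_field_derivative_at_within, rule g)
  have [measurable]: "g \<in> borel_measurable borel" "g' \<in> borel_measurable borel"
    using contg g(2) by (auto intro: borel_measurable_continuous_onI)
  note [measurable] = Zfun_meas W_meas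
  let ?H = "\<lambda>x. v * g' (Zfun (W x)) - Zfun (W x) * g (Zfun (W x))"
  have iH: "integrable Q ?H"
  proof (rule integrable_const_bound[where B="4 + 6"])
    have "\<bar>v * g' z - z * g z\<bar> \<le> 4 + 6" for z
    proof -
      have "v * \<bar>g' z\<bar> \<le> 4" using g(4)[of z] v by (simp add: field_simps)
      then have "\<bar>v * g' z\<bar> \<le> 4" using v by (simp add: abs_mult)
      then show ?thesis using g(5)[of z] by linarith
    qed
    then show "AE x in Q. norm (?H x) \<le> 4 + 6" by simp
  qed measurable
  define bad where "bad = (\<Union>i\<in>{1..p}. {x \<in> space Q. W x i > h i + \<epsilon> / p})"
  have [measurable]: "bad \<in> sets Q" unfolding bad_def by measurable
  have bad: "prob bad \<le> p * \<delta>"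
  proof -
    have "prob bad \<le> (\<Sum>i\<in>{1..p}. prob {x \<in> space Q. W x i > h i + \<epsilon> / p})"
      unfolding bad_def by (rule finite_measure_subadditive_finite) auto
    also have "\<dots> \<le> (\<Sum>i\<in>{1..p}. \<delta>)" by (intro sum_mono \<delta>)
    finally show ?thesis by simp
  qed
  have g0: "0 \<le> ?g" using abs_ge_zero order_trans good[OF q(1)] C \<epsilon> abe c0 by (auto intro!: add_nonneg_nonneg divide_nonneg_nonneg mult_nonneg_nonneg)
  have B0: "0 \<le> ?B" using order_trans[OF abs_ge_zero crude[OF q(1)]] .
  \<comment> \<open>Subtracting \<open>F\<close>, whose integral vanishes, leaves \<open>g'\<close>
    times the deviation of T from v, so T itself never has to be integrated.\<close>
  have "\<bar>\<integral>x. ?H x \<partial>Q\<bar> = \<bar>\<integral>x. ?H x - F x \<partial>Q\<bar>"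
    using F iH by (simp add: has_bochner_integral_iff)
  also have "\<dots> \<le> (\<integral>x. 4 / v * (?g + ?B * indicator bad x) \<partial>Q)"
  proof (rule order_trans[OF integral_abs_bound], rule integral_mono_AE)
    show "integrable Q (\<lambda>x. \<bar>?H x - F x\<bar>)"
      using F iH by (auto simp: has_bochner_integral_iff)
    show "integrable Q (\<lambda>x. 4 / v * (?g + ?B * indicator bad x))"
      by (intro integrable_mult_right Bochner_Integration.integrable_add integrable_const integrable_real_indicator) 
         (auto simp: less_top[symmetric])
    show "AE x in Q. \<bar>?H x - F x\<bar> \<le> 4 / v * (?g + ?B * indicator bad x)"
      using W_simplex F_eq AE_space
    proof eventually_elim
      case (elim x)
      have "?H x - F x = g' (Zfun (W x)) * (v - Tfun (W x))" using elim by (simp add: algebra_simps)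
      also have "\<bar>\<dots>\<bar> \<le> 4 / v * (?g + ?B * indicator bad x)"
        unfolding abs_mult
      proof (rule mult_mono)
        show "\<bar>v - Tfun (W x)\<bar> \<le> ?g + ?B * indicator bad x"
        proof (cases "x \<in> bad")
          case True
          then show ?thesis using crude[OF elim(1)] g0 by simp
        next
          case False
          then show ?thesis using good[OF elim(1)] elim by (auto simp: bad_def not_less)
        qed
      qed (use g v in auto)
      finally show ?case .
    qed
  qed
  also have "\<dots> = 4 / v * (?g + ?B * prob bad)"
    by (subst integral_mult_right_zero, subst Bochner_Integration.integral_add)
       (auto simp: prob_space less_top[symmetric])
  also have "\<dots> \<le> 4 / v * (?g + p * \<delta> * ?B)"
    using mult_right_mono[OF bad B0] v by (intro mult_left_mono add_left_mono) (simp_all only: mult.commute[of ?B], simp)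
  finally show "\<bar>\<integral>x. ?H x \<partial>Q\<bar> \<le> 4 / v * (?g + p * \<delta> * ?B)" .
qed (use v Zfun_meas in auto)

end

section \<open>Haar wavelets on dyadic bins\<close>

text \<open>The last bin is closed, and at the point 1 the floor formula would give p + 1.\<close>

definition bin_index :: "nat \<Rightarrow> real \<Rightarrow> nat" where
  "bin_index p x = (if x = 1 then p else nat \<lfloor>real p * x\<rfloor> + 1)"

lemma bin_iff:
  assumes "\<mu> \<in> {1..p}"
  shows "x \<in> bin p \<mu> \<longleftrightarrow> x \<in> {0..1} \<and> bin_index p x = \<mu>"
proof -
  have p: "real p > 0" using assms by auto
  have fl: "nat \<lfloor>real p * x\<rfloor> + 1 = \<mu> \<longleftrightarrow> real \<mu> - 1 \<le> real p * x \<and> real p * x < real \<mu>" if "0 \<le> x"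
  proof -
    have "0 \<le> \<lfloor>real p * x\<rfloor>" using that p by simp
    then have "nat \<lfloor>real p * x\<rfloor> + 1 = \<mu> \<longleftrightarrow> \<lfloor>real p * x\<rfloor> = int \<mu> - 1" using assms by auto
    also have "\<dots> \<longleftrightarrow> real \<mu> - 1 \<le> real p * x \<and> real p * x < real \<mu>"
      by (simp add: floor_eq_iff)
    finally show ?thesis .
  qed
  consider "\<mu> = p" "x = 1" | "\<mu> = p" "x \<noteq> 1" | "\<mu> < p" using assms by force
  then show ?thesis
  proof cases
    case 1
    then show ?thesis using p by (simp add: bin_def bin_index_def field_simps)
  next
    case 2
    have "x \<in> bin p \<mu> \<longleftrightarrow> real p - 1 \<le> real p * x \<and> x \<le> 1"
      using p 2 by (auto simp: bin_def field_simps)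
    also have "\<dots> \<longleftrightarrow> 0 \<le> x \<and> x \<le> 1 \<and> real \<mu> - 1 \<le> real p * x \<and> real p * x < real \<mu>"
    proof -
      have "0 \<le> x" if "real p - 1 \<le> real p * x"
      proof -
        have "0 \<le> real p * x" using that p assms by auto
        then show ?thesis using p by (simp add: zero_le_mult_iff)
      qed
      moreover have "real p * x < real p" if "x \<le> 1" using that 2 p by auto
      ultimately show ?thesis using 2 by auto
    qed
    finally show ?thesis using fl 2 by (auto simp: bin_index_def)
  next
    case 3
    have "x \<in> bin p \<mu> \<longleftrightarrow> real \<mu> - 1 \<le> real p * x \<and> real p * x < real \<mu>"
      using p 3 by (auto simp: bin_def field_simps)
    moreover have "0 \<le> x \<and> x < 1" if "real \<mu> - 1 \<le> real p * x" "real p * x < real \<mu>"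
    proof -
      have "0 \<le> real p * x" using that assms by auto
      moreover have "real \<mu> < real p" using 3 by simp
      with that(2) have "real p * x < real p" by (rule less_trans)
      ultimately show ?thesis using p by (simp add: zero_le_mult_iff)
    qed
    ultimately show ?thesis using fl 3 by (auto simp: bin_index_def)
  qed
qed

lemma bin_index_range:
  assumes "p \<ge> 1" "x \<in> {0..1}"
  shows "bin_index p x \<in> {1..p}"
proof (cases "x = 1")
  case False
  then have "x < 1" "0 \<le> x" using assms by auto
  then have "real p * x < real p" "0 \<le> real p * x" using assms by auto
  then have "\<lfloor>real p * x\<rfloor> < int p" "0 \<le> \<lfloor>real p * x\<rfloor>" by (auto simp: floor_less_iff)
  then have "nat \<lfloor>real p * x\<rfloor> < p" by linarith
  then show ?thesis using False by (simp add: bin_index_def)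
qed (use assms in \<open>auto simp: bin_index_def\<close>)

lemma bin_index_in_bin: "p \<ge> 1 \<Longrightarrow> x \<in> {0..1} \<Longrightarrow> x \<in> bin p (bin_index p x)"
  using bin_iff[OF bin_index_range] by simp

lemma bin_measurable [measurable]: "bin p \<mu> \<in> sets borel"
  by (simp add: bin_def)

lemma emeasure_bin: "\<mu> \<in> {1..p} \<Longrightarrow> emeasure lborel (bin p \<mu>) = ennreal (1 / p)"
  by (auto simp: bin_def field_simps)

lemma has_bochner_integral_bins:
  assumes p: "p \<ge> 1" and F: "\<And>\<mu> x. \<mu> \<in> {1..p} \<Longrightarrow> x \<in> bin p \<mu> \<Longrightarrow> F x = c \<mu>"
  shows "has_bochner_integral lborel (\<lambda>x. indicator {0..1} x *\<^sub>R F x) ((\<Sum>\<mu>=1..p. c \<mu>) / real p)"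
proof -
  have "has_bochner_integral lborel (\<lambda>x. \<Sum>\<mu>=1..p. c \<mu> * indicator (bin p \<mu>) x) (\<Sum>\<mu>=1..p. c \<mu> * (1 / p))"
  proof (intro has_bochner_integral_sum has_bochner_integral_mult_right)
    fix \<mu> assume "\<mu> \<in> {1..p}"
    then have "has_bochner_integral lborel (indicat_real (bin p \<mu>)) (measure lborel (bin p \<mu>))"
      by (intro has_bochner_integral_real_indicator) (auto simp: emeasure_bin)
    then show "has_bochner_integral lborel (indicat_real (bin p \<mu>)) (1 / p)"
      using emeasure_bin[OF \<open>\<mu> \<in> {1..p}\<close>] by (simp add: measure_def)
  qed
  also have "(\<lambda>x. \<Sum>\<mu>=1..p. c \<mu> * indicator (bin p \<mu>) x) = (\<lambda>x. indicator {0..1} x *\<^sub>R F x)"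
  proof
    fix x
    have "(\<Sum>\<mu>=1..p. c \<mu> * indicator (bin p \<mu>) x) = (\<Sum>\<mu>=1..p. if bin_index p x = \<mu> then (if x \<in> {0..1} then c \<mu> else 0) else 0)"
      by (intro sum.cong refl) (auto simp: indicator_def bin_iff)
    also have "\<dots> = indicator {0..1} x *\<^sub>R F x"
      using bin_index_range[OF p, of x] F[of "bin_index p x" x] bin_index_in_bin[OF p, of x]
      by (simp add: sum.delta indicator_def)
    finally show "(\<Sum>\<mu>=1..p. c \<mu> * indicator (bin p \<mu>) x) = indicator {0..1} x *\<^sub>R F x" .
  qed
  finally show ?thesis by (simp add: sum_divide_distrib)
qed

lemma LINT_bins:
  assumes p: "p \<ge> 1" and F: "\<And>\<mu> x. \<mu> \<in> {1..p} \<Longrightarrow> x \<in> bin p \<mu> \<Longrightarrow> F x = c \<mu>"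
  shows "(LINT x:{0..1}|lborel. F x) = (\<Sum>\<mu>=1..p. c \<mu>) / real p"
  using has_bochner_integral_bins[OF assms] unfolding set_lebesgue_integral_def
  by (simp add: has_bochner_integral_iff)

text \<open>The value of \<open>haar j k\<close> on bin \<open>\<mu>\<close> of the partition into \<open>2 ^ (J + 1)\<close> bins.\<close>

definition haar_coef :: "nat \<Rightarrow> nat \<times> nat \<Rightarrow> nat \<Rightarrow> real" where
  "haar_coef J = (\<lambda>(j, k) \<mu>. 2 powr (real j / 2) *
     (if (\<mu> - 1) div 2 ^ (J - j) div 2 = k - 1 then (if even ((\<mu> - 1) div 2 ^ (J - j)) then 1 else -1) else 0))"

lemma haar_idx_iff: "(j, k) \<in> haar_idx J \<longleftrightarrow> j \<le> J \<and> 1 \<le> k \<and> k \<le> 2 ^ j"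
  by (auto simp: haar_idx_def)

lemma finite_haar_idx [simp]: "finite (haar_idx J)"
  by (auto simp: haar_idx_def)

text \<open>With indices counted from 0, merging neighbouring bins in pairs drops the last binary
  digit. At the point 1 the index is not given by a floor; there the claim is that 2^(J+1) - 1
  divided by 2^(J-j) rounds down to 2^(j+1) - 1.\<close>

lemma bin_index_coarse:
  assumes "j \<le> J" "x \<in> {0..1}"
  shows "bin_index (2 ^ (j + 1)) x - 1 = (bin_index (2 ^ (J + 1)) x - 1) div 2 ^ (J - j)"
proof (cases "x = 1")
  case True
  obtain a b :: nat where ab: "(2::nat) ^ (j + 1) = Suc a" "(2::nat) ^ (J - j) = Suc b"
    by (metis Suc_pred zero_less_numeral zero_less_power)
  have "(2::nat) ^ (J + 1) = 2 ^ (j + 1) * 2 ^ (J - j)"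
    using assms(1) by (simp add: power_add[symmetric])
  also have "\<dots> - 1 = b + a * Suc b" unfolding ab by simp
  finally have "((2::nat) ^ (J + 1) - 1) div 2 ^ (J - j) = 2 ^ (j + 1) - 1"
    unfolding ab by (simp only: div_mult_self1) simp
  then show ?thesis using True by (simp add: bin_index_def)
next
  case False
  have e: "real (2 ^ (j + 1)) * x = real (2 ^ (J + 1)) * x / real_of_int (2 ^ (J - j))"
  proof -
    have "real (2 ^ (J + 1)) = real (2 ^ (j + 1)) * real (2 ^ (J - j))"
      unfolding of_nat_mult[symmetric] power_add[symmetric] using assms(1) by simp
    then show ?thesis by simp
  qed
  have "\<lfloor>real (2 ^ (j + 1)) * x\<rfloor> = \<lfloor>real (2 ^ (J + 1)) * x\<rfloor> div 2 ^ (J - j)"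
    unfolding e by (rule floor_divide_real_eq_div) simp
  moreover have "0 \<le> \<lfloor>real (2 ^ (J + 1)) * x\<rfloor>" using assms by simp
  ultimately have "nat \<lfloor>real (2 ^ (j + 1)) * x\<rfloor> = nat \<lfloor>real (2 ^ (J + 1)) * x\<rfloor> div 2 ^ (J - j)"
    by (simp add: nat_div_distrib nat_power_eq)
  then show ?thesis using False by (simp add: bin_index_def)
qed

text \<open>On the support of the wavelet the zero-based index of the half containing x is 2 (k - 1)
  or 2 (k - 1) + 1. Its quotient by 2 identifies k, and its parity decides the sign.\<close>

lemma haar_eq_haar_coef:
  assumes jk: "(j, k) \<in> haar_idx J" and \<mu>: "\<mu> \<in> {1..2 ^ (J + 1)}" and x: "x \<in> bin (2 ^ (J + 1)) \<mu>"
  shows "haar j k x = haar_coef J (j, k) \<mu>"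
proof -
  have jJ: "j \<le> J" and k: "1 \<le> k" "k \<le> 2 ^ j" using jk by (auto simp: haar_idx_iff)
  have x01: "x \<in> {0..1}" and \<mu>': "\<mu> = bin_index (2 ^ (J + 1)) x" using x bin_iff[OF \<mu>] by auto
  define e where "e = bin_index (2 ^ (j + 1)) x - 1"
  have e: "bin_index (2 ^ (j + 1)) x = e + 1"
    using bin_index_range[of "2 ^ (j + 1)" x] x01 by (simp add: e_def)
  have e2: "e = (\<mu> - 1) div 2 ^ (J - j)"
    unfolding e_def \<mu>' by (rule bin_index_coarse[OF jJ x01])
  have "2 * k - 1 \<in> {1..2 ^ (j + 1)}" "2 * k \<in> {1..2 ^ (j + 1)}" using k by (auto simp: power_add)
  from bin_iff[OF this(1), of x] bin_iff[OF this(2), of x] x01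
  have "x \<in> bin (2 ^ (j + 1)) (2 * k - 1) \<longleftrightarrow> e + 1 = 2 * k - 1" "x \<in> bin (2 ^ (j + 1)) (2 * k) \<longleftrightarrow> e + 1 = 2 * k"
    unfolding e by auto
  moreover have "e + 1 = 2 * k - 1 \<longleftrightarrow> even e \<and> e div 2 = k - 1" "e + 1 = 2 * k \<longleftrightarrow> odd e \<and> e div 2 = k - 1"
    using k by presburger+
  ultimately show ?thesis unfolding haar_def haar_coef_def prod.case e2[symmetric]
    by (auto simp: indicator_def)
qed

text \<open>\<open>f j\<close> is the kernel of the projection onto histograms at resolution 2^(-j):
  it equals 2^j when both bins lie in one dyadic interval of that length. The wavelets of level j
  contribute exactly \<open>f (Suc j) - f j\<close>, so the sum telescopes, and the constant
  function supplies \<open>f 0 = 1\<close>.\<close>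

lemma haar_kernel:
  assumes "\<mu> \<in> {1..2 ^ (J + 1)}" "\<nu> \<in> {1..2 ^ (J + 1)}"
  shows "1 + (\<Sum>jk\<in>haar_idx J. haar_coef J jk \<mu> * haar_coef J jk \<nu>) = (if \<mu> = \<nu> then 2 ^ (J + 1) else 0)"
proof -
  define a b where "a = \<mu> - 1" and "b = \<nu> - 1"
  have ab: "a < 2 ^ (J + 1)" "b < 2 ^ (J + 1)" "a = b \<longleftrightarrow> \<mu> = \<nu>" using assms by (auto simp: a_def b_def)
  define f :: "nat \<Rightarrow> real" where "f j = (if a div 2 ^ (J + 1 - j) = b div 2 ^ (J + 1 - j) then 2 ^ j else 0)" for j
  have "(\<Sum>k=1..2 ^ j. haar_coef J (j, k) \<mu> * haar_coef J (j, k) \<nu>) = f (Suc j) - f j" if j: "j \<in> {0..J}" for j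
  proof -
    define c d where "c = a div 2 ^ (J - j)" and "d = b div 2 ^ (J - j)"
    have half: "c div 2 = a div 2 ^ (J + 1 - j)" "d div 2 = b div 2 ^ (J + 1 - j)"
    proof -
      have "J + 1 - j = Suc (J - j)" using j by auto
      then show "c div 2 = a div 2 ^ (J + 1 - j)" "d div 2 = b div 2 ^ (J + 1 - j)"
        by (simp_all add: c_def d_def div_mult2_eq[symmetric] mult.commute)
    qed
    have "c div 2 < 2 ^ j"
      unfolding half using ab(1) j by (intro less_mult_imp_div_less) (simp add: power_add[symmetric])
    then have c2: "c div 2 + 1 \<in> {1..2 ^ j}" by simp
    \<comment> \<open>Exactly one wavelet of level j is nonzero on bin \<mu>; the product survives
      only if the same wavelet lives on bin \<nu>.\<close>
    have "(\<Sum>k=1..2 ^ j. haar_coef J (j, k) \<mu> * haar_coef J (j, k) \<nu>)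
      = (\<Sum>k=1..2 ^ j. if c div 2 + 1 = k then 2 ^ j * (if d div 2 = c div 2 then (if even c = even d then 1 else -1) else 0) else 0)"
    proof (intro sum.cong refl)
      fix k :: nat assume k: "k \<in> {1..2 ^ j}"
      have "2 powr (real j / 2) * 2 powr (real j / 2) = (2::real) ^ j"
        by (simp add: powr_add[symmetric] powr_realpow)
      moreover have "c div 2 = k - 1 \<longleftrightarrow> c div 2 + 1 = k" "d div 2 = k - 1 \<longleftrightarrow> d div 2 + 1 = k" using k by auto
      ultimately show "haar_coef J (j, k) \<mu> * haar_coef J (j, k) \<nu>
        = (if c div 2 + 1 = k then 2 ^ j * (if d div 2 = c div 2 then (if even c = even d then 1 else -1) else 0) else 0)"
        by (auto simp: haar_coef_def a_def[symmetric] b_def[symmetric] c_def[symmetric] d_def[symmetric])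
    qed
    also have "\<dots> = 2 ^ j * (if d div 2 = c div 2 then (if even c = even d then 1 else -1) else 0)"
      using c2 by simp
    also have "\<dots> = (if c = d then 2 ^ Suc j else 0) - (if c div 2 = d div 2 then 2 ^ j else 0)"
    proof -
      have "c = d \<longleftrightarrow> c div 2 = d div 2 \<and> even c = even d" by presburger
      then show ?thesis by auto
    qed
    also have "\<dots> = f (Suc j) - f j" by (simp add: f_def half) (simp add: c_def d_def)
    finally show ?thesis .
  qed
  then have "(\<Sum>jk\<in>haar_idx J. haar_coef J jk \<mu> * haar_coef J jk \<nu>) = (\<Sum>j=0..J. f (Suc j) - f j)"
    using sum.Sigma[of "{0..J}" "\<lambda>j. {1..2 ^ j}" "\<lambda>j k. haar_coef J (j, k) \<mu> * haar_coef J (j, k) \<nu>"]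
    by (simp add: haar_idx_def case_prod_beta)
  also have "\<dots> = f (Suc J) - f 0" by (rule sum_Suc_diff) simp
  also have "\<dots> = (if \<mu> = \<nu> then 2 ^ (J + 1) else 0) - 1"
    using ab by (simp add: f_def div_less power_add)
  finally show ?thesis by simp
qed

text \<open>The support consists of 2^(J+1-j) consecutive bins, on which the square is constantly
  2^j.\<close>

lemma haar_coef_norm:
  assumes "(j, k) \<in> haar_idx J"
  shows "(\<Sum>\<mu>=1..2 ^ (J + 1). (haar_coef J (j, k) \<mu>)\<^sup>2) = 2 ^ (J + 1)"
proof -
  have jJ: "j \<le> J" and k: "1 \<le> k" "k \<le> 2 ^ j" using assms by (auto simp: haar_idx_iff)
  define m :: nat where "m = 2 ^ (J + 1 - j)"
  have m0: "m > 0" by (simp add: m_def)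
  have pm: "(2::nat) ^ (J + 1) = 2 ^ j * m" using jJ by (simp add: m_def power_add[symmetric])
  have "(haar_coef J (j, k) \<mu>)\<^sup>2 = (if \<mu> \<in> {(k - 1) * m + 1..k * m} then 2 ^ j else 0)"
    if "\<mu> \<in> {1..2 ^ (J + 1)}" for \<mu>
  proof -
    have "(\<mu> - 1) div 2 ^ (J - j) div 2 = (\<mu> - 1) div m"
    proof -
      have "J + 1 - j = Suc (J - j)" using jJ by auto
      then show ?thesis by (simp add: m_def div_mult2_eq[symmetric] mult.commute)
    qed
    moreover have "(\<mu> - 1) div m = k - 1 \<longleftrightarrow> (k - 1) * m \<le> \<mu> - 1 \<and> \<mu> - 1 < k * m"
    proof -
      have "(\<mu> - 1) div m = k - 1 \<longleftrightarrow> k - 1 \<le> (\<mu> - 1) div m \<and> (\<mu> - 1) div m < k" using k by auto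
      then show ?thesis using m0 by (simp add: div_less_iff_less_mult less_eq_div_iff_mult_less_eq)
    qed
    moreover have "(k - 1) * m \<le> \<mu> - 1 \<and> \<mu> - 1 < k * m \<longleftrightarrow> \<mu> \<in> {(k - 1) * m + 1..k * m}"
      using that by auto
    moreover have "(2 powr (real j / 2))\<^sup>2 = (2::real) ^ j"
      by (simp add: power2_eq_square powr_add[symmetric] powr_realpow)
    ultimately show ?thesis by (auto simp: haar_coef_def power_mult_distrib)
  qed
  then have "(\<Sum>\<mu>=1..2 ^ (J + 1). (haar_coef J (j, k) \<mu>)\<^sup>2)
    = (\<Sum>\<mu>=1..2 ^ (J + 1). if \<mu> \<in> {(k - 1) * m + 1..k * m} then 2 ^ j else 0)"
    by (intro sum.cong) auto
  also have "\<dots> = (\<Sum>\<mu>\<in>{1..2 ^ (J + 1)} \<inter> {(k - 1) * m + 1..k * m}. 2 ^ j)"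
    by (rule sum.inter_restrict[symmetric]) simp
  also have "{1..2 ^ (J + 1)} \<inter> {(k - 1) * m + 1..k * m} = {(k - 1) * m + 1..k * m}"
    using mult_le_mono1[OF k(2), of m] unfolding pm by auto
  also have "(\<Sum>\<mu>\<in>{(k - 1) * m + 1..k * m}. (2::real) ^ j) = real m * 2 ^ j"
    using k by (cases k) auto
  also have "\<dots> = 2 ^ (J + 1)" using pm[THEN arg_cong, of real] by simp
  finally show ?thesis .
qed

text \<open>After expanding both products and summing over the wavelets first, the kernel identity
  leaves only the diagonal.\<close>

lemma haar_parseval:
  "(\<Sum>\<mu>=1..2 ^ (J + 1). u \<mu>) * (\<Sum>\<mu>=1..2 ^ (J + 1). v \<mu>)
     + (\<Sum>jk\<in>haar_idx J. (\<Sum>\<mu>=1..2 ^ (J + 1). haar_coef J jk \<mu> * u \<mu>) * (\<Sum>\<mu>=1..2 ^ (J + 1). haar_coef J jk \<mu> * v \<mu>))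
   = 2 ^ (J + 1) * (\<Sum>\<mu>=1..2 ^ (J + 1). u \<mu> * v \<mu>)"
proof -
  let ?I = "{1..2 ^ (J + 1)} :: nat set"
  have "(\<Sum>jk\<in>haar_idx J. (\<Sum>\<mu>\<in>?I. haar_coef J jk \<mu> * u \<mu>) * (\<Sum>\<mu>\<in>?I. haar_coef J jk \<mu> * v \<mu>))
    = (\<Sum>jk\<in>haar_idx J. \<Sum>\<mu>\<in>?I. \<Sum>\<nu>\<in>?I. (u \<mu> * v \<nu>) * (haar_coef J jk \<mu> * haar_coef J jk \<nu>))"
    unfolding sum_product by (intro sum.cong refl) (simp add: mult_ac)
  also have "\<dots> = (\<Sum>\<mu>\<in>?I. \<Sum>\<nu>\<in>?I. (u \<mu> * v \<nu>) * (\<Sum>jk\<in>haar_idx J. haar_coef J jk \<mu> * haar_coef J jk \<nu>))"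
    unfolding sum_distrib_left by (subst sum.swap, rule sum.cong[OF refl], rule sum.swap)
  finally have "(\<Sum>\<mu>\<in>?I. u \<mu>) * (\<Sum>\<mu>\<in>?I. v \<mu>) + (\<Sum>jk\<in>haar_idx J. (\<Sum>\<mu>\<in>?I. haar_coef J jk \<mu> * u \<mu>) * (\<Sum>\<mu>\<in>?I. haar_coef J jk \<mu> * v \<mu>))
    = (\<Sum>\<mu>\<in>?I. \<Sum>\<nu>\<in>?I. (u \<mu> * v \<nu>) * (1 + (\<Sum>jk\<in>haar_idx J. haar_coef J jk \<mu> * haar_coef J jk \<nu>)))"
    by (simp add: sum_product sum.distrib distrib_left)
  also have "\<dots> = (\<Sum>\<mu>\<in>?I. \<Sum>\<nu>\<in>?I. (u \<mu> * v \<nu>) * (if \<mu> = \<nu> then 2 ^ (J + 1) else 0))"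
    by (intro sum.cong refl arg_cong2[where f="(*)"] haar_kernel)
  also have "\<dots> = (\<Sum>\<mu>\<in>?I. u \<mu> * v \<mu> * 2 ^ (J + 1))"
  proof (rule sum.cong[OF refl])
    fix \<mu> assume "\<mu> \<in> ?I"
    have "(\<Sum>\<nu>\<in>?I. (u \<mu> * v \<nu>) * (if \<mu> = \<nu> then 2 ^ (J + 1) else 0))
      = (\<Sum>\<nu>\<in>?I. if \<mu> = \<nu> then (u \<mu> * v \<nu>) * 2 ^ (J + 1) else 0)" by (intro sum.cong) auto
    then show "(\<Sum>\<nu>\<in>?I. (u \<mu> * v \<nu>) * (if \<mu> = \<nu> then 2 ^ (J + 1) else 0)) = u \<mu> * v \<mu> * 2 ^ (J + 1)"
      using \<open>\<mu> \<in> ?I\<close> by simp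
  qed
  finally show ?thesis by (simp add: sum_distrib_left mult_ac)
qed

text \<open>Orthogonality comes for free from the completeness relation: by Parseval, a vector of the family
  with the right norm leaves no room for other components.\<close>

lemma haar_orthogonal:
  assumes jk: "jk \<in> haar_idx J"
  shows "(\<Sum>\<mu>=1..2 ^ (J + 1). haar_coef J jk \<mu>) = 0"
    and "jk' \<in> haar_idx J \<Longrightarrow>
      (\<Sum>\<mu>=1..2 ^ (J + 1). haar_coef J jk' \<mu> * haar_coef J jk \<mu>) = (if jk' = jk then 2 ^ (J + 1) else 0)"
proof -
  let ?I = "{1..2 ^ (J + 1)} :: nat set"
  define ip where "ip l = (\<Sum>\<mu>\<in>?I. haar_coef J l \<mu> * haar_coef J jk \<mu>)" for l
  define s where "s = (\<Sum>\<mu>\<in>?I. haar_coef J jk \<mu>)"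
  have n: "ip jk = 2 ^ (J + 1)"
    using haar_coef_norm[of "fst jk" "snd jk" J] jk by (simp add: ip_def power2_eq_square)
  have "s * s + (\<Sum>l\<in>haar_idx J. ip l * ip l) = 2 ^ (J + 1) * ip jk"
    unfolding s_def ip_def by (rule haar_parseval)
  also have "(\<Sum>l\<in>haar_idx J. ip l * ip l) = ip jk * ip jk + (\<Sum>l\<in>haar_idx J - {jk}. ip l * ip l)"
    using jk by (intro sum.remove) auto
  finally have z: "s * s + (\<Sum>l\<in>haar_idx J - {jk}. ip l * ip l) = 0" using n by simp
  have "0 \<le> (\<Sum>l\<in>haar_idx J - {jk}. ip l * ip l)" by (intro sum_nonneg) simp
  then have s0: "s * s = 0" and S0: "(\<Sum>l\<in>haar_idx J - {jk}. ip l * ip l) = 0"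
    using z zero_le_square[of s] by linarith+
  show "(\<Sum>\<mu>\<in>?I. haar_coef J jk \<mu>) = 0" using s0 by (simp add: s_def)
  have "ip l = 0" if "l \<in> haar_idx J - {jk}" for l
    using S0 that by (subst (asm) sum_nonneg_eq_0_iff) auto
  then show "(\<Sum>\<mu>\<in>?I. haar_coef J jk' \<mu> * haar_coef J jk \<mu>) = (if jk' = jk then 2 ^ (J + 1) else 0)"
    if "jk' \<in> haar_idx J" using n that by (auto simp: ip_def)
qed

section \<open>Bin frequencies and the empirical histogram\<close>

definition bin_freq :: "nat \<Rightarrow> nat \<Rightarrow> (nat \<Rightarrow> real) \<Rightarrow> nat \<Rightarrow> real" where
  "bin_freq p n X \<mu> = (\<Sum>i=1..n. if bin_index p (X i) = \<mu> then 1 else 0) / real n"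

lemma bin_freq_nonneg: "0 \<le> bin_freq p n X \<mu>"
  by (simp add: bin_freq_def sum_nonneg)

lemma sum_bin_freq:
  assumes "p \<ge> 1" "\<And>i. i \<in> {1..n} \<Longrightarrow> X i \<in> {0..1}"
  shows "(\<Sum>\<mu>=1..p. bin_freq p n X \<mu> * c \<mu>) = (\<Sum>i=1..n. c (bin_index p (X i))) / real n"
proof -
  have "(\<Sum>\<mu>=1..p. bin_freq p n X \<mu> * c \<mu>)
    = (\<Sum>\<mu>=1..p. \<Sum>i=1..n. (if bin_index p (X i) = \<mu> then c \<mu> else 0)) / real n"
    unfolding bin_freq_def sum_divide_distrib sum_distrib_right
    by (intro sum.cong refl) (auto simp: sum_divide_distrib)
  also have "\<dots> = (\<Sum>i=1..n. \<Sum>\<mu>=1..p. (if bin_index p (X i) = \<mu> then c \<mu> else 0)) / real n"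
    by (subst sum.swap) simp
  also have "\<dots> = (\<Sum>i=1..n. c (bin_index p (X i))) / real n"
    using bin_index_range[OF assms(1) assms(2)] by (intro arg_cong2[where f="(/)"] sum.cong refl) simp
  finally show ?thesis .
qed

lemma sum_bin_freq_1:
  assumes "p \<ge> 1" "n \<ge> 1" "\<And>i. i \<in> {1..n} \<Longrightarrow> X i \<in> {0..1}"
  shows "(\<Sum>\<mu>=1..p. bin_freq p n X \<mu>) = 1"
  using sum_bin_freq[of p n X "\<lambda>_. 1"] assms by simp

text \<open>For each observation the sum over the wavelets is a value of the kernel, which is p if
  the observation shares the bin of x and 0 otherwise.\<close>

lemma empirical_histogram_eq:
  assumes n: "n \<ge> 1" and X: "\<And>i. i \<in> {1..n} \<Longrightarrow> X i \<in> {0..1}"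
    and \<nu>: "\<nu> \<in> {1..2 ^ (J + 1)}" and x: "x \<in> bin (2 ^ (J + 1)) \<nu>"
  shows "empirical_histogram J n X x = 2 ^ (J + 1) * bin_freq (2 ^ (J + 1)) n X \<nu>"
proof -
  let ?p = "2 ^ (J + 1) :: nat"
  let ?b = "\<lambda>i. bin_index ?p (X i)"
  have b: "?b i \<in> {1..?p}" if "i \<in> {1..n}" for i by (rule bin_index_range) (use X[OF that] in auto)
  have "empirical_histogram J n X x = 1 + (\<Sum>jk\<in>haar_idx J. empirical_mean n X (haar (fst jk) (snd jk)) * haar (fst jk) (snd jk) x)"
    using sum.Sigma[of "{0..J}" "\<lambda>j. {1..2 ^ j}" "\<lambda>j k. empirical_mean n X (haar j k) * haar j k x"]
    by (simp add: empirical_histogram_def haar_idx_def case_prod_beta)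
  also have "(\<Sum>jk\<in>haar_idx J. empirical_mean n X (haar (fst jk) (snd jk)) * haar (fst jk) (snd jk) x)
    = (\<Sum>jk\<in>haar_idx J. \<Sum>i=1..n. (haar_coef J jk (?b i) * haar_coef J jk \<nu>) / n)"
  proof (rule sum.cong[OF refl])
    fix jk assume jk: "jk \<in> haar_idx J"
    have "haar (fst jk) (snd jk) (X i) = haar_coef J jk (?b i)" if "i \<in> {1..n}" for i
      using haar_eq_haar_coef[of "fst jk" "snd jk" J "?b i" "X i"] jk b[OF that] bin_index_in_bin[of ?p "X i"] X[OF that] by simp
    moreover have "haar (fst jk) (snd jk) x = haar_coef J jk \<nu>"
      using haar_eq_haar_coef[of "fst jk" "snd jk" J \<nu> x] jk \<nu> x by simp
    ultimately show "empirical_mean n X (haar (fst jk) (snd jk)) * haar (fst jk) (snd jk) x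
        = (\<Sum>i=1..n. (haar_coef J jk (?b i) * haar_coef J jk \<nu>) / n)"
      by (simp add: empirical_mean_def sum_divide_distrib sum_distrib_right)
  qed
  also have "\<dots> = (\<Sum>i=1..n. (\<Sum>jk\<in>haar_idx J. haar_coef J jk (?b i) * haar_coef J jk \<nu>) / n)"
    by (subst sum.swap) (simp add: sum_divide_distrib)
  also have "1 + \<dots> = (\<Sum>i=1..n. (1 + (\<Sum>jk\<in>haar_idx J. haar_coef J jk (?b i) * haar_coef J jk \<nu>)) / n)"
    using n by (simp add: add_divide_distrib sum.distrib)
  also have "\<dots> = (\<Sum>i=1..n. (if ?b i = \<nu> then 2 ^ (J + 1) else 0) / n)"
    by (intro sum.cong refl arg_cong2[where f="(/)"] haar_kernel b \<nu>)
  also have "\<dots> = 2 ^ (J + 1) * bin_freq ?p n X \<nu>"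
    unfolding bin_freq_def sum_distrib_left times_divide_eq_right sum_divide_distrib by (intro sum.cong) auto
  finally show ?thesis .
qed

lemma LINT_bins_power2:
  assumes p: "p \<ge> 1" and F: "\<And>\<mu> x. \<mu> \<in> {1..p} \<Longrightarrow> x \<in> bin p \<mu> \<Longrightarrow> F x = real p * w \<mu>"
  shows "(LINT x:{0..1}|lborel. (F x)\<^sup>2) = real p * (\<Sum>\<mu>=1..p. (w \<mu>)\<^sup>2)"
proof -
  have "(LINT x:{0..1}|lborel. (F x)\<^sup>2) = (\<Sum>\<mu>=1..p. (real p * w \<mu>)\<^sup>2) / real p"
    by (rule LINT_bins[OF p]) (simp add: F)
  also have "\<dots> = (real p)\<^sup>2 * (\<Sum>\<mu>=1..p. (w \<mu>)\<^sup>2) / real p"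
    by (simp add: power_mult_distrib sum_distrib_left)
  finally show ?thesis using p by (simp add: power2_eq_square)
qed

lemma centring_eq:
  assumes n: "n \<ge> 1" and X: "\<And>i. i \<in> {1..n} \<Longrightarrow> X i \<in> {0..1}"
  shows "centring J n X = 2 ^ (J + 1) * (\<Sum>\<mu>=1..2 ^ (J + 1). (bin_freq (2 ^ (J + 1)) n X \<mu>)\<^sup>2) - 2 ^ (J + 1) / n"
  unfolding centring_def
  by (subst LINT_bins_power2[where p="2 ^ (J + 1)" and w="bin_freq (2 ^ (J + 1)) n X"])
     (use empirical_histogram_eq[OF n X] in auto)

section \<open>Integration by parts along translations\<close>

text \<open>Invariance of \<open>M\<close> makes the integral of \<open>K\<close> along the maps
  constant, so each difference quotient has integral 0. \<open>D\<close> dominates the quotients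
  along 1 / (i + 1), and the limit inherits the zero integral.\<close>

lemma translation_ibp:
  fixes M :: "'a measure" and \<tau> :: "real \<Rightarrow> 'a \<Rightarrow> 'a" and K K' D :: "'a \<Rightarrow> real"
  assumes \<tau>: "\<And>t. \<tau> t \<in> measurable M M" "\<And>t. distr M M (\<tau> t) = M"
    and K: "integrable M K"
    and K': "\<And>x. x \<in> space M \<Longrightarrow> ((\<lambda>t. K (\<tau> t x)) has_real_derivative K' x) (at 0)"
    and \<tau>0: "\<And>x. x \<in> space M \<Longrightarrow> \<tau> 0 x = x"
    and D: "integrable M D" "\<And>x t. x \<in> space M \<Longrightarrow> \<bar>t\<bar> \<le> 1 \<Longrightarrow> \<bar>K (\<tau> t x) - K x\<bar> \<le> \<bar>t\<bar> * D x"
  shows "has_bochner_integral M K' 0"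
proof -
  note [measurable] = \<tau>(1) borel_measurable_integrable[OF K]
  define f where "f i x = (K (\<tau> (inverse (real (Suc i))) x) - K x) / inverse (real (Suc i))" for i x
  have fm: "f i \<in> borel_measurable M" for i unfolding f_def by measurable
  have lim: "(\<lambda>i. f i x) \<longlonglongrightarrow> K' x" if x: "x \<in> space M" for x
  proof -
    have "((\<lambda>t. (K (\<tau> t x) - K x) / t) \<longlongrightarrow> K' x) (at 0)"
      using K'[OF x] \<tau>0[OF x] by (simp add: DERIV_def)
    moreover have "filterlim (\<lambda>i. inverse (real (Suc i))) (at 0) sequentially"
      using LIMSEQ_inverse_real_of_nat by (simp add: filterlim_at del: of_nat_Suc)
    ultimately show ?thesis unfolding f_def by (rule filterlim_compose)
  qed
  have K'm: "K' \<in> borel_measurable M"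
    by (rule borel_measurable_LIMSEQ_real[OF lim fm])
  have bound: "\<bar>f i x\<bar> \<le> D x" if x: "x \<in> space M" for i x
  proof -
    have "\<bar>K (\<tau> (inverse (real (Suc i))) x) - K x\<bar> \<le> inverse (real (Suc i)) * D x"
      using D(2)[OF x, of "inverse (real (Suc i))"] by (simp add: inverse_le_1_iff)
    then show ?thesis by (simp add: f_def abs_divide pos_divide_le_eq mult.commute del: of_nat_Suc)
  qed
  have "integral\<^sup>L M (f i) = 0" for i
  proof -
    have "integrable M (\<lambda>x. K (\<tau> t x))" for t
      by (rule integrable_distr[OF \<tau>(1)]) (simp add: \<tau>(2) K)
    moreover have "(\<integral>x. K (\<tau> t x) \<partial>M) = (\<integral>x. K x \<partial>M)" for t
      by (subst integral_distr[OF \<tau>(1), symmetric]) (simp_all add: \<tau>(2))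
    ultimately show ?thesis unfolding f_def by (simp add: K)
  qed
  moreover have "(\<lambda>i. integral\<^sup>L M (f i)) \<longlonglongrightarrow> integral\<^sup>L M K'"
    by (rule integral_dominated_convergence[OF K'm fm D(1)]) (auto intro!: AE_I2 lim bound)
  moreover have "integrable M K'"
    by (rule integrable_dominated_convergence[OF K'm fm D(1)]) (auto intro!: AE_I2 lim bound)
  ultimately show ?thesis
    by (simp add: has_bochner_integral_iff LIMSEQ_const_iff)
qed

text \<open>The restriction keeps the result in the space of the product measure, whose elements are
  undefined off \<open>I\<close>.\<close>

definition translate :: "'i set \<Rightarrow> ('i \<Rightarrow> real) \<Rightarrow> real \<Rightarrow> ('i \<Rightarrow> real) \<Rightarrow> ('i \<Rightarrow> real)" where
  "translate I c t x = (\<lambda>i\<in>I. x i + t * c i)"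

lemma translate_measurable:
  "translate I c t \<in> measurable (Pi\<^sub>M I (\<lambda>_. lborel)) (Pi\<^sub>M I (\<lambda>_. lborel))"
  unfolding translate_def by (rule measurable_restrict) measurable

lemma distr_translate:
  assumes I: "finite I"
  shows "distr (Pi\<^sub>M I (\<lambda>_. lborel)) (Pi\<^sub>M I (\<lambda>_. lborel)) (translate I c t) = Pi\<^sub>M I (\<lambda>_. lborel)"
proof -
  interpret product_sigma_finite "\<lambda>_::'a. lborel :: real measure" by standard
  show ?thesis
  proof (rule PiM_eqI[OF I])
    show "sets (distr (Pi\<^sub>M I (\<lambda>_. lborel)) (Pi\<^sub>M I (\<lambda>_. lborel)) (translate I c t)) = sets (Pi\<^sub>M I (\<lambda>_. lborel))"
      by simp
    fix A :: "'a \<Rightarrow> real set" assume A: "\<And>i. i \<in> I \<Longrightarrow> A i \<in> sets lborel"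
    then have A': "(\<lambda>x. x + t * c i) -` A i \<in> sets lborel" if "i \<in> I" for i
      using measurable_sets[of "\<lambda>x. x + t * c i" lborel borel "A i"] that by simp
    have "translate I c t -` Pi\<^sub>E I A \<inter> space (Pi\<^sub>M I (\<lambda>_. lborel)) = Pi\<^sub>E I (\<lambda>i. (\<lambda>x. x + t * c i) -` A i)"
      by (auto simp: translate_def space_PiM PiE_def Pi_def extensional_def)
    then have "emeasure (distr (Pi\<^sub>M I (\<lambda>_. lborel)) (Pi\<^sub>M I (\<lambda>_. lborel)) (translate I c t)) (Pi\<^sub>E I A)
        = emeasure (Pi\<^sub>M I (\<lambda>_. lborel)) (Pi\<^sub>E I (\<lambda>i. (\<lambda>x. x + t * c i) -` A i))"
      using A by (subst emeasure_distr[OF translate_measurable]) (auto intro!: sets_PiM_I_finite[OF I])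
    also have "\<dots> = (\<Prod>i\<in>I. emeasure lborel ((\<lambda>x. x + t * c i) -` A i))"
      using A' by (intro emeasure_PiM I)
    also have "\<dots> = (\<Prod>i\<in>I. emeasure lborel (A i))"
    proof (rule prod.cong[OF refl])
      fix i assume i: "i \<in> I"
      have pl: "(+) (t * c i) = (\<lambda>x. x + t * c i)" by auto
      have "emeasure lborel (A i) = emeasure (distr lborel borel ((+) (t * c i))) (A i)"
        by (simp add: lborel_distr_plus)
      also have "\<dots> = emeasure lborel ((\<lambda>x. x + t * c i) -` A i)"
        unfolding pl using A[OF i] by (subst emeasure_distr) auto
      finally show "emeasure lborel ((\<lambda>x. x + t * c i) -` A i) = emeasure lborel (A i)" by simp
    qed
    finally show "emeasure (distr (Pi\<^sub>M I (\<lambda>_. lborel)) (Pi\<^sub>M I (\<lambda>_. lborel)) (translate I c t)) (Pi\<^sub>E I A)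
      = (\<Prod>i\<in>I. emeasure lborel (A i))" .
  qed
qed

lemma translate_space: "translate I c t x \<in> space (Pi\<^sub>M I (\<lambda>_. lborel))"
  by (simp add: translate_def space_PiM)

lemma translate_0: "x \<in> space (Pi\<^sub>M I (\<lambda>_. lborel)) \<Longrightarrow> translate I c 0 x = x"
  by (auto simp: translate_def space_PiM PiE_def extensional_def fun_eq_iff)

lemma translate_translate: "translate I c s (translate I c t x) = translate I c (s + t) x"
  by (auto simp: translate_def fun_eq_iff algebra_simps)

text \<open>Translations in a fixed direction form a group, so a derivative at time 0 from every
  starting point gives one at every time.\<close>

lemma translate_has_derivative:
  assumes "\<And>x. x \<in> space (Pi\<^sub>M I (\<lambda>_. lborel)) \<Longrightarrow> ((\<lambda>t. K (translate I c t x)) has_real_derivative K' x) (at 0)"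
  shows "((\<lambda>t. K (translate I c t x)) has_real_derivative K' (translate I c t x)) (at t)"
proof -
  have "((\<lambda>s. K (translate I c (s + t) x)) has_real_derivative K' (translate I c t x)) (at 0)"
    using assms[OF translate_space, of c t x] by (simp add: translate_translate)
  then show ?thesis using DERIV_shift[of "\<lambda>t. K (translate I c t x)" _ 0 t] by (simp add: add.commute)
qed

text \<open>A bound on the derivative at all translates with |t| <= 1 gives the bound on increments
  by the mean value inequality.\<close>

lemma translate_ibp:
  assumes I: "finite I" and K: "integrable (Pi\<^sub>M I (\<lambda>_. lborel)) K"
    and K': "\<And>x. x \<in> space (Pi\<^sub>M I (\<lambda>_. lborel)) \<Longrightarrow> ((\<lambda>t. K (translate I c t x)) has_real_derivative K' x) (at 0)"
    and D: "integrable (Pi\<^sub>M I (\<lambda>_. lborel)) D"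
      "\<And>x t. x \<in> space (Pi\<^sub>M I (\<lambda>_. lborel)) \<Longrightarrow> \<bar>t\<bar> \<le> 1 \<Longrightarrow> \<bar>K' (translate I c t x)\<bar> \<le> D x"
  shows "has_bochner_integral (Pi\<^sub>M I (\<lambda>_. lborel)) K' 0"
proof (rule translation_ibp[OF translate_measurable distr_translate[OF I] K K' translate_0 D(1)])
  fix x :: "'a \<Rightarrow> real" and t :: real assume x: "x \<in> space (Pi\<^sub>M I (\<lambda>_. lborel))" and t: "\<bar>t\<bar> \<le> 1"
  have d: "((\<lambda>t. K (translate I c t x)) has_real_derivative K' (translate I c z x)) (at z)" for z
    using K' by (rule translate_has_derivative)
  have "\<bar>K (translate I c t x) - K (translate I c 0 x)\<bar> \<le> D x * \<bar>t - 0\<bar>"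
  proof (rule field_differentiable_bound[where S="{-1..1::real}" and f="\<lambda>t. K (translate I c t x)" and f'="\<lambda>t. K' (translate I c t x)", unfolded real_norm_def])
    show "((\<lambda>t. K (translate I c t x)) has_real_derivative K' (translate I c z x)) (at z within {-1..1})" for z
      by (rule has_field_derivative_at_within[OF d])
  qed (use t D(2)[OF x] in \<open>auto simp: abs_le_iff\<close>)
  then show "\<bar>K (translate I c t x) - K x\<bar> \<le> \<bar>t\<bar> * D x"
    using translate_0[OF x] by (simp add: mult.commute)
qed auto

text \<open>Positive and finite evidence turns the extended nonnegative quotient into an ordinary
  real density. The prior density is not normalised, so improper priors are covered.\<close>

lemma posterior_eq_density:
  assumes \<pi>[measurable]: "\<pi> \<in> borel_measurable L" and l[measurable]: "l \<in> borel_measurable L"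
    and nonneg: "\<And>x. x \<in> space L \<Longrightarrow> 0 \<le> \<pi> x" "\<And>x. x \<in> space L \<Longrightarrow> 0 \<le> l x"
    and lik: "\<And>x. x \<in> space L \<Longrightarrow> likelihood F n X x = ennreal (l x)"
    and fin: "evidence (density L (\<lambda>x. ennreal (\<pi> x))) F n X < \<infinity>"
    and pos: "0 < evidence (density L (\<lambda>x. ennreal (\<pi> x))) F n X"
  obtains E where "E > 0" "posterior (density L (\<lambda>x. ennreal (\<pi> x))) F n X = density L (\<lambda>x. ennreal (\<pi> x * l x / E))"
    "prob_space (density L (\<lambda>x. ennreal (\<pi> x * l x / E)))" "integrable L (\<lambda>x. \<pi> x * l x)"
proof -
  let ?ev = "evidence (density L (\<lambda>x. ennreal (\<pi> x))) F n X"
  have lm: "likelihood F n X \<in> borel_measurable L"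
    by (subst measurable_cong[OF lik]) measurable
  have ev: "?ev = (\<integral>\<^sup>+x. ennreal (\<pi> x * l x) \<partial>L)"
    unfolding evidence_def
    by (subst nn_integral_density[OF _ lm]) (auto intro!: nn_integral_cong simp: lik ennreal_mult[symmetric] nonneg)
  obtain E where E: "?ev = ennreal E" "E \<ge> 0" using fin by (cases ?ev) auto
  then have "E > 0" using pos by (cases "E = 0") auto
  have "posterior (density L (\<lambda>x. ennreal (\<pi> x))) F n X = density L (\<lambda>x. ennreal (\<pi> x) * (likelihood F n X x / ennreal E))"
    unfolding posterior_def E(1) by (rule density_density_eq) (use lm in measurable)
  also have "\<dots> = density L (\<lambda>x. ennreal (\<pi> x * l x / E))"
  proof (rule density_cong)
    show "AE x in L. ennreal (\<pi> x) * (likelihood F n X x / ennreal E) = ennreal (\<pi> x * l x / E)"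
      using \<open>E > 0\<close> by (intro AE_I2) (simp add: lik nonneg divide_ennreal ennreal_mult[symmetric] mult_ac)
  qed (use lm in measurable)
  finally have 1: "posterior (density L (\<lambda>x. ennreal (\<pi> x))) F n X = density L (\<lambda>x. ennreal (\<pi> x * l x / E))" .
  have 2: "integrable L (\<lambda>x. \<pi> x * l x)"
    by (rule integrableI_nonneg) (use fin ev nonneg in auto)
  have "prob_space (density L (\<lambda>x. ennreal (\<pi> x * l x / E)))"
  proof
    have "(\<integral>\<^sup>+x. ennreal (\<pi> x * l x / E) \<partial>L) = (\<integral>\<^sup>+x. ennreal (\<pi> x * l x) / ennreal E \<partial>L)"
      by (rule nn_integral_cong) (use \<open>E > 0\<close> nonneg in \<open>simp add: divide_ennreal\<close>)
    also have "\<dots> = ennreal E / ennreal E"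
      by (subst nn_integral_divide) (simp_all add: ev[symmetric] E)
    also have "\<dots> = 1" using \<open>E > 0\<close> by (simp add: divide_ennreal)
    finally show "emeasure (density L (\<lambda>x. ennreal (\<pi> x * l x / E))) (space (density L (\<lambda>x. ennreal (\<pi> x * l x / E)))) = 1"
      by (simp add: emeasure_density cong: nn_integral_cong)
  qed
  from that[OF \<open>E > 0\<close> 1 this 2] show thesis .
qed

section \<open>The Haar series posterior\<close>

locale series_setting =
  fixes J n :: nat and H :: "real \<Rightarrow> real" and \<sigma> :: "nat \<Rightarrow> real" and X :: "nat \<Rightarrow> real"
    and B \<sigma>0 :: real and p :: nat
  defines "p \<equiv> 2 ^ (J + 1)"
  assumes n: "n \<ge> 1" and X: "\<And>i. i \<in> {1..n} \<Longrightarrow> X i \<in> {0..1}"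
    and \<sigma>0: "\<sigma>0 > 0" and \<sigma>: "\<And>j. j \<le> J \<Longrightarrow> \<sigma>0 \<le> \<sigma> j"
    and H1: "\<And>x. H differentiable (at x)" and H2: "\<And>x. deriv H differentiable (at x)"
    and B: "\<And>x. \<bar>deriv H x\<bar> \<le> B" "\<And>x. \<bar>deriv (deriv H) x\<bar> \<le> B"
begin

abbreviation "I \<equiv> haar_idx J"
abbreviation "L \<equiv> Pi\<^sub>M I (\<lambda>_. lborel) :: (nat \<times> nat \<Rightarrow> real) measure"
abbreviation "hc \<equiv> haar_coef J"
abbreviation "h \<equiv> bin_freq p n X"
abbreviation "sg jk \<equiv> \<sigma> (fst jk)"

definition lin :: "(nat \<times> nat \<Rightarrow> real) \<Rightarrow> nat \<Rightarrow> real" where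
  "lin \<theta> \<nu> = (\<Sum>jk\<in>I. \<theta> jk * hc jk \<nu>)"

definition S where "S \<theta> = (\<Sum>\<nu>=1..p. exp (lin \<theta> \<nu>))"

definition W where "W \<theta> \<nu> = exp (lin \<theta> \<nu>) / S \<theta>"

text \<open>The Haar coefficient of the log density, recovered from bin probabilities: the
  normaliser is constant over the bins and disappears against a wavelet of mean zero. It lets the
  prior score be written as a function of \<open>w\<close> instead of \<theta>.\<close>

definition tau :: "nat \<times> nat \<Rightarrow> (nat \<Rightarrow> real) \<Rightarrow> real" where
  "tau jk w = (\<Sum>\<nu>=1..p. hc jk \<nu> * ln (w \<nu>)) / p"

text \<open>The derivative of the log prior when \<theta> moves in the direction
  \<open>hc jk i / p\<close>, the Haar coefficients of the indicator of bin i.\<close>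

definition R :: "nat \<Rightarrow> (nat \<Rightarrow> real) \<Rightarrow> real" where
  "R i w = (\<Sum>jk\<in>I. - (deriv H (1 / sg jk * tau jk w) * (1 / sg jk) * (hc jk i / p)))"

definition R' :: "nat \<Rightarrow> (nat \<Rightarrow> real) \<Rightarrow> nat \<Rightarrow> real" where
  "R' i w k = (\<Sum>jk\<in>I. - (deriv (deriv H) (1 / sg jk * tau jk w) * (1 / sg jk)\<^sup>2 * (hc jk i / p)) * (hc jk k / (real p * w k)))"

lemma p1: "p \<ge> 1" by (simp add: p_def)

lemma p_real: "real p = 2 ^ (J + 1)" by (simp add: p_def)

lemma B0: "0 \<le> B" using B(1)[of 0] by linarith

lemma sg_pos: "jk \<in> I \<Longrightarrow> 0 < sg jk" and sg_ge: "jk \<in> I \<Longrightarrow> \<sigma>0 \<le> sg jk"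
  using \<sigma>[of "fst jk"] \<sigma>0 by (auto simp: haar_idx_def)

lemma S_pos: "S \<theta> > 0"
  unfolding S_def using p1 by (intro sum_pos) auto

lemma W_pos: "W \<theta> \<nu> > 0" using S_pos by (simp add: W_def)

lemma W_simplex: "W \<theta> \<in> open_simplex p"
  using S_pos[of \<theta>] W_pos by (auto simp: open_simplex_def W_def sum_divide_distrib[symmetric] S_def[symmetric])

lemma kernel: "\<mu> \<in> {1..p} \<Longrightarrow> \<nu> \<in> {1..p} \<Longrightarrow> (\<Sum>jk\<in>I. hc jk \<mu> * hc jk \<nu>) = (if \<mu> = \<nu> then real p else 0) - 1"
proof -
  assume "\<mu> \<in> {1..p}" "\<nu> \<in> {1..p}"
  then have "(\<Sum>jk\<in>I. hc jk \<mu> * hc jk \<nu>) = (if \<mu> = \<nu> then 2 ^ (J + 1) else 0) - 1"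
    using haar_kernel[of \<mu> J \<nu>] unfolding p_def by linarith
  then show ?thesis by (simp add: p_def)
qed

lemma hc_sum: "jk \<in> I \<Longrightarrow> (\<Sum>\<nu>=1..p. hc jk \<nu>) = 0"
  unfolding p_def by (rule haar_orthogonal)

lemma lin_haar:
  assumes "\<nu> \<in> {1..p}" "x \<in> bin p \<nu>"
  shows "(\<Sum>(j, k)\<in>I. \<theta> (j, k) * haar j k x) = lin \<theta> \<nu>"
  unfolding lin_def using haar_eq_haar_coef[of _ _ J \<nu> x] assms
  by (intro sum.cong) (auto simp: p_def)

lemma series_density_eq:
  assumes "\<nu> \<in> {1..p}" "x \<in> bin p \<nu>"
  shows "series_density J \<theta> x = real p * W \<theta> \<nu>"
proof -
  have "(LINT x:{0..1}|lborel. exp (\<Sum>(j, k)\<in>I. \<theta> (j, k) * haar j k x)) = S \<theta> / p"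
    unfolding S_def by (rule LINT_bins[OF p1]) (simp add: lin_haar)
  then have "log_normaliser J \<theta> = ln (S \<theta> / p)" by (simp add: log_normaliser_def)
  then have "series_density J \<theta> x = exp (lin \<theta> \<nu>) / (S \<theta> / p)"
    using S_pos[of \<theta>] p1 by (simp add: series_density_def lin_haar[OF assms] exp_diff)
  then show ?thesis by (simp add: W_def mult.commute)
qed

lemma tau_W:
  assumes "jk \<in> I"
  shows "tau jk (W \<theta>) = \<theta> jk"
proof -
  have "(\<Sum>\<nu>=1..p. hc jk \<nu> * ln (W \<theta> \<nu>)) = (\<Sum>\<nu>=1..p. hc jk \<nu> * lin \<theta> \<nu> - hc jk \<nu> * ln (S \<theta>))"
    using S_pos[of \<theta>] by (intro sum.cong refl) (simp add: W_def ln_div right_diff_distrib)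
  also have "\<dots> = (\<Sum>\<nu>=1..p. hc jk \<nu> * lin \<theta> \<nu>)"
    by (simp add: sum_subtractf sum_distrib_right[symmetric] hc_sum[OF assms])
  also have "\<dots> = (\<Sum>l\<in>I. \<Sum>\<nu>=1..p. \<theta> l * (hc l \<nu> * hc jk \<nu>))"
    unfolding lin_def sum_distrib_left by (subst sum.swap) (simp add: mult_ac)
  also have "\<dots> = (\<Sum>l\<in>I. if l = jk then \<theta> l * real p else 0)"
    unfolding sum_distrib_left[symmetric]
    using haar_orthogonal(2)[OF assms] by (intro sum.cong refl) (auto simp: p_def)
  also have "\<dots> = \<theta> jk * real p" using assms by simp
  finally show ?thesis using p1 by (simp add: tau_def)
qed

lemma inner_haar:
  assumes "jk \<in> I" "\<And>\<nu> x. \<nu> \<in> {1..p} \<Longrightarrow> x \<in> bin p \<nu> \<Longrightarrow> f x = c \<nu>"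
  shows "inner_L2 (haar (fst jk) (snd jk)) f = (\<Sum>\<nu>=1..p. hc jk \<nu> * c \<nu>) / p"
  unfolding inner_L2_def
  using haar_eq_haar_coef[of "fst jk" "snd jk" J] assms
  by (intro LINT_bins[OF p1]) (auto simp: p_def)

lemma R_u: "(\<Sum>i=1..p. u i * R i w) = - (\<Sum>jk\<in>I. deriv H (1 / sg jk * tau jk w) * (1 / sg jk) * ((\<Sum>i=1..p. hc jk i * u i) / p))"
proof -
  have "(\<Sum>i=1..p. u i * R i w) = (\<Sum>jk\<in>I. \<Sum>i=1..p. - (deriv H (1 / sg jk * tau jk w) * (1 / sg jk)) * (hc jk i * u i / p))"
    unfolding R_def sum_distrib_left by (subst sum.swap) (simp add: mult_ac)
  then show ?thesis by (simp add: sum_negf sum_distrib_left sum_divide_distrib mult_ac)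
qed

text \<open>The right-hand side is \<open>Zfun\<close>. The centring already contains - p / n, so
  one of the two terms p / n of the functional cancels. Exchanging summations in the definition of
  \<open>R\<close> turns the wavelet sum into a sum over bins.\<close>

lemma functional_eq:
  "sqrt n * (series_functional J H \<sigma> n X (series_density J \<theta>) - centring J n X)
   = ((real n + 1) * real p * (\<Sum>i=1..p. (W \<theta> i)\<^sup>2) - real p
    - (\<Sum>i=1..p. real p * (W \<theta> i + h i) * R i (W \<theta>)) - real n * real p * (\<Sum>i=1..p. (h i)\<^sup>2)) / sqrt n"
proof -
  have f2: "(LINT x:{0..1}|lborel. (series_density J \<theta> x)\<^sup>2) = real p * (\<Sum>i=1..p. (W \<theta> i)\<^sup>2)"
    by (rule LINT_bins_power2[OF p1]) (rule series_density_eq)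
  have i1: "inner_L2 (haar (fst jk) (snd jk)) (\<lambda>x. ln (series_density J \<theta> x)) = tau jk (W \<theta>)" if "jk \<in> I" for jk
  proof -
    have "inner_L2 (haar (fst jk) (snd jk)) (\<lambda>x. ln (series_density J \<theta> x)) = (\<Sum>\<nu>=1..p. hc jk \<nu> * (ln p + ln (W \<theta> \<nu>))) / p"
      using p1 by (intro inner_haar[OF that]) (auto simp: series_density_eq ln_mult W_pos less_imp_neq[OF W_pos, THEN not_sym])
    also have "(\<Sum>\<nu>=1..p. hc jk \<nu> * (ln p + ln (W \<theta> \<nu>))) = (\<Sum>\<nu>=1..p. hc jk \<nu> * ln (W \<theta> \<nu>))"
      by (simp add: distrib_left sum.distrib sum_distrib_right[symmetric] hc_sum[OF that])
    finally show ?thesis by (simp add: tau_def)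
  qed
  have i2: "inner_L2 (haar (fst jk) (snd jk)) (\<lambda>x. empirical_histogram J n X x + series_density J \<theta> x)
      = (\<Sum>i=1..p. hc jk i * (real p * (W \<theta> i + h i))) / p" if "jk \<in> I" for jk
    using empirical_histogram_eq[OF n X] 
    by (intro inner_haar[OF that]) (auto simp: series_density_eq p_def algebra_simps)
  have "(\<Sum>j=0..J. 1 / \<sigma> j * (\<Sum>k=1..2 ^ j.
         deriv H (1 / \<sigma> j * inner_L2 (haar j k) (\<lambda>x. ln (series_density J \<theta> x)))
         * inner_L2 (haar j k) (\<lambda>x. empirical_histogram J n X x + series_density J \<theta> x)))
    = (\<Sum>jk\<in>I. 1 / sg jk *
         (deriv H (1 / sg jk * inner_L2 (haar (fst jk) (snd jk)) (\<lambda>x. ln (series_density J \<theta> x)))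
         * inner_L2 (haar (fst jk) (snd jk)) (\<lambda>x. empirical_histogram J n X x + series_density J \<theta> x)))"
    unfolding sum_distrib_left haar_idx_def
    by (subst sum.Sigma) (auto simp: case_prod_beta)
  also have "\<dots> = (\<Sum>jk\<in>I. deriv H (1 / sg jk * tau jk (W \<theta>)) * (1 / sg jk) * ((\<Sum>i=1..p. hc jk i * (real p * (W \<theta> i + h i))) / p))"
    by (intro sum.cong refl) (simp only: i1 i2, simp add: mult_ac)
  also have "\<dots> = - (\<Sum>i=1..p. real p * (W \<theta> i + h i) * R i (W \<theta>))"
    unfolding R_u by simp
  finally have r: "(\<Sum>j=0..J. 1 / \<sigma> j * (\<Sum>k=1..2 ^ j.
         deriv H (1 / \<sigma> j * inner_L2 (haar j k) (\<lambda>x. ln (series_density J \<theta> x)))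
         * inner_L2 (haar j k) (\<lambda>x. empirical_histogram J n X x + series_density J \<theta> x)))
    = - (\<Sum>i=1..p. real p * (W \<theta> i + h i) * R i (W \<theta>))" .
  have c: "centring J n X = real p * (\<Sum>i=1..p. (h i)\<^sup>2) - real p / n"
    using centring_eq[OF n X, where J=J] by (simp add: p_def)
  have sq: "sqrt n = n / sqrt n" using n by (simp add: real_div_sqrt)
  show ?thesis unfolding series_functional_def f2 r c p_real[symmetric]
    by (subst (1) sq, insert n) (simp add: field_simps)
qed

text \<open>On each level a single wavelet lives on bin i, with absolute value 2^(j/2). The
  geometric sum is dominated by its last term; the induction closes with the constant 4 because 4 +
  sqrt 2 <= 4 sqrt 2. Growth like sqrt p, and not p, is what makes the prior score of order 1 /
  (\<sigma> sqrt p).\<close>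

lemma hc_abs_sum: "i \<in> {1..p} \<Longrightarrow> (\<Sum>jk\<in>I. \<bar>hc jk i\<bar>) \<le> 4 * sqrt p"
proof -
  assume i: "i \<in> {1..p}"
  have "(\<Sum>k=1..2 ^ j. \<bar>hc (j, k) i\<bar>) = sqrt 2 ^ j" if j: "j \<in> {0..J}" for j
  proof -
    let ?c = "(i - 1) div 2 ^ (J - j) div 2 + 1"
    have "(i - 1) div 2 ^ (J - j) div 2 < 2 ^ j"
    proof -
      have "J + 1 = j + Suc (J - j)" using j by auto
      then have "(2::nat) ^ (J + 1) = 2 ^ j * 2 ^ Suc (J - j)" by (simp only: power_add)
      moreover have "i - 1 < 2 ^ (J + 1)" using i by (auto simp: p_def)
      ultimately show ?thesis
        by (simp add: div_mult2_eq[symmetric] div_less_iff_less_mult mult_ac)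
    qed
    then have c: "?c \<in> {1..2 ^ j}" by simp
    have "(\<Sum>k=1..2 ^ j. \<bar>hc (j, k) i\<bar>) = (\<Sum>k=1..2 ^ j. if ?c = k then 2 powr (real j / 2) else 0)"
      by (intro sum.cong refl) (auto simp: haar_coef_def abs_mult)
    also have "\<dots> = 2 powr (real j / 2)" using c by simp
    also have "\<dots> = sqrt 2 ^ j" by (simp add: powr_half_sqrt[symmetric] powr_powr powr_realpow[symmetric])
    finally show ?thesis .
  qed
  then have "(\<Sum>jk\<in>I. \<bar>hc jk i\<bar>) = (\<Sum>j=0..J. sqrt 2 ^ j)"
    using sum.Sigma[of "{0..J}" "\<lambda>j. {1..2 ^ j}" "\<lambda>j k. \<bar>hc (j, k) i\<bar>"]
    by (simp add: haar_idx_def case_prod_beta)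
  also have "(\<Sum>j=0..J. sqrt 2 ^ j) \<le> 4 * sqrt 2 ^ J"
  proof (induction J)
    case (Suc J)
    have "(\<Sum>j=0..Suc J. sqrt 2 ^ j) \<le> (4 + sqrt 2) * sqrt 2 ^ J"
      using Suc by (simp add: distrib_right)
    also have "\<dots> \<le> (4 * sqrt 2) * sqrt 2 ^ J"
    proof (rule mult_right_mono)
      have "4 / 3 \<le> sqrt (2::real)" by (rule real_le_rsqrt) (simp add: power2_eq_square)
      then show "4 + sqrt 2 \<le> 4 * sqrt (2::real)" by simp
    qed simp
    finally show ?case by simp
  qed simp
  also have "\<dots> \<le> 4 * sqrt p"
    by (simp add: p_real real_sqrt_power[symmetric] power_add)
  finally show ?thesis .
qed

lemma R_bound: "i \<in> {1..p} \<Longrightarrow> \<bar>R i w\<bar> \<le> 4 * B / (\<sigma>0 * sqrt p)"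
proof -
  assume i: "i \<in> {1..p}"
  have "\<bar>R i w\<bar> \<le> (\<Sum>jk\<in>I. B / \<sigma>0 / p * \<bar>hc jk i\<bar>)"
    unfolding R_def
  proof (rule order_trans[OF sum_abs], rule sum_mono)
    fix jk assume jk: "jk \<in> I"
    have "\<bar>deriv H (1 / sg jk * tau jk w)\<bar> * (1 / sg jk) \<le> B * (1 / \<sigma>0)"
      using B(1) sg_pos[OF jk] sg_ge[OF jk] \<sigma>0 B0 by (intro mult_mono divide_left_mono) auto
    then have "\<bar>deriv H (1 / sg jk * tau jk w)\<bar> * (1 / sg jk) * (\<bar>hc jk i\<bar> / p) \<le> B * (1 / \<sigma>0) * (\<bar>hc jk i\<bar> / p)"
      by (intro mult_right_mono) auto
    then show "\<bar>- (deriv H (1 / sg jk * tau jk w) * (1 / sg jk) * (hc jk i / p))\<bar> \<le> B / \<sigma>0 / p * \<bar>hc jk i\<bar>"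
      using sg_pos[OF jk] by (simp add: abs_mult mult_ac)
  qed
  also have "\<dots> = B / \<sigma>0 / p * (\<Sum>jk\<in>I. \<bar>hc jk i\<bar>)" by (simp add: sum_distrib_left)
  also have "\<dots> \<le> B / \<sigma>0 / p * (4 * sqrt p)"
    using hc_abs_sum[OF i] B0 \<sigma>0 by (intro mult_left_mono) auto
  also have "\<dots> = 4 * B / (\<sigma>0 * sqrt p)"
  proof -
    define r where "r = sqrt p"
    have "r > 0" "real p = r * r" using p1 by (auto simp: r_def)
    then show ?thesis unfolding r_def[symmetric] using \<sigma>0 by (simp add: field_simps)
  qed
  finally show ?thesis .
qed

lemma tau_deriv:
  assumes \<gamma>: "\<gamma> 0 \<in> open_simplex p" "\<And>i. i \<in> {1..p} \<Longrightarrow> ((\<lambda>t. \<gamma> t i) has_real_derivative \<eta> i) (at (0::real))"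
  shows "((\<lambda>t. tau jk (\<gamma> t)) has_real_derivative (\<Sum>k=1..p. hc jk k / (real p * \<gamma> 0 k) * \<eta> k)) (at 0)"
proof -
  have "((\<lambda>t. (\<Sum>k=1..p. hc jk k * ln (\<gamma> t k)) / p) has_real_derivative
    (\<Sum>k=1..p. hc jk k * (1 / \<gamma> 0 k * \<eta> k)) / p) (at 0)"
    by (intro DERIV_cdivide DERIV_sum DERIV_cmult DERIV_chain2[where f=ln] DERIV_ln_divide)
       (use \<gamma> open_simplexD(1)[OF \<gamma>(1)] in auto)
  then show ?thesis unfolding tau_def
    by (rule DERIV_cong) (simp add: sum_divide_distrib mult_ac)
qed

lemma deriv_H: "(deriv H has_real_derivative deriv (deriv H) x) (at x)" "(H has_real_derivative deriv H x) (at x)"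
  using H1 H2 by (auto simp: DERIV_deriv_iff_real_differentiable)

lemma R_smooth:
  assumes i: "i \<in> {1..p}"
  shows "smooth_fn p (R i) (R' i)"
proof (rule smooth_fnI)
  fix \<gamma> :: "real \<Rightarrow> nat \<Rightarrow> real" and \<eta>
  assume \<gamma>: "\<gamma> 0 \<in> open_simplex p" "\<And>i. i \<in> {1..p} \<Longrightarrow> ((\<lambda>t. \<gamma> t i) has_real_derivative \<eta> i) (at 0)"
  note \<tau> = tau_deriv[of \<gamma> \<eta>, OF \<gamma>]
  have "((\<lambda>t. \<Sum>jk\<in>I. - (deriv H (1 / sg jk * tau jk (\<gamma> t)) * (1 / sg jk) * (hc jk i / p))) has_real_derivative
     (\<Sum>jk\<in>I. - (deriv (deriv H) (1 / sg jk * tau jk (\<gamma> 0)) * (1 / sg jk * (\<Sum>k=1..p. hc jk k / (real p * \<gamma> 0 k) * \<eta> k)) * (1 / sg jk) * (hc jk i / p)))) (at 0)"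
    by (intro DERIV_sum DERIV_minus DERIV_cmult_right DERIV_chain2[where f="deriv H", OF deriv_H(1)] DERIV_cmult \<tau>)
  then show "((\<lambda>t. R i (\<gamma> t)) has_real_derivative (\<Sum>k = 1..p. R' i (\<gamma> 0) k * \<eta> k)) (at 0)"
    unfolding R_def
  proof (rule DERIV_cong)
    have "(\<Sum>k = 1..p. R' i (\<gamma> 0) k * \<eta> k) = (\<Sum>jk\<in>I. \<Sum>k = 1..p. - (deriv (deriv H) (1 / sg jk * tau jk (\<gamma> 0)) * (1 / sg jk)\<^sup>2 * (hc jk i / p)) * (hc jk k / (real p * \<gamma> 0 k)) * \<eta> k)"
      unfolding R'_def sum_distrib_right by (rule sum.swap)
    then show "(\<Sum>jk\<in>I. - (deriv (deriv H) (1 / sg jk * tau jk (\<gamma> 0)) * (1 / sg jk * (\<Sum>k=1..p. hc jk k / (real p * \<gamma> 0 k) * \<eta> k)) * (1 / sg jk) * (hc jk i / p)))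
       = (\<Sum>k = 1..p. R' i (\<gamma> 0) k * \<eta> k)"
      by (simp add: sum_negf sum_distrib_left sum_distrib_right power2_eq_square mult_ac)
  qed
next
  show "\<bar>R i w\<bar> \<le> 4 * B / (\<sigma>0 * sqrt p)" for w by (rule R_bound[OF i])
  fix w k assume w: "w \<in> open_simplex p" and k: "k \<in> {1..p}"
  \<comment> \<open>The factor \<open>w k\<close> cancels the pole that differentiating the
    logarithm created.\<close>
  have eq: "w k * R' i w k = (\<Sum>jk\<in>I. - (deriv (deriv H) (1 / sg jk * tau jk w) * (1 / sg jk)\<^sup>2 * (hc jk i / p)) * (hc jk k / p))"
    unfolding R'_def sum_distrib_left using open_simplexD(1)[OF w k] by (intro sum.cong) auto
  show "\<bar>w k * R' i w k\<bar> \<le> (\<Sum>jk\<in>I. (B * (1 / sg jk)\<^sup>2 * \<bar>hc jk i / p\<bar>) * (\<Sum>k=1..p. \<bar>hc jk k / p\<bar>))"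
    unfolding eq
  proof (rule order_trans[OF sum_abs], rule sum_mono)
    fix jk assume "jk \<in> I"
    show "\<bar>- (deriv (deriv H) (1 / sg jk * tau jk w) * (1 / sg jk)\<^sup>2 * (hc jk i / p)) * (hc jk k / p)\<bar>
       \<le> (B * (1 / sg jk)\<^sup>2 * \<bar>hc jk i / p\<bar>) * (\<Sum>k=1..p. \<bar>hc jk k / p\<bar>)"
      unfolding abs_mult abs_minus_cancel
      using B(2) B0 k member_le_sum[of k "{1..p}" "\<lambda>k. \<bar>hc jk k / p\<bar>"]
      by (intro mult_mono) (auto simp: abs_mult)
  qed
qed

text \<open>The tilt derivative of \<open>tau\<close> in direction i is just
  \<open>hc jk i / p\<close>, since wavelets have mean zero. The double sum therefore equals minus a
  weighted sum of squared Haar coefficients of \<open>u\<close>, with weights bounded by B /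
  \<sigma>0^2, and Bessel's inequality bounds it by the mean square of \<open>u\<close>. No power of
  p is lost.\<close>

lemma R'_bound:
  fixes u w :: "nat \<Rightarrow> real"
  assumes w: "w \<in> open_simplex p" and u: "\<And>i. i \<in> {1..p} \<Longrightarrow> \<bar>u i\<bar> \<le> c"
  shows "\<bar>\<Sum>i=1..p. \<Sum>j=1..p. u i * u j * tilt_deriv p w (R' j w) i\<bar> \<le> B / \<sigma>0\<^sup>2 * c\<^sup>2"
proof -
  define A where "A jk = deriv (deriv H) (1 / sg jk * tau jk w) * (1 / sg jk)\<^sup>2" for jk
  have t: "tilt_deriv p w (R' j w) i = (\<Sum>jk\<in>I. - (A jk * (hc jk j / p)) * (hc jk i / p))" if i: "i \<in> {1..p}" for i j
  proof -
    have eq: "R' j w = (\<lambda>k. \<Sum>jk\<in>I. - (A jk * (hc jk j / p)) * (hc jk k / (real p * w k)))"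
      by (auto simp: R'_def A_def fun_eq_iff)
    have "tilt_deriv p w (\<lambda>k. hc jk k / (real p * w k)) i = hc jk i / p" if jk: "jk \<in> I" for jk
    proof -
      have "(\<Sum>k=1..p. w k * (hc jk k / (real p * w k))) = (\<Sum>k=1..p. hc jk k) / p"
        unfolding sum_divide_distrib
      proof (rule sum.cong[OF refl])
        fix k assume "k \<in> {1..p}"
        from open_simplexD(1)[OF w this] show "w k * (hc jk k / (real p * w k)) = hc jk k / p" by simp
      qed
      then show ?thesis using open_simplexD(1)[OF w i] by (simp add: tilt_deriv_def hc_sum[OF jk])
    qed
    then show ?thesis unfolding eq tilt_deriv_sum tilt_deriv_cmult by simp
  qed
  have "(\<Sum>i=1..p. \<Sum>j=1..p. u i * u j * tilt_deriv p w (R' j w) i)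
    = (\<Sum>i=1..p. \<Sum>j=1..p. \<Sum>jk\<in>I. - A jk * ((hc jk i * u i / p) * (hc jk j * u j / p)))"
    by (intro sum.cong refl) (simp add: t sum_distrib_left mult_ac)
  also have "\<dots> = (\<Sum>i=1..p. \<Sum>jk\<in>I. \<Sum>j=1..p. - A jk * ((hc jk i * u i / p) * (hc jk j * u j / p)))"
    by (intro sum.cong refl sum.swap)
  also have "\<dots> = (\<Sum>jk\<in>I. \<Sum>i=1..p. \<Sum>j=1..p. - A jk * ((hc jk i * u i / p) * (hc jk j * u j / p)))"
    by (rule sum.swap)
  finally have eq: "(\<Sum>i=1..p. \<Sum>j=1..p. u i * u j * tilt_deriv p w (R' j w) i)
    = (\<Sum>jk\<in>I. \<Sum>i=1..p. \<Sum>j=1..p. - A jk * ((hc jk i * u i / p) * (hc jk j * u j / p)))" .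
  have eq2: "\<dots> = (\<Sum>jk\<in>I. - A jk * ((\<Sum>i=1..p. hc jk i * u i) / p)\<^sup>2)"
    by (intro sum.cong refl) (simp only: sum_divide_distrib power2_eq_square sum_product, simp only: sum_distrib_left)
  have "\<bar>\<Sum>i=1..p. \<Sum>j=1..p. u i * u j * tilt_deriv p w (R' j w) i\<bar> \<le> (\<Sum>jk\<in>I. B / \<sigma>0\<^sup>2 * ((\<Sum>i=1..p. hc jk i * u i) / p)\<^sup>2)"
    unfolding eq eq2
  proof (rule order_trans[OF sum_abs], rule sum_mono)
    fix jk assume jk: "jk \<in> I"
    have "\<bar>A jk\<bar> \<le> B * (1 / \<sigma>0)\<^sup>2"
      unfolding A_def abs_mult using B(2) B0 sg_pos[OF jk] sg_ge[OF jk] \<sigma>0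
      by (intro mult_mono) (auto intro!: power_mono divide_left_mono)
    then show "\<bar>- A jk * ((\<Sum>i=1..p. hc jk i * u i) / p)\<^sup>2\<bar> \<le> B / \<sigma>0\<^sup>2 * ((\<Sum>i=1..p. hc jk i * u i) / p)\<^sup>2"
      unfolding abs_mult by (intro mult_mono) (auto simp: power_divide)
  qed
  also have "\<dots> = B / \<sigma>0\<^sup>2 * ((\<Sum>jk\<in>I. (\<Sum>i=1..p. hc jk i * u i) * (\<Sum>i=1..p. hc jk i * u i)) / (real p)\<^sup>2)"
    by (simp add: sum_distrib_left[symmetric] sum_divide_distrib[symmetric] power_divide power2_eq_square)
  also have "\<dots> \<le> B / \<sigma>0\<^sup>2 * c\<^sup>2"
  proof (rule mult_left_mono)
    have "(\<Sum>jk\<in>I. (\<Sum>i=1..p. hc jk i * u i) * (\<Sum>i=1..p. hc jk i * u i)) \<le> real p * (\<Sum>i=1..p. u i * u i)"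
      using haar_parseval[where J=J and u=u and v=u, folded p_def p_real] zero_le_square[of "\<Sum>i=1..p. u i"] by linarith
    also have "(\<Sum>i=1..p. u i * u i) \<le> (\<Sum>i=1..p. c\<^sup>2)"
    proof (rule sum_mono)
      fix i assume "i \<in> {1..p}"
      from power_mono[OF u[OF this] abs_ge_zero, of 2] show "u i * u i \<le> c\<^sup>2"
        by (simp add: power2_eq_square)
    qed
    finally show "(\<Sum>jk\<in>I. (\<Sum>i=1..p. hc jk i * u i) * (\<Sum>i=1..p. hc jk i * u i)) / (real p)\<^sup>2 \<le> c\<^sup>2"
      using p1 by (simp add: field_simps power2_eq_square)
  qed (use B0 in simp)
  finally show ?thesis .
qed

section \<open>The unnormalised series posterior along a tilt\<close>

definition rho :: "(nat \<times> nat \<Rightarrow> real) \<Rightarrow> real" where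
  "rho \<theta> = (\<Prod>jk\<in>I. exp (- H (\<theta> jk / sg jk))) * (\<Prod>i=1..n. real p * W \<theta> (bin_index p (X i)))"

abbreviation "tshift \<mu> \<equiv> translate I (\<lambda>jk. hc jk \<mu> / real p)"

text \<open>The kernel identity makes this translation of \<theta> add t on bin \<mu> and subtract t
  / p on all bins. The constant is absorbed by the normalisation, so the density undergoes the
  exponential tilt of bin \<mu>.\<close>

lemma lin_shift:
  assumes "\<mu> \<in> {1..p}" "\<nu> \<in> {1..p}"
  shows "lin (tshift \<mu> t \<theta>) \<nu> = lin \<theta> \<nu> + t * ((if \<mu> = \<nu> then 1 else 0) - 1 / p)"
proof -
  have "lin (tshift \<mu> t \<theta>) \<nu> = (\<Sum>jk\<in>I. \<theta> jk * hc jk \<nu> + t / p * (hc jk \<mu> * hc jk \<nu>))"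
    unfolding lin_def translate_def by (intro sum.cong refl) (simp add: algebra_simps)
  also have "\<dots> = lin \<theta> \<nu> + t / p * ((if \<mu> = \<nu> then real p else 0) - 1)"
    unfolding sum.distrib sum_distrib_left[symmetric] kernel[OF assms] lin_def ..
  also have "t / p * ((if \<mu> = \<nu> then real p else 0) - 1) = t * ((if \<mu> = \<nu> then 1 else 0) - 1 / p)"
    using p1 by (simp add: field_simps)
  finally show ?thesis .
qed

lemma lin_shift_deriv:
  assumes "\<mu> \<in> {1..p}" "\<nu> \<in> {1..p}"
  shows "((\<lambda>t. lin (tshift \<mu> t \<theta>) \<nu>) has_real_derivative (if \<mu> = \<nu> then 1 else 0) - 1 / p) (at 0)"
proof -
  have "((\<lambda>t. a + t * c) has_real_derivative c) (at 0)" for a c :: real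
    by (auto intro!: derivative_eq_intros)
  then show ?thesis unfolding lin_shift[OF assms] .
qed

lemma S_shift_deriv:
  assumes \<mu>: "\<mu> \<in> {1..p}"
  shows "((\<lambda>t. S (tshift \<mu> t \<theta>)) has_real_derivative exp (lin \<theta> \<mu>) - S \<theta> / p) (at 0)"
proof -
  have "((\<lambda>t. S (tshift \<mu> t \<theta>)) has_real_derivative
     (\<Sum>\<nu>=1..p. exp (lin (tshift \<mu> 0 \<theta>) \<nu>) * ((if \<mu> = \<nu> then 1 else 0) - 1 / p))) (at 0)"
    unfolding S_def by (intro DERIV_sum DERIV_chain2[where f=exp, OF DERIV_exp] lin_shift_deriv \<mu>)
  then show ?thesis
  proof (rule DERIV_cong)
    have "(\<Sum>\<nu>=1..p. exp (lin (tshift \<mu> 0 \<theta>) \<nu>) * ((if \<mu> = \<nu> then 1 else 0) - 1 / p))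
      = (\<Sum>\<nu>=1..p. (if \<mu> = \<nu> then exp (lin \<theta> \<nu>) else 0) - exp (lin \<theta> \<nu>) / p)"
      using \<mu> by (intro sum.cong refl) (auto simp: lin_shift right_diff_distrib)
    then show "(\<Sum>\<nu>=1..p. exp (lin (tshift \<mu> 0 \<theta>) \<nu>) * ((if \<mu> = \<nu> then 1 else 0) - 1 / p)) = exp (lin \<theta> \<mu>) - S \<theta> / p"
      using \<mu> by (simp add: sum_subtractf S_def sum_divide_distrib)
  qed
qed

lemma S_shift_0: "\<mu> \<in> {1..p} \<Longrightarrow> S (tshift \<mu> 0 \<theta>) = S \<theta>"
  by (auto simp: S_def lin_shift)

lemma W_shift_deriv:
  assumes \<mu>: "\<mu> \<in> {1..p}" and \<nu>: "\<nu> \<in> {1..p}"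
  shows "((\<lambda>t. W (tshift \<mu> t \<theta>) \<nu>) has_real_derivative W \<theta> \<nu> * ((if \<nu> = \<mu> then 1 else 0) - W \<theta> \<mu>)) (at 0)"
proof -
  have "((\<lambda>t. W (tshift \<mu> t \<theta>) \<nu>) has_real_derivative
    (exp (lin (tshift \<mu> 0 \<theta>) \<nu>) * ((if \<mu> = \<nu> then 1 else 0) - 1 / p) * S (tshift \<mu> 0 \<theta>)
      - exp (lin (tshift \<mu> 0 \<theta>) \<nu>) * (exp (lin \<theta> \<mu>) - S \<theta> / p)) / (S (tshift \<mu> 0 \<theta>) * S (tshift \<mu> 0 \<theta>))) (at 0)"
    unfolding W_def using S_pos[of "tshift \<mu> 0 \<theta>"]
    by (intro DERIV_divide DERIV_chain2[where f=exp, OF DERIV_exp] lin_shift_deriv S_shift_deriv \<mu> \<nu>) simp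
  then show ?thesis
  proof (rule DERIV_cong)
    have s: "(e * (d - c) * s - e * (m - s * c)) / (s * s) = e / s * (d - m / s)" if "s > 0" for e d c s m :: real
      using that by (simp add: field_simps)
    show "(exp (lin (tshift \<mu> 0 \<theta>) \<nu>) * ((if \<mu> = \<nu> then 1 else 0) - 1 / p) * S (tshift \<mu> 0 \<theta>)
      - exp (lin (tshift \<mu> 0 \<theta>) \<nu>) * (exp (lin \<theta> \<mu>) - S \<theta> / p)) / (S (tshift \<mu> 0 \<theta>) * S (tshift \<mu> 0 \<theta>))
      = W \<theta> \<nu> * ((if \<nu> = \<mu> then 1 else 0) - W \<theta> \<mu>)"
      using s[OF S_pos[of \<theta>], of "exp (lin \<theta> \<nu>)" "if \<mu> = \<nu> then 1 else 0" "1 / p" "exp (lin \<theta> \<mu>)"]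
      unfolding W_def S_shift_0[OF \<mu>] by (simp add: lin_shift[OF \<mu> \<nu>] eq_commute[of \<nu>])
  qed
qed

lemma bin_index_X: "i \<in> {1..n} \<Longrightarrow> bin_index p (X i) \<in> {1..p}"
  by (rule bin_index_range[OF p1 X])

lemma rho_eq_exp:
  "rho \<theta> = exp ((\<Sum>jk\<in>I. - H (\<theta> jk / sg jk)) + (\<Sum>i=1..n. ln p + lin \<theta> (bin_index p (X i)) - ln (S \<theta>)))"
proof -
  have "(\<Prod>i=1..n. real p * W \<theta> (bin_index p (X i))) = (\<Prod>i=1..n. exp (ln p + lin \<theta> (bin_index p (X i)) - ln (S \<theta>)))"
    using p1 S_pos[of \<theta>] by (intro prod.cong refl) (simp add: W_def exp_add exp_diff)
  then show ?thesis by (simp add: rho_def exp_add exp_sum)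
qed

lemma rho_pos: "rho \<theta> > 0" by (simp add: rho_eq_exp)

lemma rho_shift_deriv:
  assumes \<mu>: "\<mu> \<in> {1..p}" and \<theta>: "\<theta> \<in> space L"
  shows "((\<lambda>t. rho (tshift \<mu> t \<theta>)) has_real_derivative rho \<theta> * (n * h \<mu> - n * W \<theta> \<mu> + R \<mu> (W \<theta>))) (at 0)"
proof -
  let ?\<Lambda> = "\<lambda>\<theta>. (\<Sum>jk\<in>I. - H (\<theta> jk / sg jk)) + (\<Sum>i=1..n. ln p + lin \<theta> (bin_index p (X i)) - ln (S \<theta>))"
  have 0: "tshift \<mu> 0 \<theta> = \<theta>" using \<theta> by (rule translate_0)
  have 1: "((\<lambda>t. - H (tshift \<mu> t \<theta> jk / sg jk)) has_real_derivative
      - (deriv H (tshift \<mu> 0 \<theta> jk / sg jk) * (hc jk \<mu> / p / sg jk))) (at 0)" if "jk \<in> I" for jk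
  proof (intro DERIV_minus DERIV_chain2[where f=H, OF deriv_H(2)] DERIV_cdivide)
    have "((\<lambda>t. a + t * c) has_real_derivative c) (at 0)" for a c :: real
      by (auto intro!: derivative_eq_intros)
    from this[of "\<theta> jk" "hc jk \<mu> / p"] show "((\<lambda>t. tshift \<mu> t \<theta> jk) has_real_derivative hc jk \<mu> / p) (at 0)"
      using that by (simp add: translate_def)
  qed
  have 2: "((\<lambda>t. ln p + lin (tshift \<mu> t \<theta>) (bin_index p (X i)) - ln (S (tshift \<mu> t \<theta>))) has_real_derivative
      (0 + ((if \<mu> = bin_index p (X i) then 1 else 0) - 1 / p)) - (1 / S (tshift \<mu> 0 \<theta>) * (exp (lin \<theta> \<mu>) - S \<theta> / p))) (at 0)"
    if "i \<in> {1..n}" for i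
    using S_pos by (intro DERIV_diff DERIV_add DERIV_const lin_shift_deriv S_shift_deriv \<mu> bin_index_X[OF that]
      DERIV_chain2[where f=ln] DERIV_ln_divide)
  have "((\<lambda>t. exp (?\<Lambda> (tshift \<mu> t \<theta>))) has_real_derivative exp (?\<Lambda> (tshift \<mu> 0 \<theta>)) *
     ((\<Sum>jk\<in>I. - (deriv H (tshift \<mu> 0 \<theta> jk / sg jk) * (hc jk \<mu> / p / sg jk)))
       + (\<Sum>i=1..n. (0 + ((if \<mu> = bin_index p (X i) then 1 else 0) - 1 / p)) - (1 / S (tshift \<mu> 0 \<theta>) * (exp (lin \<theta> \<mu>) - S \<theta> / p))))) (at 0)"
    by (intro DERIV_chain2[where f=exp, OF DERIV_exp] DERIV_add DERIV_sum 1 2)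
  then show ?thesis unfolding rho_eq_exp
  proof (rule DERIV_cong)
    have "(\<Sum>jk\<in>I. - (deriv H (\<theta> jk / sg jk) * (hc jk \<mu> / p / sg jk))) = R \<mu> (W \<theta>)"
      unfolding R_def by (intro sum.cong refl) (simp add: tau_W)
    moreover have "(\<Sum>i=1..n. (0 + ((if \<mu> = bin_index p (X i) then 1 else 0) - 1 / p)) - (1 / S \<theta> * (exp (lin \<theta> \<mu>) - S \<theta> / p)))
      = n * h \<mu> - n * W \<theta> \<mu>"
    proof -
      \<comment> \<open>The \<open>- 1 / p\<close> of the shift cancels against the
        \<open>1 / p\<close> that comes from differentiating \<open>ln (S \<theta>)\<close>.\<close>
      have "(\<Sum>i=1..n. (0 + ((if \<mu> = bin_index p (X i) then 1 else 0) - 1 / p)) - (1 / S \<theta> * (exp (lin \<theta> \<mu>) - S \<theta> / p)))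
        = (\<Sum>i=1..n. (if bin_index p (X i) = \<mu> then 1 else 0) - W \<theta> \<mu>)"
        using S_pos[of \<theta>] p1 by (intro sum.cong refl) (auto simp: W_def field_simps)
      then show ?thesis using n by (simp add: sum_subtractf bin_freq_def)
    qed
    ultimately show "exp (?\<Lambda> (tshift \<mu> 0 \<theta>)) *
     ((\<Sum>jk\<in>I. - (deriv H (tshift \<mu> 0 \<theta> jk / sg jk) * (hc jk \<mu> / p / sg jk)))
       + (\<Sum>i=1..n. (0 + ((if \<mu> = bin_index p (X i) then 1 else 0) - 1 / p)) - (1 / S (tshift \<mu> 0 \<theta>) * (exp (lin \<theta> \<mu>) - S \<theta> / p))))
      = exp (?\<Lambda> \<theta>) * (n * h \<mu> - n * W \<theta> \<mu> + R \<mu> (W \<theta>))"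
      unfolding 0 by simp
  qed
qed

lemma lin_meas [measurable]: "(\<lambda>\<theta>. lin \<theta> \<nu>) \<in> borel_measurable L"
  unfolding lin_def by measurable

lemma S_meas [measurable]: "S \<in> borel_measurable L"
  unfolding S_def [abs_def] by measurable

lemma W_meas [measurable]: "(\<lambda>\<theta>. W \<theta> \<nu>) \<in> borel_measurable L"
  unfolding W_def by measurable

lemma H_meas [measurable]: "H \<in> borel_measurable borel" "deriv H \<in> borel_measurable borel"
proof -
  have "continuous_on UNIV H"
    by (rule DERIV_continuous_on, rule has_field_derivative_at_within, rule deriv_H(2))
  moreover have "continuous_on UNIV (deriv H)"
    by (rule DERIV_continuous_on, rule has_field_derivative_at_within, rule deriv_H(1))
  ultimately show "H \<in> borel_measurable borel" "deriv H \<in> borel_measurable borel"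
    by (auto intro: borel_measurable_continuous_onI)
qed

lemma rho_meas [measurable]: "rho \<in> borel_measurable L"
  unfolding rho_def [abs_def]
  by (intro borel_measurable_times borel_measurable_prod borel_measurable_const W_meas) measurable

lemma R_meas [measurable]: "(\<lambda>\<theta>. R i (W \<theta>)) \<in> borel_measurable L"
  unfolding R_def tau_def
  by (intro borel_measurable_sum borel_measurable_uminus borel_measurable_times borel_measurable_const
        measurable_compose[OF _ H_meas(2)] borel_measurable_divide borel_measurable_ln W_meas)

abbreviation "post \<equiv> posterior (series_prior J H \<sigma>) (series_density J) n X"

lemma posterior_density:
  assumes fin: "evidence (series_prior J H \<sigma>) (series_density J) n X < \<infinity>"
  obtains E where "E > 0" "post = density L (\<lambda>\<theta>. ennreal (rho \<theta> / E))" "prob_space post" "integrable L rho"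
proof -
  let ?\<pi> = "\<lambda>\<theta>. \<Prod>(j, k)\<in>I. exp (- H (\<theta> (j, k) / \<sigma> j))"
  let ?l = "\<lambda>\<theta>. \<Prod>i=1..n. real p * W \<theta> (bin_index p (X i))"
  have prior: "series_prior J H \<sigma> = density L (\<lambda>\<theta>. ennreal (?\<pi> \<theta>))" by (simp add: series_prior_def)
  have \<pi>: "?\<pi> \<theta> = (\<Prod>jk\<in>I. exp (- H (\<theta> jk / sg jk)))" for \<theta> by (intro prod.cong) auto
  have rho: "?\<pi> \<theta> * ?l \<theta> = rho \<theta>" for \<theta> unfolding \<pi> rho_def ..
  have \<pi>m: "?\<pi> \<in> borel_measurable L" unfolding \<pi> by measurable
  have lm: "?l \<in> borel_measurable L"
    by (intro borel_measurable_times borel_measurable_prod borel_measurable_const W_meas)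
  have lik: "likelihood (series_density J) n X \<theta> = ennreal (?l \<theta>)" for \<theta>
    unfolding likelihood_def
  proof (intro arg_cong[where f=ennreal] prod.cong refl)
    fix i assume i: "i \<in> {1..n}"
    show "series_density J \<theta> (X i) = real p * W \<theta> (bin_index p (X i))"
      by (rule series_density_eq[OF bin_index_X[OF i] bin_index_in_bin[OF p1 X[OF i]]])
  qed
  have likm: "likelihood (series_density J) n X \<in> borel_measurable L"
    unfolding lik using lm by measurable
  have \<pi>0: "0 \<le> ?\<pi> \<theta>" for \<theta> unfolding \<pi> by (intro prod_nonneg) simp
  have l0: "0 \<le> ?l \<theta>" for \<theta> using W_pos by (intro prod_nonneg) (simp add: less_imp_le)
  have e: "ennreal (?\<pi> \<theta>) * ennreal (?l \<theta>) = ennreal (rho \<theta>)" for \<theta>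
    unfolding rho[symmetric] by (rule ennreal_mult[symmetric, OF \<pi>0 l0])
  have "evidence (series_prior J H \<sigma>) (series_density J) n X = (\<integral>\<^sup>+\<theta>. ennreal (rho \<theta>) \<partial>L)"
    unfolding evidence_def prior
    by (subst nn_integral_density[OF _ likm]) (use \<pi>m in measurable, simp only: lik e)
  moreover have "(\<integral>\<^sup>+\<theta>. ennreal (rho \<theta>) \<partial>L) \<noteq> 0"
  proof
    assume "(\<integral>\<^sup>+\<theta>. ennreal (rho \<theta>) \<partial>L) = 0"
    then have "AE \<theta> in L. ennreal (rho \<theta>) = 0"
      by (subst (asm) nn_integral_0_iff_AE) measurable
    then have "AE \<theta> in L. False" 
    proof eventually_elim
      case (elim \<theta>)
      then show ?case using rho_pos[of \<theta>] by (simp add: ennreal_eq_0_iff)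
    qed
    \<comment> \<open>Since \<open>rho\<close> is strictly positive, zero evidence would make the
      whole space a null set, whereas its volume is a product of infinite factors.\<close>
    then have "emeasure L (space L) = 0" by (simp add: AE_iff_measurable[OF _ refl])
    moreover have "emeasure L (space L) = (\<Prod>jk\<in>I. emeasure lborel (UNIV :: real set))"
    proof -
      interpret product_sigma_finite "\<lambda>_::nat \<times> nat. lborel :: real measure" by standard
      have "space L = Pi\<^sub>E I (\<lambda>_. UNIV)" by (simp add: space_PiM)
      then show ?thesis by (simp add: emeasure_PiM)
    qed
    ultimately show False by (simp add: prod_zero_iff)
  qed
  ultimately have pos: "0 < evidence (series_prior J H \<sigma>) (series_density J) n X"
    by (simp add: zero_less_iff_neq_zero)
  obtain E where E: "E > 0" "post = density L (\<lambda>x. ennreal (?\<pi> x * ?l x / E))"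
    "prob_space (density L (\<lambda>x. ennreal (?\<pi> x * ?l x / E)))" "integrable L (\<lambda>x. ?\<pi> x * ?l x)"
    using fin pos unfolding prior
    by (rule posterior_eq_density[OF \<pi>m lm, rotated 3])
       (use \<pi>0 l0 lik in auto)
  show thesis by (rule that[of E]) (use E in \<open>simp_all add: rho\<close>)
qed

text \<open>Integration by parts for \<open>rho * G\<close> under Lebesgue measure along the
  translation that tilts bin \<mu>. The logarithmic derivative \<open>s\<close> of
  \<open>rho\<close> is bounded, so \<open>rho\<close> changes at most by a constant factor over
  unit time and serves as its own dominating function.\<close>

lemma posterior_stein:
  assumes fin: "evidence (series_prior J H \<sigma>) (series_density J) n X < \<infinity>"
    and G: "smooth_fn p G G'" and Gm: "(\<lambda>\<theta>. G (W \<theta>)) \<in> borel_measurable L" and \<mu>: "\<mu> \<in> {1..p}"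
  shows "has_bochner_integral post (\<lambda>\<theta>. tilt_deriv p (W \<theta>) (G' (W \<theta>)) \<mu>
    + G (W \<theta>) * (n * h \<mu> - n * W \<theta> \<mu> + R \<mu> (W \<theta>))) 0" (is "has_bochner_integral _ ?F 0")
proof -
  obtain E where E: "E > 0" "post = density L (\<lambda>\<theta>. ennreal (rho \<theta> / E))" "integrable L rho"
    using posterior_density[OF fin] by blast
  obtain B2 where B2: "B2 \<ge> 0" "\<And>w i. w \<in> open_simplex p \<Longrightarrow> i \<in> {1..p} \<Longrightarrow> \<bar>tilt_deriv p w (G' w) i\<bar> \<le> B2"
    using smooth_fn_tilt_deriv_bounded[OF G] by blast
  obtain B3 where B3: "B3 \<ge> 0" "\<And>w. w \<in> open_simplex p \<Longrightarrow> \<bar>G w\<bar> \<le> B3"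
    "\<And>w i. w \<in> open_simplex p \<Longrightarrow> i \<in> {1..p} \<Longrightarrow> \<bar>w i * G' w i\<bar> \<le> B3" "has_gradient p G G'"
    using smooth_fnE[OF G] by blast
  define s where "s \<theta> = n * h \<mu> - n * W \<theta> \<mu> + R \<mu> (W \<theta>)" for \<theta>
  define B1 where "B1 = real n * h \<mu> + n + 4 * B / (\<sigma>0 * sqrt p)"
  have s: "\<bar>s \<theta>\<bar> \<le> B1" for \<theta>
  proof -
    have "0 \<le> n * h \<mu>" by (simp add: bin_freq_nonneg)
    moreover have "0 \<le> n * W \<theta> \<mu>" "n * W \<theta> \<mu> \<le> n"
      using open_simplexD(1,2)[OF W_simplex[of \<theta>] \<mu>] by (auto simp: mult_left_le)
    ultimately show ?thesis using R_bound[OF \<mu>, of "W \<theta>"] unfolding s_def B1_def by linarith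
  qed
  have B1: "B1 \<ge> 0" using order_trans[OF abs_ge_zero s] .
  have tsp: "tshift \<mu> t \<theta> \<in> space L" for t \<theta> by (rule translate_space)
  have rd: "((\<lambda>t. rho (tshift \<mu> t \<theta>)) has_real_derivative rho (tshift \<mu> t \<theta>) * s (tshift \<mu> t \<theta>)) (at t)" for \<theta> t
    using translate_has_derivative[of I rho _ "\<lambda>\<theta>. rho \<theta> * s \<theta>"] rho_shift_deriv[OF \<mu>] unfolding s_def by blast
  have rho_le: "rho (tshift \<mu> t \<theta>) \<le> exp B1 * rho \<theta>" if \<theta>: "\<theta> \<in> space L" and t: "\<bar>t\<bar> \<le> 1" for \<theta> t
  proof -
    have "\<bar>ln (rho (tshift \<mu> t \<theta>)) - ln (rho (tshift \<mu> 0 \<theta>))\<bar> \<le> B1 * \<bar>t - 0\<bar>"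
    proof (rule field_differentiable_bound[where S=UNIV and f="\<lambda>t. ln (rho (tshift \<mu> t \<theta>))" and f'="\<lambda>t. s (tshift \<mu> t \<theta>)", unfolded real_norm_def])
      fix z :: real
      have "((\<lambda>t. ln (rho (tshift \<mu> t \<theta>))) has_real_derivative 1 / rho (tshift \<mu> z \<theta>) * (rho (tshift \<mu> z \<theta>) * s (tshift \<mu> z \<theta>))) (at z)"
        by (intro DERIV_chain2[where f=ln] DERIV_ln_divide rho_pos rd)
      then show "((\<lambda>t. ln (rho (tshift \<mu> t \<theta>))) has_real_derivative s (tshift \<mu> z \<theta>)) (at z within UNIV)"
        using rho_pos[of "tshift \<mu> z \<theta>"] by simp
    qed (use s in auto)
    also have "\<dots> \<le> B1" using t B1 by (simp add: mult_left_le)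
    finally have "ln (rho (tshift \<mu> t \<theta>)) \<le> B1 + ln (rho \<theta>)" using translate_0[OF \<theta>] by simp
    then have "exp (ln (rho (tshift \<mu> t \<theta>))) \<le> exp (B1 + ln (rho \<theta>))" by simp
    then show ?thesis using rho_pos by (simp add: exp_add)
  qed
  have F: "\<bar>?F \<theta>\<bar> \<le> B2 + B3 * B1" for \<theta>
  proof -
    have "\<bar>G (W \<theta>) * s \<theta>\<bar> \<le> B3 * B1"
      unfolding abs_mult using B3(2)[OF W_simplex] s B3(1) by (intro mult_mono) auto
    then show ?thesis using B2(2)[OF W_simplex \<mu>, of \<theta>] unfolding s_def by linarith
  qed
  have C: "0 \<le> B2 + B3 * B1" using B1 B2(1) B3(1) by simp
  have "has_bochner_integral L (\<lambda>\<theta>. rho \<theta> * ?F \<theta>) 0"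
  proof (rule translate_ibp[where K="\<lambda>\<theta>. rho \<theta> * G (W \<theta>)" and c="\<lambda>jk. hc jk \<mu> / real p" and D="\<lambda>\<theta>. (B2 + B3 * B1) * exp B1 * rho \<theta>"])
    show "finite I" by simp
    show "integrable L (\<lambda>\<theta>. rho \<theta> * G (W \<theta>))"
    proof (rule Bochner_Integration.integrable_bound[where f="\<lambda>\<theta>. B3 * rho \<theta>"])
      show "AE \<theta> in L. norm (rho \<theta> * G (W \<theta>)) \<le> norm (B3 * rho \<theta>)"
        using B3 W_simplex rho_pos by (auto simp: abs_mult mult.commute[of B3] less_imp_le intro!: mult_left_mono)
    qed (use E Gm in auto)
    show "integrable L (\<lambda>\<theta>. (B2 + B3 * B1) * exp B1 * rho \<theta>)" using E by simp
  next
    fix \<theta> assume \<theta>: "\<theta> \<in> space L"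
    have 0: "tshift \<mu> 0 \<theta> = \<theta>" using \<theta> by (rule translate_0)
    have "((\<lambda>t. G (W (tshift \<mu> t \<theta>))) has_real_derivative
       (\<Sum>i=1..p. G' (W (tshift \<mu> 0 \<theta>)) i * (W \<theta> i * ((if i = \<mu> then 1 else 0) - W \<theta> \<mu>)))) (at 0)"
      by (rule has_gradientD[OF B3(4) W_simplex W_shift_deriv[OF \<mu>]])
    moreover have "(\<Sum>i=1..p. G' (W (tshift \<mu> 0 \<theta>)) i * (W \<theta> i * ((if i = \<mu> then 1 else 0) - W \<theta> \<mu>))) = tilt_deriv p (W \<theta>) (G' (W \<theta>)) \<mu>"
    proof -
      have "(\<Sum>i=1..p. G' (W (tshift \<mu> 0 \<theta>)) i * (W \<theta> i * ((if i = \<mu> then 1 else 0) - W \<theta> \<mu>)))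
        = (\<Sum>i=1..p. (if \<mu> = i then W \<theta> i * G' (W \<theta>) i else 0) - W \<theta> \<mu> * (W \<theta> i * G' (W \<theta>) i))"
        unfolding 0 by (intro sum.cong refl) (auto simp: algebra_simps)
      also have "\<dots> = W \<theta> \<mu> * G' (W \<theta>) \<mu> - W \<theta> \<mu> * (\<Sum>i=1..p. W \<theta> i * G' (W \<theta>) i)"
        using \<mu> by (simp add: sum_subtractf sum_distrib_left)
      finally show ?thesis by (simp add: tilt_deriv_def right_diff_distrib)
    qed
    ultimately have "((\<lambda>t. G (W (tshift \<mu> t \<theta>))) has_real_derivative tilt_deriv p (W \<theta>) (G' (W \<theta>)) \<mu>) (at 0)" by simp
    from DERIV_mult[OF rho_shift_deriv[OF \<mu> \<theta>] this]
    show "((\<lambda>t. rho (tshift \<mu> t \<theta>) * G (W (tshift \<mu> t \<theta>))) has_real_derivative rho \<theta> * ?F \<theta>) (at 0)"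
      by (rule DERIV_cong) (simp add: 0 algebra_simps)
    fix t :: real assume t: "\<bar>t\<bar> \<le> 1"
    have "\<bar>rho (tshift \<mu> t \<theta>) * ?F (tshift \<mu> t \<theta>)\<bar> \<le> (exp B1 * rho \<theta>) * (B2 + B3 * B1)"
      unfolding abs_mult using rho_le[OF \<theta> t] rho_pos[of "tshift \<mu> t \<theta>"] F C rho_pos[of \<theta>]
      by (intro mult_mono) auto
    then show "\<bar>rho (tshift \<mu> t \<theta>) * ?F (tshift \<mu> t \<theta>)\<bar> \<le> (B2 + B3 * B1) * exp B1 * rho \<theta>"
      by (simp only: mult_ac)
  qed
  then have I0: "has_bochner_integral L (\<lambda>\<theta>. (rho \<theta> / E) *\<^sub>R ?F \<theta>) 0"
    using has_bochner_integral_mult_right[of "1 / E" L "\<lambda>\<theta>. rho \<theta> * ?F \<theta>" 0] by simp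
  \<comment> \<open>Measurability of the gradient part is not given; it follows by dividing an
    integrable function by the positive measurable \<open>rho\<close>.\<close>
  have Fm: "?F \<in> borel_measurable L"
  proof -
    have "(\<lambda>\<theta>. (rho \<theta> / E) *\<^sub>R ?F \<theta>) \<in> borel_measurable L" using I0 by auto
    then have "(\<lambda>\<theta>. (rho \<theta> / E) *\<^sub>R ?F \<theta> / (rho \<theta> / E)) \<in> borel_measurable L"
      by (rule borel_measurable_divide) measurable
    also have "(\<lambda>\<theta>. (rho \<theta> / E) *\<^sub>R ?F \<theta> / (rho \<theta> / E)) = ?F"
      using rho_pos E(1) by (auto simp: fun_eq_iff less_imp_neq[symmetric])
    finally show ?thesis .
  qed
  show ?thesis unfolding E(2)
    by (rule has_bochner_integral_density[OF Fm _ _ I0])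
       (use rho_pos E(1) in \<open>auto intro!: AE_I2 simp: less_imp_le\<close>)
qed

lemma series_stein_model:
  assumes fin: "evidence (series_prior J H \<sigma>) (series_density J) n X < \<infinity>"
  shows "stein_model post p n W h R R' (4 * B / (\<sigma>0 * sqrt p)) 0 (B / \<sigma>0\<^sup>2)"
proof -
  obtain E where E: "E > 0" "post = density L (\<lambda>\<theta>. ennreal (rho \<theta> / E))" "prob_space post"
    using posterior_density[OF fin] by blast
  have meas: "f \<in> borel_measurable post \<longleftrightarrow> f \<in> borel_measurable L" for f :: "_ \<Rightarrow> real"
    unfolding E(2) by simp
  interpret prob_space post by fact
  show ?thesis
  proof unfold_locales
    show "AE \<theta> in post. W \<theta> \<in> open_simplex p" by (simp add: W_simplex)
    show "(\<Sum>i=1..p. h i) = 1" by (rule sum_bin_freq_1[OF p1 n X])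
    show "\<bar>R i w\<bar> \<le> 4 * B / (\<sigma>0 * sqrt p) + 0 * w i" if "i \<in> {1..p}" for i w
      using R_bound[OF that] by simp
    show "\<bar>\<Sum>i=1..p. \<Sum>j=1..p. u i * u j * tilt_deriv p w (R' j w) i\<bar> \<le> B / \<sigma>0\<^sup>2 * c\<^sup>2"
      if "w \<in> open_simplex p" "\<And>i. i \<in> {1..p} \<Longrightarrow> \<bar>u i\<bar> \<le> c" for u c w
      using that by (rule R'_bound)
    fix G G' i assume G: "smooth_fn p G G'" "(\<lambda>\<theta>. G (W \<theta>)) \<in> borel_measurable post" "i \<in> {1..p}"
    show "\<exists>F. has_bochner_integral post F 0 \<and> (AE x in post. F x = tilt_deriv p (W x) (G' (W x)) i
        + G (W x) * (n * h i - n * W x i + R i (W x)))"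
      using posterior_stein[OF fin G(1) G(2)[unfolded meas] G(3)] by (intro exI conjI) auto
  qed (use p1 n B0 \<sigma>0 in \<open>auto simp: meas W_meas bin_freq_nonneg R_smooth R_meas\<close>)
qed

end

section \<open>The Dirichlet posterior\<close>

text \<open>The substitution y = s t reduces every scale to the Beta integral on the unit
  interval.\<close>

lemma nn_integral_Beta_scaled:
  fixes a b :: real
  assumes a: "a > 0" and b: "b > 0"
  obtains C :: real where "C \<ge> 0" "\<And>s. s > 0 \<Longrightarrow>
    (\<integral>\<^sup>+ y. ennreal (if 0 < y \<and> y < s then y powr (a - 1) * (s - y) powr (b - 1) else 0) \<partial>lborel)
      \<le> ennreal (C * s powr (a + b - 1))"
proof -
  let ?f = "\<lambda>t. indicator {0..1} t * (t powr (a - 1) * (1 - t) powr (b - 1))"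
  have int: "integrable lborel ?f"
    using integrable_Beta[OF a b] by (simp add: set_integrable_def)
  define C where "C = (\<integral>t. ?f t \<partial>lborel)"
  have C: "(\<integral>\<^sup>+t. ennreal (?f t) \<partial>lborel) = ennreal C"
    unfolding C_def by (rule nn_integral_eq_integral[OF int]) (auto simp: indicator_def)
  show thesis
  proof (rule that)
    show "C \<ge> 0" unfolding C_def by (rule integral_nonneg_AE) (auto simp: indicator_def)
    fix s :: real assume s: "s > 0"
    have "(\<integral>\<^sup>+ y. ennreal (if 0 < y \<and> y < s then y powr (a - 1) * (s - y) powr (b - 1) else 0) \<partial>lborel)
      = ennreal \<bar>s\<bar> * (\<integral>\<^sup>+ t. ennreal (if 0 < 0 + s * t \<and> 0 + s * t < s then (0 + s * t) powr (a - 1) * (s - (0 + s * t)) powr (b - 1) else 0) \<partial>lborel)"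
      by (rule nn_integral_real_affine) (use s in auto)
    also have "\<dots> \<le> ennreal s * (\<integral>\<^sup>+ t. ennreal (s powr (a - 1 + (b - 1))) * ennreal (?f t) \<partial>lborel)"
    proof (rule mult_mono)
      show "(\<integral>\<^sup>+ t. ennreal (if 0 < 0 + s * t \<and> 0 + s * t < s then (0 + s * t) powr (a - 1) * (s - (0 + s * t)) powr (b - 1) else 0) \<partial>lborel)
        \<le> (\<integral>\<^sup>+ t. ennreal (s powr (a - 1 + (b - 1))) * ennreal (?f t) \<partial>lborel)"
      proof (rule nn_integral_mono)
        fix t :: real
        have "(0 + s * t) powr (a - 1) * (s - (0 + s * t)) powr (b - 1) = s powr (a - 1 + (b - 1)) * ?f t"
          if "0 < s * t" "s * t < s"
        proof -
          have t: "0 < t" "t < 1" using that s by (auto simp: zero_less_mult_iff)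
          have "s - s * t = s * (1 - t)" by (simp add: algebra_simps)
          then show ?thesis using t s powr_add[of s "a - 1" "b - 1"] by (simp add: powr_mult)
        qed
        then show "ennreal (if 0 < 0 + s * t \<and> 0 + s * t < s then (0 + s * t) powr (a - 1) * (s - (0 + s * t)) powr (b - 1) else 0)
          \<le> ennreal (s powr (a - 1 + (b - 1))) * ennreal (?f t)"
          by (auto simp: ennreal_mult[symmetric])
      qed
    qed (use s in auto)
    also have "\<dots> = ennreal s * (ennreal (s powr (a - 1 + (b - 1))) * ennreal C)"
      using borel_measurable_integrable[OF int] by (subst nn_integral_cmult) (auto simp: C)
    also have "\<dots> = ennreal (C * s powr (a + b - 1))"
    proof -
      have "s * s powr (a - 1 + (b - 1)) = s powr (a + b - 1)"
        using s powr_add[of s 1 "a - 1 + (b - 1)"] by (simp add: algebra_simps)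
      then show ?thesis using s \<open>C \<ge> 0\<close> by (simp add: ennreal_mult[symmetric] mult.commute mult.assoc[symmetric])
    qed
    finally show "(\<integral>\<^sup>+ y. ennreal (if 0 < y \<and> y < s then y powr (a - 1) * (s - y) powr (b - 1) else 0) \<partial>lborel)
      \<le> ennreal (C * s powr (a + b - 1))" .
  qed
qed

text \<open>Integrating out one coordinate at a time rescales the remaining simplex, hence the scale \<open>s\<close>.\<close>

lemma dirichlet_integral_bound:
  fixes a :: "'i \<Rightarrow> real" and b :: real
  assumes "finite A" "\<And>i. i \<in> A \<Longrightarrow> a i > 0" "b > 0"
  shows "\<exists>C\<ge>0. \<forall>s>0. (\<integral>\<^sup>+ w. ennreal (if (\<forall>i\<in>A. w i > 0) \<and> (\<Sum>i\<in>A. w i) < s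
      then (\<Prod>i\<in>A. w i powr (a i - 1)) * (s - (\<Sum>i\<in>A. w i)) powr (b - 1) else 0) \<partial>Pi\<^sub>M A (\<lambda>_. lborel))
    \<le> ennreal (C * s powr ((\<Sum>i\<in>A. a i) + b - 1))"
  using assms
proof (induction A)
  case empty
  interpret product_sigma_finite "\<lambda>_::'i. lborel :: real measure" by standard
  show ?case by (intro exI[of _ 1]) (auto simp: PiM_empty nn_integral_count_space_finite)
next
  case (insert i A)
  interpret product_sigma_finite "\<lambda>_::'i. lborel :: real measure" by standard
  let ?f = "\<lambda>A s w. ennreal (if (\<forall>i\<in>A. w i > 0) \<and> (\<Sum>i\<in>A. w i) < s
      then (\<Prod>i\<in>A. w i powr (a i - 1)) * (s - (\<Sum>i\<in>A. w i)) powr (b - 1) else 0)"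
  let ?c = "(\<Sum>i\<in>A. a i) + b"
  obtain C where C: "C \<ge> 0" "\<And>s. s > 0 \<Longrightarrow> (\<integral>\<^sup>+ w. ?f A s w \<partial>Pi\<^sub>M A (\<lambda>_. lborel)) \<le> ennreal (C * s powr (?c - 1))"
    using insert by auto
  have c: "?c > 0" using insert by (intro add_nonneg_pos sum_nonneg) (auto simp: less_imp_le)
  obtain C' where C': "C' \<ge> 0" "\<And>s. s > 0 \<Longrightarrow>
    (\<integral>\<^sup>+ y. ennreal (if 0 < y \<and> y < s then y powr (a i - 1) * (s - y) powr (?c - 1) else 0) \<partial>lborel)
      \<le> ennreal (C' * s powr (a i + ?c - 1))"
    using nn_integral_Beta_scaled[of "a i" ?c] insert c by auto
  have meas: "?f B s \<in> borel_measurable (Pi\<^sub>M B (\<lambda>_. lborel))" if "finite B" for B s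
    using that by measurable
  show ?case
  proof (intro exI[of _ "C * C'"] conjI allI impI)
    fix s :: real assume s: "s > 0"
    have "(\<integral>\<^sup>+ w. ?f (insert i A) s w \<partial>Pi\<^sub>M (insert i A) (\<lambda>_. lborel))
      = (\<integral>\<^sup>+ y. \<integral>\<^sup>+ w. ?f (insert i A) s (w(i := y)) \<partial>Pi\<^sub>M A (\<lambda>_. lborel) \<partial>lborel)"
      by (rule product_nn_integral_insert_rev) (use insert meas in auto)
    also have "\<dots> \<le> (\<integral>\<^sup>+ y. ennreal C * ennreal (if 0 < y \<and> y < s then y powr (a i - 1) * (s - y) powr (?c - 1) else 0) \<partial>lborel)"
    proof (rule nn_integral_mono)
      fix y :: real
      show "(\<integral>\<^sup>+ w. ?f (insert i A) s (w(i := y)) \<partial>Pi\<^sub>M A (\<lambda>_. lborel))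
        \<le> ennreal C * ennreal (if 0 < y \<and> y < s then y powr (a i - 1) * (s - y) powr (?c - 1) else 0)"
      proof (cases "0 < y \<and> y < s")
        case True
        have "?f (insert i A) s (w(i := y)) = ennreal (y powr (a i - 1)) * ?f A (s - y) w" for w
        proof -
          have 1: "(\<Sum>j\<in>A. (w(i := y)) j) = (\<Sum>j\<in>A. w j)" "(\<Prod>j\<in>A. (w(i := y)) j powr (a j - 1)) = (\<Prod>j\<in>A. w j powr (a j - 1))"
            using insert by (auto intro!: sum.cong prod.cong)
          have 2: "(\<forall>j\<in>insert i A. (w(i := y)) j > 0) \<longleftrightarrow> (\<forall>j\<in>A. w j > 0)"
            using True insert by auto
          show ?thesis
            unfolding 2 sum.insert[OF insert.hyps] prod.insert[OF insert.hyps] 1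
            by (auto simp: ennreal_mult[symmetric] prod_nonneg algebra_simps)
        qed
        then have "(\<integral>\<^sup>+ w. ?f (insert i A) s (w(i := y)) \<partial>Pi\<^sub>M A (\<lambda>_. lborel))
          = ennreal (y powr (a i - 1)) * (\<integral>\<^sup>+ w. ?f A (s - y) w \<partial>Pi\<^sub>M A (\<lambda>_. lborel))"
          using meas[OF insert.hyps(1)] by (simp only: nn_integral_cmult)
        also have "\<dots> \<le> ennreal (y powr (a i - 1)) * ennreal (C * (s - y) powr (?c - 1))"
          using True by (intro mult_left_mono C(2)) auto
        also have "\<dots> = ennreal C * ennreal (y powr (a i - 1) * (s - y) powr (?c - 1))"
          using C(1) by (simp add: ennreal_mult[symmetric] mult_ac)
        finally show ?thesis using True by simp
      next
        case False
        then have "\<not> ((\<forall>j\<in>insert i A. (w(i := y)) j > 0) \<and> (\<Sum>j\<in>insert i A. (w(i := y)) j) < s)" for w :: "'i \<Rightarrow> real"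
        proof -
          have "(\<Sum>j\<in>insert i A. (w(i := y)) j) = y + (\<Sum>j\<in>A. (w(i := y)) j)"
            using insert.hyps by simp
          moreover have "0 \<le> (\<Sum>j\<in>A. (w(i := y)) j)" if "\<forall>j\<in>insert i A. (w(i := y)) j > 0"
            using that by (intro sum_nonneg) (auto simp: less_imp_le)
          ultimately show ?thesis using False by force
        qed
        then have "?f (insert i A) s (w(i := y)) = 0" for w
          by (simp only: if_False ennreal_0)
        then show ?thesis by simp
      qed
    qed
    also have "\<dots> = ennreal C * (\<integral>\<^sup>+ y. ennreal (if 0 < y \<and> y < s then y powr (a i - 1) * (s - y) powr (?c - 1) else 0) \<partial>lborel)"
      by (rule nn_integral_cmult) measurable
    also have "\<dots> \<le> ennreal C * ennreal (C' * s powr (a i + ?c - 1))"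
      by (intro mult_left_mono C'(2) s) auto
    also have "\<dots> = ennreal (C * C' * s powr ((\<Sum>i\<in>insert i A. a i) + b - 1))"
      using C(1) C'(1) insert.hyps by (simp add: ennreal_mult[symmetric] algebra_simps)
    finally show "(\<integral>\<^sup>+ w. ?f (insert i A) s w \<partial>Pi\<^sub>M (insert i A) (\<lambda>_. lborel))
      \<le> ennreal (C * C' * s powr ((\<Sum>i\<in>insert i A. a i) + b - 1))" .
  qed (use C C' in auto)
qed


section \<open>Bin probabilities in free coordinates\<close>

lemma sum_bin_probs: "p \<ge> 1 \<Longrightarrow> (\<Sum>i=1..p. bin_probs p w i) = 1"
proof -
  assume p: "p \<ge> 1"
  have "{1..p} = insert p {1..<p}" using p by auto
  then have "(\<Sum>i=1..p. bin_probs p w i) = bin_probs p w p + (\<Sum>i\<in>{1..<p}. bin_probs p w i)" by simp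
  also have "(\<Sum>i\<in>{1..<p}. bin_probs p w i) = (\<Sum>i\<in>{1..<p}. w i)"
    by (intro sum.cong) (auto simp: bin_probs_def)
  finally show ?thesis by (simp add: bin_probs_def)
qed

lemma bin_probs_simplex: "p \<ge> 1 \<Longrightarrow> bin_probs p w \<in> open_simplex p \<longleftrightarrow> (\<forall>i\<in>{1..p}. bin_probs p w i > 0)"
  by (simp add: open_simplex_def sum_bin_probs)

lemma bin_probs_meas [measurable]: "(\<lambda>w. bin_probs p w i) \<in> borel_measurable (Pi\<^sub>M {1..<p} (\<lambda>_. lborel))" if "i \<in> {1..p}"
proof (cases "i = p")
  case True
  then show ?thesis unfolding bin_probs_def by simp measurable
next
  case False
  then have "i \<in> {1..<p}" using that by auto
  then show ?thesis using False unfolding bin_probs_def by simp measurable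
qed

text \<open>The direction that moves mass from bin \<nu> to bin \<mu>. Tilts do not preserve
  Lebesgue measure on the simplex, but translations do, and the tilt field of bin \<mu> is the sum
  over \<nu> of \<open>w \<mu> * w \<nu>\<close> times this direction. Integration by parts is
  therefore done for each exchange, with the weight put into the integrand.\<close>

definition exchange :: "nat \<Rightarrow> nat \<Rightarrow> nat \<Rightarrow> real" where
  "exchange \<mu> \<nu> k = (if k = \<mu> then 1 else 0) - (if k = \<nu> then 1 else 0)"

lemma bin_probs_translate:
  assumes "\<mu> \<in> {1..p}" "\<nu> \<in> {1..p}" "i \<in> {1..p}"
  shows "bin_probs p (translate {1..<p} (exchange \<mu> \<nu>) t w) i = bin_probs p w i + t * exchange \<mu> \<nu> i"
proof (cases "i = p")
  case False
  then show ?thesis using assms by (simp add: bin_probs_def translate_def)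
next
  case True
  have p: "{1..p} = insert p {1..<p}" using assms by auto
  have "(\<Sum>k=1..p. exchange \<mu> \<nu> k) = (\<Sum>k=1..p. if \<mu> = k then 1 else 0) - (\<Sum>k=1..p. if \<nu> = k then 1 else 0)"
    unfolding exchange_def sum_subtractf by (intro arg_cong2[where f=minus] sum.cong) auto
  then have "(\<Sum>k=1..p. exchange \<mu> \<nu> k) = 0" using assms by simp
  then have "(\<Sum>k\<in>{1..<p}. exchange \<mu> \<nu> k) = - exchange \<mu> \<nu> p" unfolding p by simp
  moreover have "(\<Sum>k\<in>{1..<p}. translate {1..<p} (exchange \<mu> \<nu>) t w k) = (\<Sum>k\<in>{1..<p}. w k + t * exchange \<mu> \<nu> k)"
    by (intro sum.cong) (auto simp: translate_def)
  ultimately show ?thesis using True by (simp add: bin_probs_def sum.distrib sum_distrib_left[symmetric])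
qed

text \<open>Serves at and beyond the boundary of the simplex, where the integrand is continued by
  zero.\<close>

lemma DERIV_zero_of_quadratic_bound:
  fixes f :: "real \<Rightarrow> real"
  assumes "f 0 = 0" "\<And>t. \<bar>f t\<bar> \<le> B * t\<^sup>2"
  shows "(f has_real_derivative 0) (at 0)"
proof -
  have "((\<lambda>t. f t / t) \<longlongrightarrow> 0) (at 0)"
  proof (rule Lim_null_comparison)
    show "\<forall>\<^sub>F t in at 0. norm (f t / t) \<le> B * \<bar>t\<bar>"
    proof (rule eventually_at_topological[THEN iffD2], intro exI[of _ UNIV] conjI ballI impI)
      fix t :: real assume "t \<noteq> 0"
      then show "norm (f t / t) \<le> B * \<bar>t\<bar>"
        using assms(2)[of t] by (simp add: divide_simps power2_eq_square)
    qed auto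
    have "((\<lambda>t. B * \<bar>t\<bar>) \<longlongrightarrow> B * \<bar>0\<bar>) (at 0)" by (intro tendsto_intros)
    then show "((\<lambda>t::real. B * \<bar>t\<bar>) \<longlongrightarrow> 0) (at 0)" by simp
  qed
  then show ?thesis using assms(1) by (simp add: DERIV_def)
qed

text \<open>The prior density may be unbounded at the boundary when some \<open>m i\<close> is below
  1. Two observations per bin raise every exponent to at least 1, so the posterior density is
  bounded and vanishes on all faces.\<close>

locale dirichlet_setting =
  fixes J n :: nat and m X :: "nat \<Rightarrow> real" and M :: real and p :: nat
  defines "p \<equiv> 2 ^ (J + 1)"
  assumes n: "n \<ge> 1" and X: "\<And>i. i \<in> {1..n} \<Longrightarrow> X i \<in> {0..1}"
    and m: "\<And>i. i \<in> {1..p} \<Longrightarrow> 0 < m i" "\<And>i. i \<in> {1..p} \<Longrightarrow> m i \<le> M"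
    and count: "\<And>i. i \<in> {1..p} \<Longrightarrow> 2 \<le> n * bin_freq p n X i"
begin

abbreviation "L \<equiv> Pi\<^sub>M {1..<p} (\<lambda>_. lborel) :: (nat \<Rightarrow> real) measure"
abbreviation "h \<equiv> bin_freq p n X"
abbreviation "W \<equiv> bin_probs p"

definition mass :: real where "mass = (\<Sum>i=1..p. m i)"

definition \<beta> :: "nat \<Rightarrow> real" where "\<beta> i = m i + n * h i - 1"

text \<open>The tilt of bin i sends ln w_k to [k = i] - w_i, so this is the derivative of the sum of
  m_k ln w_k. The prior exponents are m_k - 1; the missing 1 is supplied by the divergence of the
  tilt field.\<close>

definition R :: "nat \<Rightarrow> (nat \<Rightarrow> real) \<Rightarrow> real" where
  "R i w = m i + (- mass) * w i"

definition R' :: "nat \<Rightarrow> (nat \<Rightarrow> real) \<Rightarrow> nat \<Rightarrow> real" where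
  "R' i w k = 0 + (- mass) * (if k = i then 1 else 0)"

definition rho :: "(nat \<Rightarrow> real) \<Rightarrow> real" where
  "rho w = (if W w \<in> open_simplex p then \<Prod>i=1..p. W w i powr \<beta> i else 0)"

lemma p1: "p \<ge> 1" by (simp add: p_def)

lemma \<beta>_ge: "i \<in> {1..p} \<Longrightarrow> 1 \<le> \<beta> i"
  using m(1)[of i] count[of i] by (simp add: \<beta>_def)

lemma mass_pos: "0 < mass" unfolding mass_def using m p1 by (intro sum_pos) auto

lemma mass_le: "mass \<le> p * M"
  unfolding mass_def using sum_bounded_above[of "{1..p}" m M] m by simp

lemma M_pos: "0 < M" using m[of 1] p1 by fastforce

lemma h_sum: "(\<Sum>i=1..p. h i) = 1" by (rule sum_bin_freq_1[OF p1 n X])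

lemma R_smooth: "i \<in> {1..p} \<Longrightarrow> smooth_fn p (R i) (R' i)"
  unfolding R_def [abs_def] R'_def [abs_def]
  by (intro smooth_fn_add smooth_fn_const smooth_fn_cmult smooth_fn_coord)

lemma R_bound:
  assumes "i \<in> {1..p}" "w \<in> open_simplex p"
  shows "\<bar>R i w\<bar> \<le> M + (p * M) * w i"
proof -
  have "0 \<le> mass * w i" "mass * w i \<le> (p * M) * w i"
    using mass_le mass_pos open_simplexD(1)[OF assms(2,1)] by (auto intro!: mult_right_mono)
  then show ?thesis using m[OF assms(1)] unfolding R_def by (simp add: abs_le_iff)
qed

text \<open>The double sum is \<open>- mass\<close> times the variance of \<open>u\<close> under the
  weights \<open>w\<close>. Bounding both parts of the variance by c^2 gives the factor 2.\<close>

lemma R'_bound: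
  fixes u w :: "nat \<Rightarrow> real"
  assumes w: "w \<in> open_simplex p" and u: "\<And>i. i \<in> {1..p} \<Longrightarrow> \<bar>u i\<bar> \<le> c"
  shows "\<bar>\<Sum>i=1..p. \<Sum>j=1..p. u i * u j * tilt_deriv p w (R' j w) i\<bar> \<le> (2 * (p * M)) * c\<^sup>2"
proof -
  have w0: "0 \<le> w i" if "i \<in> {1..p}" for i using open_simplexD(1)[OF w that] by simp
  have t: "tilt_deriv p w (R' j w) i = - mass * (w i * (if i = j then 1 else 0) - w i * w j)" if j: "j \<in> {1..p}" for i j
  proof -
    have "R' j w = (\<lambda>k. (- mass) * (if k = j then 1 else 0))" by (simp add: R'_def fun_eq_iff)
    moreover have "(\<Sum>k=1..p. w k * (if k = j then 1 else 0)) = (\<Sum>k=1..p. if j = k then w k else 0)"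
      by (intro sum.cong) auto
    ultimately show ?thesis using j by (simp only: tilt_deriv_cmult) (simp add: tilt_deriv_def right_diff_distrib)
  qed
  have e1: "(\<Sum>j=1..p. u i * u j * (w i * (if i = j then 1 else 0))) = u i * u i * w i" if "i \<in> {1..p}" for i
  proof -
    have "(\<Sum>j=1..p. u i * u j * (w i * (if i = j then 1 else 0))) = (\<Sum>j=1..p. if i = j then u i * u j * w i else 0)"
      by (intro sum.cong) auto
    then show ?thesis using that by simp
  qed
  have e2: "(\<Sum>i=1..p. \<Sum>j=1..p. u i * u j * (w i * (if i = j then 1 else 0))) = (\<Sum>i=1..p. u i * u i * w i)"
    by (rule sum.cong[OF refl e1])
  have "(\<Sum>i=1..p. \<Sum>j=1..p. u i * u j * tilt_deriv p w (R' j w) i)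
    = (\<Sum>i=1..p. \<Sum>j=1..p. - mass * (u i * u j * (w i * (if i = j then 1 else 0)) - (u i * w i) * (u j * w j)))"
    by (intro sum.cong refl) (simp only: t, simp add: algebra_simps)
  also have "\<dots> = - mass * ((\<Sum>i=1..p. u i * u i * w i) - (\<Sum>i=1..p. u i * w i) * (\<Sum>j=1..p. u j * w j))"
    unfolding sum_distrib_left[symmetric] sum_subtractf sum_distrib_right[symmetric] e2 ..
  finally have eq: "(\<Sum>i=1..p. \<Sum>j=1..p. u i * u j * tilt_deriv p w (R' j w) i)
    = - mass * ((\<Sum>i=1..p. u i * u i * w i) - (\<Sum>i=1..p. u i * w i) * (\<Sum>j=1..p. u j * w j))" .
  have c: "u i * u i \<le> c\<^sup>2" if "i \<in> {1..p}" for i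
    using power_mono[OF u[OF that] abs_ge_zero, of 2] by (simp add: power2_eq_square)
  have 1: "(\<Sum>i=1..p. u i * u i * w i) \<le> (\<Sum>i=1..p. c\<^sup>2 * w i)"
    using c w0 by (intro sum_mono mult_right_mono) auto
  have "\<bar>\<Sum>i=1..p. u i * w i\<bar> \<le> (\<Sum>i=1..p. c * w i)"
    by (rule order_trans[OF sum_abs], rule sum_mono) (use u w0 in \<open>auto simp: abs_mult intro!: mult_right_mono\<close>)
  then have "\<bar>\<Sum>i=1..p. u i * w i\<bar> \<le> c" by (simp add: sum_distrib_left[symmetric] open_simplexD(3)[OF w])
  from power_mono[OF this abs_ge_zero, of 2]
  have 2: "(\<Sum>i=1..p. u i * w i) * (\<Sum>j=1..p. u j * w j) \<le> c\<^sup>2" by (simp add: power2_eq_square)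
  have 3: "0 \<le> (\<Sum>i=1..p. u i * u i * w i)" by (intro sum_nonneg mult_nonneg_nonneg zero_le_square w0)
  have "\<bar>(\<Sum>i=1..p. u i * u i * w i) - (\<Sum>i=1..p. u i * w i) * (\<Sum>j=1..p. u j * w j)\<bar> \<le> 2 * c\<^sup>2"
    using 1[unfolded sum_distrib_left[symmetric] open_simplexD(3)[OF w]] 2 3 zero_le_square[of "\<Sum>i=1..p. u i * w i"]
    by (intro abs_leI) linarith+
  then have "mass * \<bar>(\<Sum>i=1..p. u i * u i * w i) - (\<Sum>i=1..p. u i * w i) * (\<Sum>j=1..p. u j * w j)\<bar> \<le> (p * M) * (2 * c\<^sup>2)"
    using mass_le mass_pos M_pos by (intro mult_mono) auto
  then show ?thesis unfolding eq using mass_pos by (simp add: abs_mult mult_ac)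
qed

lemma histogram_eq:
  assumes "\<nu> \<in> {1..p}" "x \<in> bin p \<nu>"
  shows "histogram p f x = real p * f \<nu>"
proof -
  have "(\<Sum>\<mu>=1..p. f \<mu> * indicator (bin p \<mu>) x) = (\<Sum>\<mu>=1..p. if \<nu> = \<mu> then f \<mu> else 0)"
    using assms bin_iff[OF assms(1), of x] by (intro sum.cong refl) (auto simp: bin_iff indicator_def)
  then show ?thesis using assms(1) by (simp add: histogram_def)
qed

lemma functional_eq:
  "sqrt n * (dirichlet_functional J m n X (histogram p (W w)) - centring J n X)
   = ((real n + 1) * real p * (\<Sum>i=1..p. (W w i)\<^sup>2) - real p
    - (\<Sum>i=1..p. real p * (W w i + h i) * R i (W w)) - real n * real p * (\<Sum>i=1..p. (h i)\<^sup>2)) / sqrt n"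
proof -
  have f2: "(LINT x:{0..1}|lborel. (histogram p (W w) x)\<^sup>2) = real p * (\<Sum>i=1..p. (W w i)\<^sup>2)"
    by (rule LINT_bins_power2[OF p1]) (rule histogram_eq)
  have m1: "(\<Sum>\<mu>=1..p. \<bar>m \<mu>\<bar>) = mass" unfolding mass_def using m(1) by (intro sum.cong) (auto simp: less_imp_le)
  have eh: "empirical_histogram J n X x = real p * h i" if "i \<in> {1..p}" "x \<in> bin p i" for i x
    using empirical_histogram_eq[where \<nu>=i and J=J and x=x, OF n X] that by (simp add: p_def)
  \<comment> \<open>On bin i the first factor times \<open>mass\<close> is
    \<open>p * R i (W w)\<close>, so the integral against the normalised parameter is the score term
    of \<open>Zfun\<close>.\<close>
  have "(LINT x:{0..1}|lborel. (histogram p (\<lambda>\<mu>. m \<mu> / mass) x - histogram p (W w) x) * (empirical_histogram J n X x + histogram p (W w) x))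
    = (\<Sum>i=1..p. (real p * (m i / mass) - real p * W w i) * (real p * h i + real p * W w i)) / p"
    by (rule LINT_bins[OF p1]) (simp add: histogram_eq eh)
  also have "\<dots> = (\<Sum>i=1..p. real p * (W w i + h i) * R i (W w)) / mass"
    unfolding sum_divide_distrib
  proof (rule sum.cong[OF refl])
    fix i
    show "(real p * (m i / mass) - real p * W w i) * (real p * h i + real p * W w i) / p = real p * (W w i + h i) * R i (W w) / mass"
      using mass_pos p1 by (simp add: R_def field_simps)
  qed
  finally have r: "mass / n * (LINT x:{0..1}|lborel. (histogram p (\<lambda>\<mu>. m \<mu> / mass) x - histogram p (W w) x) * (empirical_histogram J n X x + histogram p (W w) x))
    = (\<Sum>i=1..p. real p * (W w i + h i) * R i (W w)) / n"
    using mass_pos by simp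
  have c: "centring J n X = real p * (\<Sum>i=1..p. (h i)\<^sup>2) - real p / n"
    using centring_eq[OF n X, where J=J] by (simp add: p_def)
  have sq: "sqrt n = n / sqrt n" using n by (simp add: real_div_sqrt)
  show ?thesis unfolding dirichlet_functional_def Let_def p_def[symmetric] m1 f2 r c
    by (subst (1) sq, insert n) (simp add: field_simps)
qed

section \<open>Integration by parts across the boundary of the simplex\<close>

lemma W_le_1: "W w \<in> open_simplex p \<Longrightarrow> i \<in> {1..p} \<Longrightarrow> 0 < W w i \<and> W w i \<le> 1"
  using open_simplexD(1,2) by blast

lemma W_prod_pos: "W w \<in> open_simplex p \<Longrightarrow> 0 < (\<Prod>i=1..p. W w i powr f i)"
  using W_le_1[of w] by (intro prod_pos) fastforce

lemma rho_nonneg: "0 \<le> rho w" by (simp add: rho_def prod_nonneg)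

lemma rho_le_1: "rho w \<le> 1"
  unfolding rho_def using W_le_1[of w] \<beta>_ge
  by (auto intro!: prod_le_1 powr_le1 simp: less_imp_le order_trans[OF zero_le_one])

text \<open>Since every exponent is at least 1, one factor is at most \<open>W w i\<close> and the
  others at most 1. This linear decay at each face is one of the two orders of vanishing that make
  the zero continuation differentiable.\<close>

lemma rho_le:
  assumes "i \<in> {1..p}" "W w \<in> open_simplex p"
  shows "rho w \<le> W w i"
proof -
  have "rho w = W w i powr \<beta> i * (\<Prod>k\<in>{1..p} - {i}. W w k powr \<beta> k)"
    using assms by (simp add: rho_def prod.remove)
  also have "\<dots> \<le> W w i powr 1 * 1"
  proof (rule mult_mono)
    show "W w i powr \<beta> i \<le> W w i powr 1"
      using W_le_1[OF assms(2,1)] \<beta>_ge[OF assms(1)] by (intro powr_mono') auto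
    show "(\<Prod>k\<in>{1..p} - {i}. W w k powr \<beta> k) \<le> 1"
      using W_le_1[OF assms(2)] \<beta>_ge by (intro prod_le_1) (auto intro!: powr_le1 simp: less_imp_le order_trans[OF zero_le_one])
  qed (auto intro!: prod_nonneg)
  finally show ?thesis using W_le_1[OF assms(2,1)] by simp
qed

text \<open>The coordinates of the translated point lie in (0, 1] and each has moved by at most 1. A
  fixed box of finite volume thus carries the dominating function for all |t| <= 1.\<close>

lemma simplex_box:
  assumes "W (translate {1..<p} (exchange \<mu> \<nu>) t w) \<in> open_simplex p" "\<bar>t\<bar> \<le> 1" "w \<in> space L"
    and \<mu>: "\<mu> \<in> {1..p}" and \<nu>: "\<nu> \<in> {1..p}"
  shows "w \<in> Pi\<^sub>E {1..<p} (\<lambda>_. {-2..2})"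
proof
  show "w i = undefined" if "i \<notin> {1..<p}" for i using assms(3) that by (auto simp: space_PiM PiE_def extensional_def)
  fix i assume i: "i \<in> {1..<p}"
  have "w i = W w i" using i by (simp add: bin_probs_def)
  moreover have "0 < W w i + t * exchange \<mu> \<nu> i \<and> W w i + t * exchange \<mu> \<nu> i \<le> 1"
    using W_le_1[OF assms(1), of i] i by (simp add: bin_probs_translate[OF \<mu> \<nu>])
  moreover have "\<bar>t * exchange \<mu> \<nu> i\<bar> \<le> 1"
    using assms(2) by (auto simp: exchange_def)
  ultimately show "w i \<in> {-2..2}" by auto
qed

lemma box_sets: "Pi\<^sub>E {1..<p} (\<lambda>_. {-2..2::real}) \<in> sets L"
  by (intro sets_PiM_I_finite) auto

lemma box_finite: "emeasure L (Pi\<^sub>E {1..<p} (\<lambda>_. {-2..2::real})) < \<infinity>"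
proof -
  interpret product_sigma_finite "\<lambda>_::nat. lborel :: real measure" by standard
  have "emeasure L (Pi\<^sub>E {1..<p} (\<lambda>_. {-2..2})) = (\<Prod>i\<in>{1..<p}. ennreal 4)"
    by (subst emeasure_PiM) auto
  also have "\<dots> < \<infinity>" unfolding prod_ennreal[OF zero_le_numeral] by (rule ennreal_less_top[unfolded infinity_ennreal_def[symmetric]])
  finally show ?thesis .
qed

lemma rho_meas [measurable]: "rho \<in> borel_measurable L"
proof -
  have [measurable]: "(\<lambda>w. W w i) \<in> borel_measurable L" if "i \<in> {1..p}" for i by (rule bin_probs_meas[OF that])
  have "rho = (\<lambda>w. if \<forall>i\<in>{1..p}. 0 < W w i then \<Prod>i=1..p. W w i powr \<beta> i else 0)"
    by (auto simp: rho_def fun_eq_iff bin_probs_simplex[OF p1])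
  also have "\<dots> \<in> borel_measurable L"
    by (intro measurable_If borel_measurable_const borel_measurable_prod powr_real_measurable) measurable
  finally show ?thesis .
qed

text \<open>The derivative of \<open>W w \<mu> * W w \<nu> * G (W w) * rho w\<close> in the
  direction \<open>exchange \<mu> \<nu>\<close>, continued by zero. The summands come from the
  weight, from \<open>G\<close> and from \<open>rho\<close>; in the last one the weight cancels the
  poles of the logarithmic derivative.\<close>

definition K' :: "((nat \<Rightarrow> real) \<Rightarrow> real) \<Rightarrow> ((nat \<Rightarrow> real) \<Rightarrow> nat \<Rightarrow> real) \<Rightarrow> nat \<Rightarrow> nat \<Rightarrow> (nat \<Rightarrow> real) \<Rightarrow> real" where
  "K' G G' \<mu> \<nu> w = (if W w \<in> open_simplex p then rho w *
     ((W w \<nu> - W w \<mu>) * G (W w) + W w \<mu> * W w \<nu> * (G' (W w) \<mu> - G' (W w) \<nu>)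
      + G (W w) * (\<beta> \<mu> * W w \<nu> - \<beta> \<nu> * W w \<mu>)) else 0)"

lemma K'_deriv_inside:
  assumes G: "smooth_fn p G G'" and \<mu>: "\<mu> \<in> {1..p}" and \<nu>: "\<nu> \<in> {1..p}" "\<mu> \<noteq> \<nu>"
    and w: "w \<in> space L" "W w \<in> open_simplex p"
  shows "((\<lambda>t. let w' = translate {1..<p} (exchange \<mu> \<nu>) t w in W w' \<mu> * W w' \<nu> * G (W w') * rho w')
    has_real_derivative K' G G' \<mu> \<nu> w) (at 0)"
proof -
  let ?T = "\<lambda>t. translate {1..<p} (exchange \<mu> \<nu>) t w"
  let ?c = "exchange \<mu> \<nu>"
  have T0: "?T 0 = w" by (rule translate_0[OF w(1)])
  have Wd: "((\<lambda>t. W (?T t) i) has_real_derivative ?c i) (at 0)" if "i \<in> {1..p}" for i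
    unfolding bin_probs_translate[OF \<mu> \<nu>(1) that] by (auto intro!: derivative_eq_intros)
  have pos: "0 < W w i" if "i \<in> {1..p}" for i using W_le_1[OF w(2) that] by simp
  have ev: "\<forall>\<^sub>F t in nhds 0. W (?T t) \<in> open_simplex p"
    unfolding bin_probs_simplex[OF p1]
  proof (rule eventually_ball_finite[OF finite_atLeastAtMost], rule ballI)
    fix i assume i: "i \<in> {1..p}"
    have "((\<lambda>t. W w i + t * ?c i) \<longlongrightarrow> W w i + 0 * ?c i) (nhds 0)"
      by (intro tendsto_intros filterlim_ident)
    then have "((\<lambda>t. W (?T t) i) \<longlongrightarrow> W w i) (nhds 0)"
      unfolding bin_probs_translate[OF \<mu> \<nu>(1) i] by simp
    then show "\<forall>\<^sub>F t in nhds 0. 0 < W (?T t) i" using pos[OF i] by (rule order_tendstoD)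
  qed
  \<comment> \<open>For small t the point stays inside the simplex, and \<open>rho\<close> may be
    replaced by an exponential of logarithms, which differentiates without a case
    distinction.\<close>
  let ?F = "\<lambda>t. W (?T t) \<mu> * W (?T t) \<nu> * G (W (?T t)) * exp (\<Sum>i=1..p. \<beta> i * ln (W (?T t) i))"
  have rho_exp: "rho w' = exp (\<Sum>i=1..p. \<beta> i * ln (W w' i))" if "W w' \<in> open_simplex p" for w'
  proof -
    have "W w' i powr \<beta> i = exp (\<beta> i * ln (W w' i))" if "i \<in> {1..p}" for i
      using W_le_1[OF \<open>W w' \<in> open_simplex p\<close> that] by (simp add: powr_def)
    then show ?thesis using that by (simp add: rho_def exp_sum)
  qed
  have Gd: "((\<lambda>t. G (W (?T t))) has_real_derivative (\<Sum>i=1..p. G' (W (?T 0)) i * ?c i)) (at 0)"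
    by (rule has_gradientD) (use G w Wd T0 in \<open>auto simp: smooth_fn_def\<close>)
  have csum: "(\<Sum>i=1..p. f i * ?c i) = f \<mu> - f \<nu>" for f :: "nat \<Rightarrow> real"
  proof -
    have "(\<Sum>i=1..p. f i * ?c i) = (\<Sum>i=1..p. if \<mu> = i then f i else 0) - (\<Sum>i=1..p. if \<nu> = i then f i else 0)"
      unfolding sum_subtractf[symmetric] by (intro sum.cong) (auto simp: exchange_def)
    then show ?thesis using \<mu> \<nu> by simp
  qed
  have Ed: "((\<lambda>t. exp (\<Sum>i=1..p. \<beta> i * ln (W (?T t) i))) has_real_derivative
     exp (\<Sum>i=1..p. \<beta> i * ln (W (?T 0) i)) * (\<Sum>i=1..p. \<beta> i * (1 / W (?T 0) i * ?c i))) (at 0)"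
    by (intro DERIV_chain2[where f=exp, OF DERIV_exp] DERIV_sum DERIV_cmult DERIV_chain2[where f=ln] DERIV_ln_divide Wd)
       (simp_all add: T0 pos)
  have s: "(\<Sum>i=1..p. \<beta> i * (1 / W (?T 0) i * ?c i)) = \<beta> \<mu> / W w \<mu> - \<beta> \<nu> / W w \<nu>"
    using csum[of "\<lambda>i. \<beta> i / W w i"] unfolding T0 by simp
  have "(?F has_real_derivative
     ((?c \<mu> * W (?T 0) \<nu> + ?c \<nu> * W (?T 0) \<mu>) * G (W (?T 0)) + (\<Sum>i=1..p. G' (W (?T 0)) i * ?c i) * (W (?T 0) \<mu> * W (?T 0) \<nu>))
        * exp (\<Sum>i=1..p. \<beta> i * ln (W (?T 0) i))
     + exp (\<Sum>i=1..p. \<beta> i * ln (W (?T 0) i)) * (\<Sum>i=1..p. \<beta> i * (1 / W (?T 0) i * ?c i)) * (W (?T 0) \<mu> * W (?T 0) \<nu> * G (W (?T 0)))) (at 0)"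
    by (intro DERIV_mult Wd Gd Ed \<mu> \<nu>)
  then have "(?F has_real_derivative K' G G' \<mu> \<nu> w) (at 0)"
  proof (rule DERIV_cong)
    have "e * (b / x - b' / y) * (x * y * g) = e * (g * (b * y - b' * x))" if "x > 0" "y > 0" for b b' x y g e :: real
      using that by (simp add: field_simps)
    note f = this[OF pos[OF \<mu>] pos[OF \<nu>(1)]]
    show "((?c \<mu> * W (?T 0) \<nu> + ?c \<nu> * W (?T 0) \<mu>) * G (W (?T 0)) + (\<Sum>i=1..p. G' (W (?T 0)) i * ?c i) * (W (?T 0) \<mu> * W (?T 0) \<nu>))
        * exp (\<Sum>i=1..p. \<beta> i * ln (W (?T 0) i))
     + exp (\<Sum>i=1..p. \<beta> i * ln (W (?T 0) i)) * (\<Sum>i=1..p. \<beta> i * (1 / W (?T 0) i * ?c i)) * (W (?T 0) \<mu> * W (?T 0) \<nu> * G (W (?T 0)))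
     = K' G G' \<mu> \<nu> w"
      unfolding s unfolding T0 csum rho_exp[OF w(2), symmetric] f
      using w(2) \<nu>(2) by (simp add: K'_def exchange_def algebra_simps)
  qed
  then show ?thesis
  proof (rule DERIV_cong_ev[OF refl _ refl, THEN iffD1, rotated])
    show "\<forall>\<^sub>F t in nhds 0. ?F t = (let w' = ?T t in W w' \<mu> * W w' \<nu> * G (W w') * rho w')"
      using ev by eventually_elim (simp add: rho_exp Let_def)
  qed
qed

text \<open>If a translation by t brings the point inside, a coordinate that was nonpositive has
  become positive. It must be one of the two exchanged ones and is at most |t|. The weight and
  \<open>rho\<close> each contain it as a factor, so the integrand is of order t^2, and crossing the
  boundary leaves no boundary term.\<close>

lemma K'_deriv_outside:
  assumes G: "smooth_fn p G G'" and \<mu>: "\<mu> \<in> {1..p}" and \<nu>: "\<nu> \<in> {1..p}"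
    and w: "w \<in> space L" "W w \<notin> open_simplex p"
  shows "((\<lambda>t. let w' = translate {1..<p} (exchange \<mu> \<nu>) t w in W w' \<mu> * W w' \<nu> * G (W w') * rho w')
    has_real_derivative K' G G' \<mu> \<nu> w) (at 0)"
proof -
  let ?T = "\<lambda>t. translate {1..<p} (exchange \<mu> \<nu>) t w"
  obtain B where B: "B \<ge> 0" "\<And>w. w \<in> open_simplex p \<Longrightarrow> \<bar>G w\<bar> \<le> B"
    "\<And>w i. w \<in> open_simplex p \<Longrightarrow> i \<in> {1..p} \<Longrightarrow> \<bar>w i * G' w i\<bar> \<le> B" "has_gradient p G G'"
    using smooth_fnE[OF G] by blast
  obtain k where k: "k \<in> {1..p}" "W w k \<le> 0" using w(2) unfolding bin_probs_simplex[OF p1] by (auto simp: not_less)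
  have "((\<lambda>t. let w' = ?T t in W w' \<mu> * W w' \<nu> * G (W w') * rho w') has_real_derivative 0) (at 0)"
  proof (rule DERIV_zero_of_quadratic_bound[where B=B])
    show "(let w' = ?T 0 in W w' \<mu> * W w' \<nu> * G (W w') * rho w') = 0"
      using w(2) unfolding translate_0[OF w(1)] by (simp add: rho_def)
    fix t :: real
    show "\<bar>let w' = ?T t in W w' \<mu> * W w' \<nu> * G (W w') * rho w'\<bar> \<le> B * t\<^sup>2"
    proof (cases "W (?T t) \<in> open_simplex p")
      case False
      then show ?thesis using B(1) by (simp add: rho_def Let_def)
    next
      case True
      note le = W_le_1[OF True]
      have Wk: "W (?T t) k = W w k + t * exchange \<mu> \<nu> k" by (rule bin_probs_translate[OF \<mu> \<nu> k(1)])
      then have "exchange \<mu> \<nu> k \<noteq> 0" using le[OF k(1)] k(2) by auto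
      then have k': "k = \<mu> \<or> k = \<nu>" by (auto simp: exchange_def split: if_splits)
      have "t * exchange \<mu> \<nu> k \<le> \<bar>t\<bar>" by (auto simp: exchange_def)
      then have Wt: "W (?T t) k \<le> \<bar>t\<bar>" using Wk k(2) by linarith
      have "W (?T t) \<mu> * W (?T t) \<nu> \<le> W (?T t) k"
        using k' le[OF \<mu>] le[OF \<nu>] by (auto simp: mult_left_le mult_left_le_one_le)
      then have 1: "W (?T t) \<mu> * W (?T t) \<nu> \<le> \<bar>t\<bar>" using Wt by linarith
      have 2: "rho (?T t) \<le> \<bar>t\<bar>" using rho_le[OF k(1) True] Wt by linarith
      have "\<bar>W (?T t) \<mu> * W (?T t) \<nu>\<bar> * \<bar>G (W (?T t))\<bar> * \<bar>rho (?T t)\<bar> \<le> \<bar>t\<bar> * B * \<bar>t\<bar>"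
        using 1 2 B le[OF \<mu>] le[OF \<nu>] rho_nonneg[of "?T t"] True by (intro mult_mono) auto
      also have "\<dots> = B * t\<^sup>2" by (simp add: power2_eq_square)
      finally show ?thesis by (simp add: Let_def abs_mult)
    qed
  qed
  then show ?thesis using w(2) by (simp add: K'_def)
qed

lemma K'_integral:
  assumes G: "smooth_fn p G G'" and Gm: "(\<lambda>w. G (W w)) \<in> borel_measurable L"
    and \<mu>: "\<mu> \<in> {1..p}" and \<nu>: "\<nu> \<in> {1..p}" "\<mu> \<noteq> \<nu>"
  shows "has_bochner_integral L (K' G G' \<mu> \<nu>) 0"
proof -
  let ?box = "Pi\<^sub>E {1..<p} (\<lambda>_. {-2..2::real})"
  obtain B where B: "B \<ge> 0" "\<And>w. w \<in> open_simplex p \<Longrightarrow> \<bar>G w\<bar> \<le> B"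
    "\<And>w i. w \<in> open_simplex p \<Longrightarrow> i \<in> {1..p} \<Longrightarrow> \<bar>w i * G' w i\<bar> \<le> B" "has_gradient p G G'"
    using smooth_fnE[OF G] by blast
  define C where "C = 3 * B + B * (\<beta> \<mu> + \<beta> \<nu>)"
  have \<beta>0: "0 \<le> \<beta> \<mu>" "0 \<le> \<beta> \<nu>" using \<beta>_ge[OF \<mu>] \<beta>_ge[OF \<nu>(1)] by auto
  then have C: "C \<ge> 0" using B(1) by (simp add: C_def)
  have K'C: "\<bar>K' G G' \<mu> \<nu> w\<bar> \<le> C" if w: "W w \<in> open_simplex p" for w
  proof -
    note le = W_le_1[OF w \<mu>] W_le_1[OF w \<nu>(1)] and G = B(2)[OF w]
    have "\<bar>W w \<nu> - W w \<mu>\<bar> \<le> 1" using le by linarith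
    then have 1: "\<bar>(W w \<nu> - W w \<mu>) * G (W w)\<bar> \<le> 1 * B"
      unfolding abs_mult using G by (intro mult_mono) auto
    have 2: "\<bar>W w \<nu> * (W w \<mu> * G' (W w) \<mu>)\<bar> \<le> 1 * B" "\<bar>W w \<mu> * (W w \<nu> * G' (W w) \<nu>)\<bar> \<le> 1 * B"
      unfolding abs_mult[of "W w \<nu>"] abs_mult[of "W w \<mu>"]
      using le B(3)[OF w \<mu>] B(3)[OF w \<nu>(1)] by (intro mult_mono; simp add: abs_mult)+
    have "\<beta> \<mu> * W w \<nu> \<le> \<beta> \<mu>" "\<beta> \<nu> * W w \<mu> \<le> \<beta> \<nu>" "0 \<le> \<beta> \<mu> * W w \<nu>" "0 \<le> \<beta> \<nu> * W w \<mu>"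
      using le \<beta>0 by (auto intro!: mult_left_le)
    then have "\<bar>\<beta> \<mu> * W w \<nu> - \<beta> \<nu> * W w \<mu>\<bar> \<le> \<beta> \<mu> + \<beta> \<nu>" by linarith
    then have 3: "\<bar>G (W w) * (\<beta> \<mu> * W w \<nu> - \<beta> \<nu> * W w \<mu>)\<bar> \<le> B * (\<beta> \<mu> + \<beta> \<nu>)"
      unfolding abs_mult using G B(1) by (intro mult_mono) auto
    have e: "W w \<mu> * W w \<nu> * (G' (W w) \<mu> - G' (W w) \<nu>) = W w \<nu> * (W w \<mu> * G' (W w) \<mu>) - W w \<mu> * (W w \<nu> * G' (W w) \<nu>)"
      by (simp add: algebra_simps)
    have "\<bar>(W w \<nu> - W w \<mu>) * G (W w) + W w \<mu> * W w \<nu> * (G' (W w) \<mu> - G' (W w) \<nu>)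
      + G (W w) * (\<beta> \<mu> * W w \<nu> - \<beta> \<nu> * W w \<mu>)\<bar> \<le> C"
      unfolding e using 1 2 3 unfolding C_def by linarith
    then have "\<bar>rho w\<bar> * \<bar>(W w \<nu> - W w \<mu>) * G (W w) + W w \<mu> * W w \<nu> * (G' (W w) \<mu> - G' (W w) \<nu>)
      + G (W w) * (\<beta> \<mu> * W w \<nu> - \<beta> \<nu> * W w \<mu>)\<bar> \<le> 1 * C"
      using rho_le_1[of w] rho_nonneg[of w] by (intro mult_mono) auto
    then show ?thesis using w by (simp add: K'_def abs_mult)
  qed
  have in_box: "w \<in> ?box" if "w \<in> space L" "W w \<in> open_simplex p" for w
    using simplex_box[of \<mu> \<nu> 0 w] that \<mu> \<nu>(1) by (simp add: translate_0)
  have ind: "integrable L (\<lambda>w. c * indicator ?box w)" for c :: real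
    using box_sets box_finite by (intro integrable_mult_right integrable_real_indicator) auto
  show ?thesis
  proof (rule translate_ibp[where K="\<lambda>w. W w \<mu> * W w \<nu> * G (W w) * rho w" and c="exchange \<mu> \<nu>" and D="\<lambda>w. C * indicator ?box w"])
    show "finite {1..<p}" by simp
    show "integrable L (\<lambda>w. W w \<mu> * W w \<nu> * G (W w) * rho w)"
    proof (rule Bochner_Integration.integrable_bound[OF ind[of B]])
      show "(\<lambda>w. W w \<mu> * W w \<nu> * G (W w) * rho w) \<in> borel_measurable L"
        using Gm bin_probs_meas[OF \<mu>] bin_probs_meas[OF \<nu>(1)] by measurable
      show "AE w in L. norm (W w \<mu> * W w \<nu> * G (W w) * rho w) \<le> norm (B * indicator ?box w)"
      proof (rule AE_I2)
        fix w assume w: "w \<in> space L"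
        show "norm (W w \<mu> * W w \<nu> * G (W w) * rho w) \<le> norm (B * indicator ?box w)"
        proof (cases "W w \<in> open_simplex p")
          case True
          have "\<bar>W w \<mu>\<bar> * \<bar>W w \<nu>\<bar> * \<bar>G (W w)\<bar> * \<bar>rho w\<bar> \<le> 1 * 1 * B * 1"
            using W_le_1[OF True \<mu>] W_le_1[OF True \<nu>(1)] B(2)[OF True] B(1) rho_le_1[of w] rho_nonneg[of w]
            by (intro mult_mono) auto
          then show ?thesis using in_box[OF w True] B(1) by (simp add: abs_mult)
        qed (simp add: rho_def)
      qed
    qed
    show "integrable L (\<lambda>w. C * indicator ?box w)" by (rule ind)
  next
    fix w assume w: "w \<in> space L"
    show "((\<lambda>t. W (translate {1..<p} (exchange \<mu> \<nu>) t w) \<mu> * W (translate {1..<p} (exchange \<mu> \<nu>) t w) \<nu>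
        * G (W (translate {1..<p} (exchange \<mu> \<nu>) t w)) * rho (translate {1..<p} (exchange \<mu> \<nu>) t w))
        has_real_derivative K' G G' \<mu> \<nu> w) (at 0)"
      using K'_deriv_inside[OF G \<mu> \<nu> w] K'_deriv_outside[OF G \<mu> \<nu>(1) w] unfolding Let_def by blast
    fix t :: real assume t: "\<bar>t\<bar> \<le> 1"
    show "\<bar>K' G G' \<mu> \<nu> (translate {1..<p} (exchange \<mu> \<nu>) t w)\<bar> \<le> C * indicator ?box w"
    proof (cases "W (translate {1..<p} (exchange \<mu> \<nu>) t w) \<in> open_simplex p")
      case True
      then show ?thesis using K'C[OF True] simplex_box[OF True t w \<mu> \<nu>(1)] by simp
    next
      case False
      then show ?thesis using C by (simp add: K'_def)
    qed
  qed
qed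

text \<open>Summing over \<nu> reassembles the tilt from the exchanges. The coefficients
  \<open>1 + \<beta> \<nu>\<close> add up to n + \<open>mass\<close>, which turns the terms from the
  weight and from \<open>rho\<close> into the likelihood and prior scores.\<close>

lemma sum_K':
  assumes \<mu>: "\<mu> \<in> {1..p}" and w: "W w \<in> open_simplex p"
  shows "(\<Sum>\<nu>\<in>{1..p} - {\<mu>}. K' G G' \<mu> \<nu> w)
    = rho w * (tilt_deriv p (W w) (G' (W w)) \<mu> + G (W w) * (n * h \<mu> - n * W w \<mu> + R \<mu> (W w)))"
proof -
  let ?k = "\<lambda>\<nu>. W w \<mu> * G' (W w) \<mu> * W w \<nu> - W w \<mu> * (W w \<nu> * G' (W w) \<nu>)
      + G (W w) * ((1 + \<beta> \<mu>) * W w \<nu> - (1 + \<beta> \<nu>) * W w \<mu>)"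
  have s1: "(\<Sum>\<nu>=1..p. W w \<nu>) = 1" using open_simplexD(3)[OF w] .
  have s2: "(\<Sum>\<nu>=1..p. 1 + \<beta> \<nu>) = n + mass"
    using h_sum by (simp add: \<beta>_def mass_def sum.distrib sum_distrib_left[symmetric])
  have "(\<Sum>\<nu>\<in>{1..p} - {\<mu>}. K' G G' \<mu> \<nu> w) = (\<Sum>\<nu>\<in>{1..p} - {\<mu>}. rho w * ?k \<nu>)"
    using w by (intro sum.cong refl) (simp add: K'_def algebra_simps)
  \<comment> \<open>The added summand \<nu> = \<mu> is zero, since exchanging a bin with itself does
    nothing.\<close>
  also have "\<dots> = (\<Sum>\<nu>=1..p. rho w * ?k \<nu>)"
    using \<mu> by (intro sum.mono_neutral_left) auto
  also have "\<dots> = rho w * (\<Sum>\<nu>=1..p. ?k \<nu>)" by (rule sum_distrib_left[symmetric])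
  also have "(\<Sum>\<nu>=1..p. ?k \<nu>) = W w \<mu> * G' (W w) \<mu> * (\<Sum>\<nu>=1..p. W w \<nu>) - W w \<mu> * (\<Sum>\<nu>=1..p. W w \<nu> * G' (W w) \<nu>)
      + G (W w) * ((1 + \<beta> \<mu>) * (\<Sum>\<nu>=1..p. W w \<nu>) - (\<Sum>\<nu>=1..p. 1 + \<beta> \<nu>) * W w \<mu>)"
    by (simp only: sum.distrib sum_subtractf sum_distrib_left[symmetric] sum_distrib_right[symmetric])
  also have "\<dots> = tilt_deriv p (W w) (G' (W w)) \<mu> + G (W w) * (n * h \<mu> - n * W w \<mu> + R \<mu> (W w))"
    unfolding s1 s2 by (simp add: tilt_deriv_def \<beta>_def R_def algebra_simps)
  finally show ?thesis .
qed

section \<open>The Dirichlet posterior as a density\<close>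

abbreviation "post \<equiv> posterior (dirichlet_prior p m) (\<lambda>w. histogram p (W w)) n X"

lemma bin_index_X: "i \<in> {1..n} \<Longrightarrow> bin_index p (X i) \<in> {1..p}"
  by (rule bin_index_range[OF p1 X])

lemma prod_counts:
  assumes w: "W w \<in> open_simplex p"
  shows "(\<Prod>i=1..n. real p * W w (bin_index p (X i))) = real p ^ n * (\<Prod>\<mu>=1..p. W w \<mu> powr (n * h \<mu>))"
proof -
  have "(\<Prod>i=1..n. real p * W w (bin_index p (X i))) = real p ^ n * (\<Prod>i=1..n. W w (bin_index p (X i)))"
    by (simp add: prod.distrib)
  also have "(\<Prod>i=1..n. W w (bin_index p (X i))) = (\<Prod>i=1..n. exp (ln (W w (bin_index p (X i)))))"
    using W_le_1[OF w bin_index_X] by (intro prod.cong) auto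
  also have "\<dots> = exp (\<Sum>i=1..n. ln (W w (bin_index p (X i))))" by (simp add: exp_sum)
  also have "(\<Sum>i=1..n. ln (W w (bin_index p (X i)))) = (\<Sum>\<mu>=1..p. n * h \<mu> * ln (W w \<mu>))"
  proof -
    have "(\<Sum>\<mu>=1..p. n * h \<mu> * ln (W w \<mu>)) = n * (\<Sum>\<mu>=1..p. h \<mu> * ln (W w \<mu>))"
      by (simp add: sum_distrib_left mult.assoc)
    also have "\<dots> = (\<Sum>i=1..n. ln (W w (bin_index p (X i))))"
      using n by (subst sum_bin_freq[OF p1 X]) auto
    finally show ?thesis ..
  qed
  also have "exp \<dots> = (\<Prod>\<mu>=1..p. W w \<mu> powr (n * h \<mu>))"
  proof -
    have "W w \<mu> powr (n * h \<mu>) = exp (n * h \<mu> * ln (W w \<mu>))" if "\<mu> \<in> {1..p}" for \<mu>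
      using W_le_1[OF w that] by (simp add: powr_def)
    then show ?thesis by (simp add: exp_sum)
  qed
  finally show ?thesis .
qed

lemma weight_meas [measurable]: "dirichlet_weight p m \<in> borel_measurable L"
  unfolding dirichlet_weight_def [abs_def]
proof (intro measurable_If borel_measurable_const borel_measurable_prod powr_real_measurable)
  have [measurable]: "(\<lambda>w. W w i) \<in> borel_measurable L" if "i \<in> {1..p}" for i by (rule bin_probs_meas[OF that])
  show "{x \<in> space L. \<forall>\<mu>\<in>{1..p}. 0 < W x \<mu>} \<in> sets L" by measurable
qed (rule bin_probs_meas)

lemma weight_pos_emeasure:
  assumes f: "f \<in> borel_measurable L" and pos: "\<And>w. W w \<in> open_simplex p \<Longrightarrow> 0 < f w"
  shows "0 < (\<integral>\<^sup>+w. ennreal (f w) \<partial>L)"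
proof (rule ccontr)
  interpret product_sigma_finite "\<lambda>_::nat. lborel :: real measure" by standard
  \<comment> \<open>In this box the free coordinates sum to at most (p - 1) / p, so the last bin
    probability is positive as well, and the simplex contains a set of positive volume.\<close>
  let ?A = "Pi\<^sub>E {1..<p} (\<lambda>_. {0<..<1 / real p})"
  assume "\<not> 0 < (\<integral>\<^sup>+w. ennreal (f w) \<partial>L)"
  then have "(\<integral>\<^sup>+w. ennreal (f w) \<partial>L) = 0" by (simp add: not_less)
  then have "AE w in L. ennreal (f w) = 0" using f by (subst (asm) nn_integral_0_iff_AE) auto
  then have "AE w in L. w \<notin> ?A"
  proof eventually_elim
    case (elim w)
    have "f w > 0" if "w \<in> ?A"
    proof (rule pos)
      have 1: "0 < w i" "w i < 1 / p" if "i \<in> {1..<p}" for i using \<open>w \<in> ?A\<close> that by (auto simp: PiE_iff)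
      have "(\<Sum>i\<in>{1..<p}. w i) \<le> (\<Sum>i\<in>{1..<p}. 1 / real p)" using 1(2) by (intro sum_mono) (auto simp: less_imp_le)
      also have "\<dots> < 1" using p1 by (simp add: of_nat_diff field_simps)
      finally have "0 < W w i" if "i \<in> {1..p}" for i using 1(1) that by (auto simp: bin_probs_def)
      then show "W w \<in> open_simplex p" by (simp add: bin_probs_simplex[OF p1])
    qed
    then show ?case using elim by (auto simp: ennreal_eq_0_iff)
  qed
  moreover have A: "?A \<in> sets L" by (intro sets_PiM_I_finite) auto
  ultimately have "emeasure L ?A = 0"
    by (subst (asm) AE_iff_measurable[of ?A]) (use sets.sets_into_space[OF A] in auto)
  moreover have "emeasure L ?A = (\<Prod>i\<in>{1..<p}. ennreal (1 / real p))"
    by (subst emeasure_PiM) auto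
  ultimately show False using p1 by (auto simp: prod_zero_iff ennreal_eq_0_iff)
qed

lemma posterior_density:
  obtains E where "E > 0" "post = density L (\<lambda>w. ennreal (rho w / E))" "prob_space post"
proof -
  have "m p > 0" using m p1 by auto
  define z where "z = (\<integral>\<^sup>+ w. ennreal (dirichlet_weight p m w) \<partial>L)"
  let ?I = "\<lambda>s. (\<integral>\<^sup>+ w. ennreal (if (\<forall>i\<in>{1..<p}. w i > 0) \<and> (\<Sum>i\<in>{1..<p}. w i) < s
      then (\<Prod>i\<in>{1..<p}. w i powr (m i - 1)) * (s - (\<Sum>i\<in>{1..<p}. w i)) powr (m p - 1) else 0) \<partial>L)"
  have "\<exists>C\<ge>0. \<forall>s>0. ?I s \<le> ennreal (C * s powr ((\<Sum>i\<in>{1..<p}. m i) + m p - 1))"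
    by (rule dirichlet_integral_bound) (use m(1) \<open>m p > 0\<close> in auto)
  then obtain C where C: "\<forall>s>0. ?I s \<le> ennreal (C * s powr ((\<Sum>i\<in>{1..<p}. m i) + m p - 1))"
    by blast
  from C[rule_format, OF zero_less_one] have "?I 1 \<le> ennreal C" by (simp only: powr_one_eq_one mult_1_right)
  also have "(\<lambda>w. if (\<forall>i\<in>{1..<p}. w i > 0) \<and> (\<Sum>i\<in>{1..<p}. w i) < 1
      then (\<Prod>i\<in>{1..<p}. w i powr (m i - 1)) * (1 - (\<Sum>i\<in>{1..<p}. w i)) powr (m p - 1) else 0) = dirichlet_weight p m"
  proof
    fix w :: "nat \<Rightarrow> real"
    have p: "{1..p} = insert p {1..<p}" using p1 by auto
    have "(\<forall>\<mu>\<in>{1..p}. W w \<mu> > 0) \<longleftrightarrow> (\<forall>i\<in>{1..<p}. w i > 0) \<and> (\<Sum>i\<in>{1..<p}. w i) < 1"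
      unfolding p by (auto simp: bin_probs_def)
    moreover have "(\<Prod>\<mu>=1..p. W w \<mu> powr (m \<mu> - 1)) = (\<Prod>i\<in>{1..<p}. w i powr (m i - 1)) * (1 - (\<Sum>i\<in>{1..<p}. w i)) powr (m p - 1)"
      unfolding p by (simp add: bin_probs_def mult.commute)
    ultimately show "(if (\<forall>i\<in>{1..<p}. w i > 0) \<and> (\<Sum>i\<in>{1..<p}. w i) < 1
      then (\<Prod>i\<in>{1..<p}. w i powr (m i - 1)) * (1 - (\<Sum>i\<in>{1..<p}. w i)) powr (m p - 1) else 0) = dirichlet_weight p m w"
      by (simp add: dirichlet_weight_def)
  qed
  finally have "z \<le> ennreal C" unfolding z_def .
  then have zfin: "z < \<infinity>" by (metis ennreal_less_top infinity_ennreal_def order_le_less_trans)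
  have wpos: "0 < dirichlet_weight p m w" if "W w \<in> open_simplex p" for w
    using W_prod_pos[OF that] that by (simp add: dirichlet_weight_def bin_probs_simplex[OF p1])
  have w0: "dirichlet_weight p m w = 0" if "W w \<notin> open_simplex p" for w
    using that unfolding dirichlet_weight_def bin_probs_simplex[OF p1] by (rule if_not_P)
  have wnn: "0 \<le> dirichlet_weight p m w" for w using wpos[of w] w0[of w] by (cases "W w \<in> open_simplex p") auto
  have zpos: "0 < z" unfolding z_def by (rule weight_pos_emeasure[OF weight_meas wpos])
  obtain z' where z': "z = ennreal z'" "z' \<ge> 0" using zfin by (cases z) auto
  have z'0: "z' > 0" using zpos z' by (cases "z' = 0") auto
  let ?\<pi> = "\<lambda>w. dirichlet_weight p m w / z'"
  \<comment> \<open>Off the simplex the product may be negative, and \<open>ennreal\<close> sends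
    negative numbers to 0; the maximum gives a nonnegative likelihood everywhere.\<close>
  let ?l = "\<lambda>w. max 0 (\<Prod>i=1..n. real p * W w (bin_index p (X i)))"
  have prior: "dirichlet_prior p m = density L (\<lambda>w. ennreal (?\<pi> w))"
    unfolding dirichlet_prior_def Let_def z_def[symmetric] z'(1)
    using z'0 wnn by (intro arg_cong[where f="density L"] ext) (simp add: divide_ennreal)
  have \<pi>m: "?\<pi> \<in> borel_measurable L" by measurable
  have lm: "?l \<in> borel_measurable L"
    by (intro borel_measurable_max borel_measurable_const borel_measurable_prod borel_measurable_times bin_probs_meas bin_index_X)
  have lik: "likelihood (\<lambda>w. histogram p (W w)) n X w = ennreal (?l w)" for w
  proof -
    have "(\<Prod>i=1..n. histogram p (W w) (X i)) = (\<Prod>i=1..n. real p * W w (bin_index p (X i)))"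
      by (intro prod.cong refl histogram_eq bin_index_X bin_index_in_bin[OF p1] X)
    then show ?thesis unfolding likelihood_def by (simp add: max_def ennreal_neg)
  qed
  define c where "c = real p ^ n / z'"
  have c: "c > 0" using z'0 p1 by (simp add: c_def)
  have \<pi>l: "?\<pi> w * ?l w = c * rho w" for w
  proof (cases "W w \<in> open_simplex p")
    case True
    have "dirichlet_weight p m w * (\<Prod>\<mu>=1..p. W w \<mu> powr (n * h \<mu>)) = rho w"
    proof -
      have "dirichlet_weight p m w * (\<Prod>\<mu>=1..p. W w \<mu> powr (n * h \<mu>)) = (\<Prod>\<mu>=1..p. W w \<mu> powr (m \<mu> - 1) * W w \<mu> powr (n * h \<mu>))"
        using True by (simp add: dirichlet_weight_def bin_probs_simplex[OF p1] prod.distrib)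
      also have "\<dots> = (\<Prod>\<mu>=1..p. W w \<mu> powr \<beta> \<mu>)"
        unfolding powr_add[symmetric] by (intro prod.cong refl arg_cong2[where f="(powr)"]) (simp add: \<beta>_def)
      finally show ?thesis using True by (simp add: rho_def)
    qed
    moreover have "?l w = real p ^ n * (\<Prod>\<mu>=1..p. W w \<mu> powr (n * h \<mu>))"
      unfolding prod_counts[OF True] by (simp add: prod_nonneg)
    ultimately show ?thesis by (simp add: c_def)
  qed (simp add: w0 rho_def)
  have likm: "likelihood (\<lambda>w. histogram p (W w)) n X \<in> borel_measurable L"
    unfolding lik using lm by measurable
  have ev: "evidence (dirichlet_prior p m) (\<lambda>w. histogram p (W w)) n X = (\<integral>\<^sup>+w. ennreal (c * rho w) \<partial>L)"
    unfolding evidence_def prior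
  proof (subst nn_integral_density[OF _ likm])
    have "ennreal (?\<pi> w) * ennreal (?l w) = ennreal (c * rho w)" for w
      unfolding \<pi>l[symmetric] by (rule ennreal_mult[symmetric]) (use wnn z'0 in auto)
    then show "(\<integral>\<^sup>+w. ennreal (?\<pi> w) * likelihood (\<lambda>w. histogram p (W w)) n X w \<partial>L) = (\<integral>\<^sup>+w. ennreal (c * rho w) \<partial>L)"
      unfolding lik by simp
  qed measurable
  have pos: "0 < evidence (dirichlet_prior p m) (\<lambda>w. histogram p (W w)) n X"
    unfolding ev
  proof (rule weight_pos_emeasure)
    show "0 < c * rho w" if "W w \<in> open_simplex p" for w
      using that c W_prod_pos[OF that] by (simp add: rho_def)
  qed measurable
  have fin: "evidence (dirichlet_prior p m) (\<lambda>w. histogram p (W w)) n X < \<infinity>"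
  proof -
    let ?box = "Pi\<^sub>E {1..<p} (\<lambda>_. {-2..2::real})"
    have "(\<integral>\<^sup>+w. ennreal (c * rho w) \<partial>L) \<le> (\<integral>\<^sup>+w. ennreal c * indicator ?box w \<partial>L)"
    proof (rule nn_integral_mono)
      fix w assume w: "w \<in> space L"
      have "w \<in> ?box" if "W w \<in> open_simplex p"
        using simplex_box[of 1 1 0 w] that w p1 by (simp add: translate_0)
      then show "ennreal (c * rho w) \<le> ennreal c * indicator ?box w"
        using rho_le_1[of w] c by (cases "W w \<in> open_simplex p") (auto simp: rho_def[of w] intro!: ennreal_leI mult_left_le prod_nonneg)
    qed
    also have "\<dots> = ennreal c * emeasure L ?box" using box_sets by (simp add: nn_integral_cmult_indicator)
    also have "\<dots> < \<infinity>" using box_finite by (simp add: ennreal_mult_less_top)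
    finally show ?thesis unfolding ev .
  qed
  obtain E where E: "E > 0" "post = density L (\<lambda>x. ennreal (?\<pi> x * ?l x / E))"
    "prob_space (density L (\<lambda>x. ennreal (?\<pi> x * ?l x / E)))" "integrable L (\<lambda>x. ?\<pi> x * ?l x)"
    using fin pos unfolding prior
    by (rule posterior_eq_density[OF \<pi>m lm, rotated 3]) (use wnn z'0 lik in auto)
  show thesis
  proof (rule that[of "E / c"])
    show "post = density L (\<lambda>w. ennreal (rho w / (E / c)))" unfolding E(2) \<pi>l by (simp add: mult.commute)
    show "prob_space post" using E(2,3) by simp
  qed (use E c in simp)
qed

lemma dirichlet_stein_model: "stein_model post p n W h R R' M (p * M) (2 * (p * M))"
proof -
  obtain E where E: "E > 0" "post = density L (\<lambda>w. ennreal (rho w / E))" "prob_space post"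
    by (rule posterior_density)
  have meas: "f \<in> borel_measurable post \<longleftrightarrow> f \<in> borel_measurable L" for f :: "_ \<Rightarrow> real"
    unfolding E(2) by simp
  have rhoE: "(\<lambda>w. ennreal (rho w / E)) \<in> borel_measurable L" by measurable
  have AE: "AE w in post. W w \<in> open_simplex p"
    unfolding E(2) AE_density[OF rhoE] by (rule AE_I2) (auto simp: rho_def)
  interpret prob_space post by fact
  show ?thesis
  proof unfold_locales
    show "AE w in post. W w \<in> open_simplex p" by (rule AE)
    show "(\<Sum>i=1..p. h i) = 1" by (rule h_sum)
    show "\<bar>R i w\<bar> \<le> M + p * M * w i" if "i \<in> {1..p}" "w \<in> open_simplex p" for i w
      using R_bound[OF that] .
    show "\<bar>\<Sum>i=1..p. \<Sum>j=1..p. u i * u j * tilt_deriv p w (R' j w) i\<bar> \<le> 2 * (p * M) * c\<^sup>2"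
      if "w \<in> open_simplex p" "\<And>i. i \<in> {1..p} \<Longrightarrow> \<bar>u i\<bar> \<le> c" for u c w
      using that by (rule R'_bound)
    show "(\<lambda>w. R i (W w)) \<in> borel_measurable post" if "i \<in> {1..p}" for i
      unfolding meas R_def using bin_probs_meas[OF that] by measurable
    fix G G' i assume G: "smooth_fn p G G'" "(\<lambda>w. G (W w)) \<in> borel_measurable post" and i: "i \<in> {1..p}"
    \<comment> \<open>\<open>S / rho\<close> is the integrand with respect to the posterior.
      Division by zero is harmless because every \<open>K'\<close> vanishes wherever
      \<open>rho\<close> does.\<close>
    define S where "S w = (\<Sum>\<nu>\<in>{1..p} - {i}. K' G G' i \<nu> w)" for w
    have "has_bochner_integral L S (\<Sum>\<nu>\<in>{1..p} - {i}. 0)"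
      unfolding S_def by (intro has_bochner_integral_sum K'_integral[OF G(1) G(2)[unfolded meas] i]) auto
    then have S: "has_bochner_integral L S 0" by simp
    have Sm: "S \<in> borel_measurable L" using S by auto
    have S0: "S w = 0" if "rho w = 0" for w unfolding S_def using that by (intro sum.neutral) (simp add: K'_def)
    have "has_bochner_integral L (\<lambda>w. (1 / E) * S w) ((1 / E) * 0)" using S by (intro has_bochner_integral_mult_right)
    also have "(\<lambda>w. (1 / E) * S w) = (\<lambda>w. (rho w / E) *\<^sub>R (S w / rho w))"
      using S0 by (auto simp: fun_eq_iff)
    finally have I0: "has_bochner_integral L (\<lambda>w. (rho w / E) *\<^sub>R (S w / rho w)) 0" by simp
    have "has_bochner_integral post (\<lambda>w. S w / rho w) 0"
      unfolding E(2) by (rule has_bochner_integral_density[OF _ _ _ I0])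
        (use Sm rho_nonneg E(1) in \<open>auto intro!: AE_I2\<close>)
    moreover have "AE w in post. S w / rho w = tilt_deriv p (W w) (G' (W w)) i + G (W w) * (n * h i - n * W w i + R i (W w))"
      using AE
    proof eventually_elim
      case (elim w)
      have "rho w \<noteq> 0" using W_prod_pos[OF elim, of \<beta>] unfolding rho_def if_P[OF elim] by (rule less_imp_neq[symmetric])
      then show ?case unfolding S_def sum_K'[OF i elim] by simp
    qed
    ultimately show "\<exists>F. has_bochner_integral post F 0 \<and> (AE x in post. F x = tilt_deriv p (W x) (G' (W x)) i
        + G (W x) * (n * h i - n * W x i + R i (W x)))" by blast
  qed (use p1 n M_pos bin_probs_meas in \<open>auto simp: meas bin_freq_nonneg R_smooth\<close>)
qed

end

section \<open>Bin counts under the sampling law\<close>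

locale density_setting =
  fixes f0 :: "real \<Rightarrow> real" and s c_lo c_hi Lh :: real
  assumes s: "0 < s" and Lh: "Lh \<ge> 0" "\<And>x y. x \<in> {0..1} \<Longrightarrow> y \<in> {0..1} \<Longrightarrow> \<bar>f0 x - f0 y\<bar> \<le> Lh * \<bar>x - y\<bar> powr s"
    and c: "0 < c_lo" "\<And>x. x \<in> {0..1} \<Longrightarrow> c_lo \<le> f0 x" "\<And>x. x \<in> {0..1} \<Longrightarrow> f0 x \<le> c_hi"
    and int1: "(LINT x:{0..1}|lborel. f0 x) = 1"
begin

definition g :: "real \<Rightarrow> real" where "g x = f0 x * indicator {0..1} x"

definition \<mu>0 :: "real measure" where "\<mu>0 = density lborel (\<lambda>x. ennreal (g x))"

lemma c_hi_pos: "0 < c_hi" using c(1) c(2,3)[of 0] by auto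

lemma f0_cont: "continuous_on {0..1} f0"
  unfolding continuous_on_def
proof
  fix x :: real assume x: "x \<in> {0..1}"
  have "((\<lambda>y. Lh * \<bar>y - x\<bar> powr s) \<longlongrightarrow> Lh * 0) (at x within {0..1})"
  proof (intro tendsto_mult tendsto_const)
    have "((\<lambda>y. \<bar>y - x\<bar>) \<longlongrightarrow> \<bar>x - x\<bar>) (at x within {0..1})" by (intro tendsto_intros)
    then have "((\<lambda>y. \<bar>y - x\<bar> powr s) \<longlongrightarrow> 0 powr s) (at x within {0..1})"
      using s by (intro tendsto_powr2) auto
    then show "((\<lambda>y. \<bar>y - x\<bar> powr s) \<longlongrightarrow> 0) (at x within {0..1})" by simp
  qed
  then have "((\<lambda>y. Lh * \<bar>y - x\<bar> powr s) \<longlongrightarrow> 0) (at x within {0..1})" by simp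
  then have "((\<lambda>y. f0 y - f0 x) \<longlongrightarrow> 0) (at x within {0..1})"
    by (rule Lim_null_comparison[rotated]) (use Lh(2) x in \<open>auto simp: eventually_at_filter intro!: always_eventually\<close>)
  then show "(f0 \<longlongrightarrow> f0 x) (at x within {0..1})" by (rule Lim_null[THEN iffD2])
qed

lemma g_meas [measurable]: "g \<in> borel_measurable borel"
  using borel_measurable_continuous_on_indicator[OF _ f0_cont] by (simp add: g_def [abs_def] mult.commute)

lemma g_bounds: "0 \<le> g x" "g x \<le> c_hi * indicator {0..1} x"
  using c(2,3)[of x] c(1) by (auto simp: g_def indicator_def)

lemma g_le: "g x \<le> c_hi"
  using c(2,3)[of x] c_hi_pos by (auto simp: g_def indicator_def)

lemma integrable_01: 
  assumes "F \<in> borel_measurable borel" "\<And>x. x \<in> {0..1} \<Longrightarrow> \<bar>F x\<bar> \<le> B"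
  shows "integrable lborel (\<lambda>x. indicator {0..1::real} x * F x :: real)"
proof (rule Bochner_Integration.integrable_bound[where f="\<lambda>x. B * indicator {0..1::real} x"])
  show "integrable lborel (\<lambda>x. B * indicator {0..1::real} x)"
    by (intro integrable_mult_right integrable_real_indicator) auto
  show "AE x in lborel. norm (indicator {0..1::real} x * F x) \<le> norm (B * indicator {0..1::real} x)"
    using order_trans[OF abs_ge_zero assms(2)[of 0]] assms(2) by (intro AE_I2) (auto simp: indicator_def)
qed (use assms(1) in measurable)

lemma g_integrable: "integrable lborel (\<lambda>x. indicator {0..1} x * g x ^ k)"
  by (rule integrable_01[where B="c_hi ^ k"]) (use g_bounds(1) g_le in \<open>auto intro!: power_mono\<close>)

lemma g_integral: "integrable lborel g" "(\<integral>x. g x \<partial>lborel) = 1"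
proof -
  have e: "(\<lambda>x. indicator {0..1} x * g x ^ 1) = g" by (auto simp: g_def fun_eq_iff indicator_def)
  show "integrable lborel g" using g_integrable[of 1] unfolding e .
  show "(\<integral>x. g x \<partial>lborel) = 1" using int1 by (simp add: set_lebesgue_integral_def g_def mult.commute)
qed

lemma prob_\<mu>0: "prob_space \<mu>0"
proof
  have "emeasure \<mu>0 (space \<mu>0) = (\<integral>\<^sup>+x. ennreal (g x) \<partial>lborel)"
    by (simp add: \<mu>0_def emeasure_density cong: nn_integral_cong)
  also have "\<dots> = 1"
    by (subst nn_integral_eq_integral[OF g_integral(1)]) (use g_bounds g_integral in auto)
  finally show "emeasure \<mu>0 (space \<mu>0) = 1" .
qed

lemma sets_\<mu>0 [simp, measurable_cong]: "sets \<mu>0 = sets borel" and space_\<mu>0 [simp]: "space \<mu>0 = UNIV"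
  by (auto simp: \<mu>0_def)

lemma sampling_law_eq: "sampling_law f0 n = Pi\<^sub>M {1..n} (\<lambda>_. \<mu>0)"
  by (simp add: sampling_law_def \<mu>0_def g_def)

lemma AE_sample: "AE X in sampling_law f0 n. \<forall>i\<in>{1..n}. X i \<in> {0..1}"
  unfolding sampling_law_eq
proof (rule AE_finite_allI)
  fix i assume i: "i \<in> {1..n}"
  have "AE x in \<mu>0. x \<in> {0..1}"
  proof -
    have "(\<lambda>x. ennreal (g x)) \<in> borel_measurable lborel" by measurable
    then show ?thesis unfolding \<mu>0_def by (subst AE_density) (auto simp: g_def indicator_def)
  qed
  then show "AE X in Pi\<^sub>M {1..n} (\<lambda>_. \<mu>0). X i \<in> {0..1}"
    by (rule AE_PiM_component[OF prob_\<mu>0 i])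
qed simp

section \<open>Chernoff bounds for bin counts\<close>

definition cnt :: "nat \<Rightarrow> real set \<Rightarrow> (nat \<Rightarrow> real) \<Rightarrow> real" where
  "cnt n A X = (\<Sum>i=1..n. indicator A (X i))"

lemma cnt_meas [measurable]: "A \<in> sets borel \<Longrightarrow> cnt n A \<in> borel_measurable (sampling_law f0 n)"
  unfolding cnt_def [abs_def] sampling_law_eq
  by (intro borel_measurable_sum measurable_compose[OF measurable_component_singleton borel_measurable_indicator]) auto

text \<open>The binomial moment generating function (1 + q (e^l - 1))^n is bounded by that of the
  Poisson law with the same mean. The sign of \<open>l\<close> is free, so both tails
  follow.\<close>

lemma cnt_mgf:
  assumes A: "A \<in> sets borel"
  shows "(\<integral>\<^sup>+X. ennreal (exp (l * cnt n A X)) \<partial>sampling_law f0 n) \<le> ennreal (exp (n * measure \<mu>0 A * (exp l - 1)))"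
proof -
  interpret M: prob_space \<mu>0 by (rule prob_\<mu>0)
  interpret product_sigma_finite "\<lambda>_::nat. \<mu>0" by standard
  let ?q = "measure \<mu>0 A"
  have q: "0 \<le> ?q" "?q \<le> 1" by auto
  have 1: "(\<integral>\<^sup>+x. ennreal (exp (l * indicator A x)) \<partial>\<mu>0) = ennreal (1 + (exp l - 1) * ?q)"
  proof -
    have "(\<integral>\<^sup>+x. ennreal (exp (l * indicator A x)) \<partial>\<mu>0) = (\<integral>\<^sup>+x. ennreal (exp l) * indicator A x + indicator (- A) x \<partial>\<mu>0)"
      by (intro nn_integral_cong) (auto simp: indicator_def)
    also have "\<dots> = ennreal (exp l) * emeasure \<mu>0 A + emeasure \<mu>0 (- A)"
      using A by (subst nn_integral_add) (auto simp: nn_integral_cmult_indicator)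
    also have "emeasure \<mu>0 (- A) = ennreal (1 - ?q)"
      using M.prob_compl[of A] A by (simp add: M.emeasure_eq_measure Compl_eq_Diff_UNIV)
    also have "ennreal (exp l) * emeasure \<mu>0 A + ennreal (1 - ?q) = ennreal (exp l * ?q + (1 - ?q))"
      using q by (simp add: M.emeasure_eq_measure ennreal_mult[symmetric] ennreal_plus[symmetric] del: ennreal_plus)
    finally show ?thesis by (simp add: algebra_simps)
  qed
  have pos: "0 \<le> 1 + (exp l - 1) * ?q"
  proof -
    have "0 \<le> exp l * ?q + (1 - ?q)" using q by (intro add_nonneg_nonneg mult_nonneg_nonneg) auto
    then show ?thesis by (simp add: algebra_simps)
  qed
  have "(\<integral>\<^sup>+X. ennreal (exp (l * cnt n A X)) \<partial>sampling_law f0 n)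
    = (\<integral>\<^sup>+X. (\<Prod>i\<in>{1..n}. ennreal (exp (l * indicator A (X i)))) \<partial>Pi\<^sub>M {1..n} (\<lambda>_. \<mu>0))"
    unfolding sampling_law_eq cnt_def sum_distrib_left exp_sum[OF finite_atLeastAtMost]
    by (intro nn_integral_cong prod_ennreal[symmetric]) simp
  also have "\<dots> = (\<Prod>i\<in>{1..n}. \<integral>\<^sup>+x. ennreal (exp (l * indicator A x)) \<partial>\<mu>0)"
    using A by (intro product_nn_integral_prod) auto
  also have "\<dots> = ennreal ((1 + (exp l - 1) * ?q) ^ n)"
    unfolding 1 using pos by (simp add: ennreal_power)
  also have "\<dots> \<le> ennreal (exp ((exp l - 1) * ?q) ^ n)"
    using pos exp_ge_add_one_self[of "(exp l - 1) * ?q"] by (intro ennreal_leI power_mono) auto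
  also have "exp ((exp l - 1) * ?q) ^ n = exp (n * ?q * (exp l - 1))"
    by (simp add: exp_of_nat_mult[symmetric] mult_ac)
  finally show ?thesis .
qed

text \<open>Markov's inequality for the exponential. The event enters through a bound on
  \<open>l * cnt n A X\<close>, which for negative \<open>l\<close> describes a small count.\<close>

lemma cnt_tail:
  assumes A: "A \<in> sets borel" and E: "E \<in> sets (sampling_law f0 n)" "\<And>X. X \<in> E \<Longrightarrow> y \<le> l * cnt n A X"
  shows "emeasure (sampling_law f0 n) E \<le> ennreal (exp (n * measure \<mu>0 A * (exp l - 1) - y))"
proof -
  have "emeasure (sampling_law f0 n) E = (\<integral>\<^sup>+X. indicator E X \<partial>sampling_law f0 n)" using E by simp
  also have "\<dots> \<le> (\<integral>\<^sup>+X. ennreal (exp (- y)) * ennreal (exp (l * cnt n A X)) \<partial>sampling_law f0 n)"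
  proof (rule nn_integral_mono)
    fix X
    have "1 \<le> exp (- y) * exp (l * cnt n A X)" if "X \<in> E"
      using E(2)[OF that] by (simp add: exp_add[symmetric])
    then show "indicator E X \<le> ennreal (exp (- y)) * ennreal (exp (l * cnt n A X))"
      by (auto simp: indicator_def ennreal_mult[symmetric] ennreal_1[symmetric] simp del: ennreal_1 intro!: ennreal_leI)
  qed
  also have "\<dots> = ennreal (exp (- y)) * (\<integral>\<^sup>+X. ennreal (exp (l * cnt n A X)) \<partial>sampling_law f0 n)"
    using cnt_meas[OF A, of n] by (intro nn_integral_cmult) auto
  also have "\<dots> \<le> ennreal (exp (- y)) * ennreal (exp (n * measure \<mu>0 A * (exp l - 1)))"
    by (intro mult_left_mono cnt_mgf A) simp
  also have "\<dots> = ennreal (exp (n * measure \<mu>0 A * (exp l - 1) - y))"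
    by (simp add: ennreal_mult[symmetric] exp_add[symmetric])
  finally show ?thesis .
qed

text \<open>For \<open>l\<close> in [0, 1] the estimate e^l - 1 <= l + l^2 removes the mean and
  leaves a quadratic exponent, to be optimised later.\<close>

lemma cnt_upper:
  assumes A: "A \<in> sets borel" and l: "0 \<le> l" "l \<le> 1"
  shows "emeasure (sampling_law f0 n) {X \<in> space (sampling_law f0 n). n * measure \<mu>0 A + y < cnt n A X}
    \<le> ennreal (exp (n * measure \<mu>0 A * l\<^sup>2 - l * y))"
proof -
  have "emeasure (sampling_law f0 n) {X \<in> space (sampling_law f0 n). n * measure \<mu>0 A + y < cnt n A X}
    \<le> ennreal (exp (n * measure \<mu>0 A * (exp l - 1) - l * (n * measure \<mu>0 A + y)))"
    using A l by (intro cnt_tail) (auto intro!: mult_left_mono)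
  also have "\<dots> \<le> ennreal (exp (n * measure \<mu>0 A * l\<^sup>2 - l * y))"
  proof -
    have "n * measure \<mu>0 A * (exp l - 1) \<le> n * measure \<mu>0 A * (l + l\<^sup>2)"
      using exp_bound[OF l] by (intro mult_left_mono) auto
    then show ?thesis by (intro ennreal_leI) (simp add: algebra_simps)
  qed
  finally show ?thesis .
qed

text \<open>Taken at l = - 1/2: a count below 2 then has l times count above - 1, which is the
  summand 1 in the exponent. The factor 1/3 comes from exp(- 1/2) <= 2/3, that is, from exp(1/2) >=
  1 + 1/2.\<close>

lemma cnt_lower:
  assumes A: "A \<in> sets borel"
  shows "emeasure (sampling_law f0 n) {X \<in> space (sampling_law f0 n). cnt n A X < 2}
    \<le> ennreal (exp (1 - n * measure \<mu>0 A / 3))"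
proof -
  have "emeasure (sampling_law f0 n) {X \<in> space (sampling_law f0 n). cnt n A X < 2}
    \<le> ennreal (exp (n * measure \<mu>0 A * (exp (- (1 / 2)) - 1) - (- 1)))"
    using A by (intro cnt_tail) auto
  also have "\<dots> \<le> ennreal (exp (1 - n * measure \<mu>0 A / 3))"
  proof -
    have "3 / 2 \<le> exp (1 / 2 :: real)" using exp_ge_add_one_self[of "1 / 2"] by simp
    then have "1 / exp (1 / 2 :: real) \<le> 1 / (3 / 2)" by (intro divide_left_mono) auto
    then have "exp (- (1 / 2)) - 1 \<le> - (1 / 3 :: real)" by (simp add: exp_minus inverse_eq_divide)
    then have "n * measure \<mu>0 A * (exp (- (1 / 2)) - 1) \<le> n * measure \<mu>0 A * (- (1 / 3))"
      by (intro mult_left_mono) auto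
    then show ?thesis by (intro ennreal_leI) simp
  qed
  finally show ?thesis .
qed

section \<open>Bin probabilities of the true density and the limit variance\<close>

definition q :: "nat \<Rightarrow> nat \<Rightarrow> real" where "q p \<mu> = measure \<mu>0 (bin p \<mu>)"

lemma cnt_bin:
  assumes "\<mu> \<in> {1..p}" "n \<ge> 1" "\<And>i. i \<in> {1..n} \<Longrightarrow> X i \<in> {0..1}"
  shows "cnt n (bin p \<mu>) X = n * bin_freq p n X \<mu>"
proof -
  have "cnt n (bin p \<mu>) X = (\<Sum>i=1..n. if bin_index p (X i) = \<mu> then 1 else 0)"
    unfolding cnt_def using assms by (intro sum.cong refl) (auto simp: bin_iff indicator_def)
  then show ?thesis using assms(2) by (simp add: bin_freq_def)
qed

lemma q_eq:
  assumes "\<mu> \<in> {1..p}"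
  shows "q p \<mu> = (\<integral>x. g x * indicator (bin p \<mu>) x \<partial>lborel)" "integrable lborel (\<lambda>x. g x * indicator (bin p \<mu>) x)"
proof -
  show i: "integrable lborel (\<lambda>x. g x * indicator (bin p \<mu>) x)"
    by (intro integrable_real_mult_indicator[OF _ g_integral(1)]) simp
  have "emeasure \<mu>0 (bin p \<mu>) = (\<integral>\<^sup>+x. ennreal (g x * indicator (bin p \<mu>) x) \<partial>lborel)"
    unfolding \<mu>0_def by (subst emeasure_density) (auto intro!: nn_integral_cong simp: indicator_def)
  also have "\<dots> = ennreal (\<integral>x. g x * indicator (bin p \<mu>) x \<partial>lborel)"
    by (rule nn_integral_eq_integral[OF i]) (use g_bounds in auto)
  finally show "q p \<mu> = (\<integral>x. g x * indicator (bin p \<mu>) x \<partial>lborel)"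
    unfolding q_def measure_def using g_bounds by (simp add: integral_nonneg_AE)
qed

lemma has_bochner_integral_bin:
  assumes "\<mu> \<in> {1..p}"
  shows "has_bochner_integral lborel (\<lambda>x. k * indicator (bin p \<mu>) x) (k * (1 / p) :: real)"
proof (rule has_bochner_integral_mult_right)
  have "has_bochner_integral lborel (indicat_real (bin p \<mu>)) (measure lborel (bin p \<mu>))"
    using emeasure_bin[OF assms] by (intro has_bochner_integral_real_indicator) auto
  then show "has_bochner_integral lborel (indicat_real (bin p \<mu>)) (1 / p)"
    using emeasure_bin[OF assms] by (simp add: measure_def)
qed

lemma bin_width:
  assumes "\<mu> \<in> {1..p}" "x \<in> bin p \<mu>" "y \<in> bin p \<mu>"
  shows "\<bar>x - y\<bar> \<le> 1 / p"
proof -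
  have p: "real p > 0" using assms by auto
  have "(real \<mu> - 1) / p \<le> z \<and> z \<le> real \<mu> / p" if "z \<in> bin p \<mu>" for z
    using that p by (auto simp: bin_def split: if_splits)
  from this[OF assms(2)] this[OF assms(3)] show ?thesis by (simp add: diff_divide_distrib abs_le_iff)
qed

lemma q_approx:
  assumes \<mu>: "\<mu> \<in> {1..p}" and x: "x \<in> bin p \<mu>"
  shows "\<bar>p * q p \<mu> - f0 x\<bar> \<le> Lh * real p powr (- s)"
proof -
  have p: "real p > 0" using \<mu> by auto
  have sub: "y \<in> {0..1}" if "y \<in> bin p \<mu>" for y using that bin_iff[OF \<mu>] by simp
  note hi = has_bochner_integral_bin[OF \<mu>, unfolded has_bochner_integral_iff]
  have eq: "q p \<mu> - f0 x * (1 / p) = (\<integral>y. g y * indicator (bin p \<mu>) y - f0 x * indicator (bin p \<mu>) y \<partial>lborel)"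
    using q_eq[OF \<mu>] hi[of "f0 x"] by (subst Bochner_Integration.integral_diff) auto
  have "\<bar>q p \<mu> - f0 x * (1 / p)\<bar> \<le> (\<integral>y. (Lh * real p powr (- s)) * indicator (bin p \<mu>) y \<partial>lborel)"
    unfolding eq
  proof (rule integral_abs_bound_integral)
    show "integrable lborel (\<lambda>y. g y * indicator (bin p \<mu>) y - f0 x * indicator (bin p \<mu>) y)"
      using q_eq(2)[OF \<mu>] hi by (intro Bochner_Integration.integrable_diff) auto
    show "integrable lborel (\<lambda>y. (Lh * real p powr (- s)) * indicator (bin p \<mu>) y)" using hi by blast
    fix y :: real
    have "\<bar>f0 y - f0 x\<bar> \<le> Lh * real p powr (- s)" if y: "y \<in> bin p \<mu>"
    proof -
      have "\<bar>f0 y - f0 x\<bar> \<le> Lh * \<bar>y - x\<bar> powr s" using Lh(2) sub y x by blast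
      also have "\<dots> \<le> Lh * (1 / p) powr s"
        using bin_width[OF \<mu> y x] s Lh(1) by (intro mult_left_mono powr_mono2) auto
      also have "(1 / p) powr s = real p powr (- s)" using p by (simp add: powr_divide powr_minus_divide)
      finally show ?thesis .
    qed
    then show "\<bar>g y * indicator (bin p \<mu>) y - f0 x * indicator (bin p \<mu>) y\<bar> \<le> (Lh * real p powr (- s)) * indicator (bin p \<mu>) y"
      using sub by (auto simp: indicator_def g_def)
  qed
  also have "\<dots> = Lh * real p powr (- s) * (1 / p)" using hi by blast
  finally have "p * \<bar>q p \<mu> - f0 x * (1 / p)\<bar> \<le> p * (Lh * real p powr (- s) * (1 / p))"
    by (intro mult_left_mono) auto
  moreover have "p * \<bar>q p \<mu> - f0 x * (1 / p)\<bar> = \<bar>p * q p \<mu> - f0 x\<bar>"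
  proof -
    have "p * q p \<mu> - f0 x = p * (q p \<mu> - f0 x * (1 / p))" using p by (simp add: right_diff_distrib)
    then show ?thesis using p by (simp only: abs_mult)
  qed
  ultimately show ?thesis using p by simp
qed

lemma q_bounds:
  assumes \<mu>: "\<mu> \<in> {1..p}"
  shows "c_lo \<le> p * q p \<mu>" "p * q p \<mu> \<le> c_hi"
proof -
  have p: "real p > 0" using \<mu> by auto
  have sub: "y \<in> {0..1}" if "y \<in> bin p \<mu>" for y using that bin_iff[OF \<mu>] by simp
  note hi = has_bochner_integral_bin[OF \<mu>, unfolded has_bochner_integral_iff]
  have "(\<integral>y. c_lo * indicator (bin p \<mu>) y \<partial>lborel) \<le> q p \<mu>"
    unfolding q_eq(1)[OF \<mu>] by (rule integral_mono) (use hi q_eq(2)[OF \<mu>] c sub in \<open>auto simp: indicator_def g_def\<close>)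
  then show "c_lo \<le> p * q p \<mu>" unfolding hi[THEN conjunct2] using p by (simp add: field_simps)
  have "q p \<mu> \<le> (\<integral>y. c_hi * indicator (bin p \<mu>) y \<partial>lborel)"
    unfolding q_eq(1)[OF \<mu>] by (rule integral_mono) (use hi q_eq(2)[OF \<mu>] c sub in \<open>auto simp: indicator_def g_def\<close>)
  then show "p * q p \<mu> \<le> c_hi" unfolding hi[THEN conjunct2] using p by (simp add: field_simps)
qed

lemma q_simplex:
  assumes p: "p \<ge> 1"
  shows "q p \<in> open_simplex p"
proof -
  have "(\<Sum>\<mu>=1..p. q p \<mu>) = (\<integral>x. (\<Sum>\<mu>=1..p. g x * indicator (bin p \<mu>) x) \<partial>lborel)"
    by (subst Bochner_Integration.integral_sum) (auto simp: q_eq)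
  also have "\<dots> = (\<integral>x. g x \<partial>lborel)"
  proof (rule Bochner_Integration.integral_cong[OF refl])
    fix x :: real
    have "(\<Sum>\<mu>=1..p. g x * indicator (bin p \<mu>) x) = (\<Sum>\<mu>=1..p. if bin_index p x = \<mu> then g x else 0)"
      by (intro sum.cong refl) (auto simp: bin_iff indicator_def g_def)
    then show "(\<Sum>\<mu>=1..p. g x * indicator (bin p \<mu>) x) = g x"
      using bin_index_range[OF p, of x] by (cases "x \<in> {0..1}") (auto simp: g_def)
  qed
  also have "\<dots> = 1" by (rule g_integral)
  finally have "(\<Sum>\<mu>=1..p. q p \<mu>) = 1" .
  moreover have "q p \<mu> > 0" if "\<mu> \<in> {1..p}" for \<mu>
  proof -
    have "0 < p * q p \<mu>" using q_bounds(1)[OF that] c(1) by linarith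
    then show ?thesis by (simp add: zero_less_mult_iff)
  qed
  ultimately show ?thesis by (simp add: open_simplex_def)
qed

text \<open>The first term is the integral of the power \<open>Suc k\<close> of the binned density,
  since the factor 1 / p from the bin width leaves p^k. Factoring the difference of powers gives one
  difference, controlled by the Hoelder condition, times \<open>Suc k\<close> products bounded by
  c_hi^k.\<close>

lemma moment_approx:
  assumes p: "p \<ge> 1"
  shows "\<bar>real p ^ k * (\<Sum>\<mu>=1..p. q p \<mu> ^ Suc k) - (LINT x:{0..1}|lborel. f0 x ^ Suc k)\<bar>
     \<le> Suc k * c_hi ^ k * (Lh * real p powr (- s))"
proof -
  let ?fb = "\<lambda>x. p * q p (bin_index p x)"
  let ?d = "Suc k * c_hi ^ k * (Lh * real p powr (- s))"
  have hb: "has_bochner_integral lborel (\<lambda>x. indicator {0..1} x *\<^sub>R ?fb x ^ Suc k) ((\<Sum>\<mu>=1..p. (p * q p \<mu>) ^ Suc k) / p)"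
    by (rule has_bochner_integral_bins[OF p]) (simp add: bin_iff)
  have e: "(\<Sum>\<mu>=1..p. (p * q p \<mu>) ^ Suc k) / p = real p ^ k * (\<Sum>\<mu>=1..p. q p \<mu> ^ Suc k)"
    unfolding power_mult_distrib sum_distrib_left[symmetric] using p by simp
  have gi: "integrable lborel (\<lambda>x. indicator {0..1} x * f0 x ^ Suc k)"
  proof -
    have "(\<lambda>x. indicator {0..1} x * f0 x ^ Suc k) = (\<lambda>x. indicator {0..1} x * g x ^ Suc k)"
      by (auto simp: fun_eq_iff g_def indicator_def)
    then show ?thesis using g_integrable[of "Suc k"] by simp
  qed
  have one: "has_bochner_integral lborel (\<lambda>x. ?d * indicator {0..1::real} x) (?d * 1)"
    using has_bochner_integral_bins[OF p, of "\<lambda>_. 1" "\<lambda>_. 1"] p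
    by (intro has_bochner_integral_mult_right) simp
  have eq: "real p ^ k * (\<Sum>\<mu>=1..p. q p \<mu> ^ Suc k) - (LINT x:{0..1}|lborel. f0 x ^ Suc k)
    = (\<integral>x. indicator {0..1} x * ?fb x ^ Suc k - indicator {0..1} x * f0 x ^ Suc k \<partial>lborel)"
    using hb gi unfolding e has_bochner_integral_iff set_lebesgue_integral_def
    by (subst Bochner_Integration.integral_diff) auto
  have "\<bar>real p ^ k * (\<Sum>\<mu>=1..p. q p \<mu> ^ Suc k) - (LINT x:{0..1}|lborel. f0 x ^ Suc k)\<bar>
      \<le> (\<integral>x. ?d * indicator {0..1::real} x \<partial>lborel)"
    unfolding eq
  proof (rule integral_abs_bound_integral)
    show "integrable lborel (\<lambda>x. indicator {0..1} x * ?fb x ^ Suc k - indicator {0..1} x * f0 x ^ Suc k)"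
      using hb gi by (intro Bochner_Integration.integrable_diff) (auto simp: has_bochner_integral_iff)
    show "integrable lborel (\<lambda>x. ?d * indicator {0..1::real} x)" using one by (simp add: has_bochner_integral_iff)
    fix x :: real
    show "\<bar>indicator {0..1} x * ?fb x ^ Suc k - indicator {0..1} x * f0 x ^ Suc k\<bar> \<le> ?d * indicator {0..1::real} x"
    proof (cases "x \<in> {0..1}")
      case True
      let ?\<mu> = "bin_index p x"
      note \<mu> = bin_index_range[OF p True]
      have b: "0 \<le> ?fb x" "?fb x \<le> c_hi" "0 \<le> f0 x" "f0 x \<le> c_hi"
        using q_bounds[OF \<mu>] c True by (auto intro: order_trans[OF less_imp_le[OF c(1)]])
      have "\<bar>?fb x ^ Suc k - f0 x ^ Suc k\<bar> = \<bar>?fb x - f0 x\<bar> * \<bar>\<Sum>i\<le>k. ?fb x ^ i * f0 x ^ (k - i)\<bar>"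
        using power_diff_sumr2[of "?fb x" "Suc k" "f0 x"]
        by (simp add: abs_mult lessThan_Suc_atMost mult.commute)
      also have "\<dots> \<le> (Lh * real p powr (- s)) * (Suc k * c_hi ^ k)"
      proof (rule mult_mono)
        show "\<bar>?fb x - f0 x\<bar> \<le> Lh * real p powr (- s)"
          by (rule q_approx[OF \<mu> bin_index_in_bin[OF p True]])
        have "\<bar>\<Sum>i\<le>k. ?fb x ^ i * f0 x ^ (k - i)\<bar> \<le> (\<Sum>i\<le>k. c_hi ^ k)"
        proof (rule order_trans[OF sum_abs], rule sum_mono)
          fix i assume i: "i \<in> {..k}"
          have "?fb x ^ i * f0 x ^ (k - i) \<le> c_hi ^ i * c_hi ^ (k - i)"
            using b c_hi_pos by (intro mult_mono power_mono) auto
          also have "\<dots> = c_hi ^ k" using i by (simp add: power_add[symmetric])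
          finally show "\<bar>?fb x ^ i * f0 x ^ (k - i)\<bar> \<le> c_hi ^ k" using b by (simp add: abs_mult)
        qed
        then show "\<bar>\<Sum>i\<le>k. ?fb x ^ i * f0 x ^ (k - i)\<bar> \<le> Suc k * c_hi ^ k" by simp
      qed (use Lh in auto)
      finally show ?thesis using True by (simp add: mult_ac)
    qed simp
  qed
  also have "\<dots> = ?d" using one by (simp add: has_bochner_integral_iff)
  finally show ?thesis .
qed

lemma asymp_variance_eq:
  "asymp_variance f0 = 4 * ((LINT x:{0..1}|lborel. f0 x ^ 3) - (LINT x:{0..1}|lborel. f0 x ^ 2)\<^sup>2)"
proof -
  define m where "m = (LINT x:{0..1}|lborel. f0 x ^ 2)"
  have i: "integrable lborel (\<lambda>x. indicator {0..1} x * f0 x ^ k)" for k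
  proof -
    have "(\<lambda>x. indicator {0..1} x * f0 x ^ k) = (\<lambda>x. indicator {0..1} x * g x ^ k)"
      by (auto simp: fun_eq_iff g_def indicator_def)
    then show ?thesis using g_integrable[of k] by simp
  qed
  have "(LINT x:{0..1}|lborel. (f0 x - m)\<^sup>2 * f0 x)
    = (\<integral>x. indicator {0..1} x * f0 x ^ 3 - 2 * m * (indicator {0..1} x * f0 x ^ 2) + m\<^sup>2 * (indicator {0..1} x * f0 x ^ 1) \<partial>lborel)"
    unfolding set_lebesgue_integral_def
    by (intro Bochner_Integration.integral_cong) (auto simp: power2_eq_square power3_eq_cube algebra_simps)
  also have "\<dots> = (LINT x:{0..1}|lborel. f0 x ^ 3) - 2 * m * m + m\<^sup>2 * 1"
    using i[of 3] i[of 2] i[of 1] int1 m_def unfolding set_lebesgue_integral_def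
    by (subst Bochner_Integration.integral_add Bochner_Integration.integral_diff; simp)+
  finally show ?thesis unfolding asymp_variance_def m_def[symmetric] by (simp add: power2_eq_square)
qed

text \<open>At w = h = q the leading term is 2 (S3 - S2^2) with the second and third moments of the
  binned density, and the variance has the same form in the true moments. The constant is 28 = 4 * 3
  + 4 * (2 * 2), from the cubic moment and from the factored difference of squares.\<close>

lemma main_term_approx:
  assumes p: "p \<ge> 1"
  shows "\<bar>2 * main_term p (q p) (q p) - asymp_variance f0\<bar> \<le> 28 * c_hi\<^sup>2 * Lh * real p powr (- s)"
proof -
  define S3 S2 I3 I2 d where "S3 = real p ^ 2 * (\<Sum>\<mu>=1..p. q p \<mu> ^ 3)" and "S2 = real p ^ 1 * (\<Sum>\<mu>=1..p. q p \<mu> ^ 2)"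
    and "I3 = (LINT x:{0..1}|lborel. f0 x ^ 3)" and "I2 = (LINT x:{0..1}|lborel. f0 x ^ 2)" and "d = Lh * real p powr (- s)"
  have d: "d \<ge> 0" using Lh by (simp add: d_def)
  have 3: "\<bar>S3 - I3\<bar> \<le> 3 * c_hi\<^sup>2 * d" using moment_approx[OF p, of 2] by (simp add: S3_def I3_def d_def)
  have 2: "\<bar>S2 - I2\<bar> \<le> 2 * c_hi * d" using moment_approx[OF p, of 1] by (simp add: S2_def I2_def d_def numeral_2_eq_2[symmetric] One_nat_def)
  note qs = open_simplexD[OF q_simplex[OF p]]
  have S2b: "0 \<le> S2" "S2 \<le> c_hi"
  proof -
    show "0 \<le> S2" by (simp add: S2_def sum_nonneg)
    have "S2 = (\<Sum>\<mu>=1..p. (p * q p \<mu>) * q p \<mu>)" by (simp add: S2_def sum_distrib_left power2_eq_square mult_ac)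
    also have "\<dots> \<le> (\<Sum>\<mu>=1..p. c_hi * q p \<mu>)"
      using q_bounds(2) qs(1) by (intro sum_mono mult_right_mono) (auto simp: less_imp_le)
    also have "\<dots> = c_hi" by (simp add: sum_distrib_left[symmetric] qs(3))
    finally show "S2 \<le> c_hi" .
  qed
  have I2b: "0 \<le> I2" "I2 \<le> c_hi"
  proof -
    have i: "integrable lborel (\<lambda>x. indicator {0..1} x * g x ^ k)" for k by (rule g_integrable)
    have I2g: "I2 = (\<integral>x. indicator {0..1} x * g x ^ 2 \<partial>lborel)"
      unfolding I2_def set_lebesgue_integral_def by (intro Bochner_Integration.integral_cong) (auto simp: g_def indicator_def)
    show "0 \<le> I2" unfolding I2g by (intro integral_nonneg_AE) auto
    have "I2 \<le> (\<integral>x. c_hi * g x \<partial>lborel)" unfolding I2g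
    proof (rule integral_mono[OF i])
      show "integrable lborel (\<lambda>x. c_hi * g x)" using g_integral by simp
      fix x :: real
      show "indicator {0..1} x * g x ^ 2 \<le> c_hi * g x"
        using g_bounds[of x] by (auto simp: indicator_def power2_eq_square intro!: mult_right_mono)
    qed
    then show "I2 \<le> c_hi" using g_integral by simp
  qed
  have "main_term p (q p) (q p) = 2 * (S3 - S2\<^sup>2)"
  proof -
    define m where "m = (\<Sum>j=1..p. (q p j)\<^sup>2)"
    have "main_term p (q p) (q p) = (real p)\<^sup>2 * (\<Sum>i=1..p. 2 * q p i ^ 3 - 2 * m * (q p i)\<^sup>2)"
      unfolding main_term_def m_def[symmetric]
      by (intro arg_cong2[where f="(*)"] sum.cong refl) (simp add: power2_eq_square power3_eq_cube algebra_simps)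
    then have "main_term p (q p) (q p) = (real p)\<^sup>2 * (2 * (\<Sum>i=1..p. q p i ^ 3) - 2 * m * m)"
      by (simp add: sum_subtractf sum_distrib_left[symmetric] m_def[symmetric])
    moreover have "S2 = real p * m" by (simp add: S2_def m_def)
    ultimately show ?thesis by (simp add: S3_def power2_eq_square algebra_simps)
  qed
  then have e: "2 * main_term p (q p) (q p) - asymp_variance f0 = 4 * (S3 - I3) - 4 * ((S2 - I2) * (S2 + I2))"
    unfolding asymp_variance_eq I3_def[symmetric] I2_def[symmetric] by (simp add: power2_eq_square algebra_simps)
  have X: "\<bar>(S2 - I2) * (S2 + I2)\<bar> \<le> (2 * c_hi * d) * (2 * c_hi)"
    unfolding abs_mult using 2 S2b I2b d c_hi_pos by (intro mult_mono) auto
  have k: "4 * (3 * c_hi\<^sup>2 * d) + 4 * ((2 * c_hi * d) * (2 * c_hi)) = 28 * c_hi\<^sup>2 * Lh * real p powr (- s)"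
    by (simp add: d_def power2_eq_square)
  have "\<bar>4 * a - 4 * b\<bar> \<le> 4 * A + 4 * B" if "\<bar>a\<bar> \<le> A" "\<bar>b\<bar> \<le> B" for a b A B :: real
    using that by linarith
  from this[OF 3 X] show ?thesis unfolding e k .
qed

section \<open>Rates of convergence\<close>

text \<open>With D = n \<epsilon> / (4 p) and N = C n / p the tail exponent is at least D^2 / (24 N)
  = (n / p) \<epsilon>^2 / (384 C). The choice 1920 = 5 * 384 in \<open>K\<close> makes it 5 ln n.
  The resulting n^(-5) absorbs the union over p bins and the crude bound of order p^2 on T.\<close>

lemma d_BL_le_rate:
  fixes C K \<kappa> a b e v rate \<epsilon> :: real and p n :: nat
  assumes model: "stein_model Q p n W (bin_freq p n X) R R' a b e"
    and v: "v = asymp_variance f0" "v > 0"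
    and C: "C = c_hi + 1" and K: "K = sqrt (1920 * C)"
    and ln1: "1 \<le> ln (real n)" and pn: "p \<le> n"
  defines "\<epsilon> \<equiv> K * sqrt (p * ln n / n)"
  assumes \<epsilon>C: "\<epsilon> \<le> C" and big: "16 \<le> n * \<epsilon> / p" "12 * \<kappa> * C \<le> n * \<epsilon> / p" and a4: "a \<le> n * \<epsilon> / (4 * p)"
    and b: "b < n" "b \<le> \<kappa> * p" and \<kappa>: "0 \<le> \<kappa>"
    and r: "real p powr (- s) \<le> rate" "sqrt (p * ln n / n) \<le> rate" "(p * a + b + e) / n \<le> \<kappa> * rate"
    and h: "\<And>i. i \<in> {1..p} \<Longrightarrow> bin_freq p n X i \<le> q p i + \<epsilon> / p"
  shows "\<bar>d_BL (distr Q borel (\<lambda>x. stein_model.Zfun p n (bin_freq p n X) R (W x))) (normal_law 0 v)\<bar>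
    \<le> 4 / v * (36 * C\<^sup>2 * \<kappa> + 1872 * C\<^sup>2 * K + 36 * C\<^sup>2 + 28 * c_hi\<^sup>2 * Lh + 8 + 4 * \<kappa> + v) * rate"
proof -
  interpret stein_model Q p n W "bin_freq p n X" R R' a b e by fact
  let ?h = "bin_freq p n X"
  define \<delta> where "\<delta> = exp (- (5 * ln n))"
  have C1: "C \<ge> 1" using C c_hi_pos by simp
  have P: "real p > 0" "real n > 0" and P1: "real p \<ge> 1" using p n by auto
  have x0: "0 \<le> p * ln n / n" using ln1 P by simp
  have K0: "K > 0" using K C1 by simp
  have \<epsilon>0: "0 \<le> \<epsilon>" using K0 x0 by (simp add: \<epsilon>_def)
  have \<epsilon>2: "n / p * \<epsilon>\<^sup>2 = 1920 * C * ln n"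
    using K C1 x0 P by (simp add: \<epsilon>_def power_mult_distrib real_sqrt_pow2)
  have ph: "p * ?h i \<le> 2 * C" if "i \<in> {1..p}" for i
  proof -
    have "p * ?h i \<le> p * (q p i + \<epsilon> / p)" using h[OF that] by (intro mult_left_mono) auto
    also have "\<dots> = p * q p i + \<epsilon>" using P by (simp add: distrib_left)
    finally show ?thesis using q_bounds(2)[OF that] \<epsilon>C C by linarith
  qed
  have tail: "prob {x \<in> space Q. W x i > ?h i + \<epsilon> / p} \<le> \<delta>" if i: "i \<in> {1..p}" for i
  proof -
    define D where "D = n * \<epsilon> / (4 * p)"
    have D: "4 * D = n * \<epsilon> / p" by (simp add: D_def)
    have bh: "b * ?h i \<le> 2 * \<kappa> * C"
    proof -
      have "b * ?h i \<le> \<kappa> * p * ?h i" using b(2) h_nonneg[OF i] by (intro mult_right_mono) auto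
      also have "\<dots> \<le> \<kappa> * (2 * C)" using ph[OF i] \<kappa> by (simp add: mult.assoc mult_left_mono)
      finally show ?thesis by simp
    qed
    have be: "b * (\<epsilon> / p) \<le> \<kappa> * C"
    proof -
      have "b * (\<epsilon> / p) \<le> \<kappa> * p * (\<epsilon> / p)" using b(2) \<epsilon>0 P by (intro mult_right_mono) auto
      also have "\<dots> \<le> \<kappa> * C" using P \<epsilon>C \<kappa> by (simp add: mult_left_mono)
      finally show ?thesis .
    qed
    have "prob {x \<in> space Q. W x i > ?h i + \<epsilon> / p} \<le> exp (- (D\<^sup>2 / (8 * (n * ?h i + a + D))))"
    proof (rule upper_tail[OF i b(1)])
      show "D \<ge> 4" using big(1) D by linarith
      define kC where "kC = \<kappa> * C"
      \<comment> \<open>The margin n \<epsilon> / p is 4 D. One D is the deviation requested by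
        \<open>upper_tail\<close>, one covers \<open>a\<close>, and one covers the loss from
        replacing n by n - b, which is at most 3 \<kappa> C <= D.\<close>
      have eq: "(n - b) * (?h i + \<epsilon> / p) = n * ?h i + n * \<epsilon> / p - b * ?h i - b * (\<epsilon> / p)"
        by (simp add: algebra_simps add_divide_distrib diff_divide_distrib)
      have "a \<le> D" using a4 by (simp add: D_def)
      moreover have "b * ?h i \<le> 2 * kC" "b * (\<epsilon> / p) \<le> kC" "12 * kC \<le> 4 * D"
        using bh be big(2) by (simp_all add: kC_def D)
      moreover have "0 \<le> D" using big(1) D by linarith
      ultimately show "n * ?h i + a + D \<le> (n - b) * (?h i + \<epsilon> / p)"
        unfolding eq D[symmetric] by linarith
    qed
    also have "\<dots> \<le> \<delta>"
    proof -
      have Dp: "D > 0" using big(1) D by linarith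
      define N where "N = n / p * C"
      have N0: "N > 0" using P C1 by (simp add: N_def)
      have "n * ?h i \<le> 2 * N"
      proof -
        have "n / p * (p * ?h i) \<le> n / p * (2 * C)" using ph[OF i] by (intro mult_left_mono) auto
        then show ?thesis using P by (simp add: N_def mult_ac)
      qed
      moreover have "D \<le> N / 4"
      proof -
        have "n / p * (\<epsilon> / 4) \<le> n / p * (C / 4)" using \<epsilon>C by (intro mult_left_mono) auto
        then show ?thesis by (simp add: D_def N_def)
      qed
      moreover have "a \<le> D" using a4 by (simp add: D_def)
      \<comment> \<open>The three terms are at most 2 N, N / 4 and N / 4.\<close>
      ultimately have 1: "n * ?h i + a + D \<le> 3 * N" using N0 by linarith
      have 2: "0 < n * ?h i + a + D" using Dp h_nonneg[OF i] abe by (intro add_nonneg_pos add_nonneg_nonneg) auto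
      have "5 * ln n = D\<^sup>2 / (8 * (3 * N))"
      proof -
        have "D\<^sup>2 / (8 * (3 * N)) = (n / p * \<epsilon>\<^sup>2) / (384 * C)"
          using P C1 by (simp add: D_def N_def power2_eq_square field_simps)
        then show ?thesis unfolding \<epsilon>2 using C1 by simp
      qed
      also have "\<dots> \<le> D\<^sup>2 / (8 * (n * ?h i + a + D))"
        using 1 2 N0 by (intro divide_left_mono mult_pos_pos) auto
      finally show ?thesis by (simp add: \<delta>_def)
    qed
    finally show ?thesis .
  qed
  have Cq: "p * q p i \<le> C" if "i \<in> {1..p}" for i using q_bounds(2)[OF that] C by simp
  define c where "c = 3 * C"
  have bound: "\<bar>d_BL (distr Q borel (\<lambda>x. Zfun (W x))) (normal_law 0 v)\<bar> \<le> 4 / v *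
    ((4 * c * (p * a + b * c) + 4 * c\<^sup>2 * e) / n + 208 * c\<^sup>2 * \<epsilon> + 4 * c\<^sup>2 / n + \<bar>2 * main_term p (q p) (q p) - v\<bar>
      + p * \<delta> * ((real p)\<^sup>2 * (8 + 4 * (a + b + e) / n) + v))"
    unfolding c_def using C1 by (intro d_BL_le[OF v(2) _ q_simplex[OF p] Cq \<epsilon>0 \<epsilon>C h tail]) auto
  have rate0: "0 \<le> rate" using r(2) x0 by (meson order_trans real_sqrt_ge_zero)
  have inv_n: "1 / n \<le> rate"
  proof -
    have "1 / n \<le> sqrt (1 / n)"
      using P n by (intro real_le_rsqrt) (simp add: power2_eq_square field_simps)
    also have "\<dots> \<le> sqrt (p * ln n / n)"
      using P mult_mono[OF P1 ln1] by (intro real_sqrt_le_mono divide_right_mono) auto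
    finally show ?thesis using r(2) by linarith
  qed
  have t1: "(4 * c * (p * a + b * c) + 4 * c\<^sup>2 * e) / n \<le> 36 * C\<^sup>2 * \<kappa> * rate"
  proof -
    have "c * (p * a) \<le> c * c * (p * a)" using C1 abe P by (intro mult_right_mono) (auto simp: c_def mult_le_cancel_right1)
    then have "4 * c * (p * a + b * c) + 4 * c\<^sup>2 * e \<le> 36 * C\<^sup>2 * (p * a + b + e)"
      by (simp add: c_def power2_eq_square algebra_simps)
    then have "(4 * c * (p * a + b * c) + 4 * c\<^sup>2 * e) / n \<le> 36 * C\<^sup>2 * ((p * a + b + e) / n)"
      using P by (simp add: divide_right_mono)
    also have "\<dots> \<le> 36 * C\<^sup>2 * (\<kappa> * rate)" using r(3) by (intro mult_left_mono) auto
    finally show ?thesis by (simp add: mult.assoc)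
  qed
  have t2: "208 * c\<^sup>2 * \<epsilon> \<le> 1872 * C\<^sup>2 * K * rate"
  proof -
    have "1872 * C\<^sup>2 * K * sqrt (p * ln n / n) \<le> 1872 * C\<^sup>2 * K * rate" using r(2) K0 by (intro mult_left_mono) auto
    then show ?thesis by (simp add: c_def \<epsilon>_def power_mult_distrib)
  qed
  have t3: "4 * c\<^sup>2 / n \<le> 36 * C\<^sup>2 * rate"
  proof -
    have "36 * C\<^sup>2 * (1 / n) \<le> 36 * C\<^sup>2 * rate" using inv_n by (intro mult_left_mono) auto
    then show ?thesis by (simp add: c_def power_mult_distrib)
  qed
  have t4: "\<bar>2 * main_term p (q p) (q p) - v\<bar> \<le> 28 * c_hi\<^sup>2 * Lh * rate"
    using main_term_approx[OF p] mult_left_mono[OF r(1), of "28 * c_hi\<^sup>2 * Lh"] Lh(1) unfolding v(1) by simp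
  have t5: "p * \<delta> * ((real p)\<^sup>2 * (8 + 4 * (a + b + e) / n) + v) \<le> (8 + 4 * \<kappa> + v) * rate"
  proof -
    have d: "\<delta> = 1 / real n ^ 5"
    proof -
      have "\<delta> = inverse (exp (ln n) ^ 5)" by (simp add: \<delta>_def exp_minus exp_of_nat_mult[symmetric])
      then show ?thesis using P by (simp add: inverse_eq_divide)
    qed
    have "real p ^ 3 \<le> real n ^ 3" using pn by (intro power_mono) auto
    \<comment> \<open>For p <= n the product is at most n^3 / n^5, which even leaves a factor 1 / n
      to spare.\<close>
    then have pd3: "p * \<delta> * (real p)\<^sup>2 \<le> 1 / real n"
    proof -
      have "p * \<delta> * (real p)\<^sup>2 = real p ^ 3 / real n ^ 5" by (simp add: d power2_eq_square power3_eq_cube)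
      also have "\<dots> \<le> real n ^ 3 / real n ^ 5" using \<open>real p ^ 3 \<le> real n ^ 3\<close> by (intro divide_right_mono) auto
      also have "\<dots> = 1 / real n * (1 / real n)" 
      proof -
        have "real n ^ 5 = real n ^ 3 * (real n * real n)" using power_add[of "real n" 3 2] by (simp add: power2_eq_square)
        then show ?thesis using P by simp
      qed
      also have "\<dots> \<le> 1 / real n" using n by (intro mult_left_le) auto
      finally show ?thesis .
    qed
    have pd1: "p * \<delta> \<le> 1 / real n"
    proof -
      have "1 \<le> (real p)\<^sup>2" using P1 by simp
      then have "p * \<delta> * 1 \<le> p * \<delta> * (real p)\<^sup>2" by (intro mult_left_mono) (auto simp: \<delta>_def)
      then show ?thesis using pd3 by simp
    qed
    have abe_r: "(a + b + e) / n \<le> \<kappa> * rate"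
    proof -
      have "a \<le> p * a" using P1 abe by (simp add: mult_le_cancel_right1)
      then have "(a + b + e) / n \<le> (p * a + b + e) / n" by (intro divide_right_mono) auto
      then show ?thesis using r(3) by linarith
    qed
    have "p * \<delta> * ((real p)\<^sup>2 * (8 + 4 * (a + b + e) / n) + v)
      = 8 * (p * \<delta> * (real p)\<^sup>2) + 4 * ((p * \<delta> * (real p)\<^sup>2) * ((a + b + e) / n)) + v * (p * \<delta>)"
      by (simp add: algebra_simps)
    also have "\<dots> \<le> 8 * rate + 4 * (1 * (\<kappa> * rate)) + v * rate"
    proof (intro add_mono mult_left_mono mult_mono)
      show "p * \<delta> * (real p)\<^sup>2 \<le> rate" using pd3 inv_n by linarith
      show "p * \<delta> * (real p)\<^sup>2 \<le> 1" using pd3 n divide_le_eq_1[of 1 "real n"] by linarith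
      show "p * \<delta> \<le> rate" using pd1 inv_n by linarith
    qed (use abe_r v abe P in auto)
    finally show ?thesis by (simp add: algebra_simps)
  qed
  have "(4 * c * (p * a + b * c) + 4 * c\<^sup>2 * e) / n + 208 * c\<^sup>2 * \<epsilon> + 4 * c\<^sup>2 / n + \<bar>2 * main_term p (q p) (q p) - v\<bar>
      + p * \<delta> * ((real p)\<^sup>2 * (8 + 4 * (a + b + e) / n) + v)
    \<le> (36 * C\<^sup>2 * \<kappa> + 1872 * C\<^sup>2 * K + 36 * C\<^sup>2 + 28 * c_hi\<^sup>2 * Lh + 8 + 4 * \<kappa> + v) * rate"
    using t1 t2 t3 t4 t5 unfolding distrib_right by linarith
  moreover have "0 \<le> 4 / v" using v(2) by simp
  ultimately show ?thesis using order_trans[OF bound mult_left_mono] by (simp only: mult.assoc)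
qed

text \<open>Each of the at most n bins fails with probability at most n^(-2) from above and e n^(-2)
  from below, and (1 + e) / n <= 4 / n. The lower bound uses that the assumption \<open>lo\<close>
  makes the expected count of a bin at least 6 ln n, so a third of it is 2 ln n.\<close>

lemma data_event:
  fixes C K \<epsilon> :: real and p n :: nat
  assumes C: "C = c_hi + 1" and K: "K = sqrt (1920 * C)"
    and n: "1 \<le> ln (real n)" and pn: "p \<le> n" and p: "p \<ge> 1"
  defines "\<epsilon> \<equiv> K * sqrt (p * ln n / n)"
  assumes \<epsilon>C: "\<epsilon> \<le> C" and lo: "p * ln n / n \<le> c_lo / 6"
  obtains E where "E \<in> sets (sampling_law f0 n)" "emeasure (sampling_law f0 n) E \<le> ennreal (4 / n)"
    "\<forall>X\<in>space (sampling_law f0 n) - E. (\<forall>i\<in>{1..n}. X i \<in> {0..1}) \<longrightarrow>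
      (\<forall>i\<in>{1..p}. bin_freq p n X i \<le> q p i + \<epsilon> / p \<and> 2 \<le> n * bin_freq p n X i)"
proof -
  let ?P = "sampling_law f0 n"
  define U where "U i = {X \<in> space ?P. n * measure \<mu>0 (bin p i) + n * \<epsilon> / p < cnt n (bin p i) X}" for i
  define V where "V i = {X \<in> space ?P. cnt n (bin p i) X < 2}" for i
  have C1: "C \<ge> 1" using C c_hi_pos by simp
  have n0: "n \<ge> 1" using n by (cases n) auto
  have P: "real p > 0" "real n > 0" using p n0 by auto
  have x0: "0 \<le> p * ln n / n" using n P by simp
  have K0: "K > 0" using K C1 by simp
  have \<epsilon>0: "0 \<le> \<epsilon>" using K0 x0 by (simp add: \<epsilon>_def)
  have \<epsilon>2: "n / p * \<epsilon>\<^sup>2 = 1920 * C * ln n"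
    using K C1 x0 P by (simp add: \<epsilon>_def power_mult_distrib real_sqrt_pow2)
  have e2: "exp (- (2 * ln n)) = 1 / real n * (1 / real n)"
  proof -
    have "exp (- (2 * ln n)) = inverse (exp (ln n) * exp (ln n))" unfolding exp_add[symmetric] by (simp add: exp_minus)
    then show ?thesis using P by (simp add: inverse_eq_divide)
  qed
  have [measurable]: "U i \<in> sets ?P" "V i \<in> sets ?P" for i
    unfolding U_def V_def using cnt_meas[OF bin_measurable, of n p i] by measurable
  have U: "emeasure ?P (U i) \<le> ennreal (exp (- (2 * ln n)))" if i: "i \<in> {1..p}" for i
  proof -
    \<comment> \<open>This minimises the exponent (n / p) (C l^2 - l \<epsilon>). The minimum is -
      480 ln n, well below the required - 2 ln n, because \<open>K\<close> is dictated by the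
      posterior tail.\<close>
    define l where "l = \<epsilon> / (2 * C)"
    have l: "0 \<le> l" "l \<le> 1" using \<epsilon>0 \<epsilon>C C1 by (auto simp: l_def)
    have "emeasure ?P (U i) \<le> ennreal (exp (n * measure \<mu>0 (bin p i) * l\<^sup>2 - l * (n * \<epsilon> / p)))"
      unfolding U_def by (rule cnt_upper[OF bin_measurable l])
    also have "\<dots> \<le> ennreal (exp (- (2 * ln n)))"
    proof (intro ennreal_leI, subst exp_le_cancel_iff)
      have "n * measure \<mu>0 (bin p i) = n / p * (p * q p i)" using P by (simp add: q_def)
      also have "\<dots> \<le> n / p * C" using q_bounds(2)[OF i] C by (intro mult_left_mono) auto
      finally have "n * measure \<mu>0 (bin p i) * l\<^sup>2 \<le> n / p * C * l\<^sup>2" by (intro mult_right_mono) auto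
      also have "\<dots> = (n / p * \<epsilon>\<^sup>2) / (4 * C)" using C1 by (simp add: l_def power2_eq_square field_simps)
      finally have "n * measure \<mu>0 (bin p i) * l\<^sup>2 \<le> 480 * ln n" unfolding \<epsilon>2 using C1 by simp
      moreover have "l * (n * \<epsilon> / p) = (n / p * \<epsilon>\<^sup>2) / (2 * C)" by (simp add: l_def power2_eq_square mult_ac)
      then have "l * (n * \<epsilon> / p) = 960 * ln n" unfolding \<epsilon>2 using C1 by simp
      ultimately show "n * measure \<mu>0 (bin p i) * l\<^sup>2 - l * (n * \<epsilon> / p) \<le> - (2 * ln n)" using n by linarith
    qed
    finally show ?thesis .
  qed
  have V: "emeasure ?P (V i) \<le> ennreal (exp 1 * exp (- (2 * ln n)))" if i: "i \<in> {1..p}" for i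
  proof -
    have "emeasure ?P (V i) \<le> ennreal (exp (1 - n * measure \<mu>0 (bin p i) / 3))"
      unfolding V_def by (rule cnt_lower[OF bin_measurable])
    also have "\<dots> \<le> ennreal (exp 1 * exp (- (2 * ln n)))"
      unfolding exp_add[symmetric]
    proof (intro ennreal_leI, subst exp_le_cancel_iff)
      have "6 * ln n \<le> n / p * c_lo" using lo P by (simp add: field_simps)
      also have "\<dots> \<le> n / p * (p * q p i)" using q_bounds(1)[OF i] by (intro mult_left_mono) auto
      also have "\<dots> = n * measure \<mu>0 (bin p i)" using P by (simp add: q_def)
      finally show "1 - n * measure \<mu>0 (bin p i) / 3 \<le> 1 + - (2 * ln n)" by simp
    qed
    finally show ?thesis .
  qed
  define E where "E = (\<Union>i\<in>{1..p}. U i) \<union> (\<Union>i\<in>{1..p}. V i)"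
  show thesis
  proof (rule that[of E])
    show "E \<in> sets ?P" unfolding E_def by measurable
    have "emeasure ?P E \<le> emeasure ?P (\<Union>i\<in>{1..p}. U i) + emeasure ?P (\<Union>i\<in>{1..p}. V i)"
      unfolding E_def by (rule emeasure_subadditive) measurable
    also have "\<dots> \<le> (\<Sum>i\<in>{1..p}. emeasure ?P (U i)) + (\<Sum>i\<in>{1..p}. emeasure ?P (V i))"
      by (intro add_mono emeasure_subadditive_finite) auto
    also have "\<dots> \<le> (\<Sum>i\<in>{1..p}. ennreal (exp (- (2 * ln n)))) + (\<Sum>i\<in>{1..p}. ennreal (exp 1 * exp (- (2 * ln n))))"
      by (intro add_mono sum_mono U V)
    also have "\<dots> = ennreal (p * (exp (- (2 * ln n))) + p * (exp 1 * exp (- (2 * ln n))))"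
      by (simp add: ennreal_of_nat_eq_real_of_nat ennreal_mult[symmetric] ennreal_plus[symmetric] del: ennreal_plus)
    also have "\<dots> \<le> ennreal (4 / n)"
    proof (rule ennreal_leI)
      have "p * (exp (- (2 * ln n))) + p * (exp 1 * exp (- (2 * ln n))) = (1 + exp 1) * (p * (1 / n) * (1 / n))"
        unfolding e2 by (simp add: distrib_right add_divide_distrib)
      also have "\<dots> \<le> 4 * (1 * (1 / n))"
        using exp_le pn P by (intro mult_mono) auto
      finally show "p * (exp (- (2 * ln n))) + p * (exp 1 * exp (- (2 * ln n))) \<le> 4 / n" by simp
    qed
    finally show "emeasure ?P E \<le> ennreal (4 / n)" .
    show "\<forall>X\<in>space ?P - E. (\<forall>i\<in>{1..n}. X i \<in> {0..1}) \<longrightarrow>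
      (\<forall>i\<in>{1..p}. bin_freq p n X i \<le> q p i + \<epsilon> / p \<and> 2 \<le> n * bin_freq p n X i)"
    proof (intro ballI impI)
      fix X i assume X: "X \<in> space ?P - E" "\<forall>i\<in>{1..n}. X i \<in> {0..1}" and i: "i \<in> {1..p}"
      have cb: "cnt n (bin p i) X = n * bin_freq p n X i" by (rule cnt_bin[OF i n0]) (use X in auto)
      have "\<not> n * q p i + n * \<epsilon> / p < n * bin_freq p n X i" "\<not> n * bin_freq p n X i < 2"
        using X(1) i unfolding E_def U_def V_def cb[symmetric] q_def by auto
      moreover have "n * q p i + n * \<epsilon> / p = n * (q p i + \<epsilon> / p)" by (simp add: distrib_left)
      ultimately show "bin_freq p n X i \<le> q p i + \<epsilon> / p \<and> 2 \<le> n * bin_freq p n X i"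
        using P by (simp add: not_less)
    qed
  qed
qed

text \<open>One constant \<open>Kf\<close> serves every tolerance, because the exceptional data have
  probability at most 4 / n. The model is demanded only for data with at least two observations in
  each bin, which is what the Dirichlet posterior can offer.\<close>

lemma bigo_prob_posterior:
  fixes p :: "nat \<Rightarrow> nat" and a b e rate :: "nat \<Rightarrow> real" and D :: "nat \<Rightarrow> (nat \<Rightarrow> real) \<Rightarrow> real" and \<kappa> v :: real
  assumes v: "v = asymp_variance f0" "v > 0" and p: "\<And>n. p n \<ge> 1" and \<kappa>: "0 \<le> \<kappa>"
    and x_lim: "(\<lambda>n. p n * ln n / n) \<longlonglongrightarrow> 0"
    and a_lim: "(\<lambda>n. a n * sqrt (p n) / sqrt n) \<longlonglongrightarrow> 0"
    and b: "\<forall>\<^sub>F n in sequentially. b n \<le> \<kappa> * p n"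
    and rate: "\<forall>\<^sub>F n in sequentially. real (p n) powr (- s) \<le> rate n \<and> sqrt (p n * ln n / n) \<le> rate n
      \<and> (p n * a n + b n + e n) / n \<le> \<kappa> * rate n"
    and model: "\<forall>\<^sub>F n in sequentially. AE X in sampling_law f0 n. (\<forall>i\<in>{1..n}. X i \<in> {0..1}) \<longrightarrow>
      (\<forall>i\<in>{1..p n}. 2 \<le> n * bin_freq (p n) n X i) \<longrightarrow>
      (\<exists>(Q :: 'b measure) W R R'. stein_model Q (p n) n W (bin_freq (p n) n X) R R' (a n) (b n) (e n) \<and>
        D n X = d_BL (distr Q borel (\<lambda>x. stein_model.Zfun (p n) n (bin_freq (p n) n X) R (W x))) (normal_law 0 v))"
  shows "bigo_prob (sampling_law f0) D rate"
proof -
  define C where "C = c_hi + 1"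
  define K where "K = sqrt (1920 * C)"
  define Kf where "Kf = 4 / v * (36 * C\<^sup>2 * \<kappa> + 1872 * C\<^sup>2 * K + 36 * C\<^sup>2 + 28 * c_hi\<^sup>2 * Lh + 8 + 4 * \<kappa> + v)"
  define T where "T = max 16 (12 * \<kappa> * C)"
  have C1: "C \<ge> 1" using C_def c_hi_pos by simp
  have K0: "K > 0" using C1 by (simp add: K_def)
  have T0: "T > 0" by (simp add: T_def)
  \<comment> \<open>One threshold for x = p ln n / n collects all smallness conditions, in this
    order: \<epsilon> <= C, the lower bound \<open>T\<close> on n \<epsilon> / p, the condition of
    \<open>data_event\<close>, p <= n, and b < n.\<close>
  define \<eta> where "\<eta> = Min {(C / K)\<^sup>2, (K / T)\<^sup>2, c_lo / 6, 1, 1 / (\<kappa> + 1)}"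
  have \<eta>0: "\<eta> > 0" using C1 K0 T0 c(1) \<kappa> by (simp add: \<eta>_def)
  have e1: "\<forall>\<^sub>F n in sequentially. 1 \<le> ln (real n)" by real_asymp
  have e2: "\<forall>\<^sub>F n in sequentially. p n * ln n / n < \<eta>" by (rule order_tendstoD(2)[OF x_lim \<eta>0])
  have e3: "\<forall>\<^sub>F n in sequentially. a n * sqrt (p n) / sqrt n < K / 4"
    by (rule order_tendstoD(2)[OF a_lim]) (use K0 in simp)
  show ?thesis
    unfolding bigo_prob_def
  proof (intro allI impI exI[of _ Kf])
    fix \<epsilon>' :: real assume "\<epsilon>' > 0"
    then have e4: "\<forall>\<^sub>F n in sequentially. 4 / real n \<le> \<epsilon>'" by real_asymp
    show "\<forall>\<^sub>F n in sequentially. outer_measure_of (sampling_law f0 n) {X \<in> space (sampling_law f0 n). \<bar>D n X\<bar> > Kf * rate n} \<le> ennreal \<epsilon>'"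
      using e1 e2 e3 e4 b rate model
    proof eventually_elim
      case (elim n)
      define x where "x = p n * ln n / n"
      define \<epsilon> where "\<epsilon> = K * sqrt x"
      have n1: "n \<ge> 1" using elim(1) by (cases n) auto
      have P: "real (p n) \<ge> 1" "real n > 0" using p[of n] n1 by auto
      have x: "x < (C / K)\<^sup>2" "x < (K / T)\<^sup>2" "x < c_lo / 6" "x < 1" "x < 1 / (\<kappa> + 1)" "x > 0"
      proof -
        have "x < \<eta>" using elim(2) by (simp add: x_def)
        then show "x < (C / K)\<^sup>2" "x < (K / T)\<^sup>2" "x < c_lo / 6" "x < 1" "x < 1 / (\<kappa> + 1)"
          by (simp_all add: \<eta>_def)
        have "0 < ln (real n)" using elim(1) by linarith
        then show "x > 0" using P unfolding x_def by (intro divide_pos_pos mult_pos_pos) linarith+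
      qed
      have px: "real (p n) \<le> x * n"
        using mult_left_mono[OF elim(1), of "real (p n)"] P by (simp add: x_def)
      also have "x * n \<le> 1 * real n" using x(4) by (intro mult_right_mono) auto
      finally have pn: "p n \<le> n" by simp
      have \<epsilon>C: "\<epsilon> \<le> C"
      proof -
        have "sqrt x \<le> sqrt ((C / K)\<^sup>2)" using x(1) by (intro real_sqrt_le_mono) simp
        then have "sqrt x \<le> C / K" using C1 K0 by simp
        then show ?thesis using K0 by (simp add: \<epsilon>_def field_simps)
      qed
      have np: "n / p n = ln n / x"
      proof -
        have "N / w = l / (w * l / N)" if "l > 0" "w > 0" "N > 0" for l w N :: real
          using that by simp
        from this[of "ln n" "real (p n)" "real n"] show ?thesis using elim(1) P unfolding x_def by linarith
      qed
      have T: "T \<le> n * \<epsilon> / p n"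
      proof -
        have "sqrt x \<le> sqrt ((K / T)\<^sup>2)" using x(2) by (intro real_sqrt_le_mono) simp
        then have "sqrt x \<le> K / T" using K0 T0 by simp
        then have "T \<le> K / sqrt x" using T0 x(6) by (simp add: field_simps)
        also have "\<dots> = K * sqrt x * (1 / x)" using x(6) by (simp add: field_simps)
        also have "\<dots> \<le> K * sqrt x * (ln n / x)"
          using elim(1) x(6) K0 by (intro mult_left_mono divide_right_mono) auto
        also have "\<dots> = n * \<epsilon> / p n" unfolding np[symmetric] by (simp add: \<epsilon>_def)
        finally show ?thesis .
      qed
      \<comment> \<open>Here n \<epsilon> / p equals K sqrt(n ln n / p), so a bound K / 4 on a
        sqrt(p / n) is enough once ln n >= 1.\<close>
      have a4: "a n \<le> n * \<epsilon> / (4 * p n)"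
      proof -
        have sp: "sqrt (p n) > 0" "sqrt n > 0" using P by auto
        have "a n \<le> K / 4 * (sqrt n / sqrt (p n))"
          using elim(3) sp by (simp add: field_simps)
        also have "\<dots> \<le> K / 4 * (sqrt (ln n) * (sqrt n / sqrt (p n)))"
        proof (rule mult_left_mono)
          have "1 \<le> sqrt (ln n)" using elim(1) by (rule real_le_rsqrt[OF order_trans[OF eq_refl[OF power_one]]])
          from mult_right_mono[OF this, of "sqrt n / sqrt (p n)"]
          show "sqrt n / sqrt (p n) \<le> sqrt (ln n) * (sqrt n / sqrt (p n))" using sp by simp
        qed (use K0 in simp)
        also have "\<dots> = n * \<epsilon> / (4 * p n)"
        proof -
          define u w l where "u = sqrt n" and "w = sqrt (p n)" and "l = sqrt (ln n)"
          have "real n = u * u" "real (p n) = w * w" "u > 0" "w > 0" using P by (auto simp: u_def w_def)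
          moreover have "sqrt x = w * l / u" by (simp add: x_def u_def w_def l_def real_sqrt_mult real_sqrt_divide)
          ultimately show ?thesis
            unfolding \<epsilon>_def u_def[symmetric] w_def[symmetric] l_def[symmetric] by (simp add: field_simps)
        qed
        finally show ?thesis .
      qed
      have bn: "b n < n"
      proof -
        have "b n \<le> \<kappa> * (x * n)" using elim(5) mult_left_mono[OF px \<kappa>] by linarith
        also have "\<dots> < 1 * real n"
        proof -
          have "\<kappa> * x \<le> \<kappa> * (1 / (\<kappa> + 1))" using x(5) \<kappa> by (intro mult_left_mono) auto
          also have "\<dots> < 1" using \<kappa> by (simp add: field_simps)
          finally show ?thesis using P by (simp add: mult.assoc[symmetric])
        qed
        finally show ?thesis by simp
      qed
      note \<epsilon>' = \<epsilon>_def[unfolded x_def]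
      obtain E where E: "E \<in> sets (sampling_law f0 n)" "emeasure (sampling_law f0 n) E \<le> ennreal (4 / n)"
        "\<forall>X\<in>space (sampling_law f0 n) - E. (\<forall>i\<in>{1..n}. X i \<in> {0..1}) \<longrightarrow>
          (\<forall>i\<in>{1..p n}. bin_freq (p n) n X i \<le> q (p n) i + \<epsilon> / p n \<and> 2 \<le> n * bin_freq (p n) n X i)"
        by (rule data_event[OF C_def K_def elim(1) pn p[of n], folded \<epsilon>', OF \<epsilon>C less_imp_le[OF x(3)[unfolded x_def]]])
      have "AE X in sampling_law f0 n. X \<notin> E \<longrightarrow> \<bar>D n X\<bar> \<le> Kf * rate n"
        using AE_sample elim(7) AE_space
      proof eventually_elim
        case (elim X)
        show ?case
        proof
          assume X: "X \<notin> E"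
          note E3 = E(3)[rule_format, OF DiffI[OF elim(3) X] elim(1)[rule_format]]
          have "\<forall>i\<in>{1..p n}. 2 \<le> n * bin_freq (p n) n X i" using E3 by blast
          then obtain Q :: "'b measure" and W R R' where M: "stein_model Q (p n) n W (bin_freq (p n) n X) R R' (a n) (b n) (e n)"
            and D: "D n X = d_BL (distr Q borel (\<lambda>x. stein_model.Zfun (p n) n (bin_freq (p n) n X) R (W x))) (normal_law 0 v)"
            using elim(1,2) by blast
          show "\<bar>D n X\<bar> \<le> Kf * rate n"
            unfolding D Kf_def
          proof (rule d_BL_le_rate[OF M v C_def K_def _ pn, folded \<epsilon>'])
            show "16 \<le> n * \<epsilon> / p n" "12 * \<kappa> * C \<le> n * \<epsilon> / p n" using T by (auto simp: T_def)
          qed (use \<open>1 \<le> ln n\<close> \<open>b n \<le> \<kappa> * p n\<close> \<epsilon>C a4 bn \<kappa> E3 rate \<open>real (p n) powr (- s) \<le> rate n \<and> sqrt (p n * ln n / n) \<le> rate n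
      \<and> (p n * a n + b n + e n) / n \<le> \<kappa> * rate n\<close> in auto)
        qed
      qed
      \<comment> \<open>The distance is not known to be measurable as a function of the data. Its
        exceedance event is therefore covered by \<open>E\<close> and a null set \<open>N\<close>,
        and only the outer measure is estimated.\<close>
      then obtain N where N: "{X \<in> space (sampling_law f0 n). \<not> (X \<notin> E \<longrightarrow> \<bar>D n X\<bar> \<le> Kf * rate n)} \<subseteq> N"
        "emeasure (sampling_law f0 n) N = 0" "N \<in> sets (sampling_law f0 n)"
        by (rule AE_E)
      have "outer_measure_of (sampling_law f0 n) {X \<in> space (sampling_law f0 n). \<bar>D n X\<bar> > Kf * rate n}
        \<le> outer_measure_of (sampling_law f0 n) (E \<union> N)"
        by (rule outer_measure_of_mono) (use N(1) in auto)
      also have "\<dots> = emeasure (sampling_law f0 n) (E \<union> N)" using E(1) N(3) by (intro outer_measure_of_eq) auto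
      also have "\<dots> \<le> emeasure (sampling_law f0 n) E + emeasure (sampling_law f0 n) N"
        using E(1) N(3) by (rule emeasure_subadditive)
      also have "\<dots> \<le> ennreal (4 / n)" using E(2) N(2) by simp
      also have "\<dots> \<le> ennreal \<epsilon>'" using elim(4) by (rule ennreal_leI)
      finally show ?case .
    qed
  qed
qed

end

section \<open>Passage to the limit and the two priors\<close>

lemma tends_to_0_probI:
  assumes "bigo_prob P Y r" "r \<longlonglongrightarrow> 0"
  shows "tends_to_0_prob P Y"
  unfolding tends_to_0_prob_def
proof (intro allI impI)
  fix \<delta> :: real assume \<delta>: "\<delta> > 0"
  show "(\<lambda>n. outer_measure_of (P n) {x \<in> space (P n). \<bar>Y n x\<bar> > \<delta>}) \<longlonglongrightarrow> 0"
  proof (rule order_tendstoI)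
    fix a :: ennreal assume "0 < a"
    \<comment> \<open>The bound \<open>a\<close> may be infinite and the inequality to prove is
      strict; an intermediate value settles both.\<close>
    from dense[OF this] obtain \<epsilon>' where \<epsilon>': "0 < \<epsilon>'" "\<epsilon>' < a" by blast
    obtain \<epsilon> where \<epsilon>: "\<epsilon>' = ennreal \<epsilon>" "0 < \<epsilon>"
    proof (cases \<epsilon>')
      case (real r)
      then show ?thesis using \<epsilon>'(1) that[of r] by simp
    next
      case top
      then show ?thesis using \<epsilon>'(2) by simp
    qed
    obtain K where K: "\<forall>\<^sub>F n in sequentially. outer_measure_of (P n) {x \<in> space (P n). \<bar>Y n x\<bar> > K * r n} \<le> ennreal \<epsilon>"
      using assms(1) \<epsilon>(2) unfolding bigo_prob_def by blast
    have "(\<lambda>n. K * r n) \<longlonglongrightarrow> K * 0" by (intro tendsto_intros assms(2))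
    then have "\<forall>\<^sub>F n in sequentially. K * r n < \<delta>" using \<delta> by (intro order_tendstoD) auto
    then show "\<forall>\<^sub>F n in sequentially. outer_measure_of (P n) {x \<in> space (P n). \<bar>Y n x\<bar> > \<delta>} < a"
      using K
    proof eventually_elim
      case (elim n)
      have "outer_measure_of (P n) {x \<in> space (P n). \<bar>Y n x\<bar> > \<delta>} \<le> outer_measure_of (P n) {x \<in> space (P n). \<bar>Y n x\<bar> > K * r n}"
        by (rule outer_measure_of_mono) (use elim(1) in auto)
      also have "\<dots> \<le> \<epsilon>'" using elim(2) \<epsilon>(1) by simp
      finally show ?case using \<epsilon>'(2) by (rule le_less_trans)
    qed
  qed simp
qed

text \<open>The third claim absorbs the prior corrections of order p / n: with x = p ln n / n below
  1 and ln n >= 1 one has p / n <= x <= sqrt x.\<close>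

lemma much_less_rates:
  assumes s: "0 < s" and p: "\<And>n. p n \<ge> (1::nat)" and p1: "(\<lambda>_. 1) \<lless> (\<lambda>n. real (p n))"
    and pn: "(\<lambda>n. real (p n)) \<lless> (\<lambda>n. real n / ln (real n))"
  shows "(\<lambda>n. p n * ln n / n) \<longlonglongrightarrow> 0"
    and "(\<lambda>n. real (p n) powr (- s) + sqrt (real (p n) * ln (real n) / real n)) \<longlonglongrightarrow> 0"
    and "\<forall>\<^sub>F n in sequentially. p n / n \<le> sqrt (real (p n) * ln (real n) / real n)"
proof -
  show x: "(\<lambda>n. p n * ln n / n) \<longlonglongrightarrow> 0" using pn by (simp add: much_less_def)
  have "(\<lambda>n. (1 / real (p n)) powr s) \<longlonglongrightarrow> 0 powr s"
    using p1 s by (intro tendsto_powr2 tendsto_const) (auto simp: much_less_def)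
  moreover have "(1 / real (p n)) powr s = real (p n) powr (- s)" for n
    using p[of n] by (simp add: powr_divide powr_minus_divide)
  ultimately have "(\<lambda>n. real (p n) powr (- s)) \<longlonglongrightarrow> 0" by simp
  from tendsto_add[OF this tendsto_real_sqrt[OF x]]
  show "(\<lambda>n. real (p n) powr (- s) + sqrt (real (p n) * ln (real n) / real n)) \<longlonglongrightarrow> 0" by simp
  have "\<forall>\<^sub>F n in sequentially. p n * ln n / n < 1" by (rule order_tendstoD(2)[OF x]) simp
  moreover have "\<forall>\<^sub>F n in sequentially. 1 \<le> ln (real n)" by real_asymp
  ultimately show "\<forall>\<^sub>F n in sequentially. p n / n \<le> sqrt (real (p n) * ln (real n) / real n)"
  proof eventually_elim
    case (elim n)
    define x where "x = p n * ln n / n"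
    have "0 \<le> x" using elim(2) by (simp add: x_def)
    then have "x * x \<le> x" using elim(1) by (intro mult_left_le) (simp_all add: x_def)
    then have "x \<le> sqrt x" by (intro real_le_rsqrt) (simp add: power2_eq_square)
    moreover have "p n / n \<le> x"
      using mult_left_mono[OF elim(2), of "real (p n)"] by (simp add: x_def divide_right_mono)
    ultimately show ?case by (simp add: x_def)
  qed
qed

lemma bigo_prob_series:
  fixes f0 :: "real \<Rightarrow> real" and s c_lo c_hi Lh v B :: real and J p :: "nat \<Rightarrow> nat" and \<sigma> :: "nat \<Rightarrow> nat \<Rightarrow> real"
  assumes D: "density_setting f0 s c_lo c_hi Lh" and v: "v = asymp_variance f0" "v > 0"
    and p: "\<And>n. p n = 2 ^ (J n + 1)" and p_lim: "(\<lambda>_. 1) \<lless> (\<lambda>n. real (p n))" "(\<lambda>n. real (p n)) \<lless> (\<lambda>n. real n / ln (real n))"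
    and \<sigma>: "\<And>n j. n \<ge> 1 \<Longrightarrow> j \<le> J n \<Longrightarrow> \<sigma> n j > 0"
    and H: "\<And>x. H differentiable (at x)" "\<And>x. deriv H differentiable (at x)"
    and B: "\<And>x. \<bar>deriv H x\<bar> \<le> B" "\<And>x. \<bar>deriv (deriv H) x\<bar> \<le> B"
  defines "\<sigma>_min \<equiv> \<lambda>n. Min (\<sigma> n ` {0..J n})"
  defines "rate \<equiv> \<lambda>n. real (p n) powr (- s) + sqrt (real (p n) * ln (real n) / real n) + 1 / (real n * (\<sigma>_min n)\<^sup>2)"
  assumes \<sigma>_lim: "(\<lambda>n. real n powr (- 1 / 2)) \<lless> \<sigma>_min"
    and fin: "\<And>n. n \<ge> 1 \<Longrightarrow> AE X in sampling_law f0 n. evidence (series_prior (J n) H (\<sigma> n)) (series_density (J n)) n X < \<infinity>"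
  shows "bigo_prob (sampling_law f0)
     (\<lambda>n X. d_BL (distr (posterior (series_prior (J n) H (\<sigma> n)) (series_density (J n)) n X) borel
        (\<lambda>\<theta>. sqrt (real n) * (series_functional (J n) H (\<sigma> n) n X (series_density (J n) \<theta>) - centring (J n) n X))) (normal_law 0 v)) rate"
    and "rate \<longlonglongrightarrow> 0"
proof -
  interpret D: density_setting f0 s c_lo c_hi Lh by fact
  have p1: "p n \<ge> 1" for n by (simp add: p)
  note rates = much_less_rates[OF D.s p1 p_lim]
  have B0: "0 \<le> B" using B(1)[of 0] by linarith
  have sm: "\<sigma>_min n > 0" "\<And>j. j \<le> J n \<Longrightarrow> \<sigma>_min n \<le> \<sigma> n j" if "n \<ge> 1" for n
    using \<sigma>[OF that] by (auto simp: \<sigma>_min_def)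
  have sq: "real n powr (- 1 / 2) = 1 / sqrt n" if "n \<ge> 1" for n
    using that powr_minus_divide[of "real n" "1 / 2"] by (simp add: powr_half_sqrt)
  have ev1: "\<forall>\<^sub>F n in sequentially. n \<ge> (1::nat)" by (rule eventually_ge_at_top)
  have s_lim: "(\<lambda>n. 1 / (sqrt n * \<sigma>_min n)) \<longlonglongrightarrow> 0"
  proof (rule Lim_transform_eventually)
    show "(\<lambda>n. real n powr (- 1 / 2) / \<sigma>_min n) \<longlonglongrightarrow> 0" using \<sigma>_lim by (simp add: much_less_def)
    show "\<forall>\<^sub>F n in sequentially. real n powr (- 1 / 2) / \<sigma>_min n = 1 / (sqrt n * \<sigma>_min n)"
      using ev1
    proof eventually_elim
      case (elim n)
      show ?case unfolding sq[OF elim] by simp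
    qed
  qed
  have "(\<lambda>n. (1 / (sqrt n * \<sigma>_min n))\<^sup>2) \<longlonglongrightarrow> 0\<^sup>2" by (intro tendsto_intros s_lim)
  then have "(\<lambda>n. 1 / (real n * (\<sigma>_min n)\<^sup>2)) \<longlonglongrightarrow> 0" by (simp add: power_divide power_mult_distrib)
  from tendsto_add[OF rates(2) this] show "rate \<longlonglongrightarrow> 0" by (simp add: rate_def)
  show "bigo_prob (sampling_law f0)
     (\<lambda>n X. d_BL (distr (posterior (series_prior (J n) H (\<sigma> n)) (series_density (J n)) n X) borel
        (\<lambda>\<theta>. sqrt (real n) * (series_functional (J n) H (\<sigma> n) n X (series_density (J n) \<theta>) - centring (J n) n X))) (normal_law 0 v)) rate"
  \<comment> \<open>For this prior the score is bounded by \<open>a\<close> alone, so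
    \<open>b\<close> is 0. Multiplied by sqrt(p / n), \<open>a\<close> becomes a multiple of 1 /
    (sqrt n \<sigma>_min), which tends to 0 by the assumption on the scales.\<close>
  proof (rule D.bigo_prob_posterior[where 'b="nat \<times> nat \<Rightarrow> real" and p=p and \<kappa>="3 * B" and a="\<lambda>n. 4 * B / (\<sigma>_min n * sqrt (p n))"
        and b="\<lambda>_. 0" and e="\<lambda>n. B / (\<sigma>_min n)\<^sup>2", OF v p1 _ rates(1)])
    show "(\<lambda>n. 4 * B / (\<sigma>_min n * sqrt (p n)) * sqrt (p n) / sqrt n) \<longlonglongrightarrow> 0"
    proof -
      have "(\<lambda>n. 4 * B * (1 / (sqrt n * \<sigma>_min n))) \<longlonglongrightarrow> 4 * B * 0" by (intro tendsto_intros s_lim)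
      moreover have "4 * B / (\<sigma>_min n * sqrt (p n)) * sqrt (p n) / sqrt n = 4 * B * (1 / (sqrt n * \<sigma>_min n))" for n
        using p1[of n] by simp
      ultimately show ?thesis by simp
    qed
    show "\<forall>\<^sub>F n in sequentially. real (p n) powr (- s) \<le> rate n \<and> sqrt (p n * ln n / n) \<le> rate n
      \<and> (p n * (4 * B / (\<sigma>_min n * sqrt (p n))) + 0 + B / (\<sigma>_min n)\<^sup>2) / n \<le> 3 * B * rate n"
      using ev1 rates(3)
    proof eventually_elim
      case (elim n)
      \<comment> \<open>In these terms p a + e is B (4 w \<tau> + \<tau>^2). The inequality 2 w
        \<tau> <= w^2 + \<tau>^2 bounds it by 3 B (p + \<tau>^2), whence \<kappa> = 3 B; divided by
        n, the two parts match the terms p / n and 1 / (n \<sigma>_min^2).\<close>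
      define w \<tau> where "w = sqrt (p n)" and "\<tau> = 1 / \<sigma>_min n"
      have w: "real (p n) = w * w" "w > 0" using p1[of n] by (auto simp: w_def)
      have 0: "0 \<le> real (p n) powr (- s)" "0 \<le> sqrt (p n * ln n / n)" "0 \<le> 1 / (real n * (\<sigma>_min n)\<^sup>2)"
        using elim(1) by auto
      have "p n * (4 * B / (\<sigma>_min n * sqrt (p n))) + 0 + B / (\<sigma>_min n)\<^sup>2 = B * (4 * (w * \<tau>) + \<tau> * \<tau>)"
        unfolding w_def[symmetric] w(1) using w(2) by (simp add: \<tau>_def power2_eq_square field_simps)
      also have "\<dots> \<le> B * (3 * (p n + \<tau> * \<tau>))"
      proof (rule mult_left_mono[OF _ B0])
        have lin: "4 * a + c \<le> 3 * (b + c)" if "0 \<le> b - 2 * a + c" "0 < b" for a b c :: real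
          using that by (simp add: algebra_simps)
        have "0 \<le> w * w - 2 * (w * \<tau>) + \<tau> * \<tau>"
          using zero_le_square[of "w - \<tau>"] by (simp add: algebra_simps)
        then show "4 * (w * \<tau>) + \<tau> * \<tau> \<le> 3 * (p n + \<tau> * \<tau>)"
          unfolding w(1) using mult_pos_pos[OF w(2) w(2)] lin by blast
      qed
      finally have "(p n * (4 * B / (\<sigma>_min n * sqrt (p n))) + 0 + B / (\<sigma>_min n)\<^sup>2) / n \<le> B * (3 * (p n + \<tau> * \<tau>)) / n"
        by (rule divide_right_mono) simp
      also have "\<dots> = 3 * B * (p n / n + 1 / (real n * (\<sigma>_min n)\<^sup>2))"
        by (simp add: \<tau>_def power2_eq_square add_divide_distrib mult_ac distrib_left)
      also have "\<dots> \<le> 3 * B * rate n"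
        using elim(2) 0 B0 unfolding rate_def by (intro mult_left_mono) linarith+
      finally show ?case using 0 by (auto simp: rate_def)
    qed
    show "\<forall>\<^sub>F n in sequentially. AE X in sampling_law f0 n. (\<forall>i\<in>{1..n}. X i \<in> {0..1}) \<longrightarrow>
      (\<forall>i\<in>{1..p n}. 2 \<le> n * bin_freq (p n) n X i) \<longrightarrow>
      (\<exists>(Q :: (nat \<times> nat \<Rightarrow> real) measure) W R R'. stein_model Q (p n) n W (bin_freq (p n) n X) R R' (4 * B / (\<sigma>_min n * sqrt (p n))) 0 (B / (\<sigma>_min n)\<^sup>2) \<and>
        d_BL (distr (posterior (series_prior (J n) H (\<sigma> n)) (series_density (J n)) n X) borel
        (\<lambda>\<theta>. sqrt (real n) * (series_functional (J n) H (\<sigma> n) n X (series_density (J n) \<theta>) - centring (J n) n X))) (normal_law 0 v)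
        = d_BL (distr Q borel (\<lambda>x. stein_model.Zfun (p n) n (bin_freq (p n) n X) R (W x))) (normal_law 0 v))"
      (is "\<forall>\<^sub>F n in _. AE X in _. ?I n X \<longrightarrow> ?N n X \<longrightarrow> ?E n X")
      using ev1
    proof eventually_elim
      case (elim n)
      from fin[OF elim(1)] show ?case
      proof eventually_elim
        fix X :: "nat \<Rightarrow> real"
        assume ev: "evidence (series_prior (J n) H (\<sigma> n)) (series_density (J n)) n X < \<infinity>"
        show "?I n X \<longrightarrow> ?N n X \<longrightarrow> ?E n X"
        proof (intro impI)
          assume X: "\<forall>i\<in>{1..n}. X i \<in> {0..1}" "\<forall>i\<in>{1..p n}. 2 \<le> n * bin_freq (p n) n X i"
          interpret S: series_setting "J n" n H "\<sigma> n" X B "\<sigma>_min n" "p n"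
            using elim(1) ev X(1) sm[OF elim(1)] H B by unfold_locales (auto simp: p)
          interpret M: stein_model S.post "p n" n S.W "bin_freq (p n) n X" S.R S.R' "4 * B / (\<sigma>_min n * sqrt (p n))" 0 "B / (\<sigma>_min n)\<^sup>2"
            by (rule S.series_stein_model[OF ev])
          show "?E n X"
            using M.stein_model_axioms
            by (intro exI[of _ S.post] exI[of _ S.W] exI[of _ S.R] exI[of _ S.R'] conjI) (simp_all add: S.functional_eq M.Zfun_def)
        qed
      qed
    qed
  qed (use B0 p1 in auto)
qed

lemma bigo_prob_dirichlet:
  fixes f0 :: "real \<Rightarrow> real" and s c_lo c_hi Lh v M :: real and J p :: "nat \<Rightarrow> nat" and m :: "nat \<Rightarrow> nat \<Rightarrow> real"
  assumes D: "density_setting f0 s c_lo c_hi Lh" and v: "v = asymp_variance f0" "v > 0"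
    and p: "\<And>n. p n = 2 ^ (J n + 1)" and p_lim: "(\<lambda>_. 1) \<lless> (\<lambda>n. real (p n))" "(\<lambda>n. real (p n)) \<lless> (\<lambda>n. real n / ln (real n))"
    and m: "\<And>n i. n \<ge> 1 \<Longrightarrow> i \<in> {1..p n} \<Longrightarrow> m n i > 0" and M: "\<forall>\<^sub>F n in sequentially. \<forall>i\<in>{1..p n}. m n i \<le> M" "0 \<le> M"
  defines "rate \<equiv> \<lambda>n. real (p n) powr (- s) + sqrt (real (p n) * ln (real n) / real n)"
  shows "bigo_prob (sampling_law f0)
     (\<lambda>n X. d_BL (distr (posterior (dirichlet_prior (p n) (m n)) (\<lambda>w. histogram (p n) (bin_probs (p n) w)) n X) borel
        (\<lambda>w. sqrt (real n) * (dirichlet_functional (J n) (m n) n X (histogram (p n) (bin_probs (p n) w)) - centring (J n) n X))) (normal_law 0 v)) rate"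
    and "rate \<longlonglongrightarrow> 0"
proof -
  interpret D: density_setting f0 s c_lo c_hi Lh by fact
  have p1: "p n \<ge> 1" for n by (simp add: p)
  note rates = much_less_rates[OF D.s p1 p_lim]
  have ev1: "\<forall>\<^sub>F n in sequentially. n \<ge> (1::nat)" by (rule eventually_ge_at_top)
  show "rate \<longlonglongrightarrow> 0" using rates(2) by (simp add: rate_def)
  have pn: "(\<lambda>n. p n / n) \<longlonglongrightarrow> 0"
  proof (rule Lim_null_comparison)
    show "\<forall>\<^sub>F n in sequentially. norm (p n / n) \<le> sqrt (p n * ln n / n)" using rates(3) by simp
    show "(\<lambda>n. sqrt (p n * ln n / n)) \<longlonglongrightarrow> 0" using tendsto_real_sqrt[OF rates(1)] by simp
  qed
  show "bigo_prob (sampling_law f0)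
     (\<lambda>n X. d_BL (distr (posterior (dirichlet_prior (p n) (m n)) (\<lambda>w. histogram (p n) (bin_probs (p n) w)) n X) borel
        (\<lambda>w. sqrt (real n) * (dirichlet_functional (J n) (m n) n X (histogram (p n) (bin_probs (p n) w)) - centring (J n) n X))) (normal_law 0 v)) rate"
  \<comment> \<open>The value \<kappa> = 4 M is the sum p M + p M + 2 p M of the three prior
    contributions, divided by p.\<close>
  proof (rule D.bigo_prob_posterior[where 'b="nat \<Rightarrow> real" and p=p and \<kappa>="4 * M" and a="\<lambda>n. M" and b="\<lambda>n. p n * M" and e="\<lambda>n. 2 * (p n * M)", OF v p1 _ rates(1)])
    have "(\<lambda>n. M * sqrt (p n / n)) \<longlonglongrightarrow> M * sqrt 0" by (intro tendsto_intros pn)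
    then show "(\<lambda>n. M * sqrt (p n) / sqrt n) \<longlonglongrightarrow> 0" by (simp add: real_sqrt_divide)
    show "\<forall>\<^sub>F n in sequentially. real (p n) powr (- s) \<le> rate n \<and> sqrt (p n * ln n / n) \<le> rate n
      \<and> (p n * M + p n * M + 2 * (p n * M)) / n \<le> 4 * M * rate n"
      using ev1 rates(3)
    proof eventually_elim
      case (elim n)
      have 0: "0 \<le> real (p n) powr (- s)" "0 \<le> sqrt (p n * ln n / n)" using elim(1) by auto
      have "(p n * M + p n * M + 2 * (p n * M)) / n = 4 * M * (p n / n)" by simp
      also have "\<dots> \<le> 4 * M * rate n"
        using elim(2) 0 M(2) unfolding rate_def by (intro mult_left_mono) linarith+
      finally show ?case using 0 by (auto simp: rate_def)
    qed
    show "\<forall>\<^sub>F n in sequentially. AE X in sampling_law f0 n. (\<forall>i\<in>{1..n}. X i \<in> {0..1}) \<longrightarrow>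
      (\<forall>i\<in>{1..p n}. 2 \<le> n * bin_freq (p n) n X i) \<longrightarrow>
      (\<exists>(Q :: (nat \<Rightarrow> real) measure) W R R'. stein_model Q (p n) n W (bin_freq (p n) n X) R R' M (p n * M) (2 * (p n * M)) \<and>
        d_BL (distr (posterior (dirichlet_prior (p n) (m n)) (\<lambda>w. histogram (p n) (bin_probs (p n) w)) n X) borel
        (\<lambda>w. sqrt (real n) * (dirichlet_functional (J n) (m n) n X (histogram (p n) (bin_probs (p n) w)) - centring (J n) n X))) (normal_law 0 v)
        = d_BL (distr Q borel (\<lambda>x. stein_model.Zfun (p n) n (bin_freq (p n) n X) R (W x))) (normal_law 0 v))"
      using ev1 M(1)
    proof eventually_elim
      case (elim n)
      show ?case
      proof (rule AE_I2, intro impI)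
        fix X :: "nat \<Rightarrow> real"
        assume X: "\<forall>i\<in>{1..n}. X i \<in> {0..1}" "\<forall>i\<in>{1..p n}. 2 \<le> n * bin_freq (p n) n X i"
        interpret S: dirichlet_setting "J n" n "m n" X M "p n"
          using elim m X by unfold_locales (auto simp: p)
        interpret SM: stein_model S.post "p n" n S.W "bin_freq (p n) n X" S.R S.R' M "p n * M" "2 * (p n * M)"
          by (rule S.dirichlet_stein_model)
        show "\<exists>(Q :: (nat \<Rightarrow> real) measure) W R R'. stein_model Q (p n) n W (bin_freq (p n) n X) R R' M (p n * M) (2 * (p n * M)) \<and>
        d_BL (distr (posterior (dirichlet_prior (p n) (m n)) (\<lambda>w. histogram (p n) (bin_probs (p n) w)) n X) borel
        (\<lambda>w. sqrt (real n) * (dirichlet_functional (J n) (m n) n X (histogram (p n) (bin_probs (p n) w)) - centring (J n) n X))) (normal_law 0 v)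
        = d_BL (distr Q borel (\<lambda>x. stein_model.Zfun (p n) n (bin_freq (p n) n X) R (W x))) (normal_law 0 v)"
          using SM.stein_model_axioms
          by (intro exI[of _ S.post] exI[of _ S.W] exI[of _ S.R] exI[of _ S.R'] conjI) (simp_all add: S.functional_eq SM.Zfun_def)
      qed
    qed
  qed (use M p1 in auto)
qed

lemma BvM_conclusion:
  assumes "bigo_prob P (\<lambda>n X. d_BL (distr (Post n X) borel (\<lambda>t. sqrt (real n) * (\<Phi> n X t - c n X))) (normal_law 0 v)) r"
    and "r \<longlonglongrightarrow> 0" and "v > 0"
  shows "bigo_prob P (\<lambda>n X. d_BL (distr (Post n X) borel (\<lambda>t. sqrt (real n) * (\<Phi> n X t - c n X))) (normal_law 0 v)) r
    \<and> tends_to_0_prob P (\<lambda>n X. d_BL (distr (Post n X) borel (\<lambda>t. sqrt (real n) * (\<Phi> n X t - c n X))) (normal_law 0 v))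
    \<and> (Q \<longrightarrow> BvM P Post \<Phi> c v)"
  using assms tends_to_0_probI[OF assms(1,2)] by (simp add: BvM_def)

theorem corollary4:
  fixes f0 :: "real \<Rightarrow> real" and s c_lo c_hi v :: real and J p :: "nat \<Rightarrow> nat"
  assumes "0 < s" and "s \<le> 1" and "hoelder s f0"
    and "0 < c_lo" and "0 < c_hi" and "\<forall>x\<in>{0..1}. c_lo \<le> f0 x \<and> f0 x \<le> c_hi"
    and "(LINT x:{0..1}|lborel. f0 x) = 1"
    and v: "v = asymp_variance f0" and "v > 0"
    and p: "\<And>n. p n = 2 ^ (J n + 1)"
    and "(\<lambda>_. 1) \<lless> (\<lambda>n. real (p n))"
    and "(\<lambda>n. real (p n)) \<lless> (\<lambda>n. real n / ln (real n))"
  shows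
    "(\<forall>(\<sigma> :: nat \<Rightarrow> nat \<Rightarrow> real) (H :: real \<Rightarrow> real).
       let \<sigma>_min = (\<lambda>n. Min (\<sigma> n ` {0..J n}));
           F = (\<lambda>n. series_density (J n));
           prior = (\<lambda>n. series_prior (J n) H (\<sigma> n));
           Post = (\<lambda>n X. posterior (prior n) (F n) n X);
           \<Phi> = (\<lambda>n X \<theta>. series_functional (J n) H (\<sigma> n) n X (F n \<theta>));
           Z = (\<lambda>n X \<theta>. sqrt (real n) * (\<Phi> n X \<theta> - centring (J n) n X));
           D = (\<lambda>n X. d_BL (distr (Post n X) borel (Z n X)) (normal_law 0 v))
       in
         (\<forall>n\<ge>1. \<forall>j\<le>J n. \<sigma> n j > 0) \<longrightarrow>
         (\<forall>x. H differentiable (at x)) \<longrightarrow>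
         (\<forall>x. deriv H differentiable (at x)) \<longrightarrow>
         bounded (range (deriv H)) \<longrightarrow>
         bounded (range (deriv (deriv H))) \<longrightarrow>
         (\<lambda>n. real n powr (- 1 / 2)) \<lless> \<sigma>_min \<longrightarrow>
         (\<forall>n\<ge>1. AE X in sampling_law f0 n. evidence (prior n) (F n) n X < \<infinity>) \<longrightarrow>
           bigo_prob (sampling_law f0) D
             (\<lambda>n. real (p n) powr (- s) + sqrt (real (p n) * ln (real n) / real n)
                  + 1 / (real n * (\<sigma>_min n)\<^sup>2))
         \<and> tends_to_0_prob (sampling_law f0) D
         \<and> (1 / 4 < s \<and> (\<lambda>n. real n powr (1 / (4 * s))) \<lless> (\<lambda>n. real (p n)) \<longrightarrow>
              BvM (sampling_law f0) Post \<Phi> (\<lambda>n X. centring (J n) n X) v))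
     \<and>
     (\<forall>m :: nat \<Rightarrow> nat \<Rightarrow> real.
       let F = (\<lambda>n w. histogram (p n) (bin_probs (p n) w));
           prior = (\<lambda>n. dirichlet_prior (p n) (m n));
           Post = (\<lambda>n X. posterior (prior n) (F n) n X);
           \<Phi> = (\<lambda>n X w. dirichlet_functional (J n) (m n) n X (F n w));
           Z = (\<lambda>n X w. sqrt (real n) * (\<Phi> n X w - centring (J n) n X));
           D = (\<lambda>n X. d_BL (distr (Post n X) borel (Z n X)) (normal_law 0 v))
       in
         (\<forall>n\<ge>1. \<forall>\<mu>\<in>{1..p n}. m n \<mu> > 0) \<longrightarrow>
         (\<lambda>n. Max ((\<lambda>\<mu>. \<bar>m n \<mu>\<bar>) ` {1..p n})) \<in> O(\<lambda>_. 1) \<longrightarrow>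
           bigo_prob (sampling_law f0) D
             (\<lambda>n. real (p n) powr (- s) + sqrt (real (p n) * ln (real n) / real n))
         \<and> tends_to_0_prob (sampling_law f0) D
         \<and> (1 / 4 < s \<and> (\<lambda>n. real n powr (1 / (4 * s))) \<lless> (\<lambda>n. real (p n)) \<longrightarrow>
              BvM (sampling_law f0) Post \<Phi> (\<lambda>n X. centring (J n) n X) v))"
proof -
  obtain L where L: "\<forall>x\<in>{0..1}. \<forall>y\<in>{0..1}. \<bar>f0 x - f0 y\<bar> \<le> L * \<bar>x - y\<bar> powr s"
    using \<open>hoelder s f0\<close> unfolding hoelder_def by blast
  \<comment> \<open>The definition of \<open>hoelder\<close> does not fix the sign of the constant,
    so its absolute value is taken.\<close>
  have D: "density_setting f0 s c_lo c_hi \<bar>L\<bar>"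
  proof
    fix x y :: real assume "x \<in> {0..1}" "y \<in> {0..1}"
    then have "\<bar>f0 x - f0 y\<bar> \<le> L * \<bar>x - y\<bar> powr s" using L by blast
    also have "\<dots> \<le> \<bar>L\<bar> * \<bar>x - y\<bar> powr s" by (intro mult_right_mono) auto
    finally show "\<bar>f0 x - f0 y\<bar> \<le> \<bar>L\<bar> * \<bar>x - y\<bar> powr s" .
  qed (use assms in auto)
  show ?thesis
    unfolding Let_def
  proof ((rule conjI; intro allI impI), goal_cases)
    case (1 \<sigma> H)
    obtain B1 B2 where "\<And>x. \<bar>deriv H x\<bar> \<le> B1" "\<And>x. \<bar>deriv (deriv H) x\<bar> \<le> B2"
      using 1(4,5) unfolding bounded_iff by (metis rangeI real_norm_def)
    then have B: "\<bar>deriv H x\<bar> \<le> max B1 B2" "\<bar>deriv (deriv H) x\<bar> \<le> max B1 B2" for x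
      by (meson max.coboundedI1 max.coboundedI2)+
    note main = bigo_prob_series[OF D v \<open>v > 0\<close> p assms(11,12) 1(1)[rule_format] 1(2,3)[rule_format] B 1(6) 1(7)[rule_format]]
    show ?case by (rule BvM_conclusion[OF main \<open>v > 0\<close>])
  next
    case (2 m)
    obtain M where "eventually (\<lambda>n. norm (Max ((\<lambda>\<mu>. \<bar>m n \<mu>\<bar>) ` {1..p n})) \<le> M * norm (1 :: real)) sequentially" "M > 0"
      using 2(2) by (elim landau_o.bigE)
    moreover have "m n i \<le> M" if "norm (Max ((\<lambda>\<mu>. \<bar>m n \<mu>\<bar>) ` {1..p n})) \<le> M * norm (1 :: real)" "i \<in> {1..p n}" for n i
    proof -
      have "m n i \<le> \<bar>m n i\<bar>" by simp
      also have "\<dots> \<le> Max ((\<lambda>\<mu>. \<bar>m n \<mu>\<bar>) ` {1..p n})" using that(2) by (intro Max_ge) auto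
      finally show ?thesis using that(1) by simp
    qed
    ultimately have M: "\<forall>\<^sub>F n in sequentially. \<forall>i\<in>{1..p n}. m n i \<le> M" "0 \<le> M"
      by (auto elim: eventually_mono)
    note main = bigo_prob_dirichlet[OF D v \<open>v > 0\<close> p assms(11,12) 2(1)[rule_format] M]
    show ?case by (rule BvM_conclusion[OF main \<open>v > 0\<close>])
  qed
qed

end
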